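(* Let $(C,D,\Omega)$ be a Cartan triple and let $\mathbb{K}$ be a field that has enough roots of unity for $D$. Let $(Q^\circ,X)$ be the finite EI quiver associated to $(C,D,\Omega)$, and let $(C',D',\Omega')$ be the Cartan triple constructed from $(C,D,\Omega)$ and $\mathbb{K}$ (both described in the context). Then there is an isomorphism of algebras $$\Pi(Q^\circ,X)\cong\Pi(C',D',\Omega')$$ between the preprojective algebra of the EI quiver $(Q^\circ,X)$ and the generalized preprojective algebra of $(C',D',\Omega')$.
   Context: **Cartan triples.** Let $n\ge1$. A Cartan matrix is $C=(c_{ij})\in M_n(\mathbb{Z})$ with (C1) $c_{ii}=2$; (C2) $c_{ij}\le0$ for $i\ne j$, and $c_{ij}<0$ iff $c_{ji}<0$; (C3) there is a diagonal matrix $D=\mathrm{diag}(c_1,\dots,c_n)$, $c_i\in\mathbb{Z}_{\ge1}$, with $DC$ symmetric; such $D$ is a symmetrizer of $C$. When $c_{ij}<0$ put $g_{ij}=|\gcd(c_{ij},c_{ji})|$ and $f_{ij}=|c_{ij}|/g_{ij}$. An orientation of $C$ is a subset $\Omega\subset\{1,\dots,n\}^2$ with (O1) $\{(i,j),(j,i)\}\cap\Omega\ne\emptyset$ iff $c_{ij}<0$; (O2) for each sequence $(i_1,\dots,i_{t+1})$, $t\ge1$, with $(i_s,i_{s+1})\in\Omega$ for all $1\le s\le t$, one has $i_1\ne i_{t+1}$. A Cartan triple $(C,D,\Omega)$ consists of a Cartan matrix, a symmetrizer and an orientation. The same definitions are used with any finite index set in place of $\{1,\dots,n\}$. $\mathbb{K}$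 has enough roots of unity for $D$ if $t^{c_i}-1$ splits in $\mathbb{K}[t]$ for each $i$. **Generalized preprojective algebra $\Pi(C,D,\Omega)$.** Let $\Omega^\ast=\{(j,i)\mid(i,j)\in\Omega\}$, $\overline\Omega=\Omega\sqcup\Omega^\ast$, $\overline\Omega(-,i)=\{j\mid(j,i)\in\overline\Omega\}$, $\mathrm{sgn}(i,j)=1$ if $(i,j)\in\Omega$ and $-1$ if $(i,j)\in\Omega^\ast$. Let $\widetilde Q$ be the quiver with the index set as vertex set, arrows $\alpha_{ij}^{(g)}:j\to i$ for $(i,j)\in\overline\Omega$, $1\le g\le g_{ij}$, and a loop $\varepsilon_i$ at each vertex $i$. Then $\Pi(C,D,\Omega)=\mathbb{K}\widetilde Q/\widetilde I$ (paths composed right to left), where $\widetilde I$ is the two-sided ideal generated by the relations $\varepsilon_k^{c_k}=0$ for all $k$; $\varepsilon_i^{f_{ji}}\alpha_{ij}^{(g)}=\alpha_{ij}^{(g)}\varepsilon_j^{f_{ij}}$ for all $(i,j)\in\overline\Omega$, $1\le g\le g_{ij}$; and for each $i$ $$\sum_{j\in\overline\Omega(-,i)}\sum_{g=1}^{g_{ji}}\sum_{f=0}^{f_{ji}-1}\mathrm{sgn}(i,j)\,\varepsilon_i^f\alpha_{ij}^{(g)}\alpha_{ji}^{(g)}\varepsilon_i^{f_{ji}-1-f}=0.$$ **The triple $(C',D',\Omega')$.** If $\mathrm{char}\,\mathbb{K}=p>0$, write $c_i=p^{r_i}d_i$ with $r_i\ge0$, $\gcd(p,d_i)=1$. If $\mathrm{char}\,\mathbb{K}=0$,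 put $r_i=0$, $d_i=c_i$ and read all powers $p^{0}$ below as $1$. For $1\le i,j\le n$ let $\Sigma_{ij}=\{(l_i,l_j)\mid 0\le l_i<d_i,\ 0\le l_j<d_j,\ l_ip^{r_i}\equiv l_jp^{r_j}\ (\mathrm{mod}\ \gcd(d_i,d_j))\}$. Let $M=\bigsqcup_{i}\{(i,l_i)\mid0\le l_i<d_i\}$. $C'$ is indexed by $M$, with $c'_{(i,l_i),(j,l_j)}=2$ if $(i,l_i)=(j,l_j)$; $=-|\gcd(c_{ij},c_{ji})|\,p^{r_j-\min(r_i,r_j)}$ if $(i,l_i)\ne(j,l_j)$ and $(l_i,l_j)\in\Sigma_{ij}$; $=0$ otherwise. $D'$ is diagonal with $(i,l_i)$-entry $p^{r_i}$ (the identity matrix if $\mathrm{char}\,\mathbb{K}=0$). $\Omega'=\{((i,l_i),(j,l_j))\mid(i,j)\in\Omega,\ (l_i,l_j)\in\Sigma_{ij}\}$. **Bisets.** For groups $G_1,G_2$, a $(G_1,G_2)$-biset is a set $Y$ with commuting left $G_1$-action and right $G_2$-action. Its dual is the $(G_2,G_1)$-biset $Y^\ast=\{y^\ast\mid y\in Y\}$ with $y^\ast g_1=(g_1^{-1}y)^\ast$, $g_2y^\ast=(yg_2^{-1})^\ast$. The product $Y\times_{G_2}Z$ is $Y\times Z$ modulo $(yg,z)\sim(y,gz)$. **EI quivers and their preprojective algebras.** A finite EI quiver $(Q,X)$ is a finite quiver $Q$ with a finite group $X(i)$ for each $i\in Q_0$ and a finite nonempty $(X(t(\alpha)),X(s(\alpha)))$-biset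 $X(\alpha)$ for each $\alpha\in Q_1$; it is acyclic if $Q$ has no oriented cycles. For a path $p=\alpha_m\cdots\alpha_1$ (right to left), $X(p)=X(\alpha_m)\times_{X(t(\alpha_{m-1}))}\cdots\times_{X(t(\alpha_1))}X(\alpha_1)$, and $X(e_i)=X(i)$ for trivial paths. The category $\mathcal{C}(Q,X)$ has objects $Q_0$, $\mathrm{Hom}(x,y)=\bigsqcup_pX(p)$ over paths $p$ from $x$ to $y$, with composition induced by $X(p)\times_{X(t(q))}X(q)\cong X(pq)$. Its category algebra has the morphisms as basis and product given by composition (zero if not composable). For $(Q,X)$ acyclic, $\overline Q$ is $Q$ with a reverse arrow $\alpha^\ast$ added for each $\alpha\in Q_1$, $\overline X(i)=X(i)$, $\overline X(\alpha)=X(\alpha)$, $\overline X(\alpha^\ast)=X(\alpha)^\ast$. With $L_\alpha$ (resp. $R_\alpha$) representatives of the left $X(t(\alpha))$-orbits (resp. right $X(s(\alpha))$-orbits) of $X(\alpha)$, set $\Pi(Q,X)=\mathbb{K}\mathcal{C}(\overline Q,\overline X)/(\rho)$, $\rho=\sum_{\alpha\in Q_1}\big(\sum_{b\in R_\alpha}bb^\ast-\sum_{c\in L_\alpha}c^\ast c\big)$. **The EI quiver of $(C,D,\Omega)$.** $Q^\circ$ has vertices $1,\dots,n$ and arrows $\alpha_{ij}^{(g)}:j\to i$ for $(i,j)\in\Omega$, $1\le g\le g_{ij}$ (it is acyclic by (O2)). $X(i)=\langle\eta_i\mid\eta_i^{c_i}=1\rangle$ is cyclic of order $c_i$. For $(i,j)\in\Omega$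 let $k_{ij}=\gcd(c_i,c_j)$ and $G_{ij}=\langle\eta_{ij}\mid\eta_{ij}^{k_{ij}}=1\rangle$, embedded in $X(i)$ by $\eta_{ij}\mapsto\eta_i^{c_i/k_{ij}}$ and in $X(j)$ by $\eta_{ij}\mapsto\eta_j^{c_j/k_{ij}}$; set $X(\alpha_{ij}^{(g)})=X(i)\times_{G_{ij}}X(j)$ for each $1\le g\le g_{ij}$. *)

theory Defs
  imports
    "HOL-Algebra.QuotRing"
    "HOL-Algebra.Module"
    "HOL-Algebra.Elementary_Groups"
    "HOL-Library.Poly_Mapping"
    "HOL-Computational_Algebra.Polynomial"
    "HOL-Computational_Algebra.Primes"
    "HOL-Number_Theory.Cong"
    "Graph_Theory.Arc_Walk"
begin

section \<open>Algebras over a field\<close>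

text \<open>
  An algebra over the field \<open>'k\<close> is given by a record of type \<open>('k, 'a) module\<close>.  The library's
  locale \<^locale>\<open>algebra\<close> is restricted to commutative algebras, so isomorphisms are defined here:
  unital ring isomorphisms that are linear over \<open>'k\<close>.
\<close>

definition alg_iso :: "('k, 'a) module \<Rightarrow> ('k, 'b) module \<Rightarrow> ('a \<Rightarrow> 'b) set" where
  "alg_iso A B = {h \<in> ring_iso A B. \<forall>c. \<forall>x\<in>carrier A. h (c \<odot>\<^bsub>A\<^esub> x) = c \<odot>\<^bsub>B\<^esub> h x}"

definition alg_isomorphic :: "('k, 'a) module \<Rightarrow> ('k, 'b) module \<Rightarrow> bool"
    (infix \<open>\<cong>\<^sub>a\<close> 50) where
  "A \<cong>\<^sub>a B \<longleftrightarrow> alg_iso A B \<noteq> {}"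

text \<open>Scalar multiplication on cosets is induced from the algebra, as multiplication is
  in \<^const>\<open>rcoset_mult\<close>.\<close>

definition quot_alg :: "('k, 'a) module \<Rightarrow> 'a set \<Rightarrow> ('k, 'a set) module" (infixl \<open>Quot\<^sub>a\<close> 65) where
  "A Quot\<^sub>a J = ring.extend (A Quot J)
     (module.fields (\<lambda>c X. \<Union>x\<in>X. J +>\<^bsub>A\<^esub> (c \<odot>\<^bsub>A\<^esub> x)))"


section \<open>Category algebras and path algebras\<close>

record ('o, 'm) small_cat =
  obs :: "'o set"
  mors :: "'m set"
  cdom :: "'m \<Rightarrow> 'o"
  ccod :: "'m \<Rightarrow> 'o"
  cid :: "'o \<Rightarrow> 'm"
  ccomp :: "'m \<Rightarrow> 'm \<Rightarrow> 'm"

text \<open>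
  \<open>ccomp C f g\<close> is the composite \<open>f \<circ> g\<close>, meaningful if \<open>cdom C f = ccod C g\<close>.
  The unit of the category algebra requires finitely many objects.
\<close>

definition cat_alg :: "('o, 'm) small_cat \<Rightarrow> ('k::field, 'm \<Rightarrow>\<^sub>0 'k) module" where
  "cat_alg C =
    \<lparr>carrier = {u. Poly_Mapping.keys u \<subseteq> mors C},
     monoid.mult = (\<lambda>u v. \<Sum>f\<in>Poly_Mapping.keys u. \<Sum>g\<in>Poly_Mapping.keys v.
       if cdom C f = ccod C g
       then Poly_Mapping.single (ccomp C f g) (Poly_Mapping.lookup u f * Poly_Mapping.lookup v g)
       else 0),
     one = (\<Sum>x\<in>obs C. Poly_Mapping.single (cid C x) 1),
     zero = 0,
     add = (+),
     module.smult = (\<lambda>c. Poly_Mapping.map ((*) c))\<rparr>"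

abbreviation basis_elt :: "'m \<Rightarrow> ('m \<Rightarrow>\<^sub>0 'k::field)" where
  "basis_elt f \<equiv> Poly_Mapping.single f 1"

text \<open>
  A quiver is a \<^locale>\<open>wf_digraph\<close>.  A path is a triple (source, list of arrows, target).  The
  list is in order of traversal: the path \<open>\<alpha>\<^sub>m \<dots> \<alpha>\<^sub>1\<close>, written from right to left,
  is \<open>[\<alpha>\<^sub>1, \<dots>, \<alpha>\<^sub>m]\<close>.  The path algebra is the category algebra of the
  path category.
\<close>

type_synonym ('v, 'a) qpath = "'v \<times> 'a list \<times> 'v"

definition qpaths :: "('v, 'a) pre_digraph \<Rightarrow> ('v, 'a) qpath set" where
  "qpaths G = {(u, p, v). pre_digraph.awalk G u p v}"

fun qpath_comp :: "('v, 'a) qpath \<Rightarrow> ('v, 'a) qpath \<Rightarrow> ('v, 'a) qpath" where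
  "qpath_comp (v', q, w) (u, p, v) = (u, p @ q, w)"

definition path_cat :: "('v, 'a) pre_digraph \<Rightarrow> ('v, ('v, 'a) qpath) small_cat" where
  "path_cat G = \<lparr>obs = verts G, mors = qpaths G, cdom = fst, ccod = snd \<circ> snd,
     cid = (\<lambda>u. (u, [], u)), ccomp = qpath_comp\<rparr>"

abbreviation path_alg :: "('v, 'a) pre_digraph \<Rightarrow> ('k::field, ('v, 'a) qpath \<Rightarrow>\<^sub>0 'k) module" where
  "path_alg G \<equiv> cat_alg (path_cat G)"


section \<open>Cartan triples\<close>

text \<open>
  Matrices over a finite index set \<open>I\<close> are functions, of which only the values on \<open>I\<close> matter;
  \<open>D i\<close> is the diagonal entry \<open>c\<^sub>i\<close> of the symmetrizer.
\<close>

definition cartan_matrix :: "'v set \<Rightarrow> ('v \<Rightarrow> 'v \<Rightarrow> int) \<Rightarrow> bool" where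
  "cartan_matrix I C \<longleftrightarrow>
     (\<forall>i\<in>I. C i i = 2) \<and>
     (\<forall>i\<in>I. \<forall>j\<in>I. i \<noteq> j \<longrightarrow> C i j \<le> 0 \<and> (C i j < 0 \<longleftrightarrow> C j i < 0)) \<and>
     (\<exists>D :: 'v \<Rightarrow> nat. (\<forall>i\<in>I. D i \<ge> 1) \<and> (\<forall>i\<in>I. \<forall>j\<in>I. int (D i) * C i j = int (D j) * C j i))"

definition symmetrizer :: "'v set \<Rightarrow> ('v \<Rightarrow> 'v \<Rightarrow> int) \<Rightarrow> ('v \<Rightarrow> nat) \<Rightarrow> bool" where
  "symmetrizer I C D \<longleftrightarrow>
     (\<forall>i\<in>I. D i \<ge> 1) \<and> (\<forall>i\<in>I. \<forall>j\<in>I. int (D i) * C i j = int (D j) * C j i)"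

definition orientation :: "'v set \<Rightarrow> ('v \<Rightarrow> 'v \<Rightarrow> int) \<Rightarrow> ('v \<times> 'v) set \<Rightarrow> bool" where
  "orientation I C \<Omega> \<longleftrightarrow>
     \<Omega> \<subseteq> I \<times> I \<and>
     (\<forall>i\<in>I. \<forall>j\<in>I. {(i, j), (j, i)} \<inter> \<Omega> \<noteq> {} \<longleftrightarrow> C i j < 0) \<and>
     (\<forall>t\<ge>1. \<forall>x :: nat \<Rightarrow> 'v. (\<forall>s\<in>{1..t}. (x s, x (s + 1)) \<in> \<Omega>) \<longrightarrow> x 1 \<noteq> x (t + 1))"

definition cartan_triple ::
    "'v set \<Rightarrow> ('v \<Rightarrow> 'v \<Rightarrow> int) \<Rightarrow> ('v \<Rightarrow> nat) \<Rightarrow> ('v \<times> 'v) set \<Rightarrow> bool" where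
  "cartan_triple I C D \<Omega> \<longleftrightarrow>
     finite I \<and> I \<noteq> {} \<and> cartan_matrix I C \<and> symmetrizer I C D \<and> orientation I C \<Omega>"

definition cartan_g :: "('v \<Rightarrow> 'v \<Rightarrow> int) \<Rightarrow> 'v \<Rightarrow> 'v \<Rightarrow> nat" where
  "cartan_g C i j = nat \<bar>gcd (C i j) (C j i)\<bar>"

definition cartan_f :: "('v \<Rightarrow> 'v \<Rightarrow> int) \<Rightarrow> 'v \<Rightarrow> 'v \<Rightarrow> nat" where
  "cartan_f C i j = nat \<bar>C i j\<bar> div cartan_g C i j"

definition splits :: "'k::field poly \<Rightarrow> bool" where
  "splits f \<longleftrightarrow> (\<exists>c. \<exists>A :: 'k multiset. f = Polynomial.smult c (\<Prod>a\<in>#A. [:- a, 1:]))"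

definition enough_roots_of_unity :: "'k::field itself \<Rightarrow> 'v set \<Rightarrow> ('v \<Rightarrow> nat) \<Rightarrow> bool" where
  "enough_roots_of_unity K I D \<longleftrightarrow> (\<forall>i\<in>I. splits (Polynomial.monom 1 (D i) - 1 :: 'k poly))"


section \<open>Generalized preprojective algebras\<close>

definition double_orientation :: "('v \<times> 'v) set \<Rightarrow> ('v \<times> 'v) set" where
  "double_orientation \<Omega> = \<Omega> \<union> \<Omega>\<inverse>"

text \<open>\<open>Alpha i j g\<close> is the arrow \<open>j \<rightarrow> i\<close> with number \<open>g\<close>, and \<open>Eps i\<close> is the loop at \<open>i\<close>.\<close>

datatype 'v gp_arrow = Alpha 'v 'v nat | Eps 'v

definition gp_quiver ::
    "'v set \<Rightarrow> ('v \<Rightarrow> 'v \<Rightarrow> int) \<Rightarrow> ('v \<times> 'v) set \<Rightarrow> ('v, 'v gp_arrow) pre_digraph" where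
  "gp_quiver I C \<Omega> =
    \<lparr>verts = I,
     arcs = {Alpha i j g |i j g. (i, j) \<in> double_orientation \<Omega> \<and> g \<in> {1..cartan_g C i j}} \<union> Eps ` I,
     tail = (\<lambda>a. case a of Alpha i j g \<Rightarrow> j | Eps i \<Rightarrow> i),
     head = (\<lambda>a. case a of Alpha i j g \<Rightarrow> i | Eps i \<Rightarrow> i)\<rparr>"

abbreviation gp_alpha :: "'v \<Rightarrow> 'v \<Rightarrow> nat \<Rightarrow> (('v, 'v gp_arrow) qpath \<Rightarrow>\<^sub>0 'k::field)" where
  "gp_alpha i j g \<equiv> basis_elt (j, [Alpha i j g], i)"

abbreviation gp_eps :: "'v \<Rightarrow> (('v, 'v gp_arrow) qpath \<Rightarrow>\<^sub>0 'k::field)" where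
  "gp_eps i \<equiv> basis_elt (i, [Eps i], i)"

definition gp_sgn :: "('v \<times> 'v) set \<Rightarrow> 'v \<Rightarrow> 'v \<Rightarrow> 'k::field" where
  "gp_sgn \<Omega> i j = (if (i, j) \<in> \<Omega> then 1 else - 1)"

text \<open>
  The relations are written in the path algebra \<open>A\<close>.  There \<open>\<epsilon>\<^sub>i [^] 0\<close> is the unit of \<open>A\<close> and not the
  trivial path at \<open>i\<close>, which makes no difference in the products below.
\<close>

definition gp_relations ::
    "'v set \<Rightarrow> ('v \<Rightarrow> 'v \<Rightarrow> int) \<Rightarrow> ('v \<Rightarrow> nat) \<Rightarrow> ('v \<times> 'v) set \<Rightarrow>
     (('v, 'v gp_arrow) qpath \<Rightarrow>\<^sub>0 'k::field) set" where
  "gp_relations I C D \<Omega> =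
    (let A = path_alg (gp_quiver I C \<Omega>) in
      {gp_eps k [^]\<^bsub>A\<^esub> D k |k. k \<in> I} \<union>
      {gp_eps i [^]\<^bsub>A\<^esub> cartan_f C j i \<otimes>\<^bsub>A\<^esub> gp_alpha i j g
         - gp_alpha i j g \<otimes>\<^bsub>A\<^esub> gp_eps j [^]\<^bsub>A\<^esub> cartan_f C i j
         |i j g. (i, j) \<in> double_orientation \<Omega> \<and> g \<in> {1..cartan_g C i j}} \<union>
      {\<Sum>j\<in>{j. (j, i) \<in> double_orientation \<Omega>}. \<Sum>g=1..cartan_g C j i. \<Sum>f<cartan_f C j i.
         gp_sgn \<Omega> i j \<odot>\<^bsub>A\<^esub>
           (gp_eps i [^]\<^bsub>A\<^esub> f \<otimes>\<^bsub>A\<^esub> gp_alpha i j g \<otimes>\<^bsub>A\<^esub> gp_alpha j i g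
             \<otimes>\<^bsub>A\<^esub> gp_eps i [^]\<^bsub>A\<^esub> (cartan_f C j i - 1 - f))
         |i. i \<in> I})"

definition gen_preproj_alg ::
    "'v set \<Rightarrow> ('v \<Rightarrow> 'v \<Rightarrow> int) \<Rightarrow> ('v \<Rightarrow> nat) \<Rightarrow> ('v \<times> 'v) set \<Rightarrow>
     ('k::field, (('v, 'v gp_arrow) qpath \<Rightarrow>\<^sub>0 'k) set) module" where
  "gen_preproj_alg I C D \<Omega> =
    (let A = path_alg (gp_quiver I C \<Omega>) in A Quot\<^sub>a (Idl\<^bsub>A\<^esub> gp_relations I C D \<Omega>))"


section \<open>The Cartan triple associated with a Cartan triple and a field\<close>

text \<open>
  The characteristic \<open>p\<close> of the field is a parameter.  For \<open>p = 0\<close>, all exponents \<open>r\<close> vanish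
  and \<open>0 ^ 0 = 1\<close> is the intended reading of the powers of \<open>p\<close>.
\<close>

definition p_exp :: "nat \<Rightarrow> ('v \<Rightarrow> nat) \<Rightarrow> 'v \<Rightarrow> nat" where
  "p_exp p D i = (if p = 0 then 0 else multiplicity p (D i))"

definition p_free :: "nat \<Rightarrow> ('v \<Rightarrow> nat) \<Rightarrow> 'v \<Rightarrow> nat" where
  "p_free p D i = D i div p ^ p_exp p D i"

definition Sigma_set :: "nat \<Rightarrow> ('v \<Rightarrow> nat) \<Rightarrow> 'v \<Rightarrow> 'v \<Rightarrow> (nat \<times> nat) set" where
  "Sigma_set p D i j =
    {(l, m). l < p_free p D i \<and> m < p_free p D j \<and>
       [l * p ^ p_exp p D i = m * p ^ p_exp p D j] (mod gcd (p_free p D i) (p_free p D j))}"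

definition ass_index :: "nat \<Rightarrow> 'v set \<Rightarrow> ('v \<Rightarrow> nat) \<Rightarrow> ('v \<times> nat) set" where
  "ass_index p I D = (SIGMA i:I. {..<p_free p D i})"

definition ass_matrix ::
    "nat \<Rightarrow> ('v \<Rightarrow> 'v \<Rightarrow> int) \<Rightarrow> ('v \<Rightarrow> nat) \<Rightarrow> 'v \<times> nat \<Rightarrow> 'v \<times> nat \<Rightarrow> int" where
  "ass_matrix p C D x y =
    (case x of (i, l) \<Rightarrow> case y of (j, m) \<Rightarrow>
      if (i, l) = (j, m) then 2
      else if (l, m) \<in> Sigma_set p D i j
        then - \<bar>gcd (C i j) (C j i)\<bar> * int p ^ (p_exp p D j - min (p_exp p D i) (p_exp p D j))
      else 0)"

definition ass_symmetrizer :: "nat \<Rightarrow> ('v \<Rightarrow> nat) \<Rightarrow> 'v \<times> nat \<Rightarrow> nat" where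
  "ass_symmetrizer p D x = p ^ p_exp p D (fst x)"

definition ass_orientation ::
    "nat \<Rightarrow> ('v \<Rightarrow> nat) \<Rightarrow> ('v \<times> 'v) set \<Rightarrow> (('v \<times> nat) \<times> ('v \<times> nat)) set" where
  "ass_orientation p D \<Omega> = {((i, l), (j, m)) |i l j m. (i, j) \<in> \<Omega> \<and> (l, m) \<in> Sigma_set p D i j}"


section \<open>Bisets\<close>

record ('g, 'h, 'y) biset =
  bset :: "'y set"
  lact :: "'g \<Rightarrow> 'y \<Rightarrow> 'y"
  ract :: "'y \<Rightarrow> 'h \<Rightarrow> 'y"

locale biset = G1: group G1 + G2: group G2
  for G1 :: "'g monoid" and G2 :: "'h monoid" and Y :: "('g, 'h, 'y) biset" +
  assumes lact_closed: "g \<in> carrier G1 \<Longrightarrow> y \<in> bset Y \<Longrightarrow> lact Y g y \<in> bset Y"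
    and ract_closed: "y \<in> bset Y \<Longrightarrow> h \<in> carrier G2 \<Longrightarrow> ract Y y h \<in> bset Y"
    and lact_one: "y \<in> bset Y \<Longrightarrow> lact Y \<one>\<^bsub>G1\<^esub> y = y"
    and ract_one: "y \<in> bset Y \<Longrightarrow> ract Y y \<one>\<^bsub>G2\<^esub> = y"
    and lact_lact: "g \<in> carrier G1 \<Longrightarrow> g' \<in> carrier G1 \<Longrightarrow> y \<in> bset Y \<Longrightarrow>
      lact Y g (lact Y g' y) = lact Y (g \<otimes>\<^bsub>G1\<^esub> g') y"
    and ract_ract: "y \<in> bset Y \<Longrightarrow> h \<in> carrier G2 \<Longrightarrow> h' \<in> carrier G2 \<Longrightarrow>
      ract Y (ract Y y h) h' = ract Y y (h \<otimes>\<^bsub>G2\<^esub> h')"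
    and lact_ract: "g \<in> carrier G1 \<Longrightarrow> y \<in> bset Y \<Longrightarrow> h \<in> carrier G2 \<Longrightarrow>
      lact Y g (ract Y y h) = ract Y (lact Y g y) h"

text \<open>The element \<open>y\<^sup>*\<close> of the dual biset is represented by \<open>y\<close> itself.\<close>

definition dual_biset :: "'g monoid \<Rightarrow> 'h monoid \<Rightarrow> ('g, 'h, 'y) biset \<Rightarrow> ('h, 'g, 'y) biset" where
  "dual_biset G1 G2 Y =
    \<lparr>bset = bset Y, lact = (\<lambda>h y. ract Y y (inv\<^bsub>G2\<^esub> h)), ract = (\<lambda>y g. lact Y (inv\<^bsub>G1\<^esub> g) y)\<rparr>"

text \<open>Since \<open>H\<close> is a group, the following relation is already an equivalence relation.\<close>

definition biset_prod_rel ::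
    "'h monoid \<Rightarrow> ('g, 'h, 'y) biset \<Rightarrow> ('h, 'i, 'z) biset \<Rightarrow> (('y \<times> 'z) \<times> ('y \<times> 'z)) set" where
  "biset_prod_rel H Y Z =
    {((ract Y y h, z), (y, lact Z h z)) |y h z. y \<in> bset Y \<and> h \<in> carrier H \<and> z \<in> bset Z}"

definition biset_prod ::
    "'h monoid \<Rightarrow> ('g, 'h, 'y) biset \<Rightarrow> ('h, 'i, 'z) biset \<Rightarrow> ('g, 'i, ('y \<times> 'z) set) biset" where
  "biset_prod H Y Z =
    \<lparr>bset = (bset Y \<times> bset Z) // biset_prod_rel H Y Z,
     lact = (\<lambda>g c. biset_prod_rel H Y Z `` ((\<lambda>(y, z). (lact Y g y, z)) ` c)),
     ract = (\<lambda>c k. biset_prod_rel H Y Z `` ((\<lambda>(y, z). (y, ract Z z k)) ` c))\<rparr>"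


section \<open>EI quivers\<close>

record ('v, 'a, 'g, 'y) ei_quiver =
  quiver :: "('v, 'a) pre_digraph"
  vgrp :: "'v \<Rightarrow> 'g monoid"
  abiset :: "'a \<Rightarrow> ('g, 'g, 'y) biset"

locale finite_ei_quiver = fin_digraph "quiver Q" for Q :: "('v, 'a, 'g, 'y) ei_quiver" +
  assumes vgrp_group: "i \<in> verts (quiver Q) \<Longrightarrow> group (vgrp Q i)"
    and vgrp_finite: "i \<in> verts (quiver Q) \<Longrightarrow> finite (carrier (vgrp Q i))"
    and abiset_biset: "a \<in> arcs (quiver Q) \<Longrightarrow>
      biset (vgrp Q (head (quiver Q) a)) (vgrp Q (tail (quiver Q) a)) (abiset Q a)"
    and abiset_finite: "a \<in> arcs (quiver Q) \<Longrightarrow> finite (bset (abiset Q a))"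
    and abiset_nonempty: "a \<in> arcs (quiver Q) \<Longrightarrow> bset (abiset Q a) \<noteq> {}"

locale acyclic_ei_quiver = finite_ei_quiver +
  assumes no_oriented_cycle: "awalk u p u \<Longrightarrow> p = []"

text \<open>
  For a nontrivial path, \<open>X(p)\<close> consists of the classes of lists of biset elements; like the arrows of
  \<open>p\<close>, these are in order of traversal, so \<open>[y\<^sub>1, \<dots>, y\<^sub>m]\<close> stands for \<open>(y\<^sub>m, \<dots>, y\<^sub>1)\<close>.  Two lists
  are in the same class if they are connected by moves \<open>(\<dots>, y g, z, \<dots>) \<sim> (\<dots>, y, g z, \<dots>)\<close>
  with \<open>y\<close>, \<open>z\<close> attached to consecutive arrows of \<open>p\<close> and \<open>g\<close> in the group at their common vertex.
\<close>

definition ei_lists :: "('v, 'a, 'g, 'y) ei_quiver \<Rightarrow> 'a list \<Rightarrow> 'y list set" where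
  "ei_lists Q p = {ys. list_all2 (\<lambda>a y. y \<in> bset (abiset Q a)) p ys}"

definition ei_move :: "('v, 'a, 'g, 'y) ei_quiver \<Rightarrow> 'a list \<Rightarrow> ('y list \<times> 'y list) set" where
  "ei_move Q p =
    {(us @ [z, ract (abiset Q b) y g] @ vs, us @ [lact (abiset Q a) g z, y] @ vs)
      |us z y vs g as a b bs.
        p = as @ [a, b] @ bs \<and> length us = length as \<and> us @ [z, y] @ vs \<in> ei_lists Q p \<and>
        g \<in> carrier (vgrp Q (head (quiver Q) a))}"

definition ei_rel :: "('v, 'a, 'g, 'y) ei_quiver \<Rightarrow> 'a list \<Rightarrow> ('y list \<times> 'y list) set" where
  "ei_rel Q p = (ei_move Q p \<union> (ei_move Q p)\<inverse>)\<^sup>* \<inter> ei_lists Q p \<times> ei_lists Q p"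

text \<open>
  A morphism is a path \<open>p\<close> together with an element of \<open>X(p)\<close>: an element of the vertex group if \<open>p\<close>
  is trivial, and a class of lists otherwise.
\<close>

type_synonym ('v, 'a, 'g, 'y) ei_mor = "('v, 'a) qpath \<times> ('g + 'y list set)"

fun ei_path_set :: "('v, 'a, 'g, 'y) ei_quiver \<Rightarrow> ('v, 'a) qpath \<Rightarrow> ('g + 'y list set) set" where
  "ei_path_set Q (u, p, v) =
    (if p = [] then Inl ` carrier (vgrp Q u) else Inr ` (ei_lists Q p // ei_rel Q p))"

fun ei_comp ::
    "('v, 'a, 'g, 'y) ei_quiver \<Rightarrow> ('v, 'a, 'g, 'y) ei_mor \<Rightarrow> ('v, 'a, 'g, 'y) ei_mor \<Rightarrow>
     ('v, 'a, 'g, 'y) ei_mor" where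
  "ei_comp Q ((v', q, w), Inl g) ((u, p, v), Inl h) = ((u, p @ q, w), Inl (g \<otimes>\<^bsub>vgrp Q v\<^esub> h))"
| "ei_comp Q ((v', q, w), Inl g) ((u, p, v), Inr c) =
    ((u, p @ q, w),
     Inr (ei_rel Q p `` ((\<lambda>ys. butlast ys @ [lact (abiset Q (last p)) g (last ys)]) ` c)))"
| "ei_comp Q ((v', q, w), Inr d) ((u, p, v), Inl h) =
    ((u, p @ q, w),
     Inr (ei_rel Q q `` ((\<lambda>zs. ract (abiset Q (hd q)) (hd zs) h # tl zs) ` d)))"
| "ei_comp Q ((v', q, w), Inr d) ((u, p, v), Inr c) =
    ((u, p @ q, w), Inr (ei_rel Q (p @ q) `` {ys @ zs |ys zs. ys \<in> c \<and> zs \<in> d}))"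

definition ei_cat :: "('v, 'a, 'g, 'y) ei_quiver \<Rightarrow> ('v, ('v, 'a, 'g, 'y) ei_mor) small_cat" where
  "ei_cat Q =
    \<lparr>obs = verts (quiver Q),
     mors = (SIGMA p:qpaths (quiver Q). ei_path_set Q p),
     cdom = (\<lambda>((u, p, v), x). u),
     ccod = (\<lambda>((u, p, v), x). v),
     cid = (\<lambda>u. ((u, [], u), Inl \<one>\<^bsub>vgrp Q u\<^esub>)),
     ccomp = ei_comp Q\<rparr>"


section \<open>Preprojective algebras of EI quivers\<close>

datatype 'a darrow = Orig 'a | Star 'a

definition double_quiver :: "('v, 'a) pre_digraph \<Rightarrow> ('v, 'a darrow) pre_digraph" where
  "double_quiver G =
    \<lparr>verts = verts G,
     arcs = Orig ` arcs G \<union> Star ` arcs G,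
     tail = (\<lambda>a. case a of Orig b \<Rightarrow> tail G b | Star b \<Rightarrow> head G b),
     head = (\<lambda>a. case a of Orig b \<Rightarrow> head G b | Star b \<Rightarrow> tail G b)\<rparr>"

definition double_ei_quiver ::
    "('v, 'a, 'g, 'y) ei_quiver \<Rightarrow> ('v, 'a darrow, 'g, 'y) ei_quiver" where
  "double_ei_quiver Q =
    \<lparr>quiver = double_quiver (quiver Q),
     vgrp = vgrp Q,
     abiset = (\<lambda>a. case a of
        Orig b \<Rightarrow> abiset Q b
      | Star b \<Rightarrow> dual_biset (vgrp Q (head (quiver Q) b)) (vgrp Q (tail (quiver Q) b)) (abiset Q b))\<rparr>"

definition left_orbits :: "('v, 'a, 'g, 'y) ei_quiver \<Rightarrow> 'a \<Rightarrow> 'y set set" where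
  "left_orbits Q a =
    (\<lambda>y. (\<lambda>g. lact (abiset Q a) g y) ` carrier (vgrp Q (head (quiver Q) a))) ` bset (abiset Q a)"

definition right_orbits :: "('v, 'a, 'g, 'y) ei_quiver \<Rightarrow> 'a \<Rightarrow> 'y set set" where
  "right_orbits Q a =
    (\<lambda>y. (\<lambda>h. ract (abiset Q a) y h) ` carrier (vgrp Q (tail (quiver Q) a))) ` bset (abiset Q a)"

definition representatives :: "'y set set \<Rightarrow> 'y set" where
  "representatives S = (\<lambda>U. SOME y. y \<in> U) ` S"

text \<open>For an arrow \<open>a\<close>, \<open>X(a)\<close> consists of singleton classes of lists of length one.\<close>

definition ei_elt ::
    "('v, 'a, 'g, 'y) ei_quiver \<Rightarrow> 'a \<Rightarrow> 'y \<Rightarrow> (('v, 'a darrow, 'g, 'y) ei_mor \<Rightarrow>\<^sub>0 'k::field)" where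
  "ei_elt Q a y = basis_elt ((tail (quiver Q) a, [Orig a], head (quiver Q) a), Inr {[y]})"

definition ei_star ::
    "('v, 'a, 'g, 'y) ei_quiver \<Rightarrow> 'a \<Rightarrow> 'y \<Rightarrow> (('v, 'a darrow, 'g, 'y) ei_mor \<Rightarrow>\<^sub>0 'k::field)" where
  "ei_star Q a y = basis_elt ((head (quiver Q) a, [Star a], tail (quiver Q) a), Inr {[y]})"

text \<open>
  In an EI quiver, \<open>b b\<^sup>*\<close> depends only on the right orbit of \<open>b\<close>, and \<open>c\<^sup>* c\<close> only on the left
  orbit of \<open>c\<close>, so the choice of representatives is immaterial.
\<close>

definition ei_rho ::
    "('v, 'a, 'g, 'y) ei_quiver \<Rightarrow> (('v, 'a darrow, 'g, 'y) ei_mor \<Rightarrow>\<^sub>0 'k::field)" where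
  "ei_rho Q =
    (let A = cat_alg (ei_cat (double_ei_quiver Q)) in
      \<Sum>a\<in>arcs (quiver Q).
        (\<Sum>b\<in>representatives (right_orbits Q a). ei_elt Q a b \<otimes>\<^bsub>A\<^esub> ei_star Q a b) -
        (\<Sum>c\<in>representatives (left_orbits Q a). ei_star Q a c \<otimes>\<^bsub>A\<^esub> ei_elt Q a c))"

definition ei_preproj_alg ::
    "('v, 'a, 'g, 'y) ei_quiver \<Rightarrow>
     ('k::field, (('v, 'a darrow, 'g, 'y) ei_mor \<Rightarrow>\<^sub>0 'k) set) module" where
  "ei_preproj_alg Q =
    (let A = cat_alg (ei_cat (double_ei_quiver Q)) in A Quot\<^sub>a (Idl\<^bsub>A\<^esub> {ei_rho Q}))"


section \<open>The EI quiver of a Cartan triple\<close>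

text \<open>
  The group \<open>X(i)\<close> is \<^term>\<open>integer_mod_group (D i)\<close>, in additive notation, with generator
  \<open>\<eta>\<^sub>i = 1 mod D i\<close>.  The embedding of the cyclic group of order \<open>k\<close> into that of order \<open>c\<close>
  multiplies exponents by \<open>c div k\<close>.
\<close>

definition cyc_embed :: "nat \<Rightarrow> nat \<Rightarrow> int \<Rightarrow> int" where
  "cyc_embed k c a = (a * int (c div k)) mod int c"

definition cartan_biset :: "('v \<Rightarrow> nat) \<Rightarrow> 'v \<Rightarrow> 'v \<Rightarrow> (int, int, (int \<times> int) set) biset" where
  "cartan_biset D i j =
    (let k = gcd (D i) (D j); Gi = integer_mod_group (D i); Gj = integer_mod_group (D j) in
      biset_prod (integer_mod_group k)
        \<lparr>bset = carrier Gi, lact = (\<lambda>g y. g \<otimes>\<^bsub>Gi\<^esub> y), ract = (\<lambda>y h. y \<otimes>\<^bsub>Gi\<^esub> cyc_embed k (D i) h)\<rparr>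
        \<lparr>bset = carrier Gj, lact = (\<lambda>h y. cyc_embed k (D j) h \<otimes>\<^bsub>Gj\<^esub> y), ract = (\<lambda>y g. y \<otimes>\<^bsub>Gj\<^esub> g)\<rparr>)"

text \<open>The triple \<open>(i, j, g)\<close> is the arrow \<open>j \<rightarrow> i\<close> with number \<open>g\<close>.\<close>

definition cartan_ei_quiver ::
    "'v set \<Rightarrow> ('v \<Rightarrow> 'v \<Rightarrow> int) \<Rightarrow> ('v \<Rightarrow> nat) \<Rightarrow> ('v \<times> 'v) set \<Rightarrow>
     ('v, 'v \<times> 'v \<times> nat, int, (int \<times> int) set) ei_quiver" where
  "cartan_ei_quiver I C D \<Omega> =
    \<lparr>quiver =
       \<lparr>verts = I,
        arcs = {(i, j, g). (i, j) \<in> \<Omega> \<and> g \<in> {1..cartan_g C i j}},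
        tail = (\<lambda>(i, j, g). j),
        head = (\<lambda>(i, j, g). i)\<rparr>,
     vgrp = (\<lambda>i. integer_mod_group (D i)),
     abiset = (\<lambda>(i, j, g). cartan_biset D i j)\<rparr>"

end

theory Submission
  imports Defs
begin

text \<open>Write c_i = q_i d_i with q_i the p-part of c_i, where q_i = 1 in characteristic 0. The
  generator h_i of the cyclic group X(i) is the product of a part of order dividing d_i and a part
  of order dividing q_i. As K contains the d_i-th roots of unity and d_i is invertible in K, the
  first part is diagonalizable, with spectral idempotents E_(i,l) for l < d_i. The second part is
  governed by w_i = h_i^(d_i), and \<epsilon>_(i,l) = (w_i - 1) E_(i,l) has q_i-th power 0 by
  Frobenius. So the group algebra of X(i) is a product of d_i truncated polynomial rings, one for
  each vertex (i,l) of the triple (C', D', \<Omega>').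

  An arrow of the EI quiver gives elements A_ij with h_i^(F_ij) A_ij = A_ij h_j^(F_ji), where F_ij =
  c_i / gcd(c_i, c_j). They are cut into blocks E_(i,l) A_ij E_(j,m). If the primitive roots are
  chosen compatibly (\<open>compatible_primitive_roots\<close>), comparison of eigenvalues shows
  that only the blocks with (l,m) in \<Sigma>_ij survive (\<open>EAE_zero\<close>). For these, the
  relation between the powers of w turns into the relation between the powers of \<epsilon>, because
  (w - 1)^P = w^P - 1 for powers P of p.

  The heart of the proof is the preprojective relation. At the vertex i, the relation of the EI
  quiver adds up the conjugates h_i^f A_ij A_ji h_i^(-f) for f < F_ij. By the Chinese remainder
  theorem the sum over f is a double sum. The semisimple part contributes the scalar d_i / gcd(d_i,
  d_j) on diagonal blocks and annihilates the others (\<open>conj_sum\<close>). The rest is a sum of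
  w^u Y w^(-u) over u < n with n a power of p, which is the sum of (w - 1)^f Y (w - 1)^(n-1-f)
  multiplied by w^(1-n) (\<open>sum_unipotent\<close>). The scalar and the power of w depend on j.
  To remove this dependence, the reverse arrows are rescaled by \<kappa> and twisted by a power
  \<tau> of w. Then each diagonal block of the EI relator is the mesh relator of (C', D', \<Omega>')
  times d_i w_i, which is invertible (\<open>ei_relator_component\<close>,
  \<open>ei_relator_iff\<close>). The change of generators is inverted by h_i = sum of z_i^l (1 +
  \<epsilon>_(i,l))^y E_(i,l), with y an inverse of d_i modulo q_i, and by summing the blocks
  (\<open>be_conv\<close>, \<open>bh_conv\<close>, \<open>bA_conv\<close>; \<open>gE_back\<close>,
  \<open>g\<epsilon>_back\<close>, \<open>g\<alpha>_back\<close>).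

  To compute in a type of class \<open>ring_1\<close>, each quotient algebra is embedded into the
  endomorphisms of a vector space (\<open>ideal_embedding\<close>). Elements that satisfy one of the
  two sets of relations form an \<open>ei_action\<close> or a \<open>gp_action\<close>. The two
  conversions and the universal properties of the two algebras give maps in both directions, and
  \<open>quot_alg_isomorphic\<close> obtains the isomorphism from its graph, a subalgebra of the
  product of the two rings that is generated by the pairs of generators of either kind.\<close>

section \<open>Embedding algebras into endomorphism rings\<close>

definition pm_scale :: "'k::field \<Rightarrow> ('m \<Rightarrow>\<^sub>0 'k) \<Rightarrow> ('m \<Rightarrow>\<^sub>0 'k)" where
  "pm_scale c = Poly_Mapping.map ((*) c)"

lemma lookup_pm_scale [simp]:
  "Poly_Mapping.lookup (pm_scale c u) m = c * Poly_Mapping.lookup u m"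
  by (simp add: pm_scale_def Poly_Mapping.map.rep_eq when_def)

lemma pm_scale_single [simp]: "pm_scale c (Poly_Mapping.single f a) = Poly_Mapping.single f (c * a)"
  by (simp add: pm_scale_def)

interpretation pm_vs: vector_space "pm_scale :: 'k::field \<Rightarrow> ('m \<Rightarrow>\<^sub>0 'k) \<Rightarrow> _"
  by standard (auto intro!: poly_mapping_eqI simp: lookup_add algebra_simps)

interpretation pm_vs_pair: vector_space_pair
  "pm_scale :: 'k::field \<Rightarrow> ('m \<Rightarrow>\<^sub>0 'k) \<Rightarrow> _" "pm_scale :: 'k::field \<Rightarrow> ('n \<Rightarrow>\<^sub>0 'k) \<Rightarrow> _" ..

abbreviation pm_linear :: "(('m \<Rightarrow>\<^sub>0 'k::field) \<Rightarrow> ('n \<Rightarrow>\<^sub>0 'k)) \<Rightarrow> bool" where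
  "pm_linear \<equiv> Vector_Spaces.linear pm_scale pm_scale"

lemma pm_linearI:
  fixes f :: "('m \<Rightarrow>\<^sub>0 'k::field) \<Rightarrow> ('n \<Rightarrow>\<^sub>0 'k)"
  assumes "\<And>x y. f (x + y) = f x + f y" "\<And>c x. f (pm_scale c x) = pm_scale c (f x)"
  shows "pm_linear f"
  using assms by (intro Vector_Spaces.linear.intro pm_vs.vector_space_axioms)
    (simp_all add: module_hom_def module_hom_axioms_def pm_vs.module_axioms module_hom_iff)

lemma pm_linear_add: "pm_linear f \<Longrightarrow> f (x + y) = f x + f y"
  and pm_linear_scale: "pm_linear f \<Longrightarrow> f (pm_scale c x) = pm_scale c (f x)"
  and pm_linear_diff: "pm_linear f \<Longrightarrow> f (x - y) = f x - f y"
  and pm_linear_0: "pm_linear f \<Longrightarrow> f 0 = 0"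
  for f :: "('m \<Rightarrow>\<^sub>0 'k::field) \<Rightarrow> ('n \<Rightarrow>\<^sub>0 'k)"
  by (simp_all add: pm_vs_pair.linear_add pm_vs_pair.linear_scale pm_vs_pair.linear_diff pm_vs_pair.linear_0)

text \<open>The target of the embeddings of the quotient algebras: a ring that is a whole type,
  where relations can be rewritten without carrier conditions.\<close>

typedef (overloaded) ('m, 'k::field) endo = "{f :: ('m \<Rightarrow>\<^sub>0 'k) \<Rightarrow> ('m \<Rightarrow>\<^sub>0 'k). pm_linear f}"
  by (rule exI[of _ "\<lambda>_. 0"]) (simp add: pm_linearI)

setup_lifting type_definition_endo

instantiation endo :: (type, field) ring_1
begin

lift_definition zero_endo :: "('a, 'b) endo" is "\<lambda>_. 0" by (simp add: pm_linearI)
lift_definition one_endo :: "('a, 'b) endo" is "\<lambda>x. x" by (simp add: pm_linearI)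
lift_definition plus_endo :: "('a, 'b) endo \<Rightarrow> ('a, 'b) endo \<Rightarrow> ('a, 'b) endo" is "\<lambda>f g x. f x + g x"
  by (auto intro!: pm_linearI simp: pm_linear_add pm_linear_scale pm_vs.scale_right_distrib)
lift_definition uminus_endo :: "('a, 'b) endo \<Rightarrow> ('a, 'b) endo" is "\<lambda>f x. - f x"
  by (auto intro!: pm_linearI simp: pm_linear_add pm_linear_scale)
lift_definition minus_endo :: "('a, 'b) endo \<Rightarrow> ('a, 'b) endo \<Rightarrow> ('a, 'b) endo" is "\<lambda>f g x. f x - g x"
  by (auto intro!: pm_linearI simp: pm_linear_add pm_linear_scale pm_vs.scale_right_diff_distrib)
lift_definition times_endo :: "('a, 'b) endo \<Rightarrow> ('a, 'b) endo \<Rightarrow> ('a, 'b) endo" is "\<lambda>f g x. f (g x)"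
  by (auto intro!: pm_linearI simp: pm_linear_add pm_linear_scale)

instance
proof
  have "(\<lambda>_ :: 'a \<Rightarrow>\<^sub>0 'b. 0 :: 'a \<Rightarrow>\<^sub>0 'b) \<noteq> (\<lambda>x. x)"
    (is "?f \<noteq> ?g")
  proof
    assume "?f = ?g"
    from fun_cong[OF this, of "Poly_Mapping.single undefined 1"] have "Poly_Mapping.single undefined (1::'b) = (0 :: 'a \<Rightarrow>\<^sub>0 'b)"
      by simp
    from arg_cong[OF this, of "\<lambda>u. Poly_Mapping.lookup u undefined"] show False
      by (simp add: lookup_single)
  qed
  then show "(0 :: ('a, 'b) endo) \<noteq> 1" by transfer
qed (transfer; auto simp: fun_eq_iff pm_linear_add)+

end

lift_definition endo_scalar :: "'k::field \<Rightarrow> ('m, 'k) endo" is "pm_scale"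
  by (auto intro!: pm_linearI simp: pm_vs.scale_right_distrib mult.commute)

text \<open>A ring homomorphism from the field to the centre, that is, the structure of an algebra
  over the field.\<close>

locale scalars =
  fixes sc :: "'k::field \<Rightarrow> 't::ring_1"
  assumes sc_add: "sc (a + b) = sc a + sc b"
    and sc_mult: "sc (a * b) = sc a * sc b"
    and sc_1 [simp]: "sc 1 = 1"
    and sc_comm: "x * sc a = sc a * x"
begin

lemma sc_0 [simp]: "sc 0 = 0" using sc_add[of 0 0] by simp

lemma sc_minus: "sc (- a) = - sc a"
  using sc_add[of a "- a"] by (simp add: eq_neg_iff_add_eq_0 add.commute)

lemma sc_diff: "sc (a - b) = sc a - sc b"
  using sc_add[of a "- b"] by (simp add: sc_minus)

lemma sc_sum: "sc (sum f A) = (\<Sum>x\<in>A. sc (f x))"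
  by (induction A rule: infinite_finite_induct) (auto simp: sc_add)

lemma sc_power: "sc (a ^ n) = sc a ^ n"
  by (induction n) (auto simp: sc_mult)

lemma sc_left_comm: "x * (sc a * y) = sc a * (x * y)"
  by (simp add: sc_comm flip: mult.assoc)

end

interpretation endo: scalars "endo_scalar :: 'k::field \<Rightarrow> ('m, 'k) endo"
proof
  fix a b :: 'k and x :: "('m, 'k) endo"
  show "endo_scalar (a + b) = (endo_scalar a + endo_scalar b :: ('m, 'k) endo)"
    by transfer (simp add: fun_eq_iff pm_vs.scale_left_distrib)
  show "endo_scalar (a * b) = (endo_scalar a * endo_scalar b :: ('m, 'k) endo)"
    by transfer (simp add: fun_eq_iff)
  show "endo_scalar 1 = (1 :: ('m, 'k) endo)"
    by transfer (simp add: fun_eq_iff)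
  show "x * endo_scalar a = endo_scalar a * x"
    by transfer (simp add: fun_eq_iff pm_linear_scale)
qed

text \<open>Units are left out on purpose. When an algebra acts on a complement of an ideal inside a
  larger space, its unit acts as a projection and in general not as the identity.\<close>

definition nonunital_hom :: "('k::field, 'a) module \<Rightarrow> ('k \<Rightarrow> 't::ring_1) \<Rightarrow> ('a \<Rightarrow> 't) \<Rightarrow> bool" where
  "nonunital_hom A sc f \<longleftrightarrow>
    (\<forall>x\<in>carrier A. \<forall>y\<in>carrier A. f (x \<oplus>\<^bsub>A\<^esub> y) = f x + f y \<and> f (x \<otimes>\<^bsub>A\<^esub> y) = f x * f y) \<and>
    (\<forall>c. \<forall>x\<in>carrier A. f (c \<odot>\<^bsub>A\<^esub> x) = sc c * f x)"

section \<open>Algebras of categories with finitely many objects; their quotients as rings of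
  operators\<close>

section \<open>Category algebras are rings\<close>

lemma pm_induct [consumes 1, case_names zero single add]:
  assumes "Poly_Mapping.keys u \<subseteq> S"
    and "P 0" and "\<And>f c. f \<in> S \<Longrightarrow> P (Poly_Mapping.single f c)"
    and "\<And>u v. Poly_Mapping.keys u \<subseteq> S \<Longrightarrow> Poly_Mapping.keys v \<subseteq> S \<Longrightarrow> P u \<Longrightarrow> P v \<Longrightarrow> P (u + v)"
  shows "P (u :: 'm \<Rightarrow>\<^sub>0 'k::comm_monoid_add)"
proof -
  have *: "P (\<Sum>f\<in>B. Poly_Mapping.single f (c f)) \<and> Poly_Mapping.keys (\<Sum>f\<in>B. Poly_Mapping.single f (c f)) \<subseteq> S"
    if "finite B" "B \<subseteq> S" for B and c :: "'m \<Rightarrow> 'k"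
    using that
  proof (induction B rule: finite_induct)
    case (insert x F)
    have *: "Poly_Mapping.keys (Poly_Mapping.single x (c x)) \<subseteq> S" using insert.prems by simp
    have "Poly_Mapping.keys (Poly_Mapping.single x (c x) + (\<Sum>f\<in>F. Poly_Mapping.single f (c f))) \<subseteq> S"
      using keys_add[of "Poly_Mapping.single x (c x)" "\<Sum>f\<in>F. Poly_Mapping.single f (c f)"] * insert by auto
    moreover have "P (Poly_Mapping.single x (c x) + (\<Sum>f\<in>F. Poly_Mapping.single f (c f)))"
      using * insert by (intro assms(3,4)) auto
    ultimately show ?case using insert.hyps by simp
  qed (use assms in auto)
  have "u = (\<Sum>f\<in>Poly_Mapping.keys u. Poly_Mapping.single f (Poly_Mapping.lookup u f))"
    by (rule poly_mapping_eqI)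
      (auto simp: lookup_sum lookup_single when_def in_keys_iff sum.delta')
  then show ?thesis using *[OF finite_keys assms(1), of "Poly_Mapping.lookup u"] by simp
qed

lemma pm_induct_UNIV [case_names zero single add]:
  assumes "P 0" and "\<And>f c. P (Poly_Mapping.single f c)"
    and "\<And>u v. P u \<Longrightarrow> P v \<Longrightarrow> P (u + v)"
  shows "P (u :: 'm \<Rightarrow>\<^sub>0 'k::comm_monoid_add)"
  using subset_UNIV by (rule pm_induct) (use assms in auto)

definition pm_sum :: "('m \<Rightarrow> 'k::comm_monoid_add \<Rightarrow> 't::comm_monoid_add) \<Rightarrow> ('m \<Rightarrow>\<^sub>0 'k) \<Rightarrow> 't" where
  "pm_sum G u = (\<Sum>f\<in>Poly_Mapping.keys u. G f (Poly_Mapping.lookup u f))"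

lemma pm_sum_superset:
  assumes "finite B" "Poly_Mapping.keys u \<subseteq> B" "\<And>f. G f 0 = 0"
  shows "pm_sum G u = (\<Sum>f\<in>B. G f (Poly_Mapping.lookup u f))"
  unfolding pm_sum_def using assms by (intro sum.mono_neutral_left) (auto simp: in_keys_iff)

lemma pm_sum_add:
  assumes "\<And>f. G f 0 = 0" "\<And>f a b. G f (a + b) = G f a + G f b"
  shows "pm_sum G (u + v) = pm_sum G u + pm_sum G v"
proof -
  let ?B = "Poly_Mapping.keys u \<union> Poly_Mapping.keys v"
  have "pm_sum G (u + v) = (\<Sum>f\<in>?B. G f (Poly_Mapping.lookup (u + v) f))"
    by (intro pm_sum_superset keys_add assms) auto
  moreover have "pm_sum G u = (\<Sum>f\<in>?B. G f (Poly_Mapping.lookup u f))"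
    "pm_sum G v = (\<Sum>f\<in>?B. G f (Poly_Mapping.lookup v f))"
    by (intro pm_sum_superset assms; auto)+
  ultimately show ?thesis by (simp add: lookup_add assms sum.distrib)
qed

lemma pm_sum_single: "G f 0 = 0 \<Longrightarrow> pm_sum G (Poly_Mapping.single f c) = G f c"
  by (simp add: pm_sum_def)

lemma pm_sum_zero [simp]: "pm_sum G 0 = 0" by (simp add: pm_sum_def)

locale finite_cat =
  fixes C :: "('o, 'm) small_cat"
  assumes finite_obs: "finite (obs C)"
    and dom_obs: "f \<in> mors C \<Longrightarrow> cdom C f \<in> obs C"
    and cod_obs: "f \<in> mors C \<Longrightarrow> ccod C f \<in> obs C"
    and id_mor: "x \<in> obs C \<Longrightarrow> cid C x \<in> mors C"
    and dom_id: "x \<in> obs C \<Longrightarrow> cdom C (cid C x) = x"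
    and cod_id: "x \<in> obs C \<Longrightarrow> ccod C (cid C x) = x"
    and comp_mor: "f \<in> mors C \<Longrightarrow> g \<in> mors C \<Longrightarrow> cdom C f = ccod C g \<Longrightarrow> ccomp C f g \<in> mors C"
    and dom_comp: "f \<in> mors C \<Longrightarrow> g \<in> mors C \<Longrightarrow> cdom C f = ccod C g \<Longrightarrow> cdom C (ccomp C f g) = cdom C g"
    and cod_comp: "f \<in> mors C \<Longrightarrow> g \<in> mors C \<Longrightarrow> cdom C f = ccod C g \<Longrightarrow> ccod C (ccomp C f g) = ccod C f"
    and comp_id: "f \<in> mors C \<Longrightarrow> ccomp C f (cid C (cdom C f)) = f"
    and id_comp: "f \<in> mors C \<Longrightarrow> ccomp C (cid C (ccod C f)) f = f"
    and comp_assoc: "f \<in> mors C \<Longrightarrow> g \<in> mors C \<Longrightarrow> h \<in> mors C \<Longrightarrow>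
      cdom C f = ccod C g \<Longrightarrow> cdom C g = ccod C h \<Longrightarrow>
      ccomp C (ccomp C f g) h = ccomp C f (ccomp C g h)"

lemma cat_alg_mult_pm_sum:
  "u \<otimes>\<^bsub>cat_alg C\<^esub> v =
    pm_sum (\<lambda>f a. pm_sum (\<lambda>g b. if cdom C f = ccod C g
      then Poly_Mapping.single (ccomp C f g) (a * b) else 0) v) u"
  by (simp add: cat_alg_def pm_sum_def)

lemma cat_alg_simps [simp]:
  "u \<oplus>\<^bsub>cat_alg C\<^esub> v = u + v" "\<zero>\<^bsub>cat_alg C\<^esub> = 0" "c \<odot>\<^bsub>cat_alg C\<^esub> u = pm_scale c u"
  "\<one>\<^bsub>cat_alg C\<^esub> = (\<Sum>x\<in>obs C. Poly_Mapping.single (cid C x) 1)"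
  by (simp_all add: cat_alg_def pm_scale_def)

lemma cat_alg_carrier: "u \<in> carrier (cat_alg C) \<longleftrightarrow> Poly_Mapping.keys u \<subseteq> mors C"
  by (simp add: cat_alg_def)

lemma cat_alg_mult_single:
  "Poly_Mapping.single f a \<otimes>\<^bsub>cat_alg C\<^esub> Poly_Mapping.single g b =
    (if cdom C f = ccod C g then Poly_Mapping.single (ccomp C f g) (a * b) else 0)"
  by (simp add: cat_alg_mult_pm_sum pm_sum_single)

lemma cat_alg_add_mult: "(u + u') \<otimes>\<^bsub>cat_alg C\<^esub> v = u \<otimes>\<^bsub>cat_alg C\<^esub> v + u' \<otimes>\<^bsub>cat_alg C\<^esub> v"
proof -
  have "pm_sum (\<lambda>g b. if cdom C f = ccod C g then Poly_Mapping.single (ccomp C f g) ((a + a') * b) else 0) v =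
      pm_sum (\<lambda>g b. if cdom C f = ccod C g then Poly_Mapping.single (ccomp C f g) (a * b) else 0) v +
      pm_sum (\<lambda>g b. if cdom C f = ccod C g then Poly_Mapping.single (ccomp C f g) (a' * b) else 0) v" for f a a'
    by (auto simp: pm_sum_def single_add distrib_right intro!: sum.cong simp flip: sum.distrib)
  then show ?thesis unfolding cat_alg_mult_pm_sum
    by (intro pm_sum_add) (auto simp: pm_sum_def intro!: sum.neutral)
qed

lemma cat_alg_mult_add: "u \<otimes>\<^bsub>cat_alg C\<^esub> (v + v') = u \<otimes>\<^bsub>cat_alg C\<^esub> v + u \<otimes>\<^bsub>cat_alg C\<^esub> v'"
proof -
  have "pm_sum (\<lambda>g b. if cdom C f = ccod C g then Poly_Mapping.single (ccomp C f g) (a * b) else 0) (v + v') =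
      pm_sum (\<lambda>g b. if cdom C f = ccod C g then Poly_Mapping.single (ccomp C f g) (a * b) else 0) v +
      pm_sum (\<lambda>g b. if cdom C f = ccod C g then Poly_Mapping.single (ccomp C f g) (a * b) else 0) v'" for f a
    by (intro pm_sum_add) (auto simp: single_add distrib_left)
  then show ?thesis unfolding cat_alg_mult_pm_sum
    by (simp add: pm_sum_def sum.distrib)
qed

lemma cat_alg_zero_mult [simp]: "0 \<otimes>\<^bsub>cat_alg C\<^esub> v = 0" "u \<otimes>\<^bsub>cat_alg C\<^esub> 0 = 0"
  using cat_alg_add_mult[where u = 0 and u' = 0] cat_alg_mult_add[where v = 0 and v' = 0] by simp_all

lemma cat_alg_mult_sum: "u \<otimes>\<^bsub>cat_alg C\<^esub> (\<Sum>x\<in>B. g x) = (\<Sum>x\<in>B. u \<otimes>\<^bsub>cat_alg C\<^esub> g x)"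
  "(\<Sum>x\<in>B. g x) \<otimes>\<^bsub>cat_alg C\<^esub> u = (\<Sum>x\<in>B. g x \<otimes>\<^bsub>cat_alg C\<^esub> u)"
  by (induction B rule: infinite_finite_induct; simp add: cat_alg_mult_add cat_alg_add_mult)+

lemma cat_alg_scale_mult: "pm_scale c u \<otimes>\<^bsub>cat_alg C\<^esub> v = pm_scale c (u \<otimes>\<^bsub>cat_alg C\<^esub> v)"
proof (induction u rule: pm_induct_UNIV)
  case (single f a)
  show ?case
    by (induction v rule: pm_induct_UNIV)
      (simp_all add: cat_alg_mult_single cat_alg_mult_add pm_vs.scale_right_distrib mult.assoc)
qed (simp_all add: cat_alg_add_mult pm_vs.scale_right_distrib)

lemma cat_alg_mult_scale: "u \<otimes>\<^bsub>cat_alg C\<^esub> pm_scale c v = pm_scale c (u \<otimes>\<^bsub>cat_alg C\<^esub> v)"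
proof (induction u rule: pm_induct_UNIV)
  case (single f a)
  show ?case
    by (induction v rule: pm_induct_UNIV)
      (simp_all add: cat_alg_mult_single cat_alg_mult_add pm_vs.scale_right_distrib mult.left_commute)
qed (simp_all add: cat_alg_add_mult pm_vs.scale_right_distrib)

context finite_cat
begin

abbreviation "A \<equiv> cat_alg C :: ('k::field, 'm \<Rightarrow>\<^sub>0 'k) module"

lemma single_carrier: "f \<in> mors C \<Longrightarrow> Poly_Mapping.single f c \<in> carrier A"
  by (auto simp: cat_alg_carrier)

lemma add_carrier: "u \<in> carrier A \<Longrightarrow> v \<in> carrier A \<Longrightarrow> u + v \<in> carrier A"
  using keys_add[of u v] by (auto simp: cat_alg_carrier)

lemma zero_carrier: "0 \<in> carrier A" by (simp add: cat_alg_carrier)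

lemma sum_carrier: "(\<And>x. x \<in> B \<Longrightarrow> g x \<in> carrier A) \<Longrightarrow> sum g B \<in> carrier A"
  by (induction B rule: infinite_finite_induct) (auto intro: add_carrier zero_carrier)

lemma scale_carrier: "u \<in> carrier A \<Longrightarrow> pm_scale c u \<in> carrier A"
  by (auto simp: cat_alg_carrier in_keys_iff subset_iff)

lemma minus_carrier: "u \<in> carrier A \<Longrightarrow> - u \<in> carrier A"
  by (auto simp: cat_alg_carrier in_keys_iff subset_iff)

lemma carrier_induct [consumes 1, case_names zero single add]:
  assumes "u \<in> carrier A" "P 0" "\<And>f c. f \<in> mors C \<Longrightarrow> P (Poly_Mapping.single f c)"
    "\<And>u v. u \<in> carrier A \<Longrightarrow> v \<in> carrier A \<Longrightarrow> P u \<Longrightarrow> P v \<Longrightarrow> P (u + v)"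
  shows "P u"
  using assms(1) unfolding cat_alg_carrier
  by (rule pm_induct) (fact assms(2), erule assms(3), rule assms(4), simp_all add: cat_alg_carrier)

lemma mult_carrier: "u \<in> carrier A \<Longrightarrow> v \<in> carrier A \<Longrightarrow> u \<otimes>\<^bsub>A\<^esub> v \<in> carrier A"
proof (induction u rule: carrier_induct)
  case (single f a)
  show ?case using single(2)
    by (induction v rule: carrier_induct)
      (auto simp: cat_alg_mult_single cat_alg_mult_add zero_carrier intro!: add_carrier single_carrier comp_mor single)
qed (auto simp: cat_alg_add_mult zero_carrier intro: add_carrier)

lemma mult_assoc: 
  assumes "u \<in> carrier A" "v \<in> carrier A" "w \<in> carrier A"
  shows "u \<otimes>\<^bsub>A\<^esub> v \<otimes>\<^bsub>A\<^esub> w = u \<otimes>\<^bsub>A\<^esub> (v \<otimes>\<^bsub>A\<^esub> w)"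
  using assms(1)
proof (induction u rule: carrier_induct)
  case (single f a)
  show ?case using assms(2)
  proof (induction v rule: carrier_induct)
    case s2: (single g b)
    show ?case using assms(3)
      by (induction w rule: carrier_induct)
        (use single s2 in \<open>simp_all add: cat_alg_mult_single cat_alg_mult_add dom_comp cod_comp comp_assoc mult.assoc\<close>)
  qed (simp_all add: cat_alg_add_mult cat_alg_mult_add)
qed (simp_all add: cat_alg_add_mult cat_alg_mult_add)

lemma one_mult: "u \<in> carrier A \<Longrightarrow> \<one>\<^bsub>A\<^esub> \<otimes>\<^bsub>A\<^esub> u = u"
proof (induction u rule: carrier_induct)
  case (single f a)
  then have "\<one>\<^bsub>A\<^esub> \<otimes>\<^bsub>A\<^esub> Poly_Mapping.single f a = (\<Sum>x\<in>obs C. if x = ccod C f then Poly_Mapping.single f a else 0)"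
    by (auto simp: cat_alg_mult_sum cat_alg_mult_single dom_id id_comp intro!: sum.cong)
  also have "\<dots> = Poly_Mapping.single f a"
    using single cod_obs finite_obs by (simp add: sum.delta)
  finally show ?case .
qed (simp_all add: cat_alg_mult_add)

lemma mult_one: "u \<in> carrier A \<Longrightarrow> u \<otimes>\<^bsub>A\<^esub> \<one>\<^bsub>A\<^esub> = u"
proof (induction u rule: carrier_induct)
  case (single f a)
  then have "Poly_Mapping.single f a \<otimes>\<^bsub>A\<^esub> \<one>\<^bsub>A\<^esub> = (\<Sum>x\<in>obs C. if x = cdom C f then Poly_Mapping.single f a else 0)"
    by (auto simp: cat_alg_mult_sum cat_alg_mult_single cod_id comp_id intro!: sum.cong)
  also have "\<dots> = Poly_Mapping.single f a"
    using single dom_obs finite_obs by (simp add: sum.delta)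
  finally show ?case .
qed (simp_all add: cat_alg_add_mult)

lemma one_carrier: "\<one>\<^bsub>A\<^esub> \<in> carrier A"
  by (auto intro!: sum_carrier single_carrier id_mor)

lemma ring_cat_alg: "ring A"
proof (rule ringI)
  have "\<exists>y\<in>carrier A. y \<oplus>\<^bsub>A\<^esub> x = \<zero>\<^bsub>A\<^esub>" if "x \<in> carrier A" for x
    by (rule bexI[of _ "- x"]) (use that minus_carrier in simp_all)
  then show "abelian_group A"
    by (intro abelian_groupI) (simp_all add: zero_carrier ac_simps add_carrier)
  show "Group.monoid A"
    by (rule monoidI) (use mult_carrier mult_assoc one_carrier one_mult mult_one in auto)
qed (simp_all add: cat_alg_add_mult cat_alg_mult_add)

text \<open>Scaling by \<open>c\<close> is multiplication by \<open>c\<close> times the unit, so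
  ideals are subspaces.\<close>

lemma ideal_scale: 
  assumes "ideal J A" "u \<in> J"
  shows "pm_scale c u \<in> J"
proof -
  interpret ideal J A by fact
  have "u \<in> carrier A" using assms(2) a_Hcarr by blast
  have "pm_scale c \<one>\<^bsub>A\<^esub> \<otimes>\<^bsub>A\<^esub> u \<in> J"
    by (rule I_l_closed[OF assms(2) scale_carrier[OF one_carrier]])
  moreover have "pm_scale c \<one>\<^bsub>A\<^esub> \<otimes>\<^bsub>A\<^esub> u = pm_scale c u"
    unfolding cat_alg_scale_mult using one_mult[OF \<open>u \<in> carrier A\<close>] by (simp only:)
  ultimately show ?thesis by (simp only:)
qed

end

text \<open>A basis \<open>B\<close> of \<open>J\<close> is extended to a basis of the whole space;
  the projection kills \<open>B\<close> and fixes the added basis vectors.\<close>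

lemma pm_projection:
  fixes J :: "('m \<Rightarrow>\<^sub>0 'k::field) set"
  assumes "pm_vs.subspace J"
  obtains \<pi> where "pm_linear \<pi>" "\<And>x. x - \<pi> x \<in> J" "\<And>x. x \<in> J \<Longrightarrow> \<pi> x = 0"
proof -
  obtain B where B: "B \<subseteq> J" "pm_vs.independent B" "J \<subseteq> pm_vs.span B"
    using pm_vs.maximal_independent_subset .
  obtain B' where B': "B \<subseteq> B'" "pm_vs.independent B'" "UNIV \<subseteq> pm_vs.span B'"
    using pm_vs.maximal_independent_subset_extend[OF subset_UNIV B(2)] by metis
  obtain \<pi> :: "('m \<Rightarrow>\<^sub>0 'k) \<Rightarrow> ('m \<Rightarrow>\<^sub>0 'k)" where lin: "pm_linear \<pi>"
    and \<pi>: "\<And>x. x \<in> B' \<Longrightarrow> \<pi> x = (if x \<in> B then 0 else x)"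
    using pm_vs_pair.linear_independent_extend[OF B'(2), of "\<lambda>x. if x \<in> B then 0 else x"] by auto
  note simps = pm_linear_add[OF lin] pm_linear_scale[OF lin] pm_linear_0[OF lin]
  have "pm_vs.subspace {x. \<pi> x = 0}" "pm_vs.subspace {x. x - \<pi> x \<in> J}"
    using pm_vs.subspace_add[OF assms] pm_vs.subspace_scale[OF assms] pm_vs.subspace_0[OF assms]
    by (auto simp: pm_vs.subspace_def simps add_diff_add simp flip: pm_vs.scale_right_diff_distrib)
  moreover have "B \<subseteq> {x. \<pi> x = 0}" "B' \<subseteq> {x. x - \<pi> x \<in> J}"
    using B B' \<pi> pm_vs.subspace_0[OF assms] by auto
  ultimately have "pm_vs.span B \<subseteq> {x. \<pi> x = 0}" "pm_vs.span B' \<subseteq> {x. x - \<pi> x \<in> J}"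
    using pm_vs.span_minimal by meson+
  with B B' have "x - \<pi> x \<in> J" "x \<in> J \<Longrightarrow> \<pi> x = 0" for x by auto
  with lin show thesis by (rule that)
qed

lemma nonunital_homD:
  assumes "nonunital_hom A sc f"
  shows "\<And>x y. x \<in> carrier A \<Longrightarrow> y \<in> carrier A \<Longrightarrow> f (x \<oplus>\<^bsub>A\<^esub> y) = f x + f y"
    and "\<And>x y. x \<in> carrier A \<Longrightarrow> y \<in> carrier A \<Longrightarrow> f (x \<otimes>\<^bsub>A\<^esub> y) = f x * f y"
    and "\<And>c x. x \<in> carrier A \<Longrightarrow> f (c \<odot>\<^bsub>A\<^esub> x) = sc c * f x"
  using assms by (auto simp: nonunital_hom_def)

context finite_cat
begin

text \<open>
  Left multiplication on the quotient by \<open>J\<close>, identified by means of a projection \<open>\<pi>\<close> with a complement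
  of \<open>J\<close>.
\<close>

lemma ideal_embedding:
  fixes J :: "('m \<Rightarrow>\<^sub>0 'k::field) set"
  assumes J: "ideal J A"
  obtains r :: "('m \<Rightarrow>\<^sub>0 'k) \<Rightarrow> ('m, 'k) endo"
  where "nonunital_hom A endo_scalar r" "\<And>a. a \<in> carrier A \<Longrightarrow> r a = 0 \<longleftrightarrow> a \<in> J"
proof -
  interpret ideal J A by fact
  have JA: "J \<subseteq> carrier A" using a_Hcarr by blast
  have sub: "pm_vs.subspace J"
    using additive_subgroup.zero_closed[OF is_additive_subgroup]
      additive_subgroup.a_closed[OF is_additive_subgroup] ideal_scale[OF J]
    by (auto simp: pm_vs.subspace_def)
  obtain \<pi> where lin: "pm_linear \<pi>" and \<pi>: "\<And>x. x - \<pi> x \<in> J" "\<And>x. x \<in> J \<Longrightarrow> \<pi> x = 0"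
    using pm_projection[OF sub] by blast
  note lin_simps = pm_linear_add[OF lin] pm_linear_scale[OF lin] pm_linear_0[OF lin] pm_linear_diff[OF lin]
  \<comment> \<open>The operators must be defined on the whole type, so basis vectors that are not
    morphisms are first sent to 0.\<close>
  define res :: "('m \<Rightarrow>\<^sub>0 'k) \<Rightarrow> ('m \<Rightarrow>\<^sub>0 'k)"
    where "res = pm_sum (\<lambda>f a. if f \<in> mors C then Poly_Mapping.single f a else 0)"
  have res_add: "res (u + v) = res u + res v" for u v
    unfolding res_def by (rule pm_sum_add) (auto simp: single_add)
  have res_single: "res (Poly_Mapping.single f a) = (if f \<in> mors C then Poly_Mapping.single f a else 0)" for f a
    by (simp add: res_def pm_sum_single)
  have res_0: "res 0 = 0" by (simp add: res_def)
  have res_scale: "res (pm_scale c u) = pm_scale c (res u)" for c u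
    by (induction u rule: pm_induct_UNIV)
      (simp_all add: res_add res_single res_0 pm_vs.scale_right_distrib)
  have res_carrier: "res u \<in> carrier A" for u
    by (induction u rule: pm_induct_UNIV)
      (simp_all add: res_add res_single res_0 add_carrier zero_carrier single_carrier)
  have res_id: "res u = u" if "u \<in> carrier A" for u
    using that by (induction u rule: carrier_induct) (simp_all add: res_add res_single res_0)
  define r0 where "r0 a v = \<pi> (a \<otimes>\<^bsub>A\<^esub> res v)" for a v
  have r0_lin: "pm_linear (r0 a)" for a
    by (rule pm_linearI)
      (simp_all add: r0_def res_add res_scale cat_alg_mult_add cat_alg_mult_scale lin_simps)
  define r where "r a = Abs_endo (r0 a)" for a
  have rep: "Rep_endo (r a) = r0 a" for a
    using r0_lin by (simp add: r_def Abs_endo_inverse)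
  have eqI: "x = y" if "\<And>v. Rep_endo x v = Rep_endo y v" for x y :: "('m, 'k) endo"
    using that Rep_endo_inject by blast
  have "nonunital_hom A endo_scalar r"
    unfolding nonunital_hom_def
  proof (intro conjI ballI allI)
    fix a b :: "'m \<Rightarrow>\<^sub>0 'k" assume ab: "a \<in> carrier A" "b \<in> carrier A"
    show "r (a \<oplus>\<^bsub>A\<^esub> b) = r a + r b"
      by (rule eqI) (simp add: rep plus_endo.rep_eq r0_def cat_alg_add_mult lin_simps)
    show "r (a \<otimes>\<^bsub>A\<^esub> b) = r a * r b"
    proof (rule eqI)
      fix v
      let ?w = "b \<otimes>\<^bsub>A\<^esub> res v"
      \<comment> \<open>For multiplicativity, \<open>?w\<close> has to be replaced by its
        projection; the difference lies in \<open>J\<close>, and multiplication by \<open>a\<close>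
        stays in \<open>J\<close>.\<close>
      have w: "?w \<in> carrier A" using ab res_carrier by (intro mult_carrier)
      have "?w - \<pi> ?w \<in> carrier A" using \<pi> JA by blast
      from add_carrier[OF w minus_carrier[OF this]] have \<pi>w: "\<pi> ?w \<in> carrier A" by simp
      have "a \<otimes>\<^bsub>A\<^esub> (?w - \<pi> ?w) \<in> J" using \<pi> ab I_l_closed by blast
      then have "\<pi> (a \<otimes>\<^bsub>A\<^esub> (?w - \<pi> ?w)) = 0" by (rule \<pi>)
      moreover have "a \<otimes>\<^bsub>A\<^esub> ?w = a \<otimes>\<^bsub>A\<^esub> (?w - \<pi> ?w) + a \<otimes>\<^bsub>A\<^esub> \<pi> ?w"
        unfolding cat_alg_mult_add[symmetric] by simp
      ultimately have "\<pi> (a \<otimes>\<^bsub>A\<^esub> ?w) = \<pi> (a \<otimes>\<^bsub>A\<^esub> \<pi> ?w)"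
        by (simp add: lin_simps)
      then show "Rep_endo (r (a \<otimes>\<^bsub>A\<^esub> b)) v = Rep_endo (r a * r b) v"
        using ab by (simp add: rep times_endo.rep_eq r0_def res_id[OF \<pi>w] mult_assoc res_carrier)
    qed
  next
    fix c and a :: "'m \<Rightarrow>\<^sub>0 'k" assume "a \<in> carrier A"
    show "r (c \<odot>\<^bsub>A\<^esub> a) = endo_scalar c * r a"
      by (rule eqI) (simp add: rep times_endo.rep_eq endo_scalar.rep_eq r0_def cat_alg_scale_mult lin_simps)
  qed
  moreover have "r a = 0 \<longleftrightarrow> a \<in> J" if a: "a \<in> carrier A" for a
  proof
    assume "r a = 0"
    then have "r0 a = (\<lambda>_. 0)" using rep[of a] by (simp only: zero_endo.rep_eq)
    \<comment> \<open>Evaluation at the unit gives \<open>\<pi> a\<close>, so an element that acts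
      as zero is congruent to 0 modulo \<open>J\<close>.\<close>
    then have "r0 a \<one>\<^bsub>A\<^esub> = 0" by (rule fun_cong)
    then have "\<pi> a = 0" unfolding r0_def res_id[OF one_carrier] mult_one[OF a] .
    then show "a \<in> J" using \<pi>(1)[of a] by simp
  next
    assume "a \<in> J"
    then have "r0 a v = 0" for v
      unfolding r0_def using I_r_closed res_carrier \<pi> by blast
    then show "r a = 0" by (intro eqI) (simp add: rep zero_endo.rep_eq)
  qed
  ultimately show thesis by (rule that)
qed

end

section \<open>Quotient algebras described by a map whose kernel is the ideal\<close>

section \<open>Isomorphisms of quotients\<close>

text \<open>The cosets of \<open>J\<close> are the fibres of \<open>f\<close>, which replaces
  computations with cosets by computations with values of \<open>f\<close>.\<close>

locale embedded_quotient = ideal J A for J and A :: "('k::field, 'a) module" +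
  fixes sc :: "'k \<Rightarrow> 't::ring_1" and f :: "'a \<Rightarrow> 't"
  assumes smult_carrier: "x \<in> carrier A \<Longrightarrow> c \<odot>\<^bsub>A\<^esub> x \<in> carrier A"
    and hom: "nonunital_hom A sc f"
    and kernel: "x \<in> carrier A \<Longrightarrow> f x = 0 \<longleftrightarrow> x \<in> J"
begin

lemmas hom_simps = nonunital_homD[OF hom]

lemma coset_eq: 
  assumes a: "a \<in> carrier A"
  shows "J +>\<^bsub>A\<^esub> a = {x \<in> carrier A. f x = f a}"
proof (intro equalityI subsetI)
  fix x assume "x \<in> J +>\<^bsub>A\<^esub> a"
  then obtain j where j: "j \<in> J" "x = j \<oplus>\<^bsub>A\<^esub> a" by (auto simp: a_r_coset_def')
  moreover have "j \<in> carrier A" using j a_Hcarr by blast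
  moreover have "f j = 0" using kernel j \<open>j \<in> carrier A\<close> by blast
  ultimately show "x \<in> {x \<in> carrier A. f x = f a}" using a by (simp add: hom_simps)
next
  fix x assume "x \<in> {x \<in> carrier A. f x = f a}"
  then have x: "x \<in> carrier A" "f x = f a" by auto
  let ?j = "x \<ominus>\<^bsub>A\<^esub> a"
  have j: "?j \<in> carrier A" using x a by simp
  have xj: "x = ?j \<oplus>\<^bsub>A\<^esub> a" using x a by (simp add: a_minus_def a_assoc l_neg)
  have "f ?j + f a = f x" using hom_simps(1)[OF j a] xj by simp
  then have "f ?j = 0" using x by simp
  then have "?j \<in> J" using kernel[OF j] by simp
  then show "x \<in> J +>\<^bsub>A\<^esub> a" using xj by (auto simp: a_r_coset_def')
qed

lemma carrier_quot: "carrier (A Quot\<^sub>a J) = (\<lambda>a. J +>\<^bsub>A\<^esub> a) ` carrier A"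
  by (auto simp: quot_alg_def ring.defs module.defs FactRing_def A_RCOSETS_def')

lemma mult_quot:
  "a \<in> carrier A \<Longrightarrow> b \<in> carrier A \<Longrightarrow>
    (J +>\<^bsub>A\<^esub> a) \<otimes>\<^bsub>A Quot\<^sub>a J\<^esub> (J +>\<^bsub>A\<^esub> b) = J +>\<^bsub>A\<^esub> (a \<otimes>\<^bsub>A\<^esub> b)"
  by (simp add: quot_alg_def ring.defs module.defs FactRing_def rcoset_mult_add)

lemma add_quot:
  "a \<in> carrier A \<Longrightarrow> b \<in> carrier A \<Longrightarrow>
    (J +>\<^bsub>A\<^esub> a) \<oplus>\<^bsub>A Quot\<^sub>a J\<^esub> (J +>\<^bsub>A\<^esub> b) = J +>\<^bsub>A\<^esub> (a \<oplus>\<^bsub>A\<^esub> b)"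
  by (simp add: quot_alg_def ring.defs module.defs FactRing_def
      abelian_subgroup.a_rcos_sum[OF abelian_subgroupI3[OF is_additive_subgroup is_abelian_group]])

lemma one_quot: "\<one>\<^bsub>A Quot\<^sub>a J\<^esub> = J +>\<^bsub>A\<^esub> \<one>\<^bsub>A\<^esub>"
  by (simp add: quot_alg_def ring.defs module.defs FactRing_def)

lemma smult_quot:
  assumes "a \<in> carrier A"
  shows "c \<odot>\<^bsub>A Quot\<^sub>a J\<^esub> (J +>\<^bsub>A\<^esub> a) = J +>\<^bsub>A\<^esub> (c \<odot>\<^bsub>A\<^esub> a)"
proof -
  have "J +>\<^bsub>A\<^esub> (c \<odot>\<^bsub>A\<^esub> x) = J +>\<^bsub>A\<^esub> (c \<odot>\<^bsub>A\<^esub> a)" if "x \<in> J +>\<^bsub>A\<^esub> a" for x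
    using that assms by (simp add: coset_eq smult_carrier hom_simps)
  moreover have "a \<in> J +>\<^bsub>A\<^esub> a" using assms by (simp add: coset_eq)
  ultimately have "(\<Union>x\<in>J +>\<^bsub>A\<^esub> a. J +>\<^bsub>A\<^esub> (c \<odot>\<^bsub>A\<^esub> x)) = J +>\<^bsub>A\<^esub> (c \<odot>\<^bsub>A\<^esub> a)" by blast
  then show ?thesis by (simp add: quot_alg_def ring.defs module.defs)
qed

end

text \<open>By \<open>g1\<close> and \<open>g2\<close> the pairs \<open>(f1 a, \<psi> a)\<close> and
  the pairs \<open>(\<phi> b, f2 b)\<close> form the same set, which is the graph of the
  isomorphism. The second entry is determined by the first because \<open>\<psi>\<close> vanishes on
  \<open>J1\<close>, and the first by the second because \<open>\<phi>\<close> vanishes on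
  \<open>J2\<close>.\<close>

lemma quot_alg_isomorphic:
  fixes A1 :: "('k::field, 'a) module" and A2 :: "('k, 'b) module"
    and f1 :: "'a \<Rightarrow> 't::ring_1" and f2 :: "'b \<Rightarrow> 's::ring_1"
  assumes E1: "embedded_quotient J1 A1 sc1 f1" and E2: "embedded_quotient J2 A2 sc2 f2"
    and \<psi>: "nonunital_hom A1 sc2 \<psi>" and \<phi>: "nonunital_hom A2 sc1 \<phi>"
    and \<psi>0: "\<And>a. a \<in> J1 \<Longrightarrow> \<psi> a = 0" and \<phi>0: "\<And>b. b \<in> J2 \<Longrightarrow> \<phi> b = 0"
    and g1: "\<And>a. a \<in> carrier A1 \<Longrightarrow> \<exists>b\<in>carrier A2. f1 a = \<phi> b \<and> \<psi> a = f2 b"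
    and g2: "\<And>b. b \<in> carrier A2 \<Longrightarrow> \<exists>a\<in>carrier A1. f1 a = \<phi> b \<and> \<psi> a = f2 b"
  shows "A1 Quot\<^sub>a J1 \<cong>\<^sub>a A2 Quot\<^sub>a J2"
proof -
  interpret E1: embedded_quotient J1 A1 sc1 f1 by fact
  interpret E2: embedded_quotient J2 A2 sc2 f2 by fact
  note hs = nonunital_homD[OF \<psi>] nonunital_homD[OF \<phi>]
  have \<phi>_cong: "\<phi> b = \<phi> b'" if "b \<in> carrier A2" "b' \<in> carrier A2" "f2 b = f2 b'" for b b'
  proof -
    have "b \<in> J2 +>\<^bsub>A2\<^esub> b'" using that by (simp add: E2.coset_eq)
    then obtain j where j: "j \<in> J2" "b = j \<oplus>\<^bsub>A2\<^esub> b'" by (auto simp: a_r_coset_def')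
    moreover have "j \<in> carrier A2" using j E2.a_Hcarr by blast
    ultimately show ?thesis using that \<phi>0 by (simp add: hs)
  qed
  have \<psi>_cong: "\<psi> a = \<psi> a'" if "a \<in> carrier A1" "a' \<in> carrier A1" "f1 a = f1 a'" for a a'
  proof -
    have "a \<in> J1 +>\<^bsub>A1\<^esub> a'" using that by (simp add: E1.coset_eq)
    then obtain j where j: "j \<in> J1" "a = j \<oplus>\<^bsub>A1\<^esub> a'" by (auto simp: a_r_coset_def')
    moreover have "j \<in> carrier A1" using j E1.a_Hcarr by blast
    ultimately show ?thesis using that \<psi>0 by (simp add: hs)
  qed
  define h where "h X = {b \<in> carrier A2. \<exists>a\<in>X. \<psi> a = f2 b}" for X
  have h: "h (J1 +>\<^bsub>A1\<^esub> a) = J2 +>\<^bsub>A2\<^esub> b"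
    if "a \<in> carrier A1" "b \<in> carrier A2" "\<psi> a = f2 b" for a b
  proof -
    have "(\<exists>a'\<in>{x \<in> carrier A1. f1 x = f1 a}. \<psi> a' = f2 b') \<longleftrightarrow> f2 b' = f2 b" for b'
      using that \<psi>_cong by (metis (mono_tags, lifting) mem_Collect_eq)
    then show ?thesis by (simp add: h_def E1.coset_eq[OF that(1)] E2.coset_eq[OF that(2)])
  qed
  have graph: "f1 a = \<phi> b" if "a \<in> carrier A1" "b \<in> carrier A2" "\<psi> a = f2 b" for a b
    using g1[OF that(1)] \<phi>_cong that by metis
  have pick: "\<exists>a b. X = J1 +>\<^bsub>A1\<^esub> a \<and> h X = J2 +>\<^bsub>A2\<^esub> b \<and> a \<in> carrier A1 \<and> b \<in> carrier A2 \<and> \<psi> a = f2 b"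
    if "X \<in> carrier (A1 Quot\<^sub>a J1)" for X
  proof -
    from that obtain a where a: "a \<in> carrier A1" "X = J1 +>\<^bsub>A1\<^esub> a" by (auto simp: E1.carrier_quot)
    with g1 obtain b where "b \<in> carrier A2" "\<psi> a = f2 b" by metis
    with a h show ?thesis by metis
  qed
  have "h \<in> ring_iso (A1 Quot\<^sub>a J1) (A2 Quot\<^sub>a J2)"
    unfolding ring_iso_def
  proof (intro CollectI conjI ring_hom_memI)
    fix X assume "X \<in> carrier (A1 Quot\<^sub>a J1)"
    from pick[OF this] show "h X \<in> carrier (A2 Quot\<^sub>a J2)" by (auto simp: E2.carrier_quot)
  next
    fix X Y assume X: "X \<in> carrier (A1 Quot\<^sub>a J1)" and Y: "Y \<in> carrier (A1 Quot\<^sub>a J1)"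
    from pick[OF X] pick[OF Y] obtain a b a' b' where
      *: "X = J1 +>\<^bsub>A1\<^esub> a" "h X = J2 +>\<^bsub>A2\<^esub> b" "a \<in> carrier A1" "b \<in> carrier A2" "\<psi> a = f2 b"
      "Y = J1 +>\<^bsub>A1\<^esub> a'" "h Y = J2 +>\<^bsub>A2\<^esub> b'" "a' \<in> carrier A1" "b' \<in> carrier A2" "\<psi> a' = f2 b'"
      by blast
    show "h (X \<otimes>\<^bsub>A1 Quot\<^sub>a J1\<^esub> Y) = h X \<otimes>\<^bsub>A2 Quot\<^sub>a J2\<^esub> h Y"
      using * h[of "a \<otimes>\<^bsub>A1\<^esub> a'" "b \<otimes>\<^bsub>A2\<^esub> b'"] by (simp add: E1.mult_quot E2.mult_quot hs E2.hom_simps)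
    show "h (X \<oplus>\<^bsub>A1 Quot\<^sub>a J1\<^esub> Y) = h X \<oplus>\<^bsub>A2 Quot\<^sub>a J2\<^esub> h Y"
      using * h[of "a \<oplus>\<^bsub>A1\<^esub> a'" "b \<oplus>\<^bsub>A2\<^esub> b'"] by (simp add: E1.add_quot E2.add_quot hs E2.hom_simps)
  next
    \<comment> \<open>None of the maps is known to preserve units. However, \<open>\<psi>\<close> of
      the first unit is a left unit for the values of \<open>\<psi>\<close>, among them
      \<open>f2\<close> of the second unit, which in turn is a right unit for the values of
      \<open>f2\<close>. So the two agree.\<close>
    obtain b where b: "b \<in> carrier A2" "\<psi> \<one>\<^bsub>A1\<^esub> = f2 b" using g1[of "\<one>\<^bsub>A1\<^esub>"] by auto
    obtain a where a: "a \<in> carrier A1" "\<psi> a = f2 \<one>\<^bsub>A2\<^esub>" using g2[of "\<one>\<^bsub>A2\<^esub>"] by auto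
    have "f2 b = f2 b * f2 \<one>\<^bsub>A2\<^esub>" using b E2.hom_simps(2)[of b "\<one>\<^bsub>A2\<^esub>"] by simp
    also have "\<dots> = \<psi> \<one>\<^bsub>A1\<^esub> * \<psi> a" using a b by simp
    also have "\<dots> = f2 \<one>\<^bsub>A2\<^esub>" using a hs(2)[of "\<one>\<^bsub>A1\<^esub>" a] by simp
    finally show "h \<one>\<^bsub>A1 Quot\<^sub>a J1\<^esub> = \<one>\<^bsub>A2 Quot\<^sub>a J2\<^esub>"
      using b h[of "\<one>\<^bsub>A1\<^esub>" "\<one>\<^bsub>A2\<^esub>"] by (simp add: E1.one_quot E2.one_quot)
  next
    show "bij_betw h (carrier (A1 Quot\<^sub>a J1)) (carrier (A2 Quot\<^sub>a J2))"
      unfolding bij_betw_def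
    proof (intro conjI inj_onI)
      fix X Y assume X: "X \<in> carrier (A1 Quot\<^sub>a J1)" and Y: "Y \<in> carrier (A1 Quot\<^sub>a J1)"
        and hXY: "h X = h Y"
      from pick[OF X] pick[OF Y] obtain a b a' b' where
        *: "X = J1 +>\<^bsub>A1\<^esub> a" "h X = J2 +>\<^bsub>A2\<^esub> b" "a \<in> carrier A1" "b \<in> carrier A2" "\<psi> a = f2 b"
        "Y = J1 +>\<^bsub>A1\<^esub> a'" "h Y = J2 +>\<^bsub>A2\<^esub> b'" "a' \<in> carrier A1" "b' \<in> carrier A2" "\<psi> a' = f2 b'"
        by blast
      then have "f2 b = f2 b'" using hXY by (auto simp: E2.coset_eq)
      then have "f1 a = f1 a'" using graph * \<phi>_cong by metis
      then show "X = Y" using * by (simp add: E1.coset_eq)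
    next
      have "Z \<in> carrier (A2 Quot\<^sub>a J2)" if "Z \<in> h ` carrier (A1 Quot\<^sub>a J1)" for Z
      proof -
        from that obtain X where X: "X \<in> carrier (A1 Quot\<^sub>a J1)" "Z = h X" by blast
        from pick[OF X(1)] X(2) show ?thesis by (auto simp: E2.carrier_quot)
      qed
      moreover have "Z \<in> h ` carrier (A1 Quot\<^sub>a J1)" if "Z \<in> carrier (A2 Quot\<^sub>a J2)" for Z
      proof -
        from that obtain b where b: "b \<in> carrier A2" "Z = J2 +>\<^bsub>A2\<^esub> b" by (auto simp: E2.carrier_quot)
        then obtain a where "a \<in> carrier A1" "\<psi> a = f2 b" using g2 by metis
        then have "Z = h (J1 +>\<^bsub>A1\<^esub> a)" "J1 +>\<^bsub>A1\<^esub> a \<in> carrier (A1 Quot\<^sub>a J1)"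
          using b h by (auto simp: E1.carrier_quot)
        then show ?thesis by blast
      qed
      ultimately show "h ` carrier (A1 Quot\<^sub>a J1) = carrier (A2 Quot\<^sub>a J2)" by blast
    qed
  qed
  moreover have "h (c \<odot>\<^bsub>A1 Quot\<^sub>a J1\<^esub> X) = c \<odot>\<^bsub>A2 Quot\<^sub>a J2\<^esub> h X" if "X \<in> carrier (A1 Quot\<^sub>a J1)" for c X
  proof -
    from pick[OF that] obtain a b where
      *: "X = J1 +>\<^bsub>A1\<^esub> a" "h X = J2 +>\<^bsub>A2\<^esub> b" "a \<in> carrier A1" "b \<in> carrier A2" "\<psi> a = f2 b" by metis
    then show ?thesis
      using h[of "c \<odot>\<^bsub>A1\<^esub> a" "c \<odot>\<^bsub>A2\<^esub> b"]
      by (simp add: E1.smult_quot E2.smult_quot hs E2.hom_simps E1.smult_carrier E2.smult_carrier)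
  qed
  ultimately show ?thesis by (auto simp: alg_isomorphic_def alg_iso_def)
qed


section \<open>Linear extension of functors to category algebras\<close>

section \<open>Representations of categories\<close>

text \<open>Products of morphisms that cannot be composed must vanish, as they do in the category
  algebra; with this clause the linear extension is multiplicative.\<close>

definition cat_rep :: "('o, 'm) small_cat \<Rightarrow> ('m \<Rightarrow> 't::ring_1) \<Rightarrow> bool" where
  "cat_rep C F \<longleftrightarrow> (\<forall>f\<in>mors C. \<forall>g\<in>mors C.
     F f * F g = (if cdom C f = ccod C g then F (ccomp C f g) else 0))"

context scalars
begin

definition lin_ext :: "('m \<Rightarrow> 't) \<Rightarrow> ('m \<Rightarrow>\<^sub>0 'k) \<Rightarrow> 't" where
  "lin_ext F u = pm_sum (\<lambda>f a. sc a * F f) u"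

lemma lin_ext_add: "lin_ext F (u + v) = lin_ext F u + lin_ext F v"
  unfolding lin_ext_def by (rule pm_sum_add) (simp_all add: sc_add distrib_right)

lemma lin_ext_single [simp]: "lin_ext F (Poly_Mapping.single f a) = sc a * F f"
  by (simp add: lin_ext_def pm_sum_single)

lemma lin_ext_zero [simp]: "lin_ext F 0 = 0" by (simp add: lin_ext_def)

lemma lin_ext_scale: "lin_ext F (pm_scale c u) = sc c * lin_ext F u"
  by (induction u rule: pm_induct_UNIV)
    (simp_all add: lin_ext_add pm_vs.scale_right_distrib distrib_left sc_mult mult.assoc)

lemma lin_ext_hom:
  assumes "finite_cat C" "cat_rep C F"
  shows "nonunital_hom (cat_alg C) sc (lin_ext F)"
proof -
  interpret finite_cat C by fact
  have "lin_ext F (u \<otimes>\<^bsub>A\<^esub> v) = lin_ext F u * lin_ext F v" if "u \<in> carrier A" "v \<in> carrier A" for u v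
    using that(1)
  proof (induction u rule: carrier_induct)
    case (single f a)
    show ?case using that(2)
    proof (induction v rule: carrier_induct)
      case (single g b)
      have "sc a * F f * (sc b * F g) = sc (a * b) * (F f * F g)"
        using sc_left_comm[of "F f" b "F g"] by (simp add: sc_mult mult.assoc)
      also have "F f * F g = (if cdom C f = ccod C g then F (ccomp C f g) else 0)"
        using assms(2) single \<open>f \<in> mors C\<close> by (simp add: cat_rep_def)
      finally show ?case by (simp add: cat_alg_mult_single)
    qed (simp_all add: cat_alg_mult_add lin_ext_add distrib_left)
  qed (simp_all add: cat_alg_add_mult lin_ext_add distrib_right)
  then show ?thesis by (simp add: nonunital_hom_def lin_ext_add lin_ext_scale)
qed

end

text \<open>The kernel is an ideal, so only the generators have to be checked.\<close>

lemma nonunital_hom_genideal: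
  fixes A :: "('k::field, 'a) module" and f :: "'a \<Rightarrow> 't::ring_1"
  assumes "ring A" "nonunital_hom A sc f" "S \<subseteq> carrier A" "\<And>s. s \<in> S \<Longrightarrow> f s = 0" "x \<in> Idl\<^bsub>A\<^esub> S"
  shows "f x = 0"
proof -
  interpret ring A by fact
  note hs = nonunital_homD[OF assms(2)]
  have f0: "f \<zero>\<^bsub>A\<^esub> = 0" using hs(1)[of "\<zero>\<^bsub>A\<^esub>" "\<zero>\<^bsub>A\<^esub>"] by simp
  have neg: "f (\<ominus>\<^bsub>A\<^esub> a) = - f a" if "a \<in> carrier A" for a
    using hs(1)[of "\<ominus>\<^bsub>A\<^esub> a" a] that f0 by (simp add: l_neg eq_neg_iff_add_eq_0)
  have "ideal {x \<in> carrier A. f x = 0} A"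
  proof (rule idealI)
    show "subgroup {x \<in> carrier A. f x = 0} (add_monoid A)"
      by (rule group.subgroupI) (auto simp: a_group f0 hs neg simp flip: a_inv_def)
  qed (auto simp: hs ring_axioms)
  then have "Idl\<^bsub>A\<^esub> S \<subseteq> {x \<in> carrier A. f x = 0}"
    using assms(3,4) by (intro genideal_minimal) auto
  with assms(5) show ?thesis by auto
qed

section \<open>Representations of path algebras by idempotents and arrows\<close>

section \<open>Path algebras\<close>

lemma (in wf_digraph) finite_cat_path_cat:
  assumes "finite (verts G)"
  shows "finite_cat (path_cat G)"
  using assms
  by unfold_locales (auto simp: path_cat_def qpaths_def awalk_Nil_iff dest: awalk_hd_in_verts awalk_last_in_verts
      intro: awalk_appendI)

text \<open>The factors come in reverse order, since arrows are listed in order of traversal whereas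
  products are read from right to left.\<close>

fun path_prod :: "('a \<Rightarrow> 't::ring_1) \<Rightarrow> 'a list \<Rightarrow> 't" where
  "path_prod M [] = 1"
| "path_prod M (a # p) = path_prod M p * M a"

lemma path_prod_append: "path_prod M (p @ q) = path_prod M q * path_prod M p"
  by (induction p) (simp_all add: mult.assoc)

text \<open>The factor at the source makes the trivial path at \<open>u\<close> act as the
  idempotent \<open>e u\<close>.\<close>

definition path_rep :: "('v \<Rightarrow> 't::ring_1) \<Rightarrow> ('a \<Rightarrow> 't) \<Rightarrow> ('v, 'a) qpath \<Rightarrow> 't" where
  "path_rep e M = (\<lambda>(u, p, v). path_prod M p * e u)"

lemma (in wf_digraph) cat_rep_path_rep:
  fixes e :: "'a \<Rightarrow> 't::ring_1"
  assumes e: "\<And>u v. u \<in> verts G \<Longrightarrow> v \<in> verts G \<Longrightarrow> e u * e v = (if u = v then e u else 0)"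
    and M: "\<And>a. a \<in> arcs G \<Longrightarrow> e (head G a) * M a = M a"
  shows "cat_rep (path_cat G) (path_rep e M)"
proof -
  have left: "e v * (path_prod M p * e u) = path_prod M p * e u" if "awalk u p v" for u p v
    using that
  proof (induction p arbitrary: u v rule: rev_induct)
    case Nil then show ?case by (auto simp: awalk_Nil_iff e)
  next
    case (snoc a p)
    then have "v = head G a" "a \<in> arcs G" by (auto simp: awalk_Cons_iff awalk_Nil_iff)
    then show ?case by (simp add: path_prod_append M mult.assoc[symmetric])
  qed
  have "path_prod M q * e v' * (path_prod M p * e u) = (if v' = v then path_prod M (p @ q) * e u else 0)"
    if "awalk v' q w" "awalk u p v" for v' q w u p v
  proof -
    have "path_prod M q * e v' * (path_prod M p * e u) = path_prod M q * (e v' * e v) * (path_prod M p * e u)"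
      using left[OF that(2)] by (simp add: mult.assoc)
    also have "e v' * e v = (if v' = v then e v else 0)"
      using e[OF awalk_hd_in_verts[OF that(1)] awalk_last_in_verts[OF that(2)]] by auto
    finally show ?thesis using left[OF that(2)] by (simp add: path_prod_append mult.assoc)
  qed
  then show ?thesis
    by (auto simp: cat_rep_def path_cat_def qpaths_def path_rep_def)
qed

section \<open>Duals and products of bisets\<close>

section \<open>Bisets\<close>

lemma (in biset) biset_dual: "biset G2 G1 (dual_biset G1 G2 Y)"
  by unfold_locales
    (auto simp: dual_biset_def lact_closed ract_closed lact_one ract_one lact_lact ract_ract lact_ract
      G1.inv_mult_group G2.inv_mult_group)

locale biset_pair = L: biset G1 H Y + R: biset H G2 Z
  for G1 :: "'g monoid" and H :: "'h monoid" and G2 :: "'i monoid"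
    and Y :: "('g, 'h, 'y) biset" and Z :: "('h, 'i, 'z) biset"
begin

abbreviation "S \<equiv> biset_prod_rel H Y Z"

lemma rel_iff:
  "((y, z), (y', z')) \<in> S \<longleftrightarrow>
    y' \<in> bset Y \<and> z \<in> bset Z \<and> (\<exists>h\<in>carrier H. y = ract Y y' h \<and> z' = lact Z h z)"
  by (auto simp: biset_prod_rel_def)

lemma equiv_rel: "equiv (bset Y \<times> bset Z) S"
proof (rule equivI)
  show "S \<subseteq> (bset Y \<times> bset Z) \<times> bset Y \<times> bset Z"
    by (auto simp: biset_prod_rel_def L.ract_closed R.lact_closed)
  show "refl_on (bset Y \<times> bset Z) S"
    by (rule refl_onI) (auto simp: rel_iff L.ract_one R.lact_one intro!: bexI[of _ "\<one>\<^bsub>H\<^esub>"])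
  show "sym S"
  proof (rule symI, clarify)
    fix y z y' z' assume "((y, z), (y', z')) \<in> S"
    then obtain h where h: "h \<in> carrier H" "y = ract Y y' h" "z' = lact Z h z" "y' \<in> bset Y" "z \<in> bset Z"
      by (auto simp: rel_iff)
    then show "((y', z'), (y, z)) \<in> S"
      by (auto simp: rel_iff L.ract_closed R.lact_closed L.ract_ract R.lact_lact L.ract_one R.lact_one
          intro!: bexI[of _ "inv\<^bsub>H\<^esub> h"])
  qed
  show "trans S"
  proof (rule transI, clarify)
    fix y z y' z' y'' z'' assume "((y, z), (y', z')) \<in> S" "((y', z'), (y'', z'')) \<in> S"
    then obtain h k where "h \<in> carrier H" "y = ract Y y' h" "z' = lact Z h z" "y' \<in> bset Y" "z \<in> bset Z"
      "k \<in> carrier H" "y' = ract Y y'' k" "z'' = lact Z k z'" "y'' \<in> bset Y"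
      by (auto simp: rel_iff)
    then show "((y, z), (y'', z'')) \<in> S"
      by (auto simp: rel_iff L.ract_ract R.lact_lact intro!: bexI[of _ "k \<otimes>\<^bsub>H\<^esub> h"])
  qed
qed

lemma prod_elem: "y \<in> bset Y \<Longrightarrow> z \<in> bset Z \<Longrightarrow> S `` {(y, z)} \<in> bset (biset_prod H Y Z)"
  by (auto simp: biset_prod_def intro!: quotientI)

lemma prod_elemE:
  assumes "c \<in> bset (biset_prod H Y Z)"
  obtains y z where "y \<in> bset Y" "z \<in> bset Z" "c = S `` {(y, z)}"
  using assms by (auto simp: biset_prod_def elim!: quotientE)

lemma class_eqI: "(a, b) \<in> S \<Longrightarrow> S `` {a} = S `` {b}"
  using equiv_rel by (rule equiv_class_eq)

text \<open>The actions on a product of bisets are defined by images of classes. A map compatible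
  with the relation sends a class into a single class, so its effect can be read off from one
  representative.\<close>

lemma image_class:
  assumes "\<And>a b. (a, b) \<in> S \<Longrightarrow> (\<phi> a, \<phi> b) \<in> S" "a \<in> bset Y \<times> bset Z"
  shows "S `` (\<phi> ` (S `` {a})) = S `` {\<phi> a}"
proof -
  have "S `` {\<phi> b} = S `` {\<phi> a}" if "b \<in> S `` {a}" for b
    using assms(1) that class_eqI by (metis Image_singleton_iff)
  moreover have "a \<in> S `` {a}" by (rule equiv_class_self[OF equiv_rel assms(2)])
  moreover have "S `` (\<phi> ` (S `` {a})) = (\<Union>b\<in>S `` {a}. S `` {\<phi> b})" by blast
  ultimately show ?thesis by blast
qed

lemma lact_prod:
  assumes "g \<in> carrier G1" "y \<in> bset Y" "z \<in> bset Z"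
  shows "lact (biset_prod H Y Z) g (S `` {(y, z)}) = S `` {(lact Y g y, z)}"
  using image_class[of "\<lambda>(y, z). (lact Y g y, z)" "(y, z)"] assms
  by (force simp: biset_prod_def rel_iff L.lact_closed L.lact_ract)

lemma ract_prod:
  assumes "k \<in> carrier G2" "y \<in> bset Y" "z \<in> bset Z"
  shows "ract (biset_prod H Y Z) (S `` {(y, z)}) k = S `` {(y, ract Z z k)}"
  using image_class[of "\<lambda>(y, z). (y, ract Z z k)" "(y, z)"] assms
  by (force simp: biset_prod_def rel_iff R.ract_closed R.lact_ract)

lemma biset_biset_prod: "biset G1 G2 (biset_prod H Y Z)"
  by unfold_locales
    (auto elim!: prod_elemE simp: lact_prod ract_prod prod_elem L.lact_closed R.ract_closed L.lact_one R.ract_one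
      L.lact_lact R.ract_ract)

end


section \<open>The equivalence of lists that defines X(p), and the group actions on it\<close>

section \<open>The category of an EI quiver\<close>

lemma (in finite_ei_quiver) finite_double: "finite_ei_quiver (double_ei_quiver Q)"
proof -
  interpret D: fin_digraph "quiver (double_ei_quiver Q)"
    by unfold_locales (auto simp: double_ei_quiver_def double_quiver_def)
  show ?thesis
  proof (intro finite_ei_quiver.intro finite_ei_quiver_axioms.intro D.fin_digraph_axioms)
    fix a assume "a \<in> arcs (quiver (double_ei_quiver Q))"
    then obtain b where b: "b \<in> arcs (quiver Q)" "a = Orig b \<or> a = Star b"
      by (auto simp: double_ei_quiver_def double_quiver_def)
    interpret biset "vgrp Q (head (quiver Q) b)" "vgrp Q (tail (quiver Q) b)" "abiset Q b"
      using b by (intro abiset_biset)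
    show "biset (vgrp (double_ei_quiver Q) (head (quiver (double_ei_quiver Q)) a))
        (vgrp (double_ei_quiver Q) (tail (quiver (double_ei_quiver Q)) a)) (abiset (double_ei_quiver Q) a)"
      using b(2) biset_dual biset_axioms by (auto simp: double_ei_quiver_def double_quiver_def)
    show "finite (bset (abiset (double_ei_quiver Q) a))" "bset (abiset (double_ei_quiver Q) a) \<noteq> {}"
      using b abiset_finite abiset_nonempty by (auto simp: double_ei_quiver_def dual_biset_def)
  qed (auto simp: double_ei_quiver_def double_quiver_def vgrp_group vgrp_finite)
qed

fun list_prod :: "('a \<Rightarrow> 'y \<Rightarrow> 't::ring_1) \<Rightarrow> 'a list \<Rightarrow> 'y list \<Rightarrow> 't" where
  "list_prod \<beta> (a # p) (y # ys) = list_prod \<beta> p ys * \<beta> a y"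
| "list_prod \<beta> _ _ = 1"

lemma list_prod_append:
  "length p = length ys \<Longrightarrow> list_prod \<beta> (p @ q) (ys @ zs) = list_prod \<beta> q zs * list_prod \<beta> p ys"
  by (induction p ys rule: list_induct2) (simp_all add: mult.assoc)

context finite_ei_quiver
begin

abbreviation "X v \<equiv> vgrp Q v"
abbreviation "Y a \<equiv> abiset Q a"
abbreviation "s a \<equiv> tail (quiver Q) a"
abbreviation "t a \<equiv> head (quiver Q) a"

lemma biset_closed:
  assumes "a \<in> arcs (quiver Q)" "y \<in> bset (Y a)"
  shows "g \<in> carrier (X (t a)) \<Longrightarrow> lact (Y a) g y \<in> bset (Y a)"
    and "h \<in> carrier (X (s a)) \<Longrightarrow> ract (Y a) y h \<in> bset (Y a)"
    and "lact (Y a) \<one>\<^bsub>X (t a)\<^esub> y = y" and "ract (Y a) y \<one>\<^bsub>X (s a)\<^esub> = y"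
    and "g \<in> carrier (X (t a)) \<Longrightarrow> g' \<in> carrier (X (t a)) \<Longrightarrow>
      lact (Y a) g (lact (Y a) g' y) = lact (Y a) (g \<otimes>\<^bsub>X (t a)\<^esub> g') y"
    and "h \<in> carrier (X (s a)) \<Longrightarrow> h' \<in> carrier (X (s a)) \<Longrightarrow>
      ract (Y a) (ract (Y a) y h) h' = ract (Y a) y (h \<otimes>\<^bsub>X (s a)\<^esub> h')"
    and "g \<in> carrier (X (t a)) \<Longrightarrow> h \<in> carrier (X (s a)) \<Longrightarrow>
      lact (Y a) g (ract (Y a) y h) = ract (Y a) (lact (Y a) g y) h"
proof -
  interpret biset "X (t a)" "X (s a)" "Y a" using assms(1) by (rule abiset_biset)
  show "g \<in> carrier (X (t a)) \<Longrightarrow> lact (Y a) g y \<in> bset (Y a)"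
    "h \<in> carrier (X (s a)) \<Longrightarrow> ract (Y a) y h \<in> bset (Y a)"
    "lact (Y a) \<one>\<^bsub>X (t a)\<^esub> y = y" "ract (Y a) y \<one>\<^bsub>X (s a)\<^esub> = y"
    "g \<in> carrier (X (t a)) \<Longrightarrow> g' \<in> carrier (X (t a)) \<Longrightarrow>
      lact (Y a) g (lact (Y a) g' y) = lact (Y a) (g \<otimes>\<^bsub>X (t a)\<^esub> g') y"
    "h \<in> carrier (X (s a)) \<Longrightarrow> h' \<in> carrier (X (s a)) \<Longrightarrow>
      ract (Y a) (ract (Y a) y h) h' = ract (Y a) y (h \<otimes>\<^bsub>X (s a)\<^esub> h')"
    "g \<in> carrier (X (t a)) \<Longrightarrow> h \<in> carrier (X (s a)) \<Longrightarrow>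
      lact (Y a) g (ract (Y a) y h) = ract (Y a) (lact (Y a) g y) h"
    using assms(2) by (simp_all add: lact_closed ract_closed lact_one ract_one lact_lact ract_ract lact_ract)
qed

lemma awalk_consecutive:
  assumes "awalk u (as @ [a, b] @ bs) v"
  shows "a \<in> arcs (quiver Q)" "b \<in> arcs (quiver Q)" "t a = s b"
  using assms by (auto simp: awalk_Cons_iff)

lemma ei_lists_Nil [simp]: "ys \<in> ei_lists Q [] \<longleftrightarrow> ys = []"
  by (simp add: ei_lists_def)

lemma ei_lists_append:
  "ys \<in> ei_lists Q p \<Longrightarrow> zs \<in> ei_lists Q q \<Longrightarrow> ys @ zs \<in> ei_lists Q (p @ q)"
  by (simp add: ei_lists_def list_all2_appendI)

lemma ei_lists_length: "ys \<in> ei_lists Q p \<Longrightarrow> length ys = length p"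
  by (simp add: ei_lists_def list_all2_lengthD)

lemma ei_lists_split:
  assumes "length us = length as"
  shows "us @ vs \<in> ei_lists Q (as @ bs) \<longleftrightarrow> us \<in> ei_lists Q as \<and> vs \<in> ei_lists Q bs"
  using assms by (auto simp: ei_lists_def list_all2_append)

lemma ei_lists_Cons [simp]:
  "y # ys \<in> ei_lists Q (a # p) \<longleftrightarrow> y \<in> bset (Y a) \<and> ys \<in> ei_lists Q p"
  by (simp add: ei_lists_def)

lemma ei_moveE:
  assumes "(ys, ys') \<in> ei_move Q p" "awalk u p v"
  obtains us z y vs g as a b bs where
    "ys = us @ [z, ract (Y b) y g] @ vs" "ys' = us @ [lact (Y a) g z, y] @ vs"
    "p = as @ [a, b] @ bs" "us \<in> ei_lists Q as" "vs \<in> ei_lists Q bs"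
    "z \<in> bset (Y a)" "y \<in> bset (Y b)" "g \<in> carrier (X (t a))"
    "a \<in> arcs (quiver Q)" "b \<in> arcs (quiver Q)" "t a = s b"
proof -
  from assms(1) obtain us z y vs g as a b bs where *:
    "ys = us @ [z, ract (Y b) y g] @ vs" "ys' = us @ [lact (Y a) g z, y] @ vs"
    "p = as @ [a, b] @ bs" "length us = length as" "us @ [z, y] @ vs \<in> ei_lists Q p"
    "g \<in> carrier (X (t a))"
    unfolding ei_move_def by blast
  moreover have "us \<in> ei_lists Q as" "z # y # vs \<in> ei_lists Q (a # b # bs)"
    using *(5) unfolding *(3) by (simp_all add: ei_lists_split[OF *(4)])
  ultimately show thesis
    using awalk_consecutive[of u as a b bs v] assms(2) by (intro that[of us z b y g vs a as bs]) auto
qed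

lemma ei_moveI:
  assumes "us \<in> ei_lists Q as" "vs \<in> ei_lists Q bs" "z \<in> bset (Y a)" "y \<in> bset (Y b)" "g \<in> carrier (X (t a))"
  shows "(us @ [z, ract (Y b) y g] @ vs, us @ [lact (Y a) g z, y] @ vs) \<in> ei_move Q (as @ [a, b] @ bs)"
proof -
  have "us @ [z, y] @ vs \<in> ei_lists Q (as @ [a, b] @ bs)"
    using assms by (intro ei_lists_append) auto
  then show ?thesis
    unfolding ei_move_def using ei_lists_length[OF assms(1)] assms(5) by blast
qed

lemma ei_move_lists:
  assumes "(ys, ys') \<in> ei_move Q p" "awalk u p v"
  shows "ys \<in> ei_lists Q p" "ys' \<in> ei_lists Q p"
  using assms
  by (auto elim!: ei_moveE simp: ei_lists_split ei_lists_length biset_closed)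

lemma equiv_ei_rel: "equiv (ei_lists Q p) (ei_rel Q p)"
proof (rule equivI)
  let ?R = "ei_move Q p \<union> (ei_move Q p)\<inverse>"
  have "sym (?R\<^sup>*)" by (intro sym_rtrancl sym_Un_converse)
  then show "sym (ei_rel Q p)" by (auto simp: ei_rel_def sym_def)
  show "trans (ei_rel Q p)" unfolding ei_rel_def by (rule transI) (auto intro: rtrancl_trans)
qed (auto simp: ei_rel_def refl_on_def)

lemma ei_rel_class_eq: "(ys, ys') \<in> ei_rel Q p \<Longrightarrow> ei_rel Q p `` {ys} = ei_rel Q p `` {ys'}"
  by (rule equiv_class_eq[OF equiv_ei_rel])

lemma ei_rel_refl: "ys \<in> ei_lists Q p \<Longrightarrow> (ys, ys) \<in> ei_rel Q p"
  by (simp add: ei_rel_def)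

lemma ei_rel_sym: "(ys, ys') \<in> ei_rel Q p \<Longrightarrow> (ys', ys) \<in> ei_rel Q p"
  using equiv_ei_rel by (meson equiv_def symD)

lemma ei_rel_trans: "(ys, ys') \<in> ei_rel Q p \<Longrightarrow> (ys', ys'') \<in> ei_rel Q p \<Longrightarrow> (ys, ys'') \<in> ei_rel Q p"
  using equiv_ei_rel by (meson equiv_def transD)

lemma ei_rel_lists: "(ys, ys') \<in> ei_rel Q p \<Longrightarrow> ys \<in> ei_lists Q p \<and> ys' \<in> ei_lists Q p"
  by (simp add: ei_rel_def)

lemma ei_move_rel: "(ys, ys') \<in> ei_move Q p \<Longrightarrow> awalk u p v \<Longrightarrow> (ys, ys') \<in> ei_rel Q p"
  using ei_move_lists[of ys ys' p u v] by (auto simp: ei_rel_def)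

lemma ei_rel_induct [consumes 2, case_names refl move sym trans]:
  assumes "(ys, ys') \<in> ei_rel Q p" "awalk u p v"
    and "\<And>ys. ys \<in> ei_lists Q p \<Longrightarrow> P ys ys"
    and "\<And>ys ys'. (ys, ys') \<in> ei_move Q p \<Longrightarrow> P ys ys'"
    and "\<And>ys ys'. P ys ys' \<Longrightarrow> P ys' ys"
    and "\<And>ys ys' ys''. P ys ys' \<Longrightarrow> P ys' ys'' \<Longrightarrow> P ys ys''"
  shows "P ys ys'"
proof -
  from assms(1) have "(ys, ys') \<in> (ei_move Q p \<union> (ei_move Q p)\<inverse>)\<^sup>*" "ys \<in> ei_lists Q p"
    by (auto simp: ei_rel_def)
  then show ?thesis
  proof (induction rule: rtrancl_induct)
    case base then show ?case by (rule assms(3))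
  next
    case (step y z)
    have "P y z" using step.hyps(2) assms(4,5) by blast
    with step show ?case using assms(6) by blast
  qed
qed

text \<open>For an operation on lists to pass to classes, it is enough to consider elementary
  moves.\<close>

lemma ei_rel_map:
  assumes "(ys, ys') \<in> ei_rel Q p" "awalk u p v"
    and "\<And>ys. ys \<in> ei_lists Q p \<Longrightarrow> f ys \<in> ei_lists Q p'"
    and "\<And>ys ys'. (ys, ys') \<in> ei_move Q p \<Longrightarrow> (f ys, f ys') \<in> ei_rel Q p'"
  shows "(f ys, f ys') \<in> ei_rel Q p'"
  using assms(1,2)
proof (induction rule: ei_rel_induct)
  case (refl ys) then show ?case by (intro ei_rel_refl assms(3))
next
  case (move ys ys') then show ?case by (rule assms(4))
next
  case (sym ys ys') then show ?case by (rule ei_rel_sym)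
next
  case (trans ys ys' ys'') then show ?case by (rule ei_rel_trans)
qed

lemma ei_rel_image_class:
  assumes "ys \<in> ei_lists Q p" "\<And>ys'. (ys, ys') \<in> ei_rel Q p \<Longrightarrow> (f ys, f ys') \<in> ei_rel Q p'"
  shows "ei_rel Q p' `` (f ` (ei_rel Q p `` {ys})) = ei_rel Q p' `` {f ys}"
proof -
  have "ei_rel Q p' `` {f zs} = ei_rel Q p' `` {f ys}" if "zs \<in> ei_rel Q p `` {ys}" for zs
    using ei_rel_class_eq[OF assms(2)] that by auto
  moreover have "ys \<in> ei_rel Q p `` {ys}" using ei_rel_refl[OF assms(1)] by simp
  moreover have "ei_rel Q p' `` (f ` (ei_rel Q p `` {ys})) = (\<Union>zs\<in>ei_rel Q p `` {ys}. ei_rel Q p' `` {f zs})"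
    by blast
  ultimately show ?thesis by blast
qed

lemma ei_rel_append_right:
  assumes "(ys, ys') \<in> ei_rel Q p" "awalk u p v" "awalk v q w" "zs \<in> ei_lists Q q"
  shows "(ys @ zs, ys' @ zs) \<in> ei_rel Q (p @ q)"
  using assms(1,2)
proof (rule ei_rel_map[where f = "\<lambda>ys. ys @ zs"])
  fix ys ys' assume "(ys, ys') \<in> ei_move Q p"
  from this assms(2) obtain us z y vs g as a b bs where *:
    "ys = us @ [z, ract (Y b) y g] @ vs" "ys' = us @ [lact (Y a) g z, y] @ vs"
    "p = as @ [a, b] @ bs" "us \<in> ei_lists Q as" "vs \<in> ei_lists Q bs"
    "z \<in> bset (Y a)" "y \<in> bset (Y b)" "g \<in> carrier (X (t a))"
    by (rule ei_moveE)
  have "(us @ [z, ract (Y b) y g] @ (vs @ zs), us @ [lact (Y a) g z, y] @ (vs @ zs))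
      \<in> ei_move Q (as @ [a, b] @ (bs @ q))"
    by (rule ei_moveI) (use * assms(4) in \<open>auto intro: ei_lists_append\<close>)
  then show "(ys @ zs, ys' @ zs) \<in> ei_rel Q (p @ q)"
    using * awalk_appendI[OF assms(2,3)] by (intro ei_move_rel) auto
qed (use assms(4) ei_lists_append in blast)

lemma ei_rel_append_left:
  assumes "(zs, zs') \<in> ei_rel Q q" "awalk u p v" "awalk v q w" "ys \<in> ei_lists Q p"
  shows "(ys @ zs, ys @ zs') \<in> ei_rel Q (p @ q)"
  using assms(1,3)
proof (rule ei_rel_map[where f = "\<lambda>zs. ys @ zs"])
  fix zs zs' assume "(zs, zs') \<in> ei_move Q q"
  from this assms(3) obtain us z y vs g as a b bs where *:
    "zs = us @ [z, ract (Y b) y g] @ vs" "zs' = us @ [lact (Y a) g z, y] @ vs"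
    "q = as @ [a, b] @ bs" "us \<in> ei_lists Q as" "vs \<in> ei_lists Q bs"
    "z \<in> bset (Y a)" "y \<in> bset (Y b)" "g \<in> carrier (X (t a))"
    by (rule ei_moveE)
  have "((ys @ us) @ [z, ract (Y b) y g] @ vs, (ys @ us) @ [lact (Y a) g z, y] @ vs)
      \<in> ei_move Q ((p @ as) @ [a, b] @ bs)"
    by (rule ei_moveI) (use * assms(4) in \<open>auto intro: ei_lists_append\<close>)
  then show "(ys @ zs, ys @ zs') \<in> ei_rel Q (p @ q)"
    using * awalk_appendI[OF assms(2,3)] by (intro ei_move_rel) auto
qed (use assms(4) ei_lists_append in blast)

text \<open>The two outer actions on X(p): the group at the target acts on the last entry of a list,
  and the group at the source on the first entry (\<open>act_hd\<close>).\<close>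

definition act_last :: "'a list \<Rightarrow> 'g \<Rightarrow> 'y list \<Rightarrow> 'y list" where
  "act_last p g ys = butlast ys @ [lact (Y (last p)) g (last ys)]"

definition act_hd :: "'a list \<Rightarrow> 'y list \<Rightarrow> 'g \<Rightarrow> 'y list" where
  "act_hd p ys h = ract (Y (hd p)) (hd ys) h # tl ys"

lemma act_last_snoc [simp]: "act_last (p @ [a]) g (ys @ [y]) = ys @ [lact (Y a) g y]"
  by (simp add: act_last_def)

lemma act_hd_Cons [simp]: "act_hd (a # p) (y # ys) h = ract (Y a) y h # ys"
  by (simp add: act_hd_def)

lemma ei_lists_snocE:
  assumes "ys \<in> ei_lists Q p" "p \<noteq> []"
  obtains p' a ys' y where "p = p' @ [a]" "ys = ys' @ [y]" "ys' \<in> ei_lists Q p'" "y \<in> bset (Y a)"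
proof -
  obtain p' a where p: "p = p' @ [a]" using assms(2) by (cases p rule: rev_cases) auto
  moreover from ei_lists_length[OF assms(1)] p obtain ys' y where ys: "ys = ys' @ [y]"
    by (cases ys rule: rev_cases) auto
  moreover have "ys' \<in> ei_lists Q p'" "y \<in> bset (Y a)"
    using assms(1) ei_lists_length[OF assms(1)] unfolding p ys by (simp_all add: ei_lists_split)
  ultimately show thesis by (rule that)
qed

lemma ei_lists_ConsE:
  assumes "ys \<in> ei_lists Q p" "p \<noteq> []"
  obtains p' a ys' y where "p = a # p'" "ys = y # ys'" "ys' \<in> ei_lists Q p'" "y \<in> bset (Y a)"
  using assms by (cases p; cases ys) (auto simp: ei_lists_def)

lemma awalk_snoc_iff: "awalk u (p @ [a]) v \<longleftrightarrow> awalk u p (s a) \<and> a \<in> arcs (quiver Q) \<and> t a = v"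
  by (auto simp: awalk_Cons_iff awalk_Nil_iff dest: awalk_ends)

lemma act_last_lists:
  assumes "awalk u p v" "p \<noteq> []" "ys \<in> ei_lists Q p" "g \<in> carrier (X v)"
  shows "act_last p g ys \<in> ei_lists Q p"
proof -
  from assms(3,2) obtain p' a ys' y where "p = p' @ [a]" "ys = ys' @ [y]" "ys' \<in> ei_lists Q p'" "y \<in> bset (Y a)"
    by (rule ei_lists_snocE)
  then show ?thesis using assms by (auto simp: ei_lists_split ei_lists_length awalk_snoc_iff biset_closed)
qed

lemma act_hd_lists:
  assumes "awalk u p v" "p \<noteq> []" "ys \<in> ei_lists Q p" "h \<in> carrier (X u)"
  shows "act_hd p ys h \<in> ei_lists Q p"
proof -
  from assms(3,2) obtain p' a ys' y where "p = a # p'" "ys = y # ys'" "ys' \<in> ei_lists Q p'" "y \<in> bset (Y a)"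
    by (rule ei_lists_ConsE)
  then show ?thesis using assms by (auto simp: awalk_Cons_iff biset_closed)
qed

text \<open>A move at the last two arrows is compatible with the action because the left and right
  actions on a biset commute. Any other move does not touch the last entry.\<close>

lemma act_last_rel:
  assumes "(ys, ys') \<in> ei_rel Q p" "awalk u p v" "p \<noteq> []" "k \<in> carrier (X v)"
  shows "(act_last p k ys, act_last p k ys') \<in> ei_rel Q p"
  using assms(1,2)
proof (rule ei_rel_map[where f = "act_last p k"])
  fix ys ys' assume "(ys, ys') \<in> ei_move Q p"
  from this assms(2) obtain us z y vs g as a b bs where *:
    "ys = us @ [z, ract (Y b) y g] @ vs" "ys' = us @ [lact (Y a) g z, y] @ vs"
    "p = as @ [a, b] @ bs" "us \<in> ei_lists Q as" "vs \<in> ei_lists Q bs"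
    "z \<in> bset (Y a)" "y \<in> bset (Y b)" "g \<in> carrier (X (t a))"
    "a \<in> arcs (quiver Q)" "b \<in> arcs (quiver Q)" "t a = s b"
    by (rule ei_moveE)
  show "(act_last p k ys, act_last p k ys') \<in> ei_rel Q p"
  proof (cases "bs = []")
    case True
    then have vs: "vs = []" and k: "k \<in> carrier (X (t b))"
      using * assms(2,4) by (auto simp: awalk_Cons_iff awalk_Nil_iff)
    have "(us @ [z, ract (Y b) (lact (Y b) k y) g] @ [], us @ [lact (Y a) g z, lact (Y b) k y] @ [])
        \<in> ei_move Q (as @ [a, b] @ [])"
      by (rule ei_moveI) (use * k in \<open>simp_all add: biset_closed\<close>)
    moreover have "act_last p k ys = us @ [z, ract (Y b) (lact (Y b) k y) g]"
      "act_last p k ys' = us @ [lact (Y a) g z, lact (Y b) k y]"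
      using True vs * k by (simp_all add: act_last_def butlast_append biset_closed)
    ultimately show ?thesis using ei_move_rel[OF _ assms(2)] * True by simp
  next
    case False
    from *(5) False obtain bs' c vs' x where **: "bs = bs' @ [c]" "vs = vs' @ [x]" "vs' \<in> ei_lists Q bs'" "x \<in> bset (Y c)"
      by (rule ei_lists_snocE)
    then have "c \<in> arcs (quiver Q)" "k \<in> carrier (X (t c))"
      using *(3) assms(2,4) awalk_snoc_iff[of u "as @ [a, b] @ bs'" c v] by auto
    then have "vs' @ [lact (Y c) k x] \<in> ei_lists Q bs" using ** by (simp add: ei_lists_split ei_lists_length biset_closed)
    then have "(us @ [z, ract (Y b) y g] @ (vs' @ [lact (Y c) k x]), us @ [lact (Y a) g z, y] @ (vs' @ [lact (Y c) k x]))
        \<in> ei_move Q (as @ [a, b] @ bs)"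
      by (intro ei_moveI) (use * in auto)
    moreover have "act_last p k ys = us @ [z, ract (Y b) y g] @ (vs' @ [lact (Y c) k x])"
      "act_last p k ys' = us @ [lact (Y a) g z, y] @ (vs' @ [lact (Y c) k x])"
      using * ** by (simp_all add: act_last_def butlast_append)
    ultimately show ?thesis using ei_move_rel[OF _ assms(2)] * by simp
  qed
qed (rule act_last_lists[OF assms(2,3) _ assms(4)])

lemma act_hd_rel:
  assumes "(ys, ys') \<in> ei_rel Q p" "awalk u p v" "p \<noteq> []" "k \<in> carrier (X u)"
  shows "(act_hd p ys k, act_hd p ys' k) \<in> ei_rel Q p"
  using assms(1,2)
proof (rule ei_rel_map[where f = "\<lambda>ys. act_hd p ys k"])
  fix ys ys' assume "(ys, ys') \<in> ei_move Q p"
  from this assms(2) obtain us z y vs g as a b bs where *: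
    "ys = us @ [z, ract (Y b) y g] @ vs" "ys' = us @ [lact (Y a) g z, y] @ vs"
    "p = as @ [a, b] @ bs" "us \<in> ei_lists Q as" "vs \<in> ei_lists Q bs"
    "z \<in> bset (Y a)" "y \<in> bset (Y b)" "g \<in> carrier (X (t a))"
    "a \<in> arcs (quiver Q)" "b \<in> arcs (quiver Q)" "t a = s b"
    by (rule ei_moveE)
  show "(act_hd p ys k, act_hd p ys' k) \<in> ei_rel Q p"
  proof (cases "as = []")
    case True
    then have us: "us = []" and k: "k \<in> carrier (X (s a))"
      using * assms(2,4) by (auto simp: awalk_Cons_iff)
    have "([] @ [ract (Y a) z k, ract (Y b) y g] @ vs, [] @ [lact (Y a) g (ract (Y a) z k), y] @ vs)
        \<in> ei_move Q ([] @ [a, b] @ bs)"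
      by (rule ei_moveI) (use * k in \<open>simp_all add: biset_closed\<close>)
    moreover have "act_hd p ys k = [ract (Y a) z k, ract (Y b) y g] @ vs"
      "act_hd p ys' k = [lact (Y a) g (ract (Y a) z k), y] @ vs"
      using True us * k by (simp_all add: act_hd_def biset_closed)
    ultimately show ?thesis using ei_move_rel[OF _ assms(2)] * True by simp
  next
    case False
    from *(4) False obtain as' c us' x where **: "as = c # as'" "us = x # us'" "us' \<in> ei_lists Q as'" "x \<in> bset (Y c)"
      by (rule ei_lists_ConsE)
    then have "c \<in> arcs (quiver Q)" "k \<in> carrier (X (s c))"
      using *(3) assms(2,4) by (auto simp: awalk_Cons_iff)
    then have "ract (Y c) x k # us' \<in> ei_lists Q as" using ** by (simp add: biset_closed)
    then have "((ract (Y c) x k # us') @ [z, ract (Y b) y g] @ vs, (ract (Y c) x k # us') @ [lact (Y a) g z, y] @ vs)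
        \<in> ei_move Q (as @ [a, b] @ bs)"
      by (intro ei_moveI) (use * in auto)
    moreover have "act_hd p ys k = (ract (Y c) x k # us') @ [z, ract (Y b) y g] @ vs"
      "act_hd p ys' k = (ract (Y c) x k # us') @ [lact (Y a) g z, y] @ vs"
      using * ** by (simp_all add: act_hd_def)
    ultimately show ?thesis using ei_move_rel[OF _ assms(2)] * by simp
  qed
qed (rule act_hd_lists[OF assms(2,3) _ assms(4)])

end

section \<open>Morphisms by representatives, the laws of a category, and its representations\<close>

context finite_ei_quiver
begin

definition gmor :: "'v \<Rightarrow> 'g \<Rightarrow> ('v, 'a, 'g, 'y) ei_mor" where
  "gmor v g = ((v, [], v), Inl g)"

text \<open>Every morphism over a nontrivial path has this form, so that composition can be computed
  with representing lists.\<close>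

definition cmor :: "'v \<Rightarrow> 'a list \<Rightarrow> 'v \<Rightarrow> 'y list \<Rightarrow> ('v, 'a, 'g, 'y) ei_mor" where
  "cmor u p v ys = ((u, p, v), Inr (ei_rel Q p `` {ys}))"

lemma mor_cases:
  assumes "f \<in> mors (ei_cat Q)"
  obtains (group) v g where "v \<in> verts (quiver Q)" "g \<in> carrier (X v)" "f = gmor v g"
  | (list) u p v ys where "awalk u p v" "p \<noteq> []" "ys \<in> ei_lists Q p" "f = cmor u p v ys"
proof -
  obtain u p v x where f: "f = ((u, p, v), x)" by (cases f) auto
  with assms have w: "awalk u p v" and x: "x \<in> ei_path_set Q (u, p, v)"
    by (auto simp: ei_cat_def qpaths_def)
  show thesis
  proof (cases "p = []")
    case True
    with w x f group show thesis by (auto simp: awalk_Nil_iff gmor_def)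
  next
    case False
    with x f list[OF w] show thesis by (auto simp: cmor_def elim!: quotientE)
  qed
qed

lemma gmor_mor: "v \<in> verts (quiver Q) \<Longrightarrow> g \<in> carrier (X v) \<Longrightarrow> gmor v g \<in> mors (ei_cat Q)"
  by (auto simp: ei_cat_def gmor_def qpaths_def awalk_Nil_iff)

lemma cmor_mor: "awalk u p v \<Longrightarrow> p \<noteq> [] \<Longrightarrow> ys \<in> ei_lists Q p \<Longrightarrow> cmor u p v ys \<in> mors (ei_cat Q)"
  by (auto simp: ei_cat_def cmor_def qpaths_def intro: quotientI)

lemma cmor_cong: "(ys, ys') \<in> ei_rel Q p \<Longrightarrow> cmor u p v ys = cmor u p v ys'"
  by (simp add: cmor_def ei_rel_class_eq)

lemma dom_cod_simps [simp]:
  "cdom (ei_cat Q) (gmor v g) = v" "ccod (ei_cat Q) (gmor v g) = v"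
  "cdom (ei_cat Q) (cmor u p w ys) = u" "ccod (ei_cat Q) (cmor u p w ys) = w"
  "cid (ei_cat Q) v = gmor v \<one>\<^bsub>X v\<^esub>" "obs (ei_cat Q) = verts (quiver Q)"
  by (simp_all add: ei_cat_def gmor_def cmor_def)

lemma comp_gmor_gmor: "ccomp (ei_cat Q) (gmor v g) (gmor v h) = gmor v (g \<otimes>\<^bsub>X v\<^esub> h)"
  by (simp add: ei_cat_def gmor_def)

lemma comp_gmor_cmor:
  assumes "awalk u p v" "p \<noteq> []" "ys \<in> ei_lists Q p" "g \<in> carrier (X v)"
  shows "ccomp (ei_cat Q) (gmor v g) (cmor u p v ys) = cmor u p v (act_last p g ys)"
proof -
  have "ei_rel Q p `` (act_last p g ` (ei_rel Q p `` {ys})) = ei_rel Q p `` {act_last p g ys}"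
    by (rule ei_rel_image_class[OF assms(3)]) (rule act_last_rel[OF _ assms(1,2,4)])
  then show ?thesis by (simp add: ei_cat_def gmor_def cmor_def act_last_def[abs_def])
qed

lemma comp_cmor_gmor:
  assumes "awalk u p v" "p \<noteq> []" "ys \<in> ei_lists Q p" "h \<in> carrier (X u)"
  shows "ccomp (ei_cat Q) (cmor u p v ys) (gmor u h) = cmor u p v (act_hd p ys h)"
proof -
  have "ei_rel Q p `` ((\<lambda>ys. act_hd p ys h) ` (ei_rel Q p `` {ys})) = ei_rel Q p `` {act_hd p ys h}"
    by (rule ei_rel_image_class[OF assms(3)]) (rule act_hd_rel[OF _ assms(1,2,4)])
  then show ?thesis by (simp add: ei_cat_def gmor_def cmor_def act_hd_def[abs_def])
qed

lemma comp_cmor_cmor: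
  assumes p: "awalk u p v" "ys \<in> ei_lists Q p" and q: "awalk v q w" "zs \<in> ei_lists Q q"
  shows "ccomp (ei_cat Q) (cmor v q w zs) (cmor u p v ys) = cmor u (p @ q) w (ys @ zs)"
proof -
  let ?S = "{ys' @ zs' |ys' zs'. ys' \<in> ei_rel Q p `` {ys} \<and> zs' \<in> ei_rel Q q `` {zs}}"
  have "ei_rel Q (p @ q) `` {x} = ei_rel Q (p @ q) `` {ys @ zs}" if "x \<in> ?S" for x
  proof -
    from that obtain ys' zs' where x: "x = ys' @ zs'" "(ys, ys') \<in> ei_rel Q p" "(zs, zs') \<in> ei_rel Q q" by blast
    have "(ys @ zs, ys' @ zs) \<in> ei_rel Q (p @ q)"
      using x p q by (intro ei_rel_append_right)
    moreover have "(ys' @ zs, ys' @ zs') \<in> ei_rel Q (p @ q)"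
      using x p q ei_rel_lists[OF x(2)] by (intro ei_rel_append_left) auto
    ultimately show ?thesis using x ei_rel_trans ei_rel_class_eq by metis
  qed
  moreover have "ys @ zs \<in> ?S" using p q ei_rel_refl by blast
  moreover have "ei_rel Q (p @ q) `` ?S = (\<Union>x\<in>?S. ei_rel Q (p @ q) `` {x})" by blast
  ultimately have "ei_rel Q (p @ q) `` ?S = ei_rel Q (p @ q) `` {ys @ zs}" by blast
  then show ?thesis by (simp add: ei_cat_def cmor_def)
qed

lemma act_last_append: "q \<noteq> [] \<Longrightarrow> zs \<noteq> [] \<Longrightarrow> act_last (p @ q) g (ys @ zs) = ys @ act_last q g zs"
  by (simp add: act_last_def butlast_append)

lemma act_hd_append: "p \<noteq> [] \<Longrightarrow> ys \<noteq> [] \<Longrightarrow> act_hd (p @ q) (ys @ zs) h = act_hd p ys h @ zs"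
  by (simp add: act_hd_def)

lemma act_assoc:
  assumes "awalk u p v" "p \<noteq> []" "ys \<in> ei_lists Q p"
  shows "g \<in> carrier (X v) \<Longrightarrow> g' \<in> carrier (X v) \<Longrightarrow>
      act_last p g (act_last p g' ys) = act_last p (g \<otimes>\<^bsub>X v\<^esub> g') ys"
    and "h \<in> carrier (X u) \<Longrightarrow> h' \<in> carrier (X u) \<Longrightarrow>
      act_hd p (act_hd p ys h) h' = act_hd p ys (h \<otimes>\<^bsub>X u\<^esub> h')"
    and "g \<in> carrier (X v) \<Longrightarrow> h \<in> carrier (X u) \<Longrightarrow>
      act_last p g (act_hd p ys h) = act_hd p (act_last p g ys) h"
    and "act_last p \<one>\<^bsub>X v\<^esub> ys = ys" and "act_hd p ys \<one>\<^bsub>X u\<^esub> = ys"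
proof -
  from assms(3,2) obtain p' a ys' y where *: "p = p' @ [a]" "ys = ys' @ [y]" "ys' \<in> ei_lists Q p'" "y \<in> bset (Y a)"
    by (rule ei_lists_snocE)
  from assms(3,2) obtain p'' b ys'' z where **: "p = b # p''" "ys = z # ys''" "ys'' \<in> ei_lists Q p''" "z \<in> bset (Y b)"
    by (rule ei_lists_ConsE)
  have a: "a \<in> arcs (quiver Q)" "t a = v" using assms(1) unfolding *(1) awalk_snoc_iff by simp_all
  have b: "b \<in> arcs (quiver Q)" "s b = u" using assms(1) **(1) by (simp_all add: awalk_Cons_iff)
  show "g \<in> carrier (X v) \<Longrightarrow> g' \<in> carrier (X v) \<Longrightarrow>
      act_last p g (act_last p g' ys) = act_last p (g \<otimes>\<^bsub>X v\<^esub> g') ys" "act_last p \<one>\<^bsub>X v\<^esub> ys = ys"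
    using a biset_closed[OF a(1) *(4)] unfolding * by simp_all
  show "h \<in> carrier (X u) \<Longrightarrow> h' \<in> carrier (X u) \<Longrightarrow>
      act_hd p (act_hd p ys h) h' = act_hd p ys (h \<otimes>\<^bsub>X u\<^esub> h')" "act_hd p ys \<one>\<^bsub>X u\<^esub> = ys"
    using b biset_closed[OF b(1) **(4)] unfolding ** by simp_all
  show "g \<in> carrier (X v) \<Longrightarrow> h \<in> carrier (X u) \<Longrightarrow>
      act_last p g (act_hd p ys h) = act_hd p (act_last p g ys) h"
  proof (cases "p'' = []")
    case True
    with ** have "p = [b]" "ys = [z]" by auto
    moreover from this * have "b = a" by auto
    ultimately show "g \<in> carrier (X v) \<Longrightarrow> h \<in> carrier (X u) \<Longrightarrow> ?thesis"
      using a b biset_closed[OF b(1) **(4)] by (simp add: act_last_def act_hd_def)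
  next
    case False
    then have "ys'' \<noteq> []" using **(3) ei_lists_length[OF **(3)] by auto
    with False show ?thesis unfolding ** by (simp add: act_last_def act_hd_def)
  qed
qed

lemma finite_cat_ei_cat: "finite_cat (ei_cat Q)"
proof
  show "finite (obs (ei_cat Q))" by simp
next
  fix f assume f: "f \<in> mors (ei_cat Q)"
  show "cdom (ei_cat Q) f \<in> obs (ei_cat Q)" "ccod (ei_cat Q) f \<in> obs (ei_cat Q)"
    using f by (cases rule: mor_cases; auto dest: awalk_hd_in_verts awalk_last_in_verts)+
  show "ccomp (ei_cat Q) f (cid (ei_cat Q) (cdom (ei_cat Q) f)) = f"
    using f
  proof (cases rule: mor_cases)
    case (group v g)
    then interpret group "X v" by (intro vgrp_group)
    show ?thesis using group by (simp add: comp_gmor_gmor)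
  next
    case (list u p v ys)
    then interpret group "X u" by (intro vgrp_group) (auto dest: awalk_hd_in_verts)
    show ?thesis using list by (simp add: comp_cmor_gmor act_assoc)
  qed
  show "ccomp (ei_cat Q) (cid (ei_cat Q) (ccod (ei_cat Q) f)) f = f"
    using f
  proof (cases rule: mor_cases)
    case (group v g)
    then interpret group "X v" by (intro vgrp_group)
    show ?thesis using group by (simp add: comp_gmor_gmor)
  next
    case (list u p v ys)
    then interpret group "X v" by (intro vgrp_group) (auto dest: awalk_last_in_verts)
    show ?thesis using list by (simp add: comp_gmor_cmor act_assoc)
  qed
next
  fix x assume "x \<in> obs (ei_cat Q)"
  then interpret group "X x" by (intro vgrp_group) simp
  show "cid (ei_cat Q) x \<in> mors (ei_cat Q)" "cdom (ei_cat Q) (cid (ei_cat Q) x) = x"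
    "ccod (ei_cat Q) (cid (ei_cat Q) x) = x"
    using \<open>x \<in> obs (ei_cat Q)\<close> by (simp_all add: gmor_mor)
next
  fix f g assume f: "f \<in> mors (ei_cat Q)" and g: "g \<in> mors (ei_cat Q)" and fg: "cdom (ei_cat Q) f = ccod (ei_cat Q) g"
  have "ccomp (ei_cat Q) f g \<in> mors (ei_cat Q) \<and> cdom (ei_cat Q) (ccomp (ei_cat Q) f g) = cdom (ei_cat Q) g
    \<and> ccod (ei_cat Q) (ccomp (ei_cat Q) f g) = ccod (ei_cat Q) f"
    using f
  proof (cases rule: mor_cases)
    case f: (group v h)
    then interpret group "X v" by (intro vgrp_group)
    from g show ?thesis
      by (cases rule: mor_cases)
        (use f fg in \<open>auto simp: comp_gmor_gmor comp_gmor_cmor gmor_mor intro!: cmor_mor act_last_lists\<close>)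
  next
    case f: (list v q w zs)
    from g show ?thesis
      by (cases rule: mor_cases)
        (use f fg in \<open>auto simp: comp_cmor_gmor comp_cmor_cmor intro!: cmor_mor act_hd_lists ei_lists_append\<close>)
  qed
  then show "ccomp (ei_cat Q) f g \<in> mors (ei_cat Q)" "cdom (ei_cat Q) (ccomp (ei_cat Q) f g) = cdom (ei_cat Q) g"
    "ccod (ei_cat Q) (ccomp (ei_cat Q) f g) = ccod (ei_cat Q) f" by auto
next
  fix f g h assume f: "f \<in> mors (ei_cat Q)" and g: "g \<in> mors (ei_cat Q)" and h: "h \<in> mors (ei_cat Q)"
    and fg: "cdom (ei_cat Q) f = ccod (ei_cat Q) g" and gh: "cdom (ei_cat Q) g = ccod (ei_cat Q) h"
  have ne: "ys \<noteq> []" if "p \<noteq> []" "ys \<in> ei_lists Q p" for p ys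
    using that by (cases p) (auto simp: ei_lists_def)
  note simps = comp_gmor_gmor comp_gmor_cmor comp_cmor_gmor comp_cmor_cmor act_last_lists act_hd_lists
    ei_lists_append act_assoc act_last_append act_hd_append ne
  show "ccomp (ei_cat Q) (ccomp (ei_cat Q) f g) h = ccomp (ei_cat Q) f (ccomp (ei_cat Q) g h)"
    using g
  proof (cases rule: mor_cases)
    case g: (group v x)
    then interpret group "X v" by (intro vgrp_group)
    from f show ?thesis
    proof (cases rule: mor_cases)
      case f: (group v' y)
      with fg g have [simp]: "v' = v" by simp
      from h show ?thesis
        by (cases rule: mor_cases) (use f g gh in \<open>auto simp: simps m_assoc\<close>)
    next
      case f: (list v' q w zs)
      with fg g have [simp]: "v' = v" by simp
      from h show ?thesis
      proof (cases rule: mor_cases)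
        case h: (group v'' y)
        with gh g have [simp]: "v'' = v" by simp
        show ?thesis using f g h by (simp add: simps)
      next
        case h: (list u p v'' ys)
        with gh g have [simp]: "v'' = v" by simp
        \<comment> \<open>The case with content: a group element between two lists. Acting with it
          on the first entry of the one list or on the last entry of the other differs by one
          elementary move at the junction.\<close>
        have "(ys @ act_hd q zs x, act_last p x ys @ zs) \<in> ei_rel Q (p @ q)"
        proof (rule ei_move_rel)
          show "awalk u (p @ q) w" using f h by (simp add: awalk_appendI)
          from h(3,2) obtain p' a ys' y where *: "p = p' @ [a]" "ys = ys' @ [y]" "ys' \<in> ei_lists Q p'" "y \<in> bset (Y a)"
            by (rule ei_lists_snocE)
          from f(3,2) obtain q' b zs' z where **: "q = b # q'" "zs = z # zs'" "zs' \<in> ei_lists Q q'" "z \<in> bset (Y b)"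
            by (rule ei_lists_ConsE)
          have "t a = v" using h(1) unfolding *(1) awalk_snoc_iff by simp
          then have "(ys' @ [y, ract (Y b) z x] @ zs', ys' @ [lact (Y a) x y, z] @ zs') \<in> ei_move Q (p' @ [a, b] @ q')"
            using * ** g by (intro ei_moveI) auto
          then show "(ys @ act_hd q zs x, act_last p x ys @ zs) \<in> ei_move Q (p @ q)"
            unfolding * ** by simp
        qed
        then show ?thesis using f g h by (simp add: simps cmor_cong)
      qed
    qed
  next
    case g: (list v q w ys)
    from f show ?thesis
    proof (cases rule: mor_cases)
      case f: (group w' x)
      with fg g have [simp]: "w' = w" by simp
      from h show ?thesis
        by (cases rule: mor_cases) (use f g gh in \<open>auto simp: simps awalk_appendI\<close>)
    next
      case f: (list w' r w'' zs)
      with fg g have [simp]: "w' = w" by simp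
      from h show ?thesis
        by (cases rule: mor_cases) (use f g gh in \<open>auto simp: simps awalk_appendI\<close>)
    qed
  qed
qed

text \<open>The choice of the list in the class is immaterial in a representation, by
  \<open>list_prod_rel\<close>.\<close>

definition ei_rep :: "('v \<Rightarrow> 'g \<Rightarrow> 't::ring_1) \<Rightarrow> ('a \<Rightarrow> 'y \<Rightarrow> 't) \<Rightarrow> ('v, 'a, 'g, 'y) ei_mor \<Rightarrow> 't" where
  "ei_rep \<gamma> \<beta> = (\<lambda>((u, p, v), x). case x of Inl g \<Rightarrow> \<gamma> u g | Inr c \<Rightarrow> list_prod \<beta> p (SOME ys. ys \<in> c))"

end

text \<open>The universal property of the category: values on group elements and on single biset
  elements, if compatible with both actions, extend to all morphisms
  (\<open>cat_rep_ei_rep\<close>).\<close>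

locale ei_representation = finite_ei_quiver Q for Q :: "('v, 'a, 'g, 'y) ei_quiver" +
  fixes \<gamma> :: "'v \<Rightarrow> 'g \<Rightarrow> 't::ring_1" and \<beta> :: "'a \<Rightarrow> 'y \<Rightarrow> 't"
  assumes \<gamma>_mult: "u \<in> verts (quiver Q) \<Longrightarrow> v \<in> verts (quiver Q) \<Longrightarrow> g \<in> carrier (X u) \<Longrightarrow> h \<in> carrier (X v) \<Longrightarrow>
      \<gamma> u g * \<gamma> v h = (if u = v then \<gamma> u (g \<otimes>\<^bsub>X u\<^esub> h) else 0)"
    and \<gamma>_\<beta>: "a \<in> arcs (quiver Q) \<Longrightarrow> y \<in> bset (Y a) \<Longrightarrow> g \<in> carrier (X (t a)) \<Longrightarrow>
      \<gamma> (t a) g * \<beta> a y = \<beta> a (lact (Y a) g y)"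
    and \<beta>_\<gamma>: "a \<in> arcs (quiver Q) \<Longrightarrow> y \<in> bset (Y a) \<Longrightarrow> h \<in> carrier (X (s a)) \<Longrightarrow>
      \<beta> a y * \<gamma> (s a) h = \<beta> a (ract (Y a) y h)"
begin

lemma list_prod_rel:
  assumes "(ys, ys') \<in> ei_rel Q p" "awalk u p v"
  shows "list_prod \<beta> p ys = list_prod \<beta> p ys'"
  using assms
proof (induction rule: ei_rel_induct)
  case (move ys ys')
  from this assms(2) obtain us z y vs g as a b bs where *:
    "ys = us @ [z, ract (Y b) y g] @ vs" "ys' = us @ [lact (Y a) g z, y] @ vs"
    "p = as @ [a, b] @ bs" "us \<in> ei_lists Q as" "vs \<in> ei_lists Q bs"
    "z \<in> bset (Y a)" "y \<in> bset (Y b)" "g \<in> carrier (X (t a))"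
    "a \<in> arcs (quiver Q)" "b \<in> arcs (quiver Q)" "t a = s b"
    by (rule ei_moveE)
  have "list_prod \<beta> [a, b] [z, ract (Y b) y g] = list_prod \<beta> [a, b] [lact (Y a) g z, y]"
    using * \<gamma>_\<beta>[of a z g] \<beta>_\<gamma>[of b y g] by (simp add: mult.assoc flip: \<gamma>_\<beta> \<beta>_\<gamma>)
  then show ?case
    unfolding * using ei_lists_length[OF *(4)] by (simp only: list_prod_append length_append list.size)
qed auto

lemma ei_rep_gmor [simp]: "ei_rep \<gamma> \<beta> (gmor v g) = \<gamma> v g"
  by (simp add: ei_rep_def gmor_def)

lemma ei_rep_cmor:
  assumes "awalk u p v" "ys \<in> ei_lists Q p"
  shows "ei_rep \<gamma> \<beta> (cmor u p v ys) = list_prod \<beta> p ys"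
proof -
  have "(SOME zs. zs \<in> ei_rel Q p `` {ys}) \<in> ei_rel Q p `` {ys}"
    by (rule someI[of _ ys]) (use assms ei_rel_refl in blast)
  then show ?thesis
    using list_prod_rel[OF _ assms(1)] by (simp add: ei_rep_def cmor_def)
qed

lemma \<gamma>_list_prod:
  assumes "awalk u p v" "p \<noteq> []" "ys \<in> ei_lists Q p" "g \<in> carrier (X v)"
  shows "\<gamma> v g * list_prod \<beta> p ys = list_prod \<beta> p (act_last p g ys)"
proof -
  from assms(3,2) obtain p' a ys' y where *: "p = p' @ [a]" "ys = ys' @ [y]" "ys' \<in> ei_lists Q p'" "y \<in> bset (Y a)"
    by (rule ei_lists_snocE)
  have "a \<in> arcs (quiver Q)" "t a = v" using assms(1) unfolding *(1) awalk_snoc_iff by simp_all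
  then show ?thesis
    unfolding * using \<gamma>_\<beta>[of a y g] * assms(4) ei_lists_length[OF *(3)]
    by (simp add: list_prod_append flip: mult.assoc)
qed

lemma list_prod_\<gamma>:
  assumes "awalk u p v" "p \<noteq> []" "ys \<in> ei_lists Q p" "h \<in> carrier (X u)"
  shows "list_prod \<beta> p ys * \<gamma> u h = list_prod \<beta> p (act_hd p ys h)"
proof -
  from assms(3,2) obtain p' a ys' y where *: "p = a # p'" "ys = y # ys'" "ys' \<in> ei_lists Q p'" "y \<in> bset (Y a)"
    by (rule ei_lists_ConsE)
  have "a \<in> arcs (quiver Q)" "s a = u" using assms(1) *(1) by (simp_all add: awalk_Cons_iff)
  then show ?thesis
    unfolding * using \<beta>_\<gamma>[of a y h] * assms(4) by (simp add: mult.assoc)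
qed

lemma one_X: "v \<in> verts (quiver Q) \<Longrightarrow> \<one>\<^bsub>X v\<^esub> \<in> carrier (X v)"
  using vgrp_group group.is_monoid monoid.one_closed by blast

lemma cat_rep_ei_rep: "cat_rep (ei_cat Q) (ei_rep \<gamma> \<beta>)"
  unfolding cat_rep_def
proof (intro ballI)
  fix f g assume f: "f \<in> mors (ei_cat Q)" and g: "g \<in> mors (ei_cat Q)"
  \<comment> \<open>Morphisms absorb the units of the groups at their ends. A product of morphisms
    that cannot be composed therefore contains a product of group elements at different vertices,
    which is 0.\<close>
  have id_l: "\<gamma> v \<one>\<^bsub>X v\<^esub> * list_prod \<beta> p ys = list_prod \<beta> p ys"
    if "awalk u p v" "p \<noteq> []" "ys \<in> ei_lists Q p" for u p v ys
    using \<gamma>_list_prod[OF that one_X] that awalk_last_in_verts[OF that(1)] by (simp add: act_assoc)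
  have id_r: "list_prod \<beta> p ys * \<gamma> u \<one>\<^bsub>X u\<^esub> = list_prod \<beta> p ys"
    if "awalk u p v" "p \<noteq> []" "ys \<in> ei_lists Q p" for u p v ys
    using list_prod_\<gamma>[OF that one_X] that awalk_hd_in_verts[OF that(1)] by (simp add: act_assoc)
  show "ei_rep \<gamma> \<beta> f * ei_rep \<gamma> \<beta> g =
      (if cdom (ei_cat Q) f = ccod (ei_cat Q) g then ei_rep \<gamma> \<beta> (ccomp (ei_cat Q) f g) else 0)"
    using f
  proof (cases rule: mor_cases)
    case f: (group v x)
    from g show ?thesis
    proof (cases rule: mor_cases)
      case g: (group v' y)
      show ?thesis using f g \<gamma>_mult[of v v' x y] by (auto simp: comp_gmor_gmor)
    next
      case g: (list u p v' ys)
      show ?thesis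
      proof (cases "v = v'")
        case True
        then show ?thesis using f g
          by (simp add: comp_gmor_cmor ei_rep_cmor \<gamma>_list_prod act_last_lists)
      next
        case False
        have v': "v' \<in> verts (quiver Q)" using g awalk_last_in_verts by blast
        have "\<gamma> v x * (\<gamma> v' \<one>\<^bsub>X v'\<^esub> * list_prod \<beta> p ys) = 0"
          using \<gamma>_mult[OF f(1) v' f(2) one_X[OF v']] False by (simp flip: mult.assoc)
        then show ?thesis using f g False by (simp add: id_l ei_rep_cmor)
      qed
    qed
  next
    case f: (list v q w zs)
    have v: "v \<in> verts (quiver Q)" using f awalk_hd_in_verts by blast
    from g show ?thesis
    proof (cases rule: mor_cases)
      case g: (group v' y)
      show ?thesis
      proof (cases "v = v'")
        case True
        then show ?thesis using f g
          by (simp add: comp_cmor_gmor ei_rep_cmor list_prod_\<gamma> act_hd_lists)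
      next
        case False
        have "list_prod \<beta> q zs * \<gamma> v \<one>\<^bsub>X v\<^esub> * \<gamma> v' y = 0"
          using \<gamma>_mult[OF v g(1) one_X[OF v] g(2)] False by (simp add: mult.assoc)
        then show ?thesis using f g False by (simp add: id_r ei_rep_cmor)
      qed
    next
      case g: (list u p v' ys)
      show ?thesis
      proof (cases "v = v'")
        case True
        then show ?thesis using f g
          by (simp add: comp_cmor_cmor ei_rep_cmor list_prod_append ei_lists_append awalk_appendI ei_lists_length)
      next
        case False
        have v': "v' \<in> verts (quiver Q)" using g awalk_last_in_verts by blast
        have "list_prod \<beta> q zs * (\<gamma> v \<one>\<^bsub>X v\<^esub> * \<gamma> v' \<one>\<^bsub>X v'\<^esub>) * list_prod \<beta> p ys = 0"
          using \<gamma>_mult[OF v v' one_X[OF v] one_X[OF v']] False by simp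
        then have "list_prod \<beta> q zs * \<gamma> v \<one>\<^bsub>X v\<^esub> * (\<gamma> v' \<one>\<^bsub>X v'\<^esub> * list_prod \<beta> p ys) = 0"
          by (simp add: mult.assoc)
        then show ?thesis using f g False by (simp add: id_r id_l ei_rep_cmor)
      qed
    qed
  qed
qed

end

section \<open>Frobenius, and polynomial identities evaluated in noncommutative rings\<close>

section \<open>Polynomial identities in algebras\<close>

text \<open>The value 1 serves for characteristic 0. All powers of \<open>P\<close> are then 1 and
  Frobenius is trivial, so that both cases are treated together.\<close>

definition char_exponent :: "'k::field itself \<Rightarrow> nat \<Rightarrow> bool" where
  "char_exponent K P \<longleftrightarrow> P = 1 \<or> prime P \<and> P = CHAR('k)"

lemma char_exponent_power_add:
  fixes a b :: "'a::comm_semiring_1"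
  assumes "char_exponent TYPE('k::field) P" "CHAR('a) = CHAR('k)"
  shows "(a + b) ^ P ^ k = a ^ P ^ k + b ^ P ^ k"
  using assms freshmans_dream'[of "P ^ k" k a b] by (auto simp: char_exponent_def)

context scalars
begin

text \<open>Horner evaluation at one element of a noncommutative ring; it is a ring homomorphism
  since scalars are central.\<close>

definition poly_eval :: "'t \<Rightarrow> 'k poly \<Rightarrow> 't" where
  "poly_eval x f = fold_coeffs (\<lambda>c r. sc c + x * r) f 0"

lemma poly_eval_0 [simp]: "poly_eval x 0 = 0"
  by (simp add: poly_eval_def)

lemma poly_eval_pCons [simp]: "poly_eval x (pCons c f) = sc c + x * poly_eval x f"
  by (cases "c = 0 \<and> f = 0") (auto simp: poly_eval_def)

lemma poly_eval_add: "poly_eval x (f + g) = poly_eval x f + poly_eval x g"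
  by (induction f g rule: poly_induct2) (simp_all add: sc_add distrib_left)

lemma poly_eval_smult: "poly_eval x (Polynomial.smult c f) = sc c * poly_eval x f"
proof (induction f)
  case (pCons a f)
  then show ?case using sc_left_comm[of x c "poly_eval x f"] by (simp add: sc_mult distrib_left)
qed simp

lemma poly_eval_mult: "poly_eval x (f * g) = poly_eval x f * poly_eval x g"
  by (induction f) (simp_all add: poly_eval_add poly_eval_smult distrib_right mult.assoc)

lemma poly_eval_1 [simp]: "poly_eval x 1 = 1"
  by (simp add: one_pCons)

lemma poly_eval_power: "poly_eval x (f ^ n) = poly_eval x f ^ n"
  by (induction n) (simp_all add: poly_eval_mult)

text \<open>Frobenius is a statement about commutative rings; here it is proved for polynomials and
  then evaluated at \<open>x\<close>.\<close>

lemma one_plus_power: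
  fixes x :: 't
  assumes "char_exponent TYPE('k) P"
  shows "(1 + x) ^ P ^ k = 1 + x ^ P ^ k"
proof -
  have "([:1:] + [:0, 1:] :: 'k poly) ^ P ^ k = [:1:] ^ P ^ k + [:0, 1:] ^ P ^ k"
    by (rule char_exponent_power_add[OF assms]) simp
  then have "poly_eval x (([:1:] + [:0, 1:]) ^ P ^ k) = poly_eval x ([:1:] ^ P ^ k + [:0, 1:] ^ P ^ k)"
    by (rule arg_cong)
  then show ?thesis by (simp only: poly_eval_add poly_eval_power) simp
qed

text \<open>
  The polynomial \<open>\<Sum> L\<^sup>i R\<^sup>j\<close>, with coefficients in \<open>K[L]\<close> and unknown \<open>R\<close>, acts on \<open>Y\<close> by
  \<open>\<Sum> x\<^sup>i Y x'\<^sup>j\<close>.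
\<close>

definition bipoly_eval :: "'t \<Rightarrow> 't \<Rightarrow> 't \<Rightarrow> 'k poly poly \<Rightarrow> 't" where
  "bipoly_eval x Y x' f = fold_coeffs (\<lambda>c r. poly_eval x c * Y + r * x') f 0"

lemma bipoly_eval_0 [simp]: "bipoly_eval x Y x' 0 = 0"
  by (simp add: bipoly_eval_def)

lemma bipoly_eval_pCons [simp]:
  "bipoly_eval x Y x' (pCons c f) = poly_eval x c * Y + bipoly_eval x Y x' f * x'"
  by (cases "c = 0 \<and> f = 0") (auto simp: bipoly_eval_def)

lemma bipoly_eval_add: "bipoly_eval x Y x' (f + g) = bipoly_eval x Y x' f + bipoly_eval x Y x' g"
  by (induction f g rule: poly_induct2) (simp_all add: poly_eval_add distrib_right)

lemma bipoly_eval_sum: "bipoly_eval x Y x' (\<Sum>i\<in>B. f i) = (\<Sum>i\<in>B. bipoly_eval x Y x' (f i))"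
  by (induction B rule: infinite_finite_induct) (simp_all add: bipoly_eval_add)

lemma bipoly_eval_smult: "bipoly_eval x Y x' (Polynomial.smult c f) = poly_eval x c * bipoly_eval x Y x' f"
  by (induction f) (simp_all add: poly_eval_mult distrib_left mult.assoc)

lemma bipoly_eval_left: "bipoly_eval x Y x' ([:c:] ^ n * f) = poly_eval x c ^ n * bipoly_eval x Y x' f"
  by (induction n) (simp_all add: bipoly_eval_smult mult.assoc)

lemma bipoly_eval_right: "bipoly_eval x Y x' ([:[:a:], 1:] ^ n) = Y * (sc a + x') ^ n"
proof (induction n)
  case (Suc n)
  have "bipoly_eval x Y x' ([:[:a:], 1:] ^ Suc n) = bipoly_eval x Y x' ([:[:a:], 1:] ^ n) * (sc a + x')"
    by (simp add: bipoly_eval_add bipoly_eval_smult distrib_left sc_comm[of _ a])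
  then show ?case using Suc by (simp add: power_commutes mult.assoc)
qed (simp add: one_pCons)

text \<open>
  With \<open>L = 1 + x\<close> and \<open>R = 1 + x'\<close>, both sums are \<open>(L\<^sup>n - R\<^sup>n) / (L - R)\<close>, because \<open>L\<^sup>n - R\<^sup>n = x\<^sup>n - x'\<^sup>n\<close>.
\<close>

lemma sum_unipotent:
  fixes x x' Y :: 't
  assumes P: "char_exponent TYPE('k) P" and n: "n = P ^ k"
  shows "(\<Sum>u<n. (1 + x) ^ u * (Y * (1 + x') ^ (n - 1 - u))) = (\<Sum>f<n. x ^ f * (Y * x' ^ (n - 1 - f)))"
proof -
  let ?L = "[:[:0, 1:]:] :: 'k poly poly" and ?R = "[:[:0:], 1:] :: 'k poly poly"
    and ?L1 = "[:[:1, 1:]:] :: 'k poly poly" and ?R1 = "[:[:1:], 1:] :: 'k poly poly"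
  have LR: "?L1 = 1 + ?L" "?R1 = 1 + ?R" by (simp_all add: one_pCons)
  have frob: "(1 + a) ^ n = 1 + a ^ n" for a :: "'k poly poly"
    using char_exponent_power_add[OF P, of 1 a k] by (simp add: n)
  have "(?L - ?R) * (\<Sum>u<n. ?R1 ^ (n - Suc u) * ?L1 ^ u) = ?L1 ^ n - ?R1 ^ n"
    using power_diff_sumr2[of ?L1 n ?R1] by (simp add: LR)
  also have "\<dots> = ?L ^ n - ?R ^ n"
    by (simp only: LR frob) simp
  also have "\<dots> = (?L - ?R) * (\<Sum>f<n. ?R ^ (n - Suc f) * ?L ^ f)"
    by (rule power_diff_sumr2)
  finally have "(\<Sum>u<n. ?R1 ^ (n - Suc u) * ?L1 ^ u) = (\<Sum>f<n. ?R ^ (n - Suc f) * ?L ^ f)"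
    by (rule mult_left_cancel[THEN iffD1, rotated]) simp
  then have "bipoly_eval x Y x' (\<Sum>u<n. ?L1 ^ u * ?R1 ^ (n - Suc u)) =
      bipoly_eval x Y x' (\<Sum>f<n. ?L ^ f * ?R ^ (n - Suc f))"
    by (simp only: mult.commute)
  then show ?thesis
    by (simp only: bipoly_eval_sum bipoly_eval_left bipoly_eval_right) simp
qed

end

section \<open>Spectral idempotents of a cyclic group whose order is q d\<close>

section \<open>Cyclic group actions\<close>

lemma power_intertwine: "a * x = x * b \<Longrightarrow> a ^ n * x = x * b ^ n" for a b x :: "'a::monoid_mult"
proof (induction n)
  case (Suc n)
  have "a ^ Suc n * x = a * (a ^ n * x)" by (simp add: mult.assoc)
  also have "\<dots> = (a * x) * b ^ n" unfolding Suc.IH[OF Suc.prems] by (simp add: mult.assoc)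
  also have "\<dots> = x * b ^ Suc n" unfolding Suc.prems by (simp add: mult.assoc)
  finally show ?case .
qed simp

lemma sum_shift_periodic:
  fixes G :: "nat \<Rightarrow> 'a::ab_group_add"
  assumes "G n = G 0"
  shows "(\<Sum>k<n. G (Suc k)) = (\<Sum>k<n. G k)"
  using sum.lessThan_Suc[of G n] sum.lessThan_Suc_shift[of G n] assms by simp

definition primitive_root :: "nat \<Rightarrow> 'k::field \<Rightarrow> bool" where
  "primitive_root d z \<longleftrightarrow> (\<forall>k. z ^ k = 1 \<longleftrightarrow> d dvd k)"

lemma primitive_root_nonzero: "primitive_root d z \<Longrightarrow> d > 0 \<Longrightarrow> z \<noteq> 0"
  unfolding primitive_root_def by (metis dvd_refl power_0_left less_irrefl zero_neq_one)

lemma primitive_root_power_eq: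
  assumes "primitive_root d z" "d > 0"
  shows "z ^ m = z ^ n \<longleftrightarrow> [m = n] (mod d)"
proof -
  have *: "z ^ m = z ^ n \<longleftrightarrow> [m = n] (mod d)" if "m \<le> n" for m n
  proof -
    have "z ^ n = z ^ m * z ^ (n - m)" using that by (simp flip: power_add)
    then have "z ^ m = z ^ n \<longleftrightarrow> z ^ (n - m) = 1"
      using primitive_root_nonzero[OF assms] by auto
    also have "\<dots> \<longleftrightarrow> d dvd n - m" using assms by (simp add: primitive_root_def)
    also have "\<dots> \<longleftrightarrow> [m = n] (mod d)"
      using that by (metis cong_sym_eq cong_altdef_nat)
    finally show ?thesis .
  qed
  show ?thesis
  proof (cases "m \<le> n")
    case False
    with *[of n m] show ?thesis by (metis cong_sym_eq nat_le_linear)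
  qed (rule *)
qed

lemma sum_root_of_unity:
  fixes u :: "'k::field"
  assumes "u ^ d = 1"
  shows "(\<Sum>k<d. u ^ k) = (if u = 1 then of_nat d else 0)"
  using assms by (simp add: sum_gp_strict)

text \<open>A cyclic group of order dividing \<open>q * d\<close>, with unit \<open>e\<close> and
  generator \<open>h\<close>. The inverses \<open>x\<close> of \<open>q\<close> and \<open>y\<close>
  of \<open>d\<close> split \<open>h\<close> into \<open>h ^ (q * x)\<close>, of order dividing
  \<open>d\<close>, and \<open>h ^ (d * y)\<close>, of order dividing \<open>q\<close>.\<close>

locale cyclic_action = scalars sc for sc :: "'k::field \<Rightarrow> 't::ring_1" +
  fixes e h :: 't and q d x y :: nat and z :: 'k
  assumes ee: "e * e = e" and eh: "e * h = h" and he: "h * e = h"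
    and h_order: "h ^ (q * d) = e"
    and q_pos: "q > 0" and d_pos: "d > 0"
    and prim: "primitive_root d z" and d_unit: "of_nat d \<noteq> (0 :: 'k)"
    and x_inv: "[x * q = 1] (mod d)" and y_inv: "[y * d = 1] (mod q)"
begin

definition w :: 't where "w = h ^ d"

text \<open>The projector to the eigenspace of \<open>h ^ q\<close> for \<open>z ^ (l * q)\<close>,
  as an average over the characters of a cyclic group of order \<open>d\<close>. With the eigenvalue
  indexed in this way, \<open>h\<close> itself acts there as \<open>z ^ l\<close> times a power of
  \<open>w\<close>; see \<open>h_E\<close>.\<close>

definition E :: "nat \<Rightarrow> 't" where
  "E l = (\<Sum>k<d. sc (inverse (z ^ (l * q)) ^ k / of_nat d) * (h ^ (q * k) * e))"

lemma z_nonzero: "z \<noteq> 0" by (rule primitive_root_nonzero[OF prim d_pos])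

lemma z_power_eq: "z ^ m = z ^ n \<longleftrightarrow> [m = n] (mod d)"
  by (rule primitive_root_power_eq[OF prim d_pos])

lemma z_order: "z ^ d = 1" using prim by (simp add: primitive_root_def)

lemma z_power_order: "(z ^ n) ^ d = 1"
  by (metis z_order mult.commute power_mult power_one)

lemma coprime_q_d: "coprime q d" 
  using x_inv by (metis coprime_iff_invertible_nat mult.commute One_nat_def)

lemma cong_qd: "[x * q + y * d = 1] (mod q * d)"
proof (rule coprime_cong_mult_nat[OF _ _ coprime_q_d])
  have "[x * q + y * d = 0 + 1] (mod q)" by (intro cong_add y_inv) (simp add: cong_0_iff)
  then show "[x * q + y * d = 1] (mod q)" by simp
  have "[x * q + y * d = 1 + 0] (mod d)" by (intro cong_add x_inv) (simp add: cong_0_iff)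
  then show "[x * q + y * d = 1] (mod d)" by simp
qed

lemma h_comm_e: "h ^ n * e = e * h ^ n"
  by (rule power_intertwine) (simp add: eh he)

lemma h_period: "h ^ (n + q * d * k) * e = h ^ n * e"
proof (induction k)
  case (Suc k)
  have "h ^ (n + q * d * Suc k) * e = h ^ (n + q * d * k) * (h ^ (q * d) * e)"
    by (simp only: mult_Suc_right add.assoc[symmetric] add.commute[of "q * d"] power_add mult.assoc)
  then show ?case using Suc by (simp add: h_order ee)
qed simp

lemma h_cong: "[m = n] (mod q * d) \<Longrightarrow> h ^ m * e = h ^ n * e"
proof -
  assume c: "[m = n] (mod q * d)"
  have "h ^ m * e = h ^ (m mod (q * d)) * e" for m
    using h_period[of "m mod (q * d)" "m div (q * d)"] by (simp only: mod_mult_div_eq)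
  with c show ?thesis by (metis cong_def)
qed

lemma E_e: "E l * e = E l"
  by (simp add: E_def sum_distrib_right mult.assoc ee)

lemma e_E: "e * E l = E l"
proof -
  have "e * (h ^ n * e) = h ^ n * e" for n by (metis h_comm_e mult.assoc ee)
  then show ?thesis by (simp add: E_def sum_distrib_left sc_left_comm[of e])
qed

lemma h_E_comm: "h ^ n * E l = E l * h ^ n"
proof -
  have "h ^ n * (sc c * (h ^ k * e)) = sc c * (h ^ k * e) * h ^ n" for c k
  proof -
    have "h ^ n * (sc c * (h ^ k * e)) = sc c * (h ^ n * h ^ k * e)"
      by (simp add: sc_left_comm mult.assoc)
    also have "h ^ n * h ^ k = h ^ k * h ^ n" by (simp add: add.commute flip: power_add)
    finally show ?thesis using h_comm_e[of n] by (simp add: mult.assoc)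
  qed
  then show ?thesis by (simp add: E_def sum_distrib_left sum_distrib_right)
qed

text \<open>Multiplication by \<open>h ^ q\<close> shifts the summation index, and the summands for
  \<open>k = 0\<close> and \<open>k = d\<close> coincide.\<close>

lemma hq_E: "h ^ q * E l = sc (z ^ (l * q)) * E l"
proof -
  let ?i = "inverse (z ^ (l * q))"
  define G where "G k = sc (?i ^ k / of_nat d) * (h ^ (q * k) * e)" for k
  have "?i ^ d = 1" by (simp only: power_inverse z_power_order inverse_1)
  then have "G d = G 0" by (simp add: G_def h_order ee)
  have "h ^ q * G k = sc (z ^ (l * q)) * G (Suc k)" for k
  proof -
    have "h ^ q * G k = sc (?i ^ k / of_nat d) * (h ^ (q * Suc k) * e)"
      by (simp add: G_def sc_left_comm power_add mult.assoc)
    also have "?i ^ k / of_nat d = z ^ (l * q) * (?i ^ Suc k / of_nat d)"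
      using z_nonzero by simp
    finally show ?thesis by (simp only: G_def sc_mult mult.assoc)
  qed
  then have "h ^ q * E l = sc (z ^ (l * q)) * (\<Sum>k<d. G (Suc k))"
    by (simp add: E_def sum_distrib_left flip: G_def)
  also have "(\<Sum>k<d. G (Suc k)) = E l"
    using sum_shift_periodic[OF \<open>G d = G 0\<close>] by (simp add: E_def G_def)
  finally show ?thesis .
qed

lemma eigen_power:
  assumes "h ^ q * X = sc (z ^ (m * q)) * X"
  shows "h ^ (q * k) * X = sc (z ^ (m * q * k)) * X"
proof (induction k)
  case (Suc k)
  have "h ^ (q * Suc k) * X = h ^ q * (h ^ (q * k) * X)"
    by (simp add: power_add mult.assoc)
  also have "\<dots> = sc (z ^ (m * q * k)) * (sc (z ^ (m * q)) * X)"
    using Suc by (simp add: sc_left_comm[of "h ^ q"] assms)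
  also have "\<dots> = sc (z ^ (m * q * k) * z ^ (m * q)) * X" by (simp add: sc_mult mult.assoc)
  also have "z ^ (m * q * k) * z ^ (m * q) = z ^ (m * q * Suc k)" by (simp add: power_add)
  finally show ?case .
qed simp

lemma hqk_E: "h ^ (q * k) * E l = sc (z ^ (l * q * k)) * E l"
  by (rule eigen_power) (rule hq_E)

text \<open>On an eigenvector, the projector becomes the average of the powers of a
  \<open>d\<close>-th root of unity, which is 1 or 0. The root is trivial only for
  \<open>l = m\<close>, because \<open>q\<close> is prime to \<open>d\<close>.\<close>

lemma E_eigen:
  assumes lm: "l < d" "m < d" and X: "e * X = X" "h ^ q * X = sc (z ^ (m * q)) * X"
  shows "E l * X = (if l = m then X else 0)"
proof -
  let ?u = "z ^ (m * q) / z ^ (l * q)"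
  have "E l * X = (\<Sum>k<d. sc (inverse (z ^ (l * q)) ^ k / of_nat d) * (h ^ (q * k) * X))"
    by (simp add: E_def[of l] sum_distrib_right mult.assoc X(1))
  also have "\<dots> = (\<Sum>k<d. sc (?u ^ k / of_nat d) * X)"
  proof (rule sum.cong[OF refl])
    fix k
    have "inverse a ^ k / c * b ^ k = (b / a) ^ k / c" for a b c :: 'k
      by (simp add: divide_inverse power_mult_distrib mult.commute)
    then have "inverse (z ^ (l * q)) ^ k / of_nat d * z ^ (m * q * k) = ?u ^ k / of_nat d"
      by (simp only: power_mult[of z "m * q" k])
    then show "sc (inverse (z ^ (l * q)) ^ k / of_nat d) * (h ^ (q * k) * X) = sc (?u ^ k / of_nat d) * X"
      unfolding eigen_power[OF X(2)] by (metis mult.assoc sc_mult)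
  qed
  also have "\<dots> = sc ((\<Sum>k<d. ?u ^ k) / of_nat d) * X"
    by (simp add: sum_divide_distrib sc_sum sum_distrib_right)
  also have "(\<Sum>k<d. ?u ^ k) = (if ?u = 1 then of_nat d else 0)"
    by (rule sum_root_of_unity) (simp only: power_divide z_power_order div_by_1)
  also have "?u = 1 \<longleftrightarrow> l = m"
  proof -
    have "?u = 1 \<longleftrightarrow> z ^ (m * q) = z ^ (l * q)" using z_nonzero by simp
    also have "\<dots> \<longleftrightarrow> [m = l] (mod d)"
      unfolding z_power_eq using cong_mult_rcancel_nat[of q d m l] coprime_q_d by simp
    also have "\<dots> \<longleftrightarrow> l = m" using lm by (auto simp: cong_def)
    finally show ?thesis .
  qed
  finally show ?thesis using d_unit by auto
qed

lemma E_E: "l < d \<Longrightarrow> m < d \<Longrightarrow> E l * E m = (if l = m then E l else 0)"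
  using E_eigen[of l m "E m"] e_E hq_E by simp

text \<open>After exchanging the two sums, orthogonality of characters leaves only the term
  \<open>k = 0\<close>.\<close>

lemma sum_E: "(\<Sum>l<d. E l) = e"
proof -
  have "(\<Sum>l<d. E l) = (\<Sum>k<d. sc ((\<Sum>l<d. (inverse (z ^ (q * k))) ^ l) / of_nat d) * (h ^ (q * k) * e))"
    unfolding E_def
  proof (subst sum.swap, rule sum.cong[OF refl])
    fix k
    have "inverse (z ^ (l * q)) ^ k = inverse (z ^ (q * k)) ^ l" for l
      by (simp add: power_inverse ac_simps flip: power_mult)
    then show "(\<Sum>l<d. sc (inverse (z ^ (l * q)) ^ k / of_nat d) * (h ^ (q * k) * e)) =
        sc ((\<Sum>l<d. inverse (z ^ (q * k)) ^ l) / of_nat d) * (h ^ (q * k) * e)"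
      by (simp add: sum_divide_distrib sc_sum sum_distrib_right)
  qed
  also have "\<dots> = (\<Sum>k<d. if k = 0 then e else 0)"
  proof (rule sum.cong[OF refl])
    fix k assume k: "k \<in> {..<d}"
    have "(\<Sum>l<d. (inverse (z ^ (q * k))) ^ l) = (if inverse (z ^ (q * k)) = 1 then of_nat d else 0)"
      by (rule sum_root_of_unity) (simp only: power_inverse z_power_order inverse_1)
    also have "inverse (z ^ (q * k)) = 1 \<longleftrightarrow> z ^ (q * k) = z ^ (q * 0)" by simp
    also have "\<dots> \<longleftrightarrow> [k = 0] (mod d)"
      unfolding z_power_eq using cong_mult_lcancel_nat[of q d k 0] coprime_q_d by simp
    also have "\<dots> \<longleftrightarrow> k = 0" using k by (auto simp: cong_def)
    finally show "sc ((\<Sum>l<d. (inverse (z ^ (q * k))) ^ l) / of_nat d) * (h ^ (q * k) * e) = (if k = 0 then e else 0)"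
      using d_unit by simp
  qed
  finally show ?thesis using d_pos by simp
qed

text \<open>As \<open>x * q + y * d = 1\<close> modulo \<open>q * d\<close>, the generator is
  \<open>h ^ (q * x)\<close> times \<open>w ^ y\<close>, and the first factor is the scalar
  \<open>z ^ l\<close> on the component.\<close>

lemma h_E: "h ^ n * E l = sc (z ^ (l * n)) * (w ^ (y * n) * E l)"
proof -
  have *: "h * E l = sc (z ^ l) * (w ^ y * E l)"
  proof -
    have "h * E l = h ^ 1 * e * E l" by (simp add: mult.assoc e_E)
    also have "h ^ 1 * e = h ^ (y * d + q * x) * e"
      by (rule h_cong) (use cong_qd in \<open>simp add: cong_sym_eq ac_simps\<close>)
    also have "\<dots> * E l = w ^ y * (h ^ (q * x) * E l)"
      by (simp add: mult.assoc e_E power_add w_def mult.commute[of y d] power_mult)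
    also have "\<dots> = sc (z ^ (l * q * x)) * (w ^ y * E l)"
      by (simp add: hqk_E sc_left_comm)
    also have "z ^ (l * q * x) = z ^ (l * 1)"
      unfolding z_power_eq using cong_scalar_left[OF x_inv, of l] by (simp only: ac_simps)
    finally show ?thesis by simp
  qed
  show ?thesis
  proof (induction n)
    case (Suc n)
    have "h ^ Suc n * E l = h ^ n * (h * E l)" by (simp add: power_commutes flip: mult.assoc)
    also have "\<dots> = sc (z ^ l) * (w ^ y * (h ^ n * E l))"
    proof -
      have "h ^ n * w ^ y = w ^ y * h ^ n" by (simp add: w_def add.commute flip: power_mult power_add)
      then have "h ^ n * (w ^ y * E l) = w ^ y * (h ^ n * E l)" by (metis mult.assoc)
      then show ?thesis by (simp add: * sc_left_comm[of "h ^ n"])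
    qed
    also have "\<dots> = sc (z ^ l) * sc (z ^ (l * n)) * (w ^ y * (w ^ (y * n) * E l))"
      using Suc sc_left_comm[of "w ^ y" "z ^ (l * n)"] by (simp add: mult.assoc)
    finally show ?case by (simp add: power_add mult.assoc flip: sc_mult)
  qed simp
qed

lemma w_order: "w ^ q = e" using h_order by (simp add: w_def mult.commute flip: power_mult)

lemma w_e: "w * e = w" "e * w = w"
proof -
  obtain d' where d: "d = Suc d'" using d_pos gr0_conv_Suc by blast
  have w: "w = h ^ Suc d'" by (simp only: w_def d[symmetric])
  show "w * e = w" by (metis w power_Suc2 mult.assoc he)
  show "e * w = w" by (metis w power_Suc mult.assoc eh)
qed

lemma w_comm_e: "w ^ n * e = e * w ^ n"
  by (rule power_intertwine) (simp add: w_e)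

lemma w_E_comm: "w ^ n * E l = E l * w ^ n"
  by (simp add: w_def h_E_comm flip: power_mult)

lemma w_cong: "[m = n] (mod q) \<Longrightarrow> w ^ m * e = w ^ n * e"
proof -
  assume c: "[m = n] (mod q)"
  have "[d * m = d * n] (mod q * d)" using c by (simp add: cong_def mult_mod_right[symmetric] mult.commute[of q d])
  from h_cong[OF this] show ?thesis by (simp add: w_def power_mult)
qed

lemma w_cong_E: "[m = n] (mod q) \<Longrightarrow> w ^ m * E l = w ^ n * E l"
proof -
  assume "[m = n] (mod q)"
  then have "w ^ m * e * E l = w ^ n * e * E l" by (simp only: w_cong)
  then show ?thesis by (simp add: mult.assoc e_E)
qed

end

section \<open>Existence of primitive roots of unity and their compatible choice\<close>

section \<open>Roots of unity\<close>

lemma power_gcd_eq_1: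
  fixes v :: "'k::field"
  assumes "v ^ m = 1" "v ^ n = 1"
  shows "v ^ gcd m n = 1"
proof (cases "m = 0")
  case False
  obtain x y where "m * x = n * y + gcd m n" using bezout_nat[OF False] by blast
  then have "(v ^ m) ^ x = (v ^ n) ^ y * v ^ gcd m n" by (simp flip: power_mult power_add)
  with assms show ?thesis by simp
qed (use assms in simp)

lemma primitive_root_prime_power:
  fixes v :: "'k::field"
  assumes "prime r" "v ^ r ^ Suc a = 1" "v ^ r ^ a \<noteq> 1"
  shows "primitive_root (r ^ Suc a) v"
  unfolding primitive_root_def
proof (intro allI iffI)
  fix k assume "v ^ k = 1"
  with assms(2) have g: "v ^ gcd (r ^ Suc a) k = 1" by (intro power_gcd_eq_1)
  have "gcd (r ^ Suc a) k dvd r ^ Suc a" by simp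
  then obtain b where b: "b \<le> Suc a" "gcd (r ^ Suc a) k = r ^ b"
    using divides_primepow_nat[OF assms(1)] by metis
  have "b = Suc a"
  proof (rule ccontr)
    assume "b \<noteq> Suc a"
    then have "r ^ b dvd r ^ a" using b by (intro le_imp_power_dvd) simp
    then obtain c where "r ^ a = r ^ b * c" by (rule dvdE)
    then show False using g b assms(3) by (simp add: power_mult)
  qed
  then show "r ^ Suc a dvd k" using b by (metis gcd_dvd2)
next
  fix k assume "r ^ Suc a dvd k"
  then obtain c where "k = r ^ Suc a * c" by (rule dvdE)
  then show "v ^ k = 1" using assms(2) by (simp only: power_mult power_one)
qed

lemma primitive_root_mult:
  assumes u: "primitive_root m u" and v: "primitive_root n v" and mn: "coprime m n"
  shows "primitive_root (m * n) (u * v)"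
  unfolding primitive_root_def
proof (intro allI iffI)
  fix k assume k: "(u * v) ^ k = 1"
  have "u ^ m = 1" "v ^ n = 1" using u v by (simp_all add: primitive_root_def)
  then have u1: "(u ^ m) ^ k = 1" and v1: "(v ^ n) ^ k = 1" by simp_all
  have "(u * v) ^ (k * n) = 1" "(u * v) ^ (k * m) = 1" using k by (simp_all add: power_mult)
  then have "u ^ (k * n) = 1" "v ^ (k * m) = 1"
    using u1 v1 by (simp_all add: power_mult_distrib mult.commute[of k] power_mult)
  then have "m dvd k * n" "n dvd k * m" using u v by (simp_all add: primitive_root_def)
  then have "m dvd k" "n dvd k" using mn by (simp_all add: coprime_dvd_mult_left_iff coprime_commute)
  then show "m * n dvd k" using mn by (simp add: divides_mult)
next
  fix k assume "m * n dvd k"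
  then have "m dvd k" "n dvd k" by (auto intro: dvd_mult_left dvd_mult_right)
  then have "u ^ k = 1" "v ^ k = 1" using u v by (simp_all add: primitive_root_def)
  then show "(u * v) ^ k = 1" by (simp add: power_mult_distrib)
qed

lemma card_roots_of_unity_le:
  assumes "n > 0"
  shows "finite {a :: 'k::field. a ^ n = 1}" "card {a :: 'k::field. a ^ n = 1} \<le> n"
proof -
  let ?f = "Polynomial.monom 1 n - 1 :: 'k poly"
  have "coeff ?f n = 1" using assms by simp
  then have nz: "?f \<noteq> 0" by (metis coeff_0 zero_neq_one)
  have *: "{a :: 'k. a ^ n = 1} = {a. poly ?f a = 0}" by (simp add: poly_monom)
  have "degree ?f \<le> n" by (intro degree_diff_le degree_monom_le) simp
  then show "finite {a :: 'k. a ^ n = 1}" "card {a :: 'k. a ^ n = 1} \<le> n"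
    unfolding * using poly_roots_finite[OF nz] card_poly_roots_bound[OF nz] by simp_all
qed

text \<open>A double root would also be a root of the derivative d t^(d-1), which is nonzero at
  \<open>a\<close>.\<close>

lemma order_root_of_unity:
  assumes "of_nat d \<noteq> (0 :: 'k::field)" "a ^ d = (1 :: 'k)"
  shows "order a (Polynomial.monom 1 d - 1) \<le> 1"
proof (rule ccontr)
  let ?f = "Polynomial.monom 1 d - 1 :: 'k poly"
  assume "\<not> order a ?f \<le> 1"
  then have "?f = 0 \<or> 2 \<le> order a ?f" by linarith
  then have "[:- a, 1:] ^ 2 dvd ?f" by (simp only: order_divides)
  then obtain g where g: "?f = [:- a, 1:] ^ 2 * g" by (rule dvdE)
  obtain l where "l = [:- a, 1:]" by simp
  moreover from this g have "?f = l * (l * g)" by (simp only: power2_eq_square mult.assoc)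
  moreover have "poly l a = 0" unfolding \<open>l = [:- a, 1:]\<close> by simp
  ultimately have "?f = l * (l * g)" "poly l a = 0" by blast+
  then have "poly (pderiv ?f) a = 0" by (simp add: pderiv_mult)
  then have "of_nat d * a ^ (d - 1) = 0"
    by (simp add: pderiv_diff pderiv_monom poly_monom)
  moreover have "a \<noteq> 0" using assms by (cases d) auto
  ultimately show False using assms(1) by simp
qed

text \<open>By Frobenius, t^(q d) - 1 is the \<open>q\<close>-th power of t^d - 1. It is a product
  of \<open>q * d\<close> linear factors, and no root occurs more than \<open>q\<close> times; so
  there are at least \<open>d\<close> roots.\<close>

lemma card_roots_of_unity:
  assumes P: "char_exponent TYPE('k::field) P" and q: "q = P ^ k" and d: "of_nat d \<noteq> (0 :: 'k)"
    and spl: "splits (Polynomial.monom 1 (q * d) - 1 :: 'k poly)"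
  shows "d \<le> card {a :: 'k. a ^ d = 1}"
proof -
  let ?f = "Polynomial.monom 1 (q * d) - 1 :: 'k poly" and ?g = "Polynomial.monom 1 d - 1 :: 'k poly"
  have "P > 0" using P by (auto simp: char_exponent_def prime_gt_0_nat)
  then have q0: "q > 0" by (simp add: q)
  have d0: "d > 0" using d by (cases d) auto
  have fg: "?f = ?g ^ q"
  proof -
    have "(?g + 1) ^ q = ?g ^ q + 1 ^ q"
      unfolding q by (rule char_exponent_power_add[OF P]) simp
    then show ?thesis by (simp add: monom_power mult.commute)
  qed
  have "coeff ?f (q * d) = 1" using q0 d0 by simp
  then have f0: "?f \<noteq> 0" by (metis coeff_0 zero_neq_one)
  have "degree ?f = q * d" 
  proof (rule antisym)
    show "degree ?f \<le> q * d" by (intro degree_diff_le degree_monom_le) simp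
    show "q * d \<le> degree ?f" by (rule le_degree) (use \<open>coeff ?f (q * d) = 1\<close> in simp)
  qed
  from spl obtain c A where A: "?f = Polynomial.smult c (\<Prod>a\<in>#A. [:- a, 1:])" by (auto simp: splits_def)
  with f0 have c: "c \<noteq> 0" by auto
  have "(\<Prod>a\<in>#A. [:- a, 1:]) \<noteq> (0 :: 'k poly)" for A :: "'k multiset"
    by (auto simp: prod_mset_zero_iff)
  then have "degree (\<Prod>a\<in>#A. [:- a, 1:]) = size A"
    by (induction A) (simp_all add: degree_mult_eq del: mult_pCons_left mult_pCons_right)
  with A c \<open>degree ?f = q * d\<close> have "size A = q * d" by (metis degree_smult_eq)
  have root: "a ^ d = 1" and mult: "count A a \<le> q" if "a \<in># A" for a
  proof -
    from that obtain B where B: "A = add_mset a B" by (metis insert_DiffM)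
    have "poly ?f a = 0" unfolding A B by simp
    then have "poly ?g a = 0" unfolding fg by (simp add: poly_power)
    then show r: "a ^ d = 1" by (simp add: poly_monom)
    have "A = replicate_mset (count A a) a + filter_mset (\<lambda>x. x \<noteq> a) A"
      by (rule multiset_eqI) simp
    then have "(\<Prod>a\<in>#A. [:- a, 1:]) = [:- a, 1:] ^ count A a * (\<Prod>a\<in>#filter_mset (\<lambda>x. x \<noteq> a) A. [:- a, 1:])"
      by (metis (no_types, lifting) image_mset_union image_replicate_mset prod_mset.union prod_mset_replicate_mset)
    then have "[:- a, 1:] ^ count A a dvd ?f" unfolding A by (simp add: dvd_smult)
    then have "count A a \<le> order a ?f" using f0 order_divides by blast
    also have "order a ?f = q * order a ?g" 
    proof -
      have "?g \<noteq> 0" using f0 q0 unfolding fg by auto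
      then show ?thesis unfolding fg by (induction q) (simp_all add: order_mult)
    qed
    also have "\<dots> \<le> q * 1" using order_root_of_unity[OF d r] by (intro mult_left_mono) auto
    finally show "count A a \<le> q" by simp
  qed
  have "q * d = (\<Sum>a\<in>set_mset A. count A a)" using \<open>size A = q * d\<close> by (simp add: size_multiset_overloaded_eq)
  also have "\<dots> \<le> (\<Sum>a\<in>set_mset A. q)" by (rule sum_mono) (rule mult)
  also have "\<dots> = q * card (set_mset A)" by simp
  also have "card (set_mset A) \<le> card {a :: 'k. a ^ d = 1}"
    by (rule card_mono[OF card_roots_of_unity_le(1)[OF d0]]) (auto simp: root)
  finally show ?thesis using q0 by simp
qed

text \<open>Put \<open>?m = r ^ a * c\<close>, which is \<open>d\<close> divided by
  \<open>r\<close>. Fewer than \<open>d\<close> elements satisfy \<open>u ^ ?m = 1\<close>, and any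
  other \<open>d\<close>-th root of unity has a power of exact order
  \<open>r ^ Suc a\<close>.\<close>

lemma exists_prime_power_root:
  assumes "d \<le> card {a :: 'k::field. a ^ d = 1}" "prime r" "r ^ Suc a dvd d" "d > 0"
  shows "\<exists>v :: 'k. primitive_root (r ^ Suc a) v"
proof -
  obtain c where c: "d = r ^ Suc a * c" using assms(3) by (rule dvdE)
  have r: "r > 1" using assms(2) by (rule prime_gt_1_nat)
  let ?m = "r ^ a * c"
  have m: "?m > 0" "?m < d" using c assms(4) r by auto
  have "\<not> {u :: 'k. u ^ d = 1} \<subseteq> {u. u ^ ?m = 1}"
  proof
    assume "{u :: 'k. u ^ d = 1} \<subseteq> {u. u ^ ?m = 1}"
    then have "card {u :: 'k. u ^ d = 1} \<le> ?m"
      using card_roots_of_unity_le[OF m(1), where 'k = 'k] by (meson card_mono order_trans)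
    with assms(1) m(2) show False by simp
  qed
  then obtain u :: 'k where u: "u ^ d = 1" "u ^ ?m \<noteq> 1" by blast
  have "primitive_root (r ^ Suc a) (u ^ c)"
    by (rule primitive_root_prime_power[OF assms(2)])
      (use u c in \<open>simp_all add: mult.commute flip: power_mult\<close>)
  then show ?thesis by blast
qed

lemma exists_primitive_root:
  assumes "N > 0" "\<And>r a. prime r \<Longrightarrow> r ^ Suc a dvd N \<Longrightarrow> \<exists>v :: 'k::field. primitive_root (r ^ Suc a) v"
  shows "\<exists>v :: 'k. primitive_root N v"
  using assms
proof (induction N rule: less_induct)
  case (less N)
  show ?case
  proof (cases "N = 1")
    case True
    then show ?thesis by (intro exI[of _ 1]) (simp add: primitive_root_def)
  next
    case False
    then obtain r where r: "prime r" "r dvd N" using prime_factor_nat by blast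
    obtain M where M: "N = r ^ multiplicity r N * M" "\<not> r dvd M"
      using multiplicity_decompose'[of N r] less.prems(1) r(1) by (metis not_prime_unit less_irrefl)
    have "multiplicity r N > 0" using r less.prems(1) by (simp add: prime_multiplicity_gt_zero_iff)
    then obtain a where a: "multiplicity r N = Suc a" using gr0_conv_Suc by blast
    have M0: "M > 0" using M less.prems(1) by (cases "M = 0") auto
    have "r ^ Suc a > 1" using prime_gt_1_nat[OF r(1)] by (intro one_less_power) auto
    then have "M < N" using M(1) M0 a by simp
    moreover have "\<exists>v :: 'k. primitive_root (r' ^ Suc b) v" if "prime r'" "r' ^ Suc b dvd M" for r' b
      using less.prems(2)[OF that(1)] that(2) M(1) by (metis dvd_mult)
    ultimately obtain v :: 'k where v: "primitive_root M v" using less.IH M0 by blast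
    have "r ^ Suc a dvd N" using M(1) a by (metis dvd_triv_left)
    then obtain u :: 'k where u: "primitive_root (r ^ Suc a) u" using less.prems(2)[OF r(1)] by blast
    have "coprime (r ^ Suc a) M" using prime_imp_coprime[OF r(1) M(2)] by simp
    from primitive_root_mult[OF u v this] show ?thesis using M(1) a by (metis)
  qed
qed

lemma prime_power_dvd_Lcm:
  assumes "finite S" "prime (r :: nat)" "r ^ Suc a dvd Lcm S" "0 \<notin> S"
  shows "\<exists>s\<in>S. r ^ Suc a dvd s"
  using assms
proof (induction S rule: finite_induct)
  case empty
  then show ?case by simp
next
  case (insert x S)
  have nz: "x \<noteq> 0" "Lcm S \<noteq> 0" using insert by (auto simp: Lcm_0_iff)
  have "multiplicity r (lcm x (Lcm S)) = max (multiplicity r x) (multiplicity r (Lcm S))"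
    using nz insert.prems(1) by (intro multiplicity_lcm) auto
  moreover have "Suc a \<le> multiplicity r (lcm x (Lcm S))"
    using insert.prems nz by (intro multiplicity_geI) (auto simp: lcm_eq_0_iff)
  ultimately have "Suc a \<le> multiplicity r x \<or> Suc a \<le> multiplicity r (Lcm S)" by auto
  then show ?case using insert by (meson insertCI multiplicity_dvd')
qed

text \<open>All \<open>z i\<close> are powers of one primitive root \<open>v\<close>, whose order
  \<open>N\<close> is the least common multiple of the \<open>d i\<close>. It exists because a prime
  power dividing \<open>N\<close> already divides some \<open>d i\<close>. Both sides of the
  compatibility condition are then \<open>v ^ (N div gcd (d i) (d j))\<close>.\<close>

lemma compatible_primitive_roots:
  fixes d :: "'v \<Rightarrow> nat"
  assumes "finite I" "\<And>i. i \<in> I \<Longrightarrow> d i > 0"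
    "\<And>i. i \<in> I \<Longrightarrow> d i \<le> card {a :: 'k::field. a ^ d i = 1}"
  obtains z :: "'v \<Rightarrow> 'k::field" where "\<And>i. i \<in> I \<Longrightarrow> primitive_root (d i) (z i)"
    "\<And>i j. i \<in> I \<Longrightarrow> j \<in> I \<Longrightarrow> z i ^ (d i div gcd (d i) (d j)) = z j ^ (d j div gcd (d i) (d j))"
proof -
  define N where "N = Lcm (d ` I)"
  have no0: "0 \<notin> d ` I" using assms(2) by force
  then have N0: "N > 0" unfolding N_def using assms(1) by (simp add: Lcm_0_iff flip: neq0_conv)
  obtain v :: 'k where v: "primitive_root N v"
  proof -
    have "\<exists>v :: 'k. primitive_root (r ^ Suc a) v" if r: "prime r" and rN: "r ^ Suc a dvd N" for r a
    proof -
      obtain i where "i \<in> I" "r ^ Suc a dvd d i"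
        using prime_power_dvd_Lcm[OF _ r, of "d ` I" a] rN assms(1) no0 by (auto simp: N_def)
      then show ?thesis using exists_prime_power_root[OF assms(3) r] assms(2) by blast
    qed
    then show thesis using exists_primitive_root[OF N0] that by blast
  qed
  have dN: "d i dvd N" if "i \<in> I" for i using that by (simp add: N_def)
  define z where "z i = v ^ (N div d i)" for i
  have "primitive_root (d i) (z i)" if i: "i \<in> I" for i
  proof -
    obtain c where c: "N = d i * c" using dN[OF i] by (rule dvdE)
    then have "N div d i = c" "c > 0" using assms(2)[OF i] N0 by auto
    then show ?thesis
      using v c by (simp add: primitive_root_def z_def mult.commute flip: power_mult)
  qed
  moreover have "z i ^ (d i div g) = v ^ (N div g)" if "i \<in> I" "g dvd d i" for i g
  proof -
    have "N div d i * (d i div g) = N div g"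
      using dN[OF that(1)] that(2) by (simp add: div_mult_swap)
    then show ?thesis by (simp add: z_def flip: power_mult)
  qed
  ultimately show thesis by (intro that[of z]) simp_all
qed


section \<open>Sums of conjugates by powers of the generator\<close>

section \<open>Conjugation sums\<close>

text \<open>Modulo \<open>a\<close> the value determines \<open>u\<close>, since \<open>d\<close> is
  invertible there, and modulo \<open>b\<close> it determines \<open>v\<close>. Surjectivity follows
  by counting.\<close>

lemma chinese_remainder_bij:
  fixes q d :: nat
  assumes "coprime q d" "a dvd q" "b dvd d" "a > 0" "b > 0"
  shows "bij_betw (\<lambda>(u, v). (d * u + q * v) mod (a * b)) ({..<a} \<times> {..<b}) {..<a * b}"
proof -
  let ?f = "\<lambda>(u, v). (d * u + q * v) mod (a * b)"
  have ca: "coprime d a" and cb: "coprime q b"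
    using assms coprime_divisors by (metis coprime_commute dvd_refl)+
  have inj: "inj_on ?f ({..<a} \<times> {..<b})"
  proof (rule inj_onI)
    fix x x' assume x: "x \<in> {..<a} \<times> {..<b}" "x' \<in> {..<a} \<times> {..<b}" and eq: "?f x = ?f x'"
    obtain u v u' v' where xx: "x = (u, v)" "x' = (u', v')" by (cases x; cases x') auto
    have uv: "u < a" "v < b" "u' < a" "v' < b" using x xx by auto
    from eq have "(d * u + q * v) mod (a * b) = (d * u' + q * v') mod (a * b)" by (simp add: xx)
    then have c: "[d * u + q * v = d * u' + q * v'] (mod a * b)" by (simp add: cong_def)
    have a0: "[q * n = 0] (mod a)" and b0: "[d * n = 0] (mod b)" for n
      using assms(2,3) by (simp_all add: cong_0_iff)
    have "[d * u + 0 = d * u' + 0] (mod a)"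
      using cong_modulus_mult_nat[OF c] cong_add[OF cong_refl a0] by (meson cong_trans cong_sym)
    then have "[u = u'] (mod a)" using ca by (simp add: cong_mult_lcancel_nat)
    have "[0 + q * v = 0 + q * v'] (mod b)"
      using cong_modulus_mult_nat[of _ _ b a] c cong_add[OF b0 cong_refl]
      by (metis cong_trans cong_sym mult.commute)
    then have "[v = v'] (mod b)" using cb by (simp add: cong_mult_lcancel_nat)
    with \<open>[u = u'] (mod a)\<close> uv show "x = x'" by (simp add: cong_def xx)
  qed
  have "?f ` ({..<a} \<times> {..<b}) = {..<a * b}"
    by (rule card_subset_eq) (use assms in \<open>auto simp: card_image[OF inj]\<close>)
  with inj show ?thesis by (simp add: bij_betw_def)
qed

context scalars
begin

lemma sc_cancel:
  assumes "sc a * Y = sc b * Y" "a \<noteq> b"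
  shows "Y = 0"
proof -
  have "sc (a - b) * Y = 0" using assms(1) by (simp add: sc_diff left_diff_distrib)
  then have "sc (inverse (a - b) * (a - b)) * Y = 0" by (simp add: sc_mult mult.assoc)
  then show ?thesis using assms(2) by simp
qed

lemma sc_cancel_0: "sc a * Y = 0 \<Longrightarrow> a \<noteq> 0 \<Longrightarrow> Y = 0"
  using sc_cancel[of a Y 0] by simp

end

context cyclic_action
begin

text \<open>The inverse of \<open>h\<close> up to the unit \<open>e\<close>, as a power with a
  nonnegative exponent.\<close>

definition hinv :: 't where "hinv = h ^ (q * d - 1)"

lemma hinv_power: "hinv ^ n = h ^ ((q * d - 1) * n)"
  by (simp only: hinv_def power_mult)

lemma qd_pred: "(q * d - 1) * n + n = q * d * n"
  using q_pos d_pos by (cases "q * d") auto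

lemma e_h_cong: "[m = n] (mod q * d) \<Longrightarrow> e * h ^ m = e * h ^ n"
  using h_cong[of m n] by (simp only: h_comm_e)

text \<open>Conjugation by \<open>h ^ F\<close> fixes \<open>X\<close>, so that \<open>f\<close>
  matters only modulo \<open>F\<close>. This permits the reindexing in
  \<open>conj_sum\<close>.\<close>

lemma conj_period:
  assumes "X * e = X" "h ^ F * X = X * h ^ F"
  shows "h ^ f * (X * hinv ^ f) = h ^ (f mod F) * (X * hinv ^ (f mod F))"
proof -
  have step: "h ^ (f + F) * (X * hinv ^ (f + F)) = h ^ f * (X * hinv ^ f)" for f
  proof -
    have "h ^ F * hinv ^ F = h ^ (q * d * F)"
      using qd_pred[of F] by (simp only: hinv_power power_add[symmetric] add.commute)
    moreover have "e * h ^ (q * d * F) = e"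
      using e_h_cong[of "q * d * F" 0] by (simp add: cong_0_iff)
    ultimately have k: "X * (h ^ F * hinv ^ F) = X"
      by (metis assms(1) mult.assoc)
    have "hinv ^ (f + F) = hinv ^ F * hinv ^ f" by (metis add.commute power_add)
    then have "h ^ (f + F) * (X * hinv ^ (f + F)) = h ^ f * ((h ^ F * X) * hinv ^ F) * hinv ^ f"
      by (simp only: power_add mult.assoc)
    also have "\<dots> = h ^ f * (X * (h ^ F * hinv ^ F)) * hinv ^ f"
      unfolding assms(2) by (simp only: mult.assoc)
    finally show ?thesis unfolding k by (simp only: mult.assoc)
  qed
  have "h ^ (f + n * F) * (X * hinv ^ (f + n * F)) = h ^ f * (X * hinv ^ f)" for f n
  proof (induction n)
    case (Suc n)
    have "f + Suc n * F = f + n * F + F" by simp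
    then show ?case using step[of "f + n * F"] Suc by (simp only:)
  qed simp
  from this[of "f mod F" "f div F"] show ?thesis by (simp add: mult.commute)
qed

lemma X_h_inverse:
  assumes "X * e = X" "f \<le> q * d"
  shows "X * h ^ (q * d - f) = X * hinv ^ f"
proof -
  have "[q * d - f + f = (q * d - 1) * f + f] (mod q * d)"
    unfolding qd_pred using assms(2) by (simp add: cong_def)
  then have "[q * d - f = (q * d - 1) * f] (mod q * d)" by (simp only: cong_add_rcancel_nat)
  then have "e * h ^ (q * d - f) = e * hinv ^ f" unfolding hinv_power by (rule e_h_cong)
  then show ?thesis by (metis assms(1) mult.assoc)
qed

text \<open>Write \<open>f\<close> as \<open>d * u + q * v\<close> modulo \<open>F = a * b\<close>.
  Conjugation by \<open>h ^ (q * v)\<close> is multiplication by a scalar on each block, and the sum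
  of these scalars over \<open>v < b\<close> is \<open>b\<close> on a diagonal block. The sum over
  \<open>u < a\<close> of conjugates by \<open>w ^ u\<close> remains.\<close>

lemma conj_sum:
  assumes a: "a dvd q" and b: "b dvd d" and F: "F = a * b"
    and X: "X * e = X" "h ^ F * X = X * h ^ F"
    and l: "l < d" "l' < d"
  shows "E l * (\<Sum>f<F. h ^ f * (X * h ^ (q * d - f))) * E l' =
    (if l = l' then sc (of_nat b) * (\<Sum>u<a. w ^ u * (E l * (X * E l') * w ^ (q - u))) else 0)"
proof -
  let ?Y = "E l * (X * E l')"
  have ab: "a > 0" "b > 0" using a b q_pos d_pos by (auto dest: dvd_pos_nat)
  have Fqd: "F \<le> q * d" unfolding F using a b q_pos d_pos by (intro mult_le_mono dvd_imp_le)
  define G where "G f = h ^ f * (X * hinv ^ f)" for f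
  \<comment> \<open>The scalar by which conjugation by \<open>h ^ q\<close> acts on the block: the
    second factor is the inverse of \<open>z ^ (l' * q)\<close>, written with the exponent
    \<open>q * d - 1\<close>.\<close>
  let ?\<zeta> = "z ^ (l * q) * z ^ (l' * q * (q * d - 1))"
  have "(\<Sum>f<F. h ^ f * (X * h ^ (q * d - f))) = (\<Sum>f<F. G f)"
    unfolding G_def using Fqd by (intro sum.cong refl) (simp add: X_h_inverse[OF X(1)])
  also have "\<dots> = (\<Sum>(u, v)\<in>{..<a} \<times> {..<b}. G ((d * u + q * v) mod F))"
    using sum.reindex_bij_betw[OF chinese_remainder_bij[OF coprime_q_d a b ab], of G]
    by (simp add: F case_prod_unfold)
  also have "\<dots> = (\<Sum>(u, v)\<in>{..<a} \<times> {..<b}. G (d * u + q * v))"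
    unfolding G_def using conj_period[OF X, symmetric] by (intro sum.cong refl) auto
  finally have 1: "E l * (\<Sum>f<F. h ^ f * (X * h ^ (q * d - f))) * E l' =
      (\<Sum>(u, v)\<in>{..<a} \<times> {..<b}. E l * G (d * u + q * v) * E l')"
    by (simp add: sum_distrib_left sum_distrib_right case_prod_unfold)
  have 2: "E l * G (d * u + q * v) * E l' = sc (?\<zeta> ^ v) * (w ^ u * (?Y * w ^ (q - u)))" if u: "u < a" for u v
  proof -
    have left: "E l * h ^ (d * u + q * v) = sc (z ^ (l * q * v)) * (w ^ u * E l)"
    proof -
      have "E l * h ^ (d * u + q * v) = h ^ (d * u) * (h ^ (q * v) * E l)"
        unfolding h_E_comm[symmetric] by (simp only: power_add mult.assoc)
      then show ?thesis
        unfolding hqk_E sc_left_comm[of "h ^ (d * u)"] by (simp only: w_def power_mult)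
    qed
    have right: "hinv ^ (d * u + q * v) * E l' = sc (z ^ (l' * q * (q * d - 1) * v)) * (E l' * w ^ (q - u))"
    proof -
      have "hinv ^ (d * u + q * v) = h ^ (d * ((q * d - 1) * u)) * h ^ (q * ((q * d - 1) * v))"
        unfolding hinv_power power_add[symmetric] by (rule arg_cong[of _ _ "power h"]) (simp add: algebra_simps)
      then have "hinv ^ (d * u + q * v) * E l' = w ^ ((q * d - 1) * u) * (sc (z ^ (l' * q * ((q * d - 1) * v))) * E l')"
        by (simp only: mult.assoc[of _ _ "E l'"] hqk_E w_def power_mult[of h d])
      also have "\<dots> = sc (z ^ (l' * q * ((q * d - 1) * v))) * (w ^ ((q * d - 1) * u) * E l')"
        by (rule sc_left_comm)
      also have "w ^ ((q * d - 1) * u) * E l' = w ^ (q - u) * E l'"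
      proof (rule w_cong_E)
        have "u \<le> q" using u a q_pos dvd_imp_le by (meson le_trans less_imp_le)
        have "(q * d - 1) * u + u = q * d * u" by (rule qd_pred)
        moreover have "q - u + u = q" using \<open>u \<le> q\<close> by simp
        ultimately have "[(q * d - 1) * u + u = q - u + u] (mod q)" by (simp add: cong_def)
        then show "[(q * d - 1) * u = q - u] (mod q)" by (simp only: cong_add_rcancel_nat)
      qed
      finally show ?thesis by (simp add: w_E_comm mult.assoc)
    qed
    have "E l * G (d * u + q * v) * E l' = (E l * h ^ (d * u + q * v)) * (X * (hinv ^ (d * u + q * v) * E l'))"
      by (simp add: G_def mult.assoc)
    also have "\<dots> = sc (z ^ (l * q * v)) * (sc (z ^ (l' * q * (q * d - 1) * v)) * (w ^ u * (?Y * w ^ (q - u))))"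
      unfolding left right by (simp add: sc_left_comm[of X] sc_left_comm[of "E l"] sc_left_comm[of "w ^ u"] mult.assoc)
    also have "\<dots> = sc (?\<zeta> ^ v) * (w ^ u * (?Y * w ^ (q - u)))"
      by (simp add: sc_mult power_mult_distrib mult.assoc flip: power_mult)
    finally show ?thesis .
  qed
  have 3: "E l * (\<Sum>f<F. h ^ f * (X * h ^ (q * d - f))) * E l' =
      sc (\<Sum>v<b. ?\<zeta> ^ v) * (\<Sum>u<a. w ^ u * (?Y * w ^ (q - u)))"
    unfolding 1 sum.cartesian_product[symmetric]
    by (simp add: 2 sc_sum sum_distrib_left sum_distrib_right)
  have z1: "z ^ (l' * q * n) * z ^ (l' * q * (q * d - 1) * n) = 1" for n
  proof -
    have "l' * q * n + l' * q * (q * d - 1) * n = l' * n * q * ((q * d - 1) * 1 + 1)"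
      by (simp add: algebra_simps)
    also have "\<dots> = d * (l' * n * q * q)" unfolding qd_pred by simp
    finally show ?thesis unfolding power_add[symmetric] by (simp only: power_mult[of z d] z_order power_one)
  qed
  show ?thesis
  proof (cases "l = l'")
    case True
    then have "?\<zeta> = 1" using z1[of 1] by simp
    then have "(\<Sum>v<b. ?\<zeta> ^ v) = of_nat b" by simp
    with 3 True show ?thesis by (simp only: if_True simp_thms)
  next
    case False
    have "sc (\<Sum>v<b. ?\<zeta> ^ v) * (\<Sum>u<a. w ^ u * (?Y * w ^ (q - u))) = 0"
    \<comment> \<open>If the two eigenvalues of \<open>h ^ (q * b)\<close> coincide, then
      \<open>?\<zeta>\<close> is a \<open>b\<close>-th root of unity other than 1 and its powers sum
      to 0. Otherwise the block itself is 0, since \<open>h ^ (q * b)\<close> is a power of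
      \<open>h ^ F\<close> and commutes with \<open>X\<close>.\<close>
    proof (cases "z ^ (l * q * b) = z ^ (l' * q * b)")
      case True
      then have "?\<zeta> ^ b = 1" using z1[of b] by (simp add: power_mult_distrib flip: power_mult)
      moreover have "?\<zeta> \<noteq> 1"
      proof
        assume "?\<zeta> = 1"
        with z1[of 1] have "z ^ (l * q) * z ^ (l' * q * (q * d - 1)) = z ^ (l' * q) * z ^ (l' * q * (q * d - 1))"
          by (simp only: mult_1_right)
        moreover have "z ^ (l' * q * (q * d - 1)) \<noteq> 0" using z_nonzero by simp
        ultimately have "z ^ (l * q) = z ^ (l' * q)" using mult_right_cancel by blast
        then have "[l * q = l' * q] (mod d)" by (simp only: z_power_eq)
        then have "[l = l'] (mod d)" using coprime_q_d by (simp add: cong_mult_rcancel_nat coprime_commute)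
        with l \<open>l \<noteq> l'\<close> show False by (simp add: cong_def)
      qed
      ultimately show ?thesis using sum_root_of_unity[of ?\<zeta> b] by simp
    next
      case False
      obtain c where "q = a * c" using a by (rule dvdE)
      then have c: "q * b = F * c" by (simp add: F)
      have "h ^ (q * b) * X = X * h ^ (q * b)"
        unfolding c power_mult by (rule power_intertwine) (rule X(2))
      then have "E l * (h ^ (q * b) * X * E l') = E l * (X * (h ^ (q * b) * E l'))" by (simp add: mult.assoc)
      moreover have "E l * (h ^ (q * b) * X * E l') = sc (z ^ (l * q * b)) * ?Y"
      proof -
        have "E l * (h ^ (q * b) * X * E l') = (E l * h ^ (q * b)) * (X * E l')" by (simp only: mult.assoc)
        also have "E l * h ^ (q * b) = sc (z ^ (l * q * b)) * E l" unfolding h_E_comm[symmetric] by (rule hqk_E)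
        finally show ?thesis by (simp only: mult.assoc)
      qed
      moreover have "E l * (X * (h ^ (q * b) * E l')) = sc (z ^ (l' * q * b)) * ?Y"
        unfolding hqk_E by (simp only: sc_left_comm)
      ultimately have "sc (z ^ (l * q * b)) * ?Y = sc (z ^ (l' * q * b)) * ?Y" by (simp only:)
      then have "?Y = 0" using False by (rule sc_cancel)
      then show ?thesis by simp
    qed
    with 3 False show ?thesis by (simp only: if_False simp_thms)
  qed
qed

end

section \<open>The two sets of generators, and the substitutions between them\<close>

section \<open>Changing generators\<close>

text \<open>
  The number \<open>q i * d i\<close> is \<open>c\<^sub>i\<close>, with \<open>P\<close>-part \<open>q i\<close>, and \<open>N i j\<close> is \<open>g\<^sub>i\<^sub>j\<close>.  Then \<open>F i j\<close> is \<open>f\<^sub>j\<^sub>i\<close>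
  and \<open>qq i j\<close> is its \<open>P\<close>-part.
\<close>

locale species =
  fixes I :: "'v set" and \<Omega> :: "('v \<times> 'v) set" and N :: "'v \<Rightarrow> 'v \<Rightarrow> nat" and P :: nat
    and r d xinv yinv :: "'v \<Rightarrow> nat" and z :: "'v \<Rightarrow> 'k::field"
  assumes finite_I: "finite I" and \<Omega>_sub: "\<Omega> \<subseteq> I \<times> I" and asym: "(i, j) \<in> \<Omega> \<Longrightarrow> (j, i) \<notin> \<Omega>"
    and N_sym: "(i, j) \<in> \<Omega> \<Longrightarrow> N i j = N j i"
    and P: "char_exponent TYPE('k) P"
    and d_pos: "i \<in> I \<Longrightarrow> d i > 0" and d_unit: "i \<in> I \<Longrightarrow> of_nat (d i) \<noteq> (0 :: 'k)"
    and prim: "i \<in> I \<Longrightarrow> primitive_root (d i) (z i)"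
    and compat: "i \<in> I \<Longrightarrow> j \<in> I \<Longrightarrow>
      z i ^ (d i div gcd (d i) (d j)) = z j ^ (d j div gcd (d i) (d j))"
    and x_inv: "i \<in> I \<Longrightarrow> [xinv i * P ^ r i = 1] (mod d i)"
    and y_inv: "i \<in> I \<Longrightarrow> [yinv i * d i = 1] (mod P ^ r i)"
begin

abbreviation q :: "'v \<Rightarrow> nat" where "q i \<equiv> P ^ r i"

definition qq :: "'v \<Rightarrow> 'v \<Rightarrow> nat" where "qq i j = P ^ (r i - min (r i) (r j))"

definition F :: "'v \<Rightarrow> 'v \<Rightarrow> nat" where "F i j = qq i j * (d i div gcd (d i) (d j))"

abbreviation dbl :: "('v \<times> 'v) set" where "dbl \<equiv> double_orientation \<Omega>"

definition M :: "('v \<times> nat) set" where "M = (SIGMA i:I. {..<d i})"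

text \<open>The double of the orientation \<Omega>', on the index set \<open>M\<close> of
  C'.\<close>

definition Sg :: "(('v \<times> nat) \<times> ('v \<times> nat)) set" where
  "Sg = {((i, l), (j, m)) |i l j m. (i, j) \<in> dbl \<and> l < d i \<and> m < d j \<and>
     [l * q i = m * q j] (mod gcd (d i) (d j))}"

definition sgn :: "'v \<Rightarrow> 'v \<Rightarrow> 'k" where "sgn = gp_sgn \<Omega>"

text \<open>Only reverse arrows are rescaled. The product over an arrow and its reverse is
  \<open>1 / gcd (d i) (d j)\<close>; compared with the scalar \<open>d i / gcd (d i) (d j)\<close>
  of the conjugation sums, it leaves the factor \<open>d i\<close>, which is independent of
  \<open>j\<close>.\<close>

definition \<kappa> :: "'v \<Rightarrow> 'v \<Rightarrow> 'k" where
  "\<kappa> i j = (if (i, j) \<in> \<Omega> then 1 else inverse (of_nat (gcd (d i) (d j))))"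

text \<open>The exponent of the twist of the reverse arrows by \<open>w j\<close>. It is
  \<open>- qq j i\<close> modulo the order of \<open>w j\<close>, and \<open>\<tau>'\<close> undoes
  it. The twist compensates for the factor \<open>w ^ (1 - qq i j)\<close> between sums of
  conjugates and mesh sums.\<close>

definition \<tau> :: "'v \<Rightarrow> 'v \<Rightarrow> nat" where
  "\<tau> i j = (if (i, j) \<in> \<Omega> then 0 else q j - qq j i)"

definition \<tau>' :: "'v \<Rightarrow> 'v \<Rightarrow> nat" where
  "\<tau>' i j = (if (i, j) \<in> \<Omega> then 0 else qq j i)"

lemma P_pos: "P > 0" using P by (auto simp: char_exponent_def prime_gt_0_nat)

lemma q_pos: "q i > 0" using P_pos by simp

lemma qq_min: "qq i j * P ^ min (r i) (r j) = q i"
  by (simp add: qq_def flip: power_add)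

lemma qq_dvd: "qq i j dvd q i" using qq_min by (metis dvd_triv_left)

lemma qq_le: "qq i j \<le> q i" using qq_dvd q_pos dvd_imp_le by blast

lemma qq_pos: "qq i j > 0" using P_pos by (simp add: qq_def)

lemma qq_min': "qq j i * P ^ min (r i) (r j) = q j"
  using qq_min[of j i] by (simp add: min.commute)

lemma dbl_iff: "(i, j) \<in> dbl \<longleftrightarrow> (i, j) \<in> \<Omega> \<or> (j, i) \<in> \<Omega>"
  by (auto simp: double_orientation_def)

lemma dbl_sym: "(i, j) \<in> dbl \<Longrightarrow> (j, i) \<in> dbl" by (auto simp: dbl_iff)

lemma dbl_I: "(i, j) \<in> dbl \<Longrightarrow> i \<in> I \<and> j \<in> I" using \<Omega>_sub by (auto simp: dbl_iff)

lemma dbl_N: "(i, j) \<in> dbl \<Longrightarrow> N i j = N j i" using N_sym by (auto simp: dbl_iff)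

lemma finite_dbl: "finite {j. (j, i) \<in> dbl}"
  by (rule finite_subset[OF _ finite_I]) (auto dest: dbl_I)

lemma Sg_iff: "((i, l), (j, m)) \<in> Sg \<longleftrightarrow>
    (i, j) \<in> dbl \<and> l < d i \<and> m < d j \<and> [l * q i = m * q j] (mod gcd (d i) (d j))"
  by (auto simp: Sg_def)

lemma Sg_sym: "(a, b) \<in> Sg \<Longrightarrow> (b, a) \<in> Sg"
  by (cases a; cases b) (auto simp: Sg_iff dbl_sym gcd.commute cong_sym)

lemma Sg_M: "(a, b) \<in> Sg \<Longrightarrow> a \<in> M \<and> b \<in> M"
  by (cases a; cases b) (auto simp: Sg_iff M_def dest: dbl_I)

lemma M_iff: "(i, l) \<in> M \<longleftrightarrow> i \<in> I \<and> l < d i" by (auto simp: M_def)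

lemma finite_M: "finite M" unfolding M_def using finite_I by (intro finite_SigmaI) auto

lemma g_unit: "i \<in> I \<Longrightarrow> of_nat (gcd (d i) (d j)) \<noteq> (0 :: 'k)"
  by (metis d_unit gcd_dvd1 dvdE mult_eq_0_iff of_nat_mult)

lemma of_nat_div_g: "i \<in> I \<Longrightarrow> of_nat (d i div gcd (d i) (d j)) = (of_nat (d i) / of_nat (gcd (d i) (d j)) :: 'k)"
proof -
  assume i: "i \<in> I"
  have "of_nat (d i) = (of_nat (d i div gcd (d i) (d j)) * of_nat (gcd (d i) (d j)) :: 'k)"
    by (simp flip: of_nat_mult)
  then show ?thesis using g_unit[OF i] by (simp add: field_simps)
qed

lemma coprime_q_g: "i \<in> I \<Longrightarrow> coprime (P ^ min (r i) (r j)) (gcd (d i) (d j))"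
proof -
  assume i: "i \<in> I"
  have "coprime (q i) (d i)"
    using x_inv[OF i] by (metis coprime_iff_invertible_nat mult.commute One_nat_def)
  then show ?thesis
    by (rule coprime_divisors[rotated 2]) (simp_all add: le_imp_power_dvd)
qed

text \<open>The common factor \<open>P ^ min (r i) (r j)\<close> of \<open>q i\<close> and
  \<open>q j\<close> is prime to the modulus and can be cancelled.\<close>

lemma Sg_cong_qq:
  assumes "((i, l), (j, m)) \<in> Sg"
  shows "[l * qq i j = m * qq j i] (mod gcd (d i) (d j))"
proof -
  have "[l * qq i j * P ^ min (r i) (r j) = m * qq j i * P ^ min (r i) (r j)] (mod gcd (d i) (d j))"
    using assms by (simp add: Sg_iff mult.assoc qq_min qq_min')
  then show ?thesis
    using coprime_q_g[of i j] assms dbl_I[of i j] by (simp add: Sg_iff cong_mult_rcancel_nat coprime_commute)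
qed

lemma \<kappa>_nonzero: "i \<in> I \<Longrightarrow> \<kappa> i j \<noteq> 0" using g_unit by (simp add: \<kappa>_def)

lemma \<kappa>_\<kappa>: "(i, j) \<in> dbl \<Longrightarrow> \<kappa> i j * \<kappa> j i = inverse (of_nat (gcd (d i) (d j)))"
  using asym by (auto simp: \<kappa>_def dbl_iff gcd.commute)

lemma \<tau>_\<tau>': "\<tau> i j + \<tau>' i j = 0 \<or> \<tau> i j + \<tau>' i j = q j"
  using qq_le[of j i] by (auto simp: \<tau>_def \<tau>'_def)

lemma sum_Sg:
  fixes G :: "'v \<times> nat \<Rightarrow> 't::comm_monoid_add"
  assumes "l < d i"
  shows "(\<Sum>y\<in>{y. (y, (i, l)) \<in> Sg}. G y) =
    (\<Sum>j\<in>{j. (j, i) \<in> dbl}. \<Sum>m<d j. if ((i, l), (j, m)) \<in> Sg then G (j, m) else 0)"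
proof -
  have "(\<Sum>j\<in>{j. (j, i) \<in> dbl}. \<Sum>m<d j. if ((i, l), (j, m)) \<in> Sg then G (j, m) else 0) =
      (\<Sum>y\<in>(SIGMA j:{j. (j, i) \<in> dbl}. {..<d j}). if ((i, l), y) \<in> Sg then G y else 0)"
    using finite_dbl by (subst sum.Sigma) (auto simp: case_prod_unfold cong: if_cong)
  also have "\<dots> = (\<Sum>y\<in>{y \<in> (SIGMA j:{j. (j, i) \<in> dbl}. {..<d j}). ((i, l), y) \<in> Sg}. G y)"
    using finite_dbl by (intro sum.inter_filter[symmetric] finite_SigmaI) auto
  also have "{y \<in> (SIGMA j:{j. (j, i) \<in> dbl}. {..<d j}). ((i, l), y) \<in> Sg} = {y. (y, (i, l)) \<in> Sg}"
  proof -
    have "(y, (i, l)) \<in> Sg \<longleftrightarrow> ((i, l), y) \<in> Sg" for y using Sg_sym by blast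
    then show ?thesis by (auto simp: Sg_iff dbl_sym)
  qed
  finally show ?thesis by simp
qed

end

locale species_algebra = species I \<Omega> N P r d xinv yinv z + scalars sc
  for I :: "'v set" and \<Omega> N P r d xinv yinv and z :: "'v \<Rightarrow> 'k::field" and sc :: "'k \<Rightarrow> 't::ring_1"
begin

lemma one_plus_q: "(1 + a) ^ P ^ k = 1 + a ^ P ^ k" for a :: 't
  by (rule one_plus_power[OF P])

lemma minus_one_q: "(a - 1) ^ P ^ k = a ^ P ^ k - 1" for a :: 't
  using one_plus_q[of "a - 1" k] by simp

text \<open>The part of \<open>ei_rho\<close> at the vertex \<open>i\<close>. Each \<open>f\<close>
  stands for an orbit of a biset, and \<open>h i ^ (q i * d i - f)\<close> replaces the inverse of
  \<open>h i ^ f\<close>.\<close>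

definition ei_relator :: "('v \<Rightarrow> 't) \<Rightarrow> ('v \<Rightarrow> 'v \<Rightarrow> nat \<Rightarrow> 't) \<Rightarrow> 'v \<Rightarrow> 't" where
  "ei_relator h A i = (\<Sum>j\<in>{j. (j, i) \<in> dbl}. \<Sum>g\<in>{1..N j i}. sc (sgn i j) *
     (\<Sum>f<F i j. h i ^ f * (A i j g * A j i g * h i ^ (q i * d i - f))))"

definition gp_relator :: "('v \<times> nat \<Rightarrow> 't) \<Rightarrow> ('v \<times> nat \<Rightarrow> 'v \<times> nat \<Rightarrow> nat \<Rightarrow> 't) \<Rightarrow> 'v \<times> nat \<Rightarrow> 't" where
  "gp_relator \<epsilon> \<alpha> x = (\<Sum>y\<in>{y. (y, x) \<in> Sg}. \<Sum>g\<in>{1..N (fst y) (fst x)}. sc (sgn (fst x) (fst y)) *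
     (\<Sum>f<qq (fst x) (fst y). \<epsilon> x ^ f * (\<alpha> x y g * \<alpha> y x g * \<epsilon> x ^ (qq (fst x) (fst y) - 1 - f))))"

text \<open>\<open>gE\<close>, \<open>g\<epsilon>\<close> and \<open>g\<alpha>\<close> produce the
  generators of the generalized preprojective algebra from those of the EI quiver;
  \<open>be\<close>, \<open>bh\<close> and \<open>bA\<close> are the substitution in the opposite
  direction.\<close>

definition gE :: "('v \<Rightarrow> 't) \<Rightarrow> ('v \<Rightarrow> 't) \<Rightarrow> 'v \<times> nat \<Rightarrow> 't" where
  "gE e h = (\<lambda>(i, l). cyclic_action.E sc (e i) (h i) (q i) (d i) (z i) l)"

definition g\<epsilon> :: "('v \<Rightarrow> 't) \<Rightarrow> ('v \<Rightarrow> 't) \<Rightarrow> 'v \<times> nat \<Rightarrow> 't" where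
  "g\<epsilon> e h = (\<lambda>(i, l). (h i ^ d i - 1) * gE e h (i, l))"

definition g\<alpha> :: "('v \<Rightarrow> 't) \<Rightarrow> ('v \<Rightarrow> 't) \<Rightarrow> ('v \<Rightarrow> 'v \<Rightarrow> nat \<Rightarrow> 't) \<Rightarrow> 'v \<times> nat \<Rightarrow> 'v \<times> nat \<Rightarrow> nat \<Rightarrow> 't" where
  "g\<alpha> e h A = (\<lambda>(i, l) (j, m) g. sc (\<kappa> i j) * (gE e h (i, l) * (A i j g * ((h j ^ d j) ^ \<tau> i j * gE e h (j, m)))))"

definition be :: "('v \<times> nat \<Rightarrow> 't) \<Rightarrow> 'v \<Rightarrow> 't" where
  "be E i = (\<Sum>l<d i. E (i, l))"

text \<open>On the component \<open>l\<close>, the group generator is \<open>z i ^ l\<close> times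
  \<open>w i ^ yinv i\<close> by \<open>cyclic_action.h_E\<close>, and \<open>w i\<close> is
  \<open>1 + \<epsilon> (i, l)\<close> there.\<close>

definition bh :: "('v \<times> nat \<Rightarrow> 't) \<Rightarrow> ('v \<times> nat \<Rightarrow> 't) \<Rightarrow> 'v \<Rightarrow> 't" where
  "bh E \<epsilon> i = (\<Sum>l<d i. sc (z i ^ l) * ((1 + \<epsilon> (i, l)) ^ yinv i * E (i, l)))"

definition bA :: "('v \<times> nat \<Rightarrow> 't) \<Rightarrow> ('v \<times> nat \<Rightarrow> 'v \<times> nat \<Rightarrow> nat \<Rightarrow> 't) \<Rightarrow> 'v \<Rightarrow> 'v \<Rightarrow> nat \<Rightarrow> 't" where
  "bA \<epsilon> \<alpha> i j g = sc (inverse (\<kappa> i j)) * (\<Sum>l<d i. \<Sum>m<d j.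
     if ((i, l), (j, m)) \<in> Sg then \<alpha> (i, l) (j, m) g * (1 + \<epsilon> (j, m)) ^ \<tau>' i j else 0)"

end

text \<open>The relations of the category of the doubled EI quiver, for idempotents, group
  generators and one element per arrow. The preprojective relation is kept apart in
  \<open>ei_relator\<close>.\<close>

locale ei_action = species_algebra I \<Omega> N P r d xinv yinv z sc
  for I :: "'v set" and \<Omega> N P r d xinv yinv and z :: "'v \<Rightarrow> 'k::field" and sc :: "'k \<Rightarrow> 't::ring_1" +
  fixes e h :: "'v \<Rightarrow> 't" and A :: "'v \<Rightarrow> 'v \<Rightarrow> nat \<Rightarrow> 't"
  assumes ee: "i \<in> I \<Longrightarrow> j \<in> I \<Longrightarrow> e i * e j = (if i = j then e i else 0)"
    and eh: "i \<in> I \<Longrightarrow> e i * h i = h i" and he: "i \<in> I \<Longrightarrow> h i * e i = h i"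
    and h_order: "i \<in> I \<Longrightarrow> h i ^ (q i * d i) = e i"
    and eA: "(i, j) \<in> dbl \<Longrightarrow> g \<in> {1..N i j} \<Longrightarrow> e i * A i j g = A i j g"
    and Ae: "(i, j) \<in> dbl \<Longrightarrow> g \<in> {1..N i j} \<Longrightarrow> A i j g * e j = A i j g"
    and hA: "(i, j) \<in> dbl \<Longrightarrow> g \<in> {1..N i j} \<Longrightarrow> h i ^ F i j * A i j g = A i j g * h j ^ F j i"

text \<open>The relations of the generalized preprojective algebra on \<open>M\<close> except for
  the mesh relations, which are kept apart in \<open>gp_relator\<close>.\<close>

locale gp_action = species_algebra I \<Omega> N P r d xinv yinv z sc
  for I :: "'v set" and \<Omega> N P r d xinv yinv and z :: "'v \<Rightarrow> 'k::field" and sc :: "'k \<Rightarrow> 't::ring_1" +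
  fixes E \<epsilon> :: "'v \<times> nat \<Rightarrow> 't" and \<alpha> :: "'v \<times> nat \<Rightarrow> 'v \<times> nat \<Rightarrow> nat \<Rightarrow> 't"
  assumes EE: "a \<in> M \<Longrightarrow> b \<in> M \<Longrightarrow> E a * E b = (if a = b then E a else 0)"
    and E\<epsilon>: "a \<in> M \<Longrightarrow> E a * \<epsilon> a = \<epsilon> a" and \<epsilon>E: "a \<in> M \<Longrightarrow> \<epsilon> a * E a = \<epsilon> a"
    and \<epsilon>_nil: "a \<in> M \<Longrightarrow> \<epsilon> a ^ q (fst a) = 0"
    and E\<alpha>: "(a, b) \<in> Sg \<Longrightarrow> g \<in> {1..N (fst a) (fst b)} \<Longrightarrow> E a * \<alpha> a b g = \<alpha> a b g"
    and \<alpha>E: "(a, b) \<in> Sg \<Longrightarrow> g \<in> {1..N (fst a) (fst b)} \<Longrightarrow> \<alpha> a b g * E b = \<alpha> a b g"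
    and \<epsilon>\<alpha>: "(a, b) \<in> Sg \<Longrightarrow> g \<in> {1..N (fst a) (fst b)} \<Longrightarrow>
      \<epsilon> a ^ qq (fst a) (fst b) * \<alpha> a b g = \<alpha> a b g * \<epsilon> b ^ qq (fst b) (fst a)"

section \<open>From group generators to idempotents and nilpotents\<close>

context ei_action
begin

abbreviation "w i \<equiv> h i ^ d i"
abbreviation "E \<equiv> gE e h"
abbreviation "\<epsilon> \<equiv> g\<epsilon> e h"
abbreviation "\<alpha> \<equiv> g\<alpha> e h A"

lemma cyc: "i \<in> I \<Longrightarrow> cyclic_action sc (e i) (h i) (q i) (d i) (xinv i) (yinv i) (z i)"
  by unfold_locales
    (simp_all add: ee eh he h_order q_pos d_pos prim d_unit x_inv y_inv P_pos del: One_nat_def)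

lemma w_eq: "i \<in> I \<Longrightarrow> cyclic_action.w (h i) (d i) = w i"
  by (rule cyclic_action.w_def[OF cyc])

lemma E_eq: "E (i, l) = cyclic_action.E sc (e i) (h i) (q i) (d i) (z i) l"
  by (simp add: gE_def)

lemma E_e: "i \<in> I \<Longrightarrow> E (i, l) * e i = E (i, l)"
  and e_E: "i \<in> I \<Longrightarrow> e i * E (i, l) = E (i, l)"
  and sum_E: "i \<in> I \<Longrightarrow> (\<Sum>l<d i. E (i, l)) = e i"
  and E_E: "i \<in> I \<Longrightarrow> l < d i \<Longrightarrow> m < d i \<Longrightarrow> E (i, l) * E (i, m) = (if l = m then E (i, l) else 0)"
  and h_E: "i \<in> I \<Longrightarrow> h i ^ n * E (i, l) = sc (z i ^ (l * n)) * (w i ^ (yinv i * n) * E (i, l))"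
  and hqk_E: "i \<in> I \<Longrightarrow> h i ^ (q i * k) * E (i, l) = sc (z i ^ (l * q i * k)) * E (i, l)"
  and h_E_comm: "i \<in> I \<Longrightarrow> h i ^ n * E (i, l) = E (i, l) * h i ^ n"
  and w_E_comm: "i \<in> I \<Longrightarrow> w i ^ n * E (i, l) = E (i, l) * w i ^ n"
  and w_cong_E: "i \<in> I \<Longrightarrow> [m = n] (mod q i) \<Longrightarrow> w i ^ m * E (i, l) = w i ^ n * E (i, l)"
  and w_order: "i \<in> I \<Longrightarrow> w i ^ q i = e i"
  unfolding E_eq
  using cyclic_action.E_e[OF cyc] cyclic_action.e_E[OF cyc] cyclic_action.sum_E[OF cyc]
    cyclic_action.E_E[OF cyc] cyclic_action.h_E[OF cyc] cyclic_action.hqk_E[OF cyc]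
    cyclic_action.h_E_comm[OF cyc] cyclic_action.w_E_comm[OF cyc] cyclic_action.w_cong_E[OF cyc]
    cyclic_action.w_order[OF cyc]
  by (simp_all add: w_eq)

lemma E_orth: "a \<in> M \<Longrightarrow> b \<in> M \<Longrightarrow> E a * E b = (if a = b then E a else 0)"
proof (cases a; cases b)
  fix i l j m assume ab: "a \<in> M" "b \<in> M" "a = (i, l)" "b = (j, m)"
  show ?thesis
  proof (cases "i = j")
    case False
    have "E a * E b = E (i, l) * (e i * e j) * E (j, m)"
      using ab by (simp add: M_iff mult.assoc e_E) (simp add: E_e flip: mult.assoc)
    with ab False show ?thesis by (simp add: ee M_iff)
  qed (use ab in \<open>auto simp: M_iff E_E\<close>)
qed

text \<open>This is the relation \<open>hA\<close> iterated \<open>gcd (d i) (d j)\<close>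
  times.\<close>

lemma wA:
  assumes "(i, j) \<in> dbl" "g \<in> {1..N i j}"
  shows "w i ^ qq i j * A i j g = A i j g * w j ^ qq j i"
proof -
  have 1: "F i j * gcd (d i) (d j) = d i * qq i j" for i j
    by (simp add: F_def mult.assoc mult.commute)
  have "h i ^ (F i j * gcd (d i) (d j)) * A i j g = A i j g * h j ^ (F j i * gcd (d j) (d i))"
    unfolding power_mult gcd.commute[of "d j"] by (rule power_intertwine) (rule hA[OF assms])
  then show ?thesis unfolding 1 power_mult .
qed

lemma w1_E_comm: "i \<in> I \<Longrightarrow> (w i - 1) * E (i, l) = E (i, l) * (w i - 1)"
  using w_E_comm[of i 1 l] by (simp add: algebra_simps)

lemma \<epsilon>_def': "\<epsilon> (i, l) = (w i - 1) * E (i, l)" by (simp add: g\<epsilon>_def)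

lemma \<epsilon>_power: "(i, l) \<in> M \<Longrightarrow> \<epsilon> (i, l) ^ n * E (i, l) = (w i - 1) ^ n * E (i, l)"
proof (induction n)
  case (Suc n)
  have "\<epsilon> (i, l) ^ Suc n * E (i, l) = (w i - 1) * (E (i, l) * (\<epsilon> (i, l) ^ n * E (i, l)))"
    by (simp add: \<epsilon>_def' mult.assoc)
  also have "\<dots> = (w i - 1) * (E (i, l) * ((w i - 1) ^ n * E (i, l)))" using Suc by simp
  also have "E (i, l) * ((w i - 1) ^ n * E (i, l)) = (w i - 1) ^ n * E (i, l)"
    using Suc.prems E_orth[of "(i, l)" "(i, l)"] power_intertwine[OF w1_E_comm, of i n l]
    by (simp add: M_iff flip: mult.assoc)
  finally show ?case by (simp add: mult.assoc)
qed simp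

lemma E_\<epsilon>_power: "(i, l) \<in> M \<Longrightarrow> E (i, l) * \<epsilon> (i, l) ^ n = E (i, l) * (w i - 1) ^ n"
proof -
  assume a: "(i, l) \<in> M"
  have "E (i, l) * \<epsilon> (i, l) = \<epsilon> (i, l) * E (i, l)"
  proof -
    have "E (i, l) * \<epsilon> (i, l) = (E (i, l) * (w i - 1)) * E (i, l)" by (simp only: \<epsilon>_def' mult.assoc)
    also have "E (i, l) * (w i - 1) = (w i - 1) * E (i, l)" using a w1_E_comm by (simp add: M_iff)
    finally show ?thesis by (simp only: \<epsilon>_def')
  qed
  then have "E (i, l) * \<epsilon> (i, l) ^ n = \<epsilon> (i, l) ^ n * E (i, l)"
    using power_intertwine[of "\<epsilon> (i, l)" "E (i, l)" "\<epsilon> (i, l)" n] by simp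
  then show ?thesis
    using \<epsilon>_power[OF a] power_intertwine[OF w1_E_comm, of i n l] a by (simp add: M_iff)
qed

lemma one_\<epsilon>_power: "(i, l) \<in> M \<Longrightarrow> (1 + \<epsilon> (i, l)) ^ n * E (i, l) = w i ^ n * E (i, l)"
proof (induction n)
  case (Suc n)
  have *: "E (i, l) * E (i, l) = E (i, l)" using Suc.prems E_orth by simp
  have comm: "w i ^ n * E (i, l) = E (i, l) * w i ^ n" using Suc.prems by (simp add: M_iff w_E_comm)
  have "(1 + \<epsilon> (i, l)) ^ Suc n * E (i, l) = (1 + \<epsilon> (i, l)) * (w i ^ n * E (i, l))"
    using Suc by (simp add: mult.assoc)
  also have "\<dots> = ((1 + \<epsilon> (i, l)) * E (i, l)) * w i ^ n" by (simp only: comm mult.assoc)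
  also have "(1 + \<epsilon> (i, l)) * E (i, l) = w i * E (i, l)"
    by (simp add: \<epsilon>_def' distrib_right left_diff_distrib mult.assoc *)
  finally show ?case by (simp add: mult.assoc comm)
qed simp

text \<open>Iterating \<open>hA\<close> moves the \<open>(d i div ?g)\<close>-th power of
  \<open>h i ^ q i\<close> across the arrow, where it becomes the \<open>(d j div ?g)\<close>-th
  power of \<open>h j ^ q j\<close>. Both act on the block by scalars. By the compatibility of
  \<open>z i\<close> and \<open>z j\<close>, the scalars are equal only under the congruence in
  \<open>Sg\<close>.\<close>

lemma EAE_zero:
  assumes ij: "(i, j) \<in> dbl" and g: "g \<in> {1..N i j}" and l: "l < d i" and m: "m < d j"
    and notin: "((i, l), (j, m)) \<notin> Sg"
  shows "E (i, l) * (A i j g * E (j, m)) = 0"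
proof -
  note I = dbl_I[OF ij, THEN conjunct1] dbl_I[OF ij, THEN conjunct2]
  let ?g = "gcd (d i) (d j)"
  let ?Y = "E (i, l) * (A i j g * E (j, m))"
  have 1: "F i j * P ^ min (r i) (r j) = q i * (d i div gcd (d i) (d j))" for i j
    by (simp add: F_def flip: qq_min[of i j])
  have "h i ^ (F i j * P ^ min (r i) (r j)) * A i j g = A i j g * h j ^ (F j i * P ^ min (r j) (r i))"
    unfolding power_mult min.commute[of "r j"] by (rule power_intertwine) (rule hA[OF ij g])
  then have c: "h i ^ (q i * (d i div ?g)) * A i j g = A i j g * h j ^ (q j * (d j div ?g))"
    unfolding 1 by (simp only: gcd.commute)
  have "sc (z i ^ (l * q i * (d i div ?g))) * ?Y = h i ^ (q i * (d i div ?g)) * E (i, l) * (A i j g * E (j, m))"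
    by (simp only: hqk_E[OF I(1)] mult.assoc)
  also have "\<dots> = E (i, l) * (h i ^ (q i * (d i div ?g)) * A i j g) * E (j, m)"
    by (simp only: h_E_comm[OF I(1)] mult.assoc)
  also have "\<dots> = E (i, l) * (A i j g * (h j ^ (q j * (d j div ?g)) * E (j, m)))"
    by (simp only: c mult.assoc)
  also have "\<dots> = sc (z j ^ (m * q j * (d j div ?g))) * ?Y"
    unfolding hqk_E[OF I(2)] by (simp only: sc_left_comm)
  finally have eq: "sc (z i ^ (l * q i * (d i div ?g))) * ?Y = sc (z j ^ (m * q j * (d j div ?g))) * ?Y" .
  have "z i ^ (l * q i * (d i div ?g)) \<noteq> z j ^ (m * q j * (d j div ?g))"
  proof
    assume "z i ^ (l * q i * (d i div ?g)) = z j ^ (m * q j * (d j div ?g))"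
    also have "\<dots> = (z j ^ (d j div ?g)) ^ (m * q j)" by (simp only: mult.commute power_mult[symmetric])
    also have "\<dots> = (z i ^ (d i div ?g)) ^ (m * q j)" by (simp only: compat[OF I])
    also have "\<dots> = z i ^ (m * q j * (d i div ?g))" by (simp only: mult.commute power_mult[symmetric])
    finally have "[l * q i * (d i div ?g) = m * q j * (d i div ?g)] (mod d i)"
      by (simp only: primitive_root_power_eq[OF prim[OF I(1)] d_pos[OF I(1)]])
    then have "(l * q i * (d i div ?g)) mod (?g * (d i div ?g)) = (m * q j * (d i div ?g)) mod (?g * (d i div ?g))"
      by (simp add: cong_def)
    then have "(l * q i mod ?g) * (d i div ?g) = (m * q j mod ?g) * (d i div ?g)"
      by (simp only: mod_mult_mult2)
    moreover have "d i div ?g > 0" using d_pos[OF I(1)] by (simp add: div_greater_zero_iff gcd_le1_nat)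
    ultimately have "[l * q i = m * q j] (mod ?g)" by (simp add: cong_def)
    with notin ij l m show False by (simp add: Sg_iff)
  qed
  with eq show ?thesis by (rule sc_cancel)
qed

end

lemma sandwich_sum: "a * (\<Sum>j\<in>S. T j) * b = (\<Sum>j\<in>S. a * T j * b)" for a b :: "'a::ring"
  by (simp add: sum_distrib_left sum_distrib_right)

lemma sandwich_sum2: "a * (\<Sum>j\<in>S. \<Sum>g\<in>R j. T j g) * b = (\<Sum>j\<in>S. \<Sum>g\<in>R j. a * T j g * b)"
  for a b :: "'a::ring"
  by (simp add: sandwich_sum)

context ei_action
begin

lemma \<alpha>_eq: "\<alpha> (i, l) (j, m) g = sc (\<kappa> i j) * (E (i, l) * (A i j g * (w j ^ \<tau> i j * E (j, m))))"
  by (simp add: g\<alpha>_def)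

lemma \<epsilon>_E_comm: "(i, l) \<in> M \<Longrightarrow> \<epsilon> (i, l) * E (i, l) = E (i, l) * \<epsilon> (i, l)"
  using \<epsilon>_power[of i l 1] E_\<epsilon>_power[of i l 1] w1_E_comm[of i l] by (simp add: M_iff)

text \<open>Frobenius translates between \<open>w\<close> and \<epsilon>:
  \<open>(w i - 1) ^ qq i j = w i ^ qq i j - 1\<close>, so that \<open>wA\<close> becomes the
  relation between powers of \<epsilon>; and \<open>(w i - 1) ^ q i = w i ^ q i - 1\<close> vanishes
  on each component.\<close>

lemma gp_action_conv: "gp_action I \<Omega> N P r d xinv yinv z sc E \<epsilon> \<alpha>"
proof (intro gp_action.intro gp_action_axioms.intro species_algebra_axioms)
  fix a b assume "a \<in> M" "b \<in> M"
  then show "E a * E b = (if a = b then E a else 0)" by (rule E_orth)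
next
  fix a assume a: "a \<in> M"
  obtain i l where al: "a = (i, l)" by (cases a)
  have i: "i \<in> I" and il: "(i, l) \<in> M" using a al by (auto simp: M_iff)
  have EE: "E (i, l) * E (i, l) = E (i, l)" using E_orth[OF il il] by simp
  show r: "\<epsilon> a * E a = \<epsilon> a" unfolding al \<epsilon>_def' by (simp add: mult.assoc EE)
  show "E a * \<epsilon> a = \<epsilon> a" unfolding al \<epsilon>_def' by (simp add: w1_E_comm[OF i] EE flip: mult.assoc)
  obtain k where k: "q i = Suc k" using q_pos[of i] gr0_conv_Suc by blast
  have "\<epsilon> a ^ q i = \<epsilon> a ^ q i * E a" unfolding k power_Suc2 by (simp only: mult.assoc r)
  also have "\<dots> = (w i ^ q i - 1) * E a" unfolding al \<epsilon>_power[OF il] minus_one_q ..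
  also have "\<dots> = 0" by (simp add: al w_order[OF i] left_diff_distrib e_E[OF i])
  finally show "\<epsilon> a ^ q (fst a) = 0" by (simp add: al)
next
  fix a b g assume ab: "(a, b) \<in> Sg" and g: "g \<in> {1..N (fst a) (fst b)}"
  obtain i l j m where a: "a = (i, l)" and b: "b = (j, m)" by (cases a; cases b)
  have ij: "(i, j) \<in> dbl" and l: "l < d i" and m: "m < d j" using ab by (auto simp: a b Sg_iff)
  have g: "g \<in> {1..N i j}" using g by (simp add: a b)
  have i: "i \<in> I" and j: "j \<in> I" using dbl_I[OF ij] by auto
  have il: "(i, l) \<in> M" and jm: "(j, m) \<in> M" using i j l m by (auto simp: M_iff)
  have EE: "E (i, l) * E (i, l) = E (i, l)" "E (j, m) * E (j, m) = E (j, m)"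
    using E_orth[OF il il] E_orth[OF jm jm] by simp_all
  show "E a * \<alpha> a b g = \<alpha> a b g"
    unfolding a b \<alpha>_eq by (simp add: sc_left_comm[of "E _"] EE flip: mult.assoc[of "E _" "E _"])
  show "\<alpha> a b g * E b = \<alpha> a b g"
    unfolding a b \<alpha>_eq by (simp add: mult.assoc EE)
  let ?n = "qq i j" and ?n' = "qq j i"
  have qq_pow: "(w i - 1) ^ ?n = w i ^ ?n - 1" "(w j - 1) ^ ?n' = w j ^ ?n' - 1"
    unfolding qq_def by (rule minus_one_q)+
  have "\<epsilon> (i, l) ^ ?n * (E (i, l) * (A i j g * (w j ^ \<tau> i j * E (j, m)))) =
      (w i - 1) ^ ?n * E (i, l) * (A i j g * (w j ^ \<tau> i j * E (j, m)))"
    unfolding \<epsilon>_power[OF il, symmetric] by (simp only: mult.assoc)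
  also have "(w i - 1) ^ ?n * E (i, l) = E (i, l) * (w i - 1) ^ ?n"
    by (rule power_intertwine) (rule w1_E_comm[OF i])
  also have "E (i, l) * (w i - 1) ^ ?n * (A i j g * (w j ^ \<tau> i j * E (j, m))) =
      E (i, l) * ((w i ^ ?n - 1) * A i j g) * (w j ^ \<tau> i j * E (j, m))"
    unfolding qq_pow by (simp only: mult.assoc)
  also have "(w i ^ ?n - 1) * A i j g = A i j g * (w j ^ ?n' - 1)"
    using wA[OF ij g] by (simp add: left_diff_distrib right_diff_distrib)
  also have "E (i, l) * (A i j g * (w j ^ ?n' - 1)) * (w j ^ \<tau> i j * E (j, m)) =
      E (i, l) * (A i j g * (((w j ^ ?n' - 1) * w j ^ \<tau> i j) * E (j, m)))"
    by (simp only: mult.assoc)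
  also have "(w j ^ ?n' - 1) * w j ^ \<tau> i j = w j ^ \<tau> i j * (w j - 1) ^ ?n'"
    unfolding qq_pow by (simp add: left_diff_distrib right_diff_distrib add.commute flip: power_add)
  also have "w j ^ \<tau> i j * (w j - 1) ^ ?n' * E (j, m) = w j ^ \<tau> i j * (E (j, m) * \<epsilon> (j, m) ^ ?n')"
    unfolding E_\<epsilon>_power[OF jm] using power_intertwine[OF w1_E_comm[OF j], of ?n' m] by (simp only: mult.assoc)
  finally have "\<epsilon> (i, l) ^ ?n * (E (i, l) * (A i j g * (w j ^ \<tau> i j * E (j, m)))) =
      E (i, l) * (A i j g * (w j ^ \<tau> i j * E (j, m))) * \<epsilon> (j, m) ^ ?n'" by (simp only: mult.assoc)
  then show "\<epsilon> a ^ qq (fst a) (fst b) * \<alpha> a b g = \<alpha> a b g * \<epsilon> b ^ qq (fst b) (fst a)"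
    unfolding a b \<alpha>_eq fst_conv by (simp only: sc_left_comm mult.assoc)
qed

lemma be_conv: "i \<in> I \<Longrightarrow> be E i = e i"
  by (simp add: be_def sum_E)

lemma bh_conv: "i \<in> I \<Longrightarrow> bh E \<epsilon> i = h i"
proof -
  assume i: "i \<in> I"
  have "bh E \<epsilon> i = (\<Sum>l<d i. h i * E (i, l))"
    unfolding bh_def
  proof (rule sum.cong[OF refl])
    fix l assume "l \<in> {..<d i}"
    then have il: "(i, l) \<in> M" using i by (simp add: M_iff)
    show "sc (z i ^ l) * ((1 + \<epsilon> (i, l)) ^ yinv i * E (i, l)) = h i * E (i, l)"
      using h_E[OF i, of 1 l] by (simp add: one_\<epsilon>_power[OF il])
  qed
  then show ?thesis by (simp add: sum_E[OF i] he[OF i] flip: sum_distrib_left)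
qed

lemma sum_EAE:
  assumes ij: "(i, j) \<in> dbl" and g: "g \<in> {1..N i j}"
  shows "(\<Sum>l<d i. \<Sum>m<d j. E (i, l) * (A i j g * E (j, m))) = A i j g"
proof -
  have "(\<Sum>m<d j. E (i, l) * (A i j g * E (j, m))) = E (i, l) * (A i j g * (\<Sum>m<d j. E (j, m)))" for l
    by (simp only: sum_distrib_left)
  then have "(\<Sum>l<d i. \<Sum>m<d j. E (i, l) * (A i j g * E (j, m))) = (\<Sum>l<d i. E (i, l)) * (A i j g * (\<Sum>m<d j. E (j, m)))"
    by (simp only: sum_distrib_right)
  then show ?thesis
    using dbl_I[OF ij] by (simp add: sum_E eA[OF ij g] Ae[OF ij g])
qed

text \<open>The blocks outside \<open>Sg\<close> are 0 by \<open>EAE_zero\<close>, so no part of the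
  arrow is lost. The twists cancel since \<open>\<tau> i j + \<tau>' i j\<close> is 0 or the order
  of \<open>w j\<close>.\<close>

lemma bA_conv:
  assumes ij: "(i, j) \<in> dbl" and g: "g \<in> {1..N i j}"
  shows "bA \<epsilon> \<alpha> i j g = A i j g"
proof -
  have i: "i \<in> I" and j: "j \<in> I" using dbl_I[OF ij] by auto
  have "(if ((i, l), (j, m)) \<in> Sg then \<alpha> (i, l) (j, m) g * (1 + \<epsilon> (j, m)) ^ \<tau>' i j else 0) =
      sc (\<kappa> i j) * (E (i, l) * (A i j g * E (j, m)))" if l: "l < d i" and m: "m < d j" for l m
  proof (cases "((i, l), (j, m)) \<in> Sg")
    case True
    have jm: "(j, m) \<in> M" using j m by (simp add: M_iff)
    have "(1 + \<epsilon> (j, m)) ^ \<tau>' i j * E (j, m) = E (j, m) * (1 + \<epsilon> (j, m)) ^ \<tau>' i j"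
      by (rule power_intertwine) (simp only: distrib_left distrib_right \<epsilon>_E_comm[OF jm] mult_1_left mult_1_right)
    then have "w j ^ \<tau> i j * E (j, m) * (1 + \<epsilon> (j, m)) ^ \<tau>' i j = w j ^ \<tau> i j * (w j ^ \<tau>' i j * E (j, m))"
      by (simp add: mult.assoc one_\<epsilon>_power[OF jm])
    also have "\<dots> = w j ^ (\<tau> i j + \<tau>' i j) * E (j, m)" by (simp add: power_add mult.assoc)
    also have "\<dots> = E (j, m)"
      using \<tau>_\<tau>'[of i j] w_order[OF j] e_E[OF j] by auto
    finally have "w j ^ \<tau> i j * E (j, m) * (1 + \<epsilon> (j, m)) ^ \<tau>' i j = E (j, m)" .
    then show ?thesis using True unfolding \<alpha>_eq by (simp only: mult.assoc if_True)
  next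
    case False
    then show ?thesis using EAE_zero[OF ij g l m] by simp
  qed
  then have "bA \<epsilon> \<alpha> i j g = sc (inverse (\<kappa> i j)) *
      (\<Sum>l<d i. \<Sum>m<d j. sc (\<kappa> i j) * (E (i, l) * (A i j g * E (j, m))))"
    unfolding bA_def by (intro arg_cong2[of _ _ _ _ "(*)"] refl sum.cong) auto
  also have "\<dots> = sc (inverse (\<kappa> i j) * \<kappa> i j) * A i j g"
    by (simp only: sum_distrib_left[of "sc (\<kappa> i j)", symmetric] sum_EAE[OF ij g] sc_mult mult.assoc)
  finally show ?thesis using \<kappa>_nonzero[OF i] by simp
qed

text \<open>The product of the opposite arrows, summed over the components of the vertex in between.\<close>

lemma sum_\<alpha>_\<alpha>:
  assumes ij: "(i, j) \<in> dbl" and g: "g \<in> {1..N i j}" and l: "l < d i"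
  shows "(\<Sum>m<d j. if ((i, l), (j, m)) \<in> Sg then \<alpha> (i, l) (j, m) g * \<alpha> (j, m) (i, l) g else 0) =
    sc (inverse (of_nat (gcd (d i) (d j)))) * (E (i, l) * (A i j g * A j i g * E (i, l)) * w i ^ (q i - qq i j))"
proof -
  have i: "i \<in> I" and j: "j \<in> I" using dbl_I[OF ij] by auto
  have ji: "(j, i) \<in> dbl" using dbl_sym[OF ij] .
  have g': "g \<in> {1..N j i}" using g dbl_N[OF ij] by simp
  let ?n = "q i - qq i j" and ?n' = "q j - qq j i"
  \<comment> \<open>\<open>wA\<close> moves \<open>w\<close> with exponent \<open>qq\<close> across
    an arrow, hence also its inverse, which is written with the complementary exponent.\<close>
  have tw: "w j ^ ?n' * A j i g = A j i g * w i ^ ?n"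
  proof -
    have "A j i g * w i ^ ?n = w j ^ q j * (A j i g * w i ^ ?n)"
      using eA[OF ji g'] by (simp add: w_order[OF j] flip: mult.assoc)
    also have "\<dots> = w j ^ ?n' * (w j ^ qq j i * A j i g) * w i ^ ?n"
      using qq_le[of j i] by (simp add: mult.assoc[symmetric] flip: power_add)
    also have "\<dots> = w j ^ ?n' * (A j i g * w i ^ q i)"
      unfolding wA[OF ji g'] using qq_le[of i j] by (simp add: mult.assoc flip: power_add)
    finally show ?thesis using Ae[OF ji g'] by (simp add: w_order[OF i])
  qed
  \<comment> \<open>Just one of the two opposite arrows carries a twist, and by \<open>tw\<close> it
    has the same effect in either position.\<close>
  have tw': "w j ^ \<tau> i j * (A j i g * w i ^ \<tau> j i) = A j i g * w i ^ ?n"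
  proof (cases "(i, j) \<in> \<Omega>")
    case True
    then show ?thesis using asym by (simp add: \<tau>_def)
  next
    case False
    then show ?thesis using tw ij by (simp add: \<tau>_def dbl_iff)
  qed
  have "(if ((i, l), (j, m)) \<in> Sg then \<alpha> (i, l) (j, m) g * \<alpha> (j, m) (i, l) g else 0) =
      sc (\<kappa> i j * \<kappa> j i) * (E (i, l) * (A i j g * E (j, m)) * (A j i g * w i ^ ?n * E (i, l)))" if m: "m < d j" for m
  proof (cases "((i, l), (j, m)) \<in> Sg")
    case True
    have EE: "E (j, m) * E (j, m) = E (j, m)" using j m E_E by simp
    have "w j ^ \<tau> i j * E (j, m) * E (j, m) * (A j i g * (w i ^ \<tau> j i * E (i, l))) =
        E (j, m) * (w j ^ \<tau> i j * (A j i g * w i ^ \<tau> j i) * E (i, l))"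
    proof -
      have "w j ^ \<tau> i j * E (j, m) * E (j, m) = E (j, m) * w j ^ \<tau> i j"
        unfolding mult.assoc EE by (rule w_E_comm[OF j])
      then show ?thesis by (simp only: mult.assoc)
    qed
    then have "\<alpha> (i, l) (j, m) g * \<alpha> (j, m) (i, l) g = sc (\<kappa> i j) * (sc (\<kappa> j i) *
        (E (i, l) * (A i j g * (E (j, m) * (w j ^ \<tau> i j * (A j i g * w i ^ \<tau> j i) * E (i, l))))))"
      unfolding \<alpha>_eq
      by (simp only: mult.assoc sc_left_comm[of "E _"] sc_left_comm[of "A _ _ _"] sc_left_comm[of "_ ^ _"])
    then show ?thesis using True unfolding tw' by (simp only: if_True sc_mult mult.assoc)
  next
    case False
    then show ?thesis using EAE_zero[OF ij g l m] by simp
  qed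
  then have "(\<Sum>m<d j. if ((i, l), (j, m)) \<in> Sg then \<alpha> (i, l) (j, m) g * \<alpha> (j, m) (i, l) g else 0) =
      (\<Sum>m<d j. sc (\<kappa> i j * \<kappa> j i) * (E (i, l) * (A i j g * E (j, m)) * (A j i g * w i ^ ?n * E (i, l))))"
    by (intro sum.cong refl) auto
  also have "\<dots> = sc (\<kappa> i j * \<kappa> j i) * (E (i, l) * (A i j g * (\<Sum>m<d j. E (j, m))) * (A j i g * w i ^ ?n * E (i, l)))"
    by (simp only: sum_distrib_left sum_distrib_right)
  also have "\<dots> = sc (inverse (of_nat (gcd (d i) (d j)))) * (E (i, l) * (A i j g * A j i g * E (i, l)) * w i ^ ?n)"
    by (simp only: sum_E[OF j] Ae[OF ij g] \<kappa>_\<kappa>[OF ij] mult.assoc w_E_comm[OF i])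
  finally show ?thesis .
qed

text \<open>The common form of both relators on the diagonal block \<open>l\<close>: a sum over
  complementary exponents of \<open>w i - 1\<close>.\<close>

definition unip :: "'v \<Rightarrow> nat \<Rightarrow> 'v \<Rightarrow> nat \<Rightarrow> 't" where
  "unip i l j g = (\<Sum>f<qq i j. (w i - 1) ^ f * (E (i, l) * (A i j g * A j i g * E (i, l)) * (w i - 1) ^ (qq i j - 1 - f)))"

text \<open>\<open>conj_sum\<close> leaves conjugates by powers of \<open>w i\<close>. Once
  \<open>w i ^ (q i + 1 - qq i j)\<close> is split off on the right, the exponents on the two sides
  add up to \<open>qq i j - 1\<close>, and \<open>sum_unipotent\<close> replaces \<open>w i\<close>
  by \<open>w i - 1\<close>.\<close>

lemma ei_summand:
  assumes ij: "(i, j) \<in> dbl" and g: "g \<in> {1..N i j}" and l: "l < d i" "l' < d i"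
  shows "E (i, l) * (\<Sum>f<F i j. h i ^ f * (A i j g * A j i g * h i ^ (q i * d i - f))) * E (i, l') =
    (if l = l' then sc (of_nat (d i) / of_nat (gcd (d i) (d j))) * (unip i l j g * w i ^ (q i + 1 - qq i j)) else 0)"
proof -
  have i: "i \<in> I" using dbl_I[OF ij] by auto
  have ji: "(j, i) \<in> dbl" using dbl_sym[OF ij] .
  have g': "g \<in> {1..N j i}" using g dbl_N[OF ij] by simp
  let ?X = "A i j g * A j i g"
  let ?Y = "E (i, l) * (?X * E (i, l))"
  have Xe: "?X * e i = ?X" using Ae[OF ji g'] by (simp add: mult.assoc)
  have hX: "h i ^ F i j * ?X = ?X * h i ^ F i j"
    using hA[OF ij g] hA[OF ji g'] by (metis mult.assoc)
  have "E (i, l) * (\<Sum>f<F i j. h i ^ f * (?X * h i ^ (q i * d i - f))) * E (i, l') =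
    (if l = l' then sc (of_nat (d i div gcd (d i) (d j))) *
      (\<Sum>u<qq i j. w i ^ u * (E (i, l) * (?X * E (i, l')) * w i ^ (q i - u))) else 0)"
  proof -
    have b: "d i div gcd (d i) (d j) dvd d i" by (metis dvd_div_mult_self dvd_triv_left gcd_dvd1)
    from cyclic_action.conj_sum[OF cyc[OF i] qq_dvd[of i j] b F_def Xe hX l] show ?thesis
      unfolding E_eq[symmetric] w_eq[OF i] .
  qed
  also have "\<dots> = (if l = l' then sc (of_nat (d i) / of_nat (gcd (d i) (d j))) *
      (\<Sum>u<qq i j. w i ^ u * (?Y * w i ^ (q i - u))) else 0)"
    by (simp add: of_nat_div_g[OF i])
  also have "(\<Sum>u<qq i j. w i ^ u * (?Y * w i ^ (q i - u))) =
      (\<Sum>u<qq i j. w i ^ u * (?Y * w i ^ (qq i j - 1 - u))) * w i ^ (q i + 1 - qq i j)"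
    unfolding sum_distrib_right
  proof (rule sum.cong[OF refl])
    fix u assume "u \<in> {..<qq i j}"
    then have "q i - u = (qq i j - 1 - u) + (q i + 1 - qq i j)" using qq_le[of i j] by auto
    then have "w i ^ (q i - u) = w i ^ (qq i j - 1 - u) * w i ^ (q i + 1 - qq i j)" by (simp only: power_add)
    then show "w i ^ u * (?Y * w i ^ (q i - u)) = w i ^ u * (?Y * w i ^ (qq i j - 1 - u)) * w i ^ (q i + 1 - qq i j)"
      by (simp only: mult.assoc)
  qed
  also have "(\<Sum>u<qq i j. w i ^ u * (?Y * w i ^ (qq i j - 1 - u))) = unip i l j g"
    using sum_unipotent[OF P qq_def[of i j], of "w i - 1" ?Y "w i - 1"] by (simp add: unip_def)
  finally show ?thesis .
qed

text \<open>The sum over \<open>m\<close> only concerns the product of the two arrows and is given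
  by \<open>sum_\<alpha>_\<alpha>\<close>. Next to \<open>E (i, l)\<close>, powers of \<epsilon> are
  powers of \<open>w i - 1\<close>, and the power of \<open>w i\<close> that comes from the twist
  commutes with them.\<close>

lemma gp_summand:
  assumes ij: "(i, j) \<in> dbl" and g: "g \<in> {1..N i j}" and l: "l < d i"
  shows "(\<Sum>m<d j. if ((i, l), (j, m)) \<in> Sg then
      (\<Sum>f<qq i j. \<epsilon> (i, l) ^ f * (\<alpha> (i, l) (j, m) g * \<alpha> (j, m) (i, l) g * \<epsilon> (i, l) ^ (qq i j - 1 - f))) else 0) =
    sc (inverse (of_nat (gcd (d i) (d j)))) * (unip i l j g * w i ^ (q i - qq i j))"
proof -
  have i: "i \<in> I" using dbl_I[OF ij] by auto
  have il: "(i, l) \<in> M" using i l by (simp add: M_iff)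
  have EE: "E (i, l) * E (i, l) = E (i, l)" using i l E_E by simp
  let ?n = "qq i j" and ?c = "sc (inverse (of_nat (gcd (d i) (d j))))"
  let ?S = "\<lambda>m. if ((i, l), (j, m)) \<in> Sg then \<alpha> (i, l) (j, m) g * \<alpha> (j, m) (i, l) g else 0"
  let ?Y = "E (i, l) * (A i j g * A j i g * E (i, l))"
  have "(\<Sum>m<d j. if ((i, l), (j, m)) \<in> Sg then
      (\<Sum>f<?n. \<epsilon> (i, l) ^ f * (\<alpha> (i, l) (j, m) g * \<alpha> (j, m) (i, l) g * \<epsilon> (i, l) ^ (?n - 1 - f))) else 0) =
      (\<Sum>m<d j. \<Sum>f<?n. \<epsilon> (i, l) ^ f * (?S m * \<epsilon> (i, l) ^ (?n - 1 - f)))"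
    by (intro sum.cong refl) auto
  also have "\<dots> = (\<Sum>f<?n. \<epsilon> (i, l) ^ f * ((\<Sum>m<d j. ?S m) * \<epsilon> (i, l) ^ (?n - 1 - f)))"
    by (subst sum.swap) (simp only: sum_distrib_left sum_distrib_right)
  also have "\<dots> = (\<Sum>f<?n. ?c * ((w i - 1) ^ f * (?Y * (w i - 1) ^ (?n - 1 - f)) * w i ^ (q i - ?n)))"
  proof (rule sum.cong[OF refl])
    fix f
    have EY: "E (i, l) * ?Y = ?Y"
    proof -
      have "E (i, l) * ?Y = (E (i, l) * E (i, l)) * (A i j g * A j i g * E (i, l))" by (simp only: mult.assoc)
      then show ?thesis by (simp only: EE)
    qed
    have YE: "?Y * E (i, l) = ?Y"
    proof -
      have "?Y * E (i, l) = E (i, l) * (A i j g * A j i g * (E (i, l) * E (i, l)))" by (simp only: mult.assoc)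
      then show ?thesis by (simp only: EE)
    qed
    have "\<epsilon> (i, l) ^ f * ?Y = \<epsilon> (i, l) ^ f * E (i, l) * ?Y" unfolding mult.assoc[of _ _ ?Y] EY ..
    also have "\<dots> = (w i - 1) ^ f * ?Y" unfolding \<epsilon>_power[OF il] mult.assoc[of _ _ ?Y] EY ..
    finally have left: "\<epsilon> (i, l) ^ f * ?Y = (w i - 1) ^ f * ?Y" .
    have right: "?Y * w i ^ (q i - ?n) * \<epsilon> (i, l) ^ k = ?Y * (w i - 1) ^ k * w i ^ (q i - ?n)" for k
    proof -
      have "?Y * w i ^ (q i - ?n) * \<epsilon> (i, l) ^ k = ?Y * E (i, l) * w i ^ (q i - ?n) * \<epsilon> (i, l) ^ k"
        unfolding YE ..
      also have "\<dots> = ?Y * (E (i, l) * w i ^ (q i - ?n)) * \<epsilon> (i, l) ^ k" by (simp only: mult.assoc)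
      also have "\<dots> = ?Y * w i ^ (q i - ?n) * (E (i, l) * \<epsilon> (i, l) ^ k)"
        unfolding w_E_comm[OF i, symmetric] by (simp only: mult.assoc)
      also have "\<dots> = ?Y * (w i ^ (q i - ?n) * E (i, l)) * (w i - 1) ^ k"
        unfolding E_\<epsilon>_power[OF il] by (simp only: mult.assoc)
      also have "\<dots> = ?Y * E (i, l) * (w i ^ (q i - ?n) * (w i - 1) ^ k)"
        unfolding w_E_comm[OF i] by (simp only: mult.assoc)
      also have "\<dots> = ?Y * (w i ^ (q i - ?n) * (w i - 1) ^ k)" unfolding YE ..
      also have "w i ^ (q i - ?n) * (w i - 1) ^ k = (w i - 1) ^ k * w i ^ (q i - ?n)"
      proof (rule power_intertwine)
        have "(w i - 1) ^ k * w i = w i * (w i - 1) ^ k"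
          by (rule power_intertwine) (simp add: algebra_simps)
        then show "w i * (w i - 1) ^ k = (w i - 1) ^ k * w i" by simp
      qed
      finally show ?thesis by (simp only: mult.assoc)
    qed
    have "\<epsilon> (i, l) ^ f * (?Y * w i ^ (q i - ?n) * \<epsilon> (i, l) ^ (?n - 1 - f)) =
        (\<epsilon> (i, l) ^ f * ?Y) * (w i - 1) ^ (?n - 1 - f) * w i ^ (q i - ?n)"
      unfolding right by (simp only: mult.assoc)
    also have "\<dots> = (w i - 1) ^ f * (?Y * (w i - 1) ^ (?n - 1 - f)) * w i ^ (q i - ?n)"
      unfolding left by (simp only: mult.assoc)
    finally have "\<epsilon> (i, l) ^ f * (?Y * w i ^ (q i - ?n) * \<epsilon> (i, l) ^ (?n - 1 - f)) =
        (w i - 1) ^ f * (?Y * (w i - 1) ^ (?n - 1 - f)) * w i ^ (q i - ?n)" .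
    then show "\<epsilon> (i, l) ^ f * ((\<Sum>m<d j. ?S m) * \<epsilon> (i, l) ^ (?n - 1 - f)) =
        ?c * ((w i - 1) ^ f * (?Y * (w i - 1) ^ (?n - 1 - f)) * w i ^ (q i - ?n))"
      unfolding sum_\<alpha>_\<alpha>[OF ij g l] by (simp only: mult.assoc sc_left_comm[of "_ ^ _"])
  qed
  also have "\<dots> = ?c * (unip i l j g * w i ^ (q i - ?n))"
    by (simp only: unip_def sum_distrib_left sum_distrib_right)
  finally show ?thesis .
qed

lemma gp_relator_conv:
  assumes i: "i \<in> I" and l: "l < d i"
  shows "gp_relator \<epsilon> \<alpha> (i, l) = (\<Sum>j\<in>{j. (j, i) \<in> dbl}. \<Sum>g\<in>{1..N j i}. sc (sgn i j) *
    (sc (inverse (of_nat (gcd (d i) (d j)))) * (unip i l j g * w i ^ (q i - qq i j))))"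
proof -
  have "gp_relator \<epsilon> \<alpha> (i, l) = (\<Sum>j\<in>{j. (j, i) \<in> dbl}. \<Sum>g\<in>{1..N j i}. sc (sgn i j) *
     (\<Sum>m<d j. if ((i, l), (j, m)) \<in> Sg then (\<Sum>f<qq i j. \<epsilon> (i, l) ^ f *
       (\<alpha> (i, l) (j, m) g * \<alpha> (j, m) (i, l) g * \<epsilon> (i, l) ^ (qq i j - 1 - f))) else 0))"
    unfolding gp_relator_def sum_Sg[OF l] fst_conv
  proof (rule sum.cong[OF refl])
    fix j
    let ?T = "\<lambda>m g. \<Sum>f<qq i j. \<epsilon> (i, l) ^ f * (\<alpha> (i, l) (j, m) g * \<alpha> (j, m) (i, l) g * \<epsilon> (i, l) ^ (qq i j - 1 - f))"
    have "(\<Sum>m<d j. if ((i, l), (j, m)) \<in> Sg then \<Sum>g\<in>{1..N j i}. sc (sgn i j) * ?T m g else 0) =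
        (\<Sum>m<d j. \<Sum>g\<in>{1..N j i}. sc (sgn i j) * (if ((i, l), (j, m)) \<in> Sg then ?T m g else 0))"
      by (intro sum.cong refl) auto
    also have "\<dots> = (\<Sum>g\<in>{1..N j i}. sc (sgn i j) * (\<Sum>m<d j. if ((i, l), (j, m)) \<in> Sg then ?T m g else 0))"
      by (subst sum.swap) (simp only: sum_distrib_left)
    finally show "(\<Sum>m<d j. if ((i, l), (j, m)) \<in> Sg then \<Sum>g\<in>{1..N j i}. sc (sgn i j) * ?T m g else 0) =
        (\<Sum>g\<in>{1..N j i}. sc (sgn i j) * (\<Sum>m<d j. if ((i, l), (j, m)) \<in> Sg then ?T m g else 0))" .
  qed
  also have "\<dots> = (\<Sum>j\<in>{j. (j, i) \<in> dbl}. \<Sum>g\<in>{1..N j i}. sc (sgn i j) *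
    (sc (inverse (of_nat (gcd (d i) (d j)))) * (unip i l j g * w i ^ (q i - qq i j))))"
    by (intro sum.cong refl, subst gp_summand[OF _ _ l]) (auto dest: dbl_sym dbl_N)
  finally show ?thesis .
qed

text \<open>By \<open>ei_summand\<close> and \<open>gp_relator_conv\<close>, the summands for each
  \<open>j\<close> differ by the factors \<open>d i\<close> and \<open>w i\<close>. Neither depends
  on \<open>j\<close>, which is the purpose of \<kappa> and \<tau>.\<close>

lemma ei_relator_component:
  assumes i: "i \<in> I" and l: "l < d i" "l' < d i"
  shows "E (i, l) * ei_relator h A i * E (i, l') =
    (if l = l' then sc (of_nat (d i)) * (gp_relator \<epsilon> \<alpha> (i, l) * w i) else 0)"
proof -
  have "E (i, l) * ei_relator h A i * E (i, l') = (\<Sum>j\<in>{j. (j, i) \<in> dbl}. \<Sum>g\<in>{1..N j i}. sc (sgn i j) *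
     (E (i, l) * (\<Sum>f<F i j. h i ^ f * (A i j g * A j i g * h i ^ (q i * d i - f))) * E (i, l')))"
    unfolding ei_relator_def sandwich_sum2
    by (intro sum.cong refl) (simp only: sc_left_comm[of "E _"] mult.assoc[of "sc _"])
  also have "\<dots> = (\<Sum>j\<in>{j. (j, i) \<in> dbl}. \<Sum>g\<in>{1..N j i}. sc (sgn i j) *
     (if l = l' then sc (of_nat (d i) / of_nat (gcd (d i) (d j))) * (unip i l j g * w i ^ (q i + 1 - qq i j)) else 0))"
    by (intro sum.cong refl, subst ei_summand[OF _ _ l]) (auto dest: dbl_sym dbl_N)
  also have "\<dots> = (if l = l' then sc (of_nat (d i)) * (gp_relator \<epsilon> \<alpha> (i, l) * w i) else 0)"
  proof (cases "l = l'")
    case True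
    have "sc s * (sc (of_nat (d i) / of_nat n) * (x * w i ^ (q i + 1 - qq i j))) =
        sc (of_nat (d i)) * (sc s * (sc (inverse (of_nat n)) * (x * w i ^ (q i - qq i j))) * w i)" for s n x j
    proof -
      have "q i + 1 - qq i j = q i - qq i j + 1" using qq_le[of i j] by simp
      then have "w i ^ (q i + 1 - qq i j) = w i ^ (q i - qq i j) * w i" by (simp only: power_add power_one_right)
      moreover have "sc s * (sc (of_nat (d i) / of_nat n) * y) = sc (of_nat (d i)) * (sc s * (sc (inverse (of_nat n)) * y))" for y
      proof -
        have "s * (of_nat (d i) / of_nat n) = of_nat (d i) * (s * inverse (of_nat n))"
          by (simp add: divide_inverse mult.left_commute)
        then have "sc (s * (of_nat (d i) / of_nat n)) * y = sc (of_nat (d i) * (s * inverse (of_nat n))) * y"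
          by (rule arg_cong)
        then show ?thesis by (simp only: sc_mult mult.assoc)
      qed
      ultimately show ?thesis by (simp only: mult.assoc)
    qed
    then have "(\<Sum>j\<in>{j. (j, i) \<in> dbl}. \<Sum>g\<in>{1..N j i}. sc (sgn i j) *
        (sc (of_nat (d i) / of_nat (gcd (d i) (d j))) * (unip i l j g * w i ^ (q i + 1 - qq i j)))) =
      (\<Sum>j\<in>{j. (j, i) \<in> dbl}. \<Sum>g\<in>{1..N j i}. sc (of_nat (d i)) * (sc (sgn i j) *
        (sc (inverse (of_nat (gcd (d i) (d j)))) * (unip i l j g * w i ^ (q i - qq i j)))) * w i)"
      by (intro sum.cong refl) (simp only: mult.assoc)
    then show ?thesis using True
      unfolding gp_relator_conv[OF i l(1)] mult.assoc[symmetric, of "sc (of_nat (d i))"] sandwich_sum2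
      by (simp only: if_True simp_thms)
  qed simp
  finally show ?thesis .
qed

text \<open>In \<open>ei_relator_component\<close>, \<open>d i\<close> is invertible in the field
  and a power of \<open>w i\<close> is the unit \<open>e i\<close>, so both factors can be
  cancelled. Conversely, the relator is the sum of its blocks.\<close>

lemma ei_relator_iff:
  assumes i: "i \<in> I"
  shows "ei_relator h A i = 0 \<longleftrightarrow> (\<forall>l<d i. gp_relator \<epsilon> \<alpha> (i, l) = 0)"
proof (intro iffI allI impI)
  fix l assume 0: "ei_relator h A i = 0" and l: "l < d i"
  have "sc (of_nat (d i)) * (gp_relator \<epsilon> \<alpha> (i, l) * w i) = 0"
    using ei_relator_component[OF i l l] 0 by simp
  then have "gp_relator \<epsilon> \<alpha> (i, l) * w i = 0" using d_unit[OF i] by (rule sc_cancel_0)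
  obtain k where k: "q i = Suc k" using q_pos[of i] gr0_conv_Suc by blast
  have "gp_relator \<epsilon> \<alpha> (i, l) * w i ^ q i = gp_relator \<epsilon> \<alpha> (i, l) * w i * w i ^ k"
    unfolding k by (simp only: power_Suc mult.assoc)
  then have "gp_relator \<epsilon> \<alpha> (i, l) * w i ^ q i = 0"
    unfolding \<open>gp_relator \<epsilon> \<alpha> (i, l) * w i = 0\<close> by simp
  then have "gp_relator \<epsilon> \<alpha> (i, l) * e i = 0" by (simp only: w_order[OF i])
  moreover have "gp_relator \<epsilon> \<alpha> (i, l) * e i = gp_relator \<epsilon> \<alpha> (i, l)"
  proof -
    have "w i ^ k * e i = e i * w i ^ k" for k
    proof (rule power_intertwine)
      show "w i * e i = e i * w i"
        using power_intertwine[of "h i" "e i" "h i" "d i"] by (simp add: eh[OF i] he[OF i])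
    qed
    then have Ye: "E (i, l) * (w i ^ k * e i) = E (i, l) * w i ^ k" for k
      by (simp only: E_e[OF i] mult.assoc[symmetric])
    have Yw1: "E (i, l) * ((w i - 1) ^ k * (w i ^ n * e i)) = E (i, l) * ((w i - 1) ^ k * w i ^ n)" for k n
    proof -
      have "(w i - 1) ^ k * E (i, l) = E (i, l) * (w i - 1) ^ k"
        by (rule power_intertwine[OF w1_E_comm[OF i]])
      then have *: "E (i, l) * ((w i - 1) ^ k * x) = (w i - 1) ^ k * (E (i, l) * x)" for x
        by (simp only: mult.assoc[symmetric])
      show ?thesis unfolding * Ye ..
    qed
    have "unip i l j g * w i ^ n * e i = unip i l j g * w i ^ n" for j g n
      unfolding unip_def sum_distrib_right by (intro sum.cong refl) (simp only: mult.assoc Yw1)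
    then show ?thesis
      unfolding gp_relator_conv[OF i l] sum_distrib_right by (simp add: mult.assoc)
  qed
  ultimately show "gp_relator \<epsilon> \<alpha> (i, l) = 0" by simp
next
  assume 0: "\<forall>l<d i. gp_relator \<epsilon> \<alpha> (i, l) = 0"
  have e1: "e i * (h i ^ f * (A i j g * A j i g * h i ^ (q i * d i - f))) * e i =
      h i ^ f * (A i j g * A j i g * h i ^ (q i * d i - f))" if "j \<in> {j. (j, i) \<in> dbl}" "g \<in> {1..N j i}" for j g f
  proof -
    have ij: "(i, j) \<in> dbl" and ji: "(j, i) \<in> dbl" using that dbl_sym by auto
    have g: "g \<in> {1..N i j}" using that dbl_N[OF ji] by simp
    have he': "h i ^ n * e i = e i * h i ^ n" for n
      by (rule power_intertwine) (simp add: eh[OF i] he[OF i])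
    have "e i * (h i ^ f * (A i j g * A j i g * h i ^ (q i * d i - f))) * e i =
        (e i * h i ^ f) * (A i j g * A j i g * (h i ^ (q i * d i - f) * e i))" by (simp only: mult.assoc)
    also have "\<dots> = h i ^ f * ((e i * A i j g) * (A j i g * e i) * h i ^ (q i * d i - f))"
      unfolding he' unfolding he'[symmetric, of f] by (simp only: mult.assoc)
    finally show ?thesis using eA[OF ij g] Ae[OF ji that(2)] by (simp only:)
  qed
  have "ei_relator h A i = e i * ei_relator h A i * e i"
    unfolding ei_relator_def sandwich_sum2
  proof (intro sum.cong refl)
    fix j g assume jg: "j \<in> {j. (j, i) \<in> dbl}" "g \<in> {1..N j i}"
    let ?T = "\<Sum>f<F i j. h i ^ f * (A i j g * A j i g * h i ^ (q i * d i - f))"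
    have "e i * ?T * e i = ?T" unfolding sandwich_sum using e1[OF jg] by (simp only:)
    then show "sc (sgn i j) * ?T = e i * (sc (sgn i j) * ?T) * e i"
      by (simp only: sc_left_comm[of "e i"] mult.assoc[of "sc _"])
  qed
  also have "\<dots> = (\<Sum>l<d i. \<Sum>l'<d i. E (i, l) * ei_relator h A i * E (i, l'))"
    by (simp only: sum_E[OF i, symmetric] sum_distrib_right[of _ _ "ei_relator h A i"] sum_product)
  also have "\<dots> = 0"
    using ei_relator_component[OF i] 0 by (intro sum.neutral ballI) auto
  finally show "ei_relator h A i = 0" .
qed

end

section \<open>From idempotents and nilpotents back to group generators\<close>

context gp_action
begin

abbreviation "e \<equiv> be E"
abbreviation "h \<equiv> bh E \<epsilon>"
abbreviation "A \<equiv> bA \<epsilon> \<alpha>"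
abbreviation "u a \<equiv> 1 + \<epsilon> a"

lemma u_E: "a \<in> M \<Longrightarrow> u a ^ n * E a = E a * u a ^ n"
  by (rule power_intertwine) (simp only: distrib_left distrib_right E\<epsilon> \<epsilon>E mult_1_left mult_1_right)

lemma u_q: "(i, l) \<in> M \<Longrightarrow> u (i, l) ^ q i = 1"
  using \<epsilon>_nil[of "(i, l)"] by (simp add: one_plus_q)

lemma u_cong:
  assumes "(i, l) \<in> M" "[m = n] (mod q i)"
  shows "u (i, l) ^ m = u (i, l) ^ n"
proof -
  have "u (i, l) ^ m = u (i, l) ^ (m mod q i)" for m
  proof -
    have "u (i, l) ^ m = u (i, l) ^ (q i * (m div q i) + m mod q i)" by simp
    also have "\<dots> = u (i, l) ^ (m mod q i)" by (simp only: power_add power_mult u_q[OF assms(1)] power_one mult_1_left)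
    finally show ?thesis .
  qed
  with assms(2) show ?thesis by (metis cong_def)
qed

lemma e_E: "(i, l) \<in> M \<Longrightarrow> j \<in> I \<Longrightarrow> e j * E (i, l) = (if i = j then E (i, l) else 0)"
proof -
  assume il: "(i, l) \<in> M" and j: "j \<in> I"
  have "e j * E (i, l) = (\<Sum>m<d j. E (j, m) * E (i, l))" by (simp only: be_def sum_distrib_right)
  also have "\<dots> = (\<Sum>m<d j. if m = l \<and> i = j then E (i, l) else 0)"
    using il j by (intro sum.cong refl) (auto simp: EE M_iff)
  also have "\<dots> = (if i = j then E (i, l) else 0)"
    using il by (auto simp: M_iff)
  finally show ?thesis .
qed

lemma E_e: "(i, l) \<in> M \<Longrightarrow> j \<in> I \<Longrightarrow> E (i, l) * e j = (if i = j then E (i, l) else 0)"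
proof -
  assume il: "(i, l) \<in> M" and j: "j \<in> I"
  have "E (i, l) * e j = (\<Sum>m<d j. E (i, l) * E (j, m))" by (simp only: be_def sum_distrib_left)
  also have "\<dots> = (\<Sum>m<d j. if m = l \<and> i = j then E (i, l) else 0)"
    using il j by (intro sum.cong refl) (auto simp: EE M_iff)
  also have "\<dots> = (if i = j then E (i, l) else 0)"
    using il by (auto simp: M_iff)
  finally show ?thesis .
qed

lemma E_e_i: "(i, l) \<in> M \<Longrightarrow> E (i, l) * e i = E (i, l)" using E_e[of i l i] by (simp add: M_iff)

lemma ee: "i \<in> I \<Longrightarrow> j \<in> I \<Longrightarrow> e i * e j = (if i = j then e i else 0)"
proof -
  assume i: "i \<in> I" and j: "j \<in> I"
  have "e i * e j = (\<Sum>l<d i. E (i, l) * e j)" by (simp only: be_def[of E i] sum_distrib_right)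
  also have "\<dots> = (\<Sum>l<d i. if i = j then E (i, l) else 0)"
    using i j by (intro sum.cong refl) (auto simp: E_e M_iff)
  finally show ?thesis by (simp add: be_def)
qed

lemma h_E1: 
  assumes "(i, l) \<in> M"
  shows "h i * E (i, l) = sc (z i ^ l) * (u (i, l) ^ yinv i * E (i, l))"
proof -
  have "h i * E (i, l) = (\<Sum>m<d i. sc (z i ^ m) * (u (i, m) ^ yinv i * (E (i, m) * E (i, l))))"
    by (simp only: bh_def sum_distrib_right mult.assoc)
  also have "\<dots> = (\<Sum>m<d i. if m = l then sc (z i ^ l) * (u (i, l) ^ yinv i * E (i, l)) else 0)"
    using assms by (intro sum.cong refl) (auto simp: EE M_iff)
  finally show ?thesis using assms by (simp add: M_iff)
qed

lemma h_E_comm: 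
  assumes "(i, l) \<in> M"
  shows "h i ^ n * E (i, l) = E (i, l) * h i ^ n"
proof (rule power_intertwine)
  have "E (i, l) * h i = (\<Sum>m<d i. sc (z i ^ m) * (E (i, l) * E (i, m) * u (i, m) ^ yinv i))"
    unfolding bh_def sum_distrib_left
  proof (rule sum.cong[OF refl])
    fix m assume "m \<in> {..<d i}"
    then have "(i, m) \<in> M" using assms by (simp add: M_iff)
    then show "E (i, l) * (sc (z i ^ m) * (u (i, m) ^ yinv i * E (i, m))) =
        sc (z i ^ m) * (E (i, l) * E (i, m) * u (i, m) ^ yinv i)"
      by (simp only: u_E sc_left_comm[of "E _"] mult.assoc)
  qed
  also have "\<dots> = (\<Sum>m<d i. if m = l then sc (z i ^ l) * (E (i, l) * u (i, l) ^ yinv i) else 0)"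
    using assms by (intro sum.cong refl) (auto simp: EE M_iff)
  finally show "h i * E (i, l) = E (i, l) * h i"
    using assms by (simp add: M_iff h_E1 u_E)
qed

lemma h_E:
  assumes "(i, l) \<in> M"
  shows "h i ^ n * E (i, l) = sc (z i ^ (l * n)) * (u (i, l) ^ (yinv i * n) * E (i, l))"
proof (induction n)
  case (Suc n)
  let ?U = "u (i, l)"
  have "h i ^ Suc n * E (i, l) = h i * (h i ^ n * E (i, l))" by (simp only: power_Suc mult.assoc)
  also have "\<dots> = sc (z i ^ (l * n)) * (h i * E (i, l) * ?U ^ (yinv i * n))"
    unfolding Suc.IH u_E[OF assms] by (simp only: sc_left_comm[of "h i"] mult.assoc)
  also have "\<dots> = sc (z i ^ (l * n)) * (sc (z i ^ l) * (?U ^ yinv i * ?U ^ (yinv i * n) * E (i, l)))"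
    unfolding h_E1[OF assms] by (simp only: u_E[OF assms, symmetric] mult.assoc)
  also have "\<dots> = sc (z i ^ (l * n) * z i ^ l) * (?U ^ (yinv i + yinv i * n) * E (i, l))"
    by (simp only: sc_mult power_add mult.assoc)
  finally show ?case by (simp add: add.commute flip: power_add)
qed simp

lemma h_e: "i \<in> I \<Longrightarrow> h i * e i = h i"
proof -
  assume i: "i \<in> I"
  show ?thesis unfolding bh_def sum_distrib_right
  proof (rule sum.cong[OF refl])
    fix l assume "l \<in> {..<d i}"
    then have "(i, l) \<in> M" using i by (simp add: M_iff)
    from E_e_i[OF this] show "sc (z i ^ l) * (u (i, l) ^ yinv i * E (i, l)) * e i =
      sc (z i ^ l) * (u (i, l) ^ yinv i * E (i, l))" by (simp only: mult.assoc)
  qed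
qed

lemma e_h: "i \<in> I \<Longrightarrow> e i * h i = h i"
proof -
  assume i: "i \<in> I"
  have "e i * h i = h i * e i"
    unfolding be_def sum_distrib_left sum_distrib_right
    by (rule sum.cong[OF refl]) (use i h_E_comm[of i _ 1] in \<open>simp add: M_iff\<close>)
  then show ?thesis using h_e[OF i] by simp
qed

text \<open>Identities at the vertex \<open>i\<close> may be checked on components, because
  \<open>e i\<close> is the sum of the \<open>E (i, l)\<close>.\<close>

lemma ext_E:
  assumes "i \<in> I" "X * e i = X" "Y * e i = Y" "\<And>l. (i, l) \<in> M \<Longrightarrow> X * E (i, l) = Y * E (i, l)"
  shows "X = Y"
proof -
  have "X * e i = Y * e i"
    unfolding be_def sum_distrib_left
    by (rule sum.cong[OF refl], rule assms(4)) (use assms(1) in \<open>simp add: M_iff\<close>)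
  then show ?thesis unfolding assms(2,3) .
qed

lemma h_power_e: "i \<in> I \<Longrightarrow> n > 0 \<Longrightarrow> h i ^ n * e i = h i ^ n"
  by (cases n) (simp_all only: power_Suc2 mult.assoc h_e less_irrefl)

lemma h_order: "i \<in> I \<Longrightarrow> h i ^ (q i * d i) = e i"
proof -
  assume i: "i \<in> I"
  show ?thesis
  proof (rule ext_E[OF i])
    show "h i ^ (q i * d i) * e i = h i ^ (q i * d i)"
      using q_pos[of i] d_pos[OF i] by (intro h_power_e[OF i]) simp
    show "e i * e i = e i" using ee[OF i i] by simp
    fix l assume il: "(i, l) \<in> M"
    have "z i ^ (l * (q i * d i)) = (z i ^ d i) ^ (l * q i)" by (simp only: power_mult[symmetric] ac_simps)
    also have "z i ^ d i = 1" using prim[OF i] by (simp add: primitive_root_def)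
    finally have "z i ^ (l * (q i * d i)) = 1" by simp
    moreover have "u (i, l) ^ (yinv i * (q i * d i)) = 1"
      using u_cong[OF il, of "yinv i * (q i * d i)" 0] by (simp add: cong_0_iff)
    ultimately show "h i ^ (q i * d i) * E (i, l) = e i * E (i, l)"
      using e_E[OF il i] by (simp add: h_E[OF il])
  qed
qed

lemma \<alpha>_u:
  assumes ab: "(a, b) \<in> Sg" "g \<in> {1..N (fst a) (fst b)}"
  shows "u a ^ qq (fst a) (fst b) * \<alpha> a b g = \<alpha> a b g * u b ^ qq (fst b) (fst a)"
  using \<epsilon>\<alpha>[OF ab] by (simp add: qq_def one_plus_q distrib_left distrib_right)

text \<open>
  Both \<open>y\<^sub>i d\<^sub>i / g\<close> and \<open>y\<^sub>j d\<^sub>j / g\<close> invert \<open>g = gcd (d\<^sub>i, d\<^sub>j)\<close> modulo the smaller one of \<open>q\<^sub>i\<close>, \<open>q\<^sub>j\<close>.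
\<close>

lemma \<alpha>_u_F:
  assumes ab: "((i, l), (j, m)) \<in> Sg" and g: "g \<in> {1..N i j}"
  shows "u (i, l) ^ (yinv i * F i j) * \<alpha> (i, l) (j, m) g = \<alpha> (i, l) (j, m) g * u (j, m) ^ (yinv j * F j i)"
proof -
  let ?g = "gcd (d i) (d j)" and ?s = "yinv i * (d i div gcd (d i) (d j))"
    and ?s' = "yinv j * (d j div gcd (d i) (d j))" and ?p = "P ^ min (r i) (r j)"
  have ij: "(i, j) \<in> dbl" using ab by (simp add: Sg_iff)
  have i: "i \<in> I" and j: "j \<in> I" using dbl_I[OF ij] by auto
  have jm: "(j, m) \<in> M" using Sg_M[OF ab] by simp
  have "u (i, l) ^ (qq i j * ?s) * \<alpha> (i, l) (j, m) g = \<alpha> (i, l) (j, m) g * u (j, m) ^ (qq j i * ?s)"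
    unfolding power_mult[of _ "qq _ _"] by (rule power_intertwine) (use \<alpha>_u[OF ab] g in simp)
  also have "u (j, m) ^ (qq j i * ?s) = u (j, m) ^ (qq j i * ?s')"
  proof (rule u_cong[OF jm])
    have "[?s * ?g = 1] (mod ?p)" "[?s' * ?g = 1] (mod ?p)"
    proof -
      have "?s * ?g = yinv i * d i" "?s' * ?g = yinv j * d j" by (simp_all add: mult.assoc)
      moreover have "[yinv i * d i = 1] (mod ?p)" "[yinv j * d j = 1] (mod ?p)"
        by (rule cong_dvd_modulus_nat[OF y_inv[OF i]] cong_dvd_modulus_nat[OF y_inv[OF j]], simp add: le_imp_power_dvd)+
      ultimately show "[?s * ?g = 1] (mod ?p)" "[?s' * ?g = 1] (mod ?p)" by (simp_all only:)
    qed
    then have "[?s * ?g = ?s' * ?g] (mod ?p)" using cong_trans cong_sym by blast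
    then have "[?s = ?s'] (mod ?p)"
      using coprime_q_g[OF i, of j] cong_mult_rcancel_nat[of ?g ?p ?s ?s'] by (simp only: coprime_commute)
    then have "[qq j i * ?s = qq j i * ?s'] (mod qq j i * ?p)"
      by (simp only: cong_def mod_mult_mult1)
    then show "[qq j i * ?s = qq j i * ?s'] (mod q j)" by (simp only: qq_min')
  qed
  finally show ?thesis by (simp add: F_def ac_simps gcd.commute)
qed

text \<open>The scalar part of the relation \<open>hA\<close> on a block. Compatibility rewrites the
  right side as a power of \<open>z i\<close>, and the exponents agree modulo \<open>d i\<close> by
  \<open>Sg_cong_qq\<close>.\<close>

lemma z_F:
  assumes ab: "((i, l), (j, m)) \<in> Sg"
  shows "z i ^ (l * F i j) = z j ^ (m * F j i)"
proof -
  have ij: "(i, j) \<in> dbl" using ab by (simp add: Sg_iff)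
  have i: "i \<in> I" and j: "j \<in> I" using dbl_I[OF ij] by auto
  let ?g = "gcd (d i) (d j)"
  have "z j ^ (m * F j i) = (z j ^ (d j div ?g)) ^ (m * qq j i)"
    by (simp add: F_def gcd.commute ac_simps flip: power_mult)
  also have "z j ^ (d j div ?g) = z i ^ (d i div ?g)" by (rule compat[OF i j, symmetric])
  also have "(z i ^ (d i div ?g)) ^ (m * qq j i) = z i ^ (m * qq j i * (d i div ?g))"
    by (simp only: power_mult[symmetric] mult.commute)
  also have "\<dots> = z i ^ (l * qq i j * (d i div ?g))"
    unfolding primitive_root_power_eq[OF prim[OF i] d_pos[OF i]]
  proof -
    have "[m * qq j i = l * qq i j] (mod ?g)" using Sg_cong_qq[OF ab] by (rule cong_sym)
    then have "[m * qq j i * (d i div ?g) = l * qq i j * (d i div ?g)] (mod ?g * (d i div ?g))"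
      by (simp only: cong_def mod_mult_mult2)
    then show "[m * qq j i * (d i div ?g) = l * qq i j * (d i div ?g)] (mod d i)" by simp
  qed
  finally show ?thesis by (simp add: F_def ac_simps)
qed

text \<open>The relations for arrows hold block by block. In the relation between powers of
  \<open>h\<close>, the scalars match by \<open>z_F\<close> and the unipotent factors by
  \<open>\<alpha>_u_F\<close>.\<close>

lemma ei_action_back: "ei_action I \<Omega> N P r d xinv yinv z sc e h A"
proof (intro ei_action.intro ei_action_axioms.intro species_algebra_axioms)
  fix i j assume "i \<in> I" "j \<in> I"
  then show "e i * e j = (if i = j then e i else 0)" by (rule ee)
next
  fix i assume i: "i \<in> I"
  then show "e i * h i = h i" "h i * e i = h i" "h i ^ (q i * d i) = e i" by (rule e_h h_e h_order)+
next
  fix i j g assume ij: "(i, j) \<in> dbl" and g: "g \<in> {1..N i j}"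
  have i: "i \<in> I" and j: "j \<in> I" using dbl_I[OF ij] by auto
  let ?T = "\<lambda>l m. if ((i, l), (j, m)) \<in> Sg then \<alpha> (i, l) (j, m) g * u (j, m) ^ \<tau>' i j else 0"
  have A: "A i j g = sc (inverse (\<kappa> i j)) * (\<Sum>l<d i. \<Sum>m<d j. ?T l m)" by (simp only: bA_def)
  have left: "e i * ?T l m = ?T l m" and right: "?T l m * e j = ?T l m"
    and inter: "h i ^ F i j * ?T l m = ?T l m * h j ^ F j i" for l m
  proof -
    have "e i * ?T l m = ?T l m \<and> ?T l m * e j = ?T l m \<and> h i ^ F i j * ?T l m = ?T l m * h j ^ F j i"
    proof (cases "((i, l), (j, m)) \<in> Sg")
      case True
      let ?a = "\<alpha> (i, l) (j, m) g" and ?t = "\<tau>' i j"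
      have il: "(i, l) \<in> M" and jm: "(j, m) \<in> M" using Sg_M[OF True] by auto
      have Ea: "E (i, l) * ?a = ?a" and aE: "?a * E (j, m) = ?a" using E\<alpha>[OF True] \<alpha>E[OF True] g by simp_all
      have aux: "?a * u (j, m) ^ n * E (j, m) = ?a * u (j, m) ^ n" for n
        unfolding mult.assoc u_E[OF jm] by (simp only: aE mult.assoc[symmetric])
      have 1: "e i * ?a = ?a"
      proof -
        have "e i * ?a = e i * E (i, l) * ?a" by (simp only: mult.assoc Ea)
        then show ?thesis using e_E[OF il i] Ea by simp
      qed
      have 2: "?a * u (j, m) ^ ?t * e j = ?a * u (j, m) ^ ?t"
      proof -
        have "?a * u (j, m) ^ ?t * e j = ?a * u (j, m) ^ ?t * (E (j, m) * e j)"
          by (simp only: aux mult.assoc[symmetric])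
        then show ?thesis using E_e_i[OF jm] aux by simp
      qed
      have "h i ^ F i j * (?a * u (j, m) ^ ?t) = h i ^ F i j * E (i, l) * ?a * u (j, m) ^ ?t"
        by (simp only: mult.assoc[of "h i ^ F i j"] Ea mult.assoc[of _ ?a])
      also have "\<dots> = sc (z i ^ (l * F i j)) * (u (i, l) ^ (yinv i * F i j) * ?a * u (j, m) ^ ?t)"
        unfolding h_E[OF il] by (simp only: mult.assoc) (simp only: Ea mult.assoc[symmetric])
      also have "u (i, l) ^ (yinv i * F i j) * ?a = ?a * u (j, m) ^ (yinv j * F j i)" by (rule \<alpha>_u_F[OF True g])
      also have "?a * u (j, m) ^ (yinv j * F j i) * u (j, m) ^ ?t = ?a * u (j, m) ^ ?t * u (j, m) ^ (yinv j * F j i)"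
        by (simp only: mult.assoc power_add[symmetric] add.commute)
      also have "z i ^ (l * F i j) = z j ^ (m * F j i)" by (rule z_F[OF True])
      also have "sc (z j ^ (m * F j i)) * (?a * u (j, m) ^ ?t * u (j, m) ^ (yinv j * F j i)) =
          ?a * u (j, m) ^ ?t * (sc (z j ^ (m * F j i)) * (u (j, m) ^ (yinv j * F j i) * E (j, m)))"
      proof -
        have "?a * u (j, m) ^ ?t * (u (j, m) ^ (yinv j * F j i) * E (j, m)) = ?a * u (j, m) ^ ?t * u (j, m) ^ (yinv j * F j i)"
          using aux[of "?t + yinv j * F j i"] by (simp only: power_add mult.assoc)
        then show ?thesis unfolding sc_left_comm[of "?a * u (j, m) ^ ?t"] by (simp only:)
      qed
      also have "\<dots> = ?a * u (j, m) ^ ?t * (E (j, m) * h j ^ F j i)"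
        unfolding h_E[OF jm, symmetric] h_E_comm[OF jm] ..
      also have "\<dots> = ?a * u (j, m) ^ ?t * h j ^ F j i" by (simp only: aux mult.assoc[symmetric])
      finally show ?thesis using 1 2 True by (simp add: mult.assoc[symmetric])
    next
      case False
      then show ?thesis by simp
    qed
    then show "e i * ?T l m = ?T l m" "?T l m * e j = ?T l m" "h i ^ F i j * ?T l m = ?T l m * h j ^ F j i"
      by blast+
  qed
  let ?S = "\<Sum>l<d i. \<Sum>m<d j. ?T l m"
  have "e i * ?S = ?S" unfolding sum_distrib_left by (intro sum.cong refl left)
  then show "e i * A i j g = A i j g" unfolding A by (simp only: sc_left_comm)
  have "?S * e j = ?S" unfolding sum_distrib_right by (intro sum.cong refl right)
  then show "A i j g * e j = A i j g" unfolding A by (simp only: mult.assoc)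
  have "h i ^ F i j * ?S = ?S * h j ^ F j i"
    unfolding sum_distrib_left sum_distrib_right by (intro sum.cong refl inter)
  then show "h i ^ F i j * A i j g = A i j g * h j ^ F j i" unfolding A by (simp only: sc_left_comm mult.assoc)
qed

text \<open>On \<open>E (i, m)\<close>, the \<open>q i\<close>-th power of the unipotent factor is
  1, so \<open>h i ^ q i\<close> acts there as \<open>z i ^ (m * q i)\<close>. The spectral
  projectors of \<open>h i ^ q i\<close> therefore are the given idempotents.\<close>

lemma gE_back:
  assumes il: "(i, l) \<in> M"
  shows "gE e h (i, l) = E (i, l)"
proof -
  interpret B: ei_action I \<Omega> N P r d xinv yinv z sc e h A by (rule ei_action_back)
  have i: "i \<in> I" using il by (simp add: M_iff)
  interpret C: cyclic_action sc "e i" "h i" "q i" "d i" "xinv i" "yinv i" "z i" by (rule B.cyc[OF i])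
  have "gE e h (i, l) * E (i, m) = (if l = m then E (i, m) else 0)" if im: "(i, m) \<in> M" for m
    unfolding B.E_eq
  proof (rule C.E_eigen)
    show "l < d i" "m < d i" using il im by (auto simp: M_iff)
    show "e i * E (i, m) = E (i, m)" using e_E[OF im i] by simp
    have "u (i, m) ^ (yinv i * q i) = 1"
      using u_cong[OF im, of "yinv i * q i" 0] by (simp add: cong_0_iff)
    then show "h i ^ q i * E (i, m) = sc (z i ^ (m * q i)) * E (i, m)" by (simp add: h_E[OF im])
  qed
  note * = this
  show ?thesis
  proof (rule ext_E[OF i B.E_e[OF i] E_e_i[OF il]])
    fix m assume im: "(i, m) \<in> M"
    show "gE e h (i, l) * E (i, m) = E (i, l) * E (i, m)"
      unfolding *[OF im] EE[OF il im] by auto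
  qed
qed

text \<open>The power \<open>d i\<close> removes the scalar part of \<open>h i\<close> and turns the
  exponent \<open>yinv i\<close> into 1 modulo \<open>q i\<close>.\<close>

lemma u_y:
  assumes il: "(i, l) \<in> M"
  shows "(h i ^ d i) ^ n * E (i, l) = u (i, l) ^ n * E (i, l)"
proof -
  have i: "i \<in> I" using il by (simp add: M_iff)
  have "z i ^ (l * (d i * n)) = (z i ^ d i) ^ (l * n)" by (simp only: power_mult[symmetric] ac_simps)
  also have "z i ^ d i = 1" using prim[OF i] by (simp add: primitive_root_def)
  finally have 1: "z i ^ (l * (d i * n)) = 1" by simp
  have "[yinv i * d i * n = 1 * n] (mod q i)" by (rule cong_scalar_right) (rule y_inv[OF i])
  then have "u (i, l) ^ (yinv i * d i * n) = u (i, l) ^ (1 * n)" by (rule u_cong[OF il])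
  then show ?thesis by (simp add: h_E[OF il] 1 mult.assoc flip: power_mult)
qed

lemma g\<epsilon>_back:
  assumes il: "(i, l) \<in> M"
  shows "g\<epsilon> e h (i, l) = \<epsilon> (i, l)"
proof -
  have "g\<epsilon> e h (i, l) = h i ^ d i * E (i, l) - E (i, l)"
    by (simp add: g\<epsilon>_def gE_back[OF il] left_diff_distrib)
  also have "h i ^ d i * E (i, l) = u (i, l) * E (i, l)" using u_y[OF il, of 1] by simp
  finally show ?thesis using il by (simp add: distrib_right \<epsilon>E)
qed

text \<open>Between \<open>E (i, l)\<close> and \<open>E (j, m)\<close> a single block of
  \<open>A i j g\<close> survives; the scalars \<kappa> and the twists then cancel.\<close>

lemma g\<alpha>_back:
  assumes ab: "((i, l), (j, m)) \<in> Sg" and g: "g \<in> {1..N i j}"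
  shows "g\<alpha> e h A (i, l) (j, m) g = \<alpha> (i, l) (j, m) g"
proof -
  have il: "(i, l) \<in> M" and jm: "(j, m) \<in> M" using Sg_M[OF ab] by auto
  have i: "i \<in> I" using il by (simp add: M_iff)
  have l: "l < d i" and m: "m < d j" using il jm by (auto simp: M_iff)
  let ?T = "\<lambda>l m. if ((i, l), (j, m)) \<in> Sg then \<alpha> (i, l) (j, m) g * u (j, m) ^ \<tau>' i j else 0"
  have comp: "E (i, l) * ?T l' m' * E (j, m) = (if l' = l \<and> m' = m then \<alpha> (i, l) (j, m) g * u (j, m) ^ \<tau>' i j else 0)" for l' m'
  proof (cases "((i, l'), (j, m')) \<in> Sg")
    case True
    let ?a = "\<alpha> (i, l') (j, m') g"
    have il': "(i, l') \<in> M" and jm': "(j, m') \<in> M" using Sg_M[OF True] by auto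
    have Ea: "E (i, l') * ?a = ?a" and aE: "?a * E (j, m') = ?a" using E\<alpha>[OF True] \<alpha>E[OF True] g by simp_all
    have "E (i, l) * (?a * u (j, m') ^ \<tau>' i j) * E (j, m) =
        E (i, l) * (E (i, l') * ?a * E (j, m') * u (j, m') ^ \<tau>' i j) * E (j, m)" by (simp only: Ea aE)
    also have "\<dots> = (E (i, l) * E (i, l')) * ?a * u (j, m') ^ \<tau>' i j * (E (j, m') * E (j, m))"
      using u_E[OF jm'] by (simp only: mult.assoc) (simp only: mult.assoc[symmetric] u_E[OF jm', symmetric])
    finally have "E (i, l) * (?a * u (j, m') ^ \<tau>' i j) * E (j, m) =
      (E (i, l) * E (i, l')) * ?a * u (j, m') ^ \<tau>' i j * (E (j, m') * E (j, m))" .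
    moreover have "?a * u (j, m') ^ \<tau>' i j * E (j, m') = ?a * u (j, m') ^ \<tau>' i j"
      unfolding mult.assoc u_E[OF jm'] by (simp only: aE mult.assoc[symmetric])
    ultimately show ?thesis using True Ea EE[OF il il'] EE[OF jm' jm] by auto
  next
    case False
    with ab show ?thesis by auto
  qed
  have "E (i, l) * A i j g * E (j, m) = sc (inverse (\<kappa> i j)) * (E (i, l) * (\<Sum>l'<d i. \<Sum>m'<d j. ?T l' m') * E (j, m))"
    by (simp only: bA_def sc_left_comm mult.assoc)
  also have "E (i, l) * (\<Sum>l'<d i. \<Sum>m'<d j. ?T l' m') * E (j, m) =
      (\<Sum>l'<d i. \<Sum>m'<d j. if l' = l \<and> m' = m then \<alpha> (i, l) (j, m) g * u (j, m) ^ \<tau>' i j else 0)"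
    unfolding sandwich_sum2 comp ..
  also have "\<dots> = (\<Sum>l'<d i. if l' = l then \<Sum>m'<d j. if m' = m then \<alpha> (i, l) (j, m) g * u (j, m) ^ \<tau>' i j else 0 else 0)"
    by (intro sum.cong refl) auto
  also have "\<dots> = \<alpha> (i, l) (j, m) g * u (j, m) ^ \<tau>' i j" using l m by simp
  finally have EAE: "E (i, l) * A i j g * E (j, m) = sc (inverse (\<kappa> i j)) * (\<alpha> (i, l) (j, m) g * u (j, m) ^ \<tau>' i j)" .
  have "g\<alpha> e h A (i, l) (j, m) g = sc (\<kappa> i j) * (E (i, l) * (A i j g * ((h j ^ d j) ^ \<tau> i j * E (j, m))))"
    by (simp add: g\<alpha>_def gE_back[OF il] gE_back[OF jm])
  also have "\<dots> = sc (\<kappa> i j) * ((E (i, l) * A i j g * E (j, m)) * u (j, m) ^ \<tau> i j)"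
    unfolding u_y[OF jm] u_E[OF jm] by (simp only: mult.assoc)
  also have "\<dots> = sc (\<kappa> i j * inverse (\<kappa> i j)) * (\<alpha> (i, l) (j, m) g * u (j, m) ^ (\<tau>' i j + \<tau> i j))"
    unfolding EAE by (simp only: mult.assoc sc_mult power_add)
  also have "u (j, m) ^ (\<tau>' i j + \<tau> i j) = 1"
    using \<tau>_\<tau>'[of i j] u_q[OF jm] by (auto simp: add.commute)
  finally show ?thesis using \<kappa>_nonzero[OF i] by simp
qed

lemma gp_relator_back:
  assumes il: "(i, l) \<in> M"
  shows "gp_relator (g\<epsilon> e h) (g\<alpha> e h A) (i, l) = gp_relator \<epsilon> \<alpha> (i, l)"
  unfolding gp_relator_def fst_conv g\<epsilon>_back[OF il]
proof (intro sum.cong refl arg_cong2[of _ _ _ _ "(*)"])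
  fix y g assume "y \<in> {y. (y, i, l) \<in> Sg}" and g: "g \<in> {1..N (fst y) i}"
  then obtain j m where y: "y = (j, m)" and ji: "((j, m), (i, l)) \<in> Sg" by (cases y) auto
  have ij: "((i, l), (j, m)) \<in> Sg" using Sg_sym[OF ji] .
  then have "N i j = N j i" by (intro dbl_N) (simp add: Sg_iff)
  then have "g \<in> {1..N j i}" "g \<in> {1..N i j}" using g by (auto simp: y)
  then show "g\<alpha> e h A (i, l) y g = \<alpha> (i, l) y g" "g\<alpha> e h A y (i, l) g = \<alpha> y (i, l) g"
    using g\<alpha>_back[OF ij] g\<alpha>_back[OF ji] by (simp_all add: y)
qed

text \<open>Going back and then forward restores the generators, so \<open>ei_relator_iff\<close>,
  applied to the converted action, speaks of the given mesh relators.\<close>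

lemma ei_relator_back:
  assumes "\<And>a. a \<in> M \<Longrightarrow> gp_relator \<epsilon> \<alpha> a = 0" "i \<in> I"
  shows "ei_relator h A i = 0"
  using ei_action.ei_relator_iff[OF ei_action_back assms(2)] assms gp_relator_back by (simp add: M_iff)

end

section \<open>Subalgebras of a product, and their stability under both substitutions\<close>

section \<open>Pairs of representations\<close>

text \<open>
  A subalgebra of a product, written as a relation.  The graph of the isomorphism is obtained as such a
  subalgebra that is generated by the pairs of old generators as well as by the pairs of new generators.
\<close>

locale linked = S: scalars sc + S': scalars sc'
  for sc :: "'k::field \<Rightarrow> 't::ring_1" and sc' :: "'k \<Rightarrow> 's::ring_1" +
  fixes R :: "'t \<Rightarrow> 's \<Rightarrow> bool"
  assumes R_zero: "R 0 0"
    and R_add: "R a a' \<Longrightarrow> R b b' \<Longrightarrow> R (a + b) (a' + b')"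
    and R_mult: "R a a' \<Longrightarrow> R b b' \<Longrightarrow> R (a * b) (a' * b')"
    and R_sc: "R a a' \<Longrightarrow> R (sc c * a) (sc' c * a')"
begin

lemma R_diff: "R a a' \<Longrightarrow> R b b' \<Longrightarrow> R (a - b) (a' - b')"
  using R_add[of a a' "sc (- 1) * b" "sc' (- 1) * b'"] R_sc[of b b' "- 1"]
  by (simp add: S.sc_minus S'.sc_minus)

lemma R_sum: "(\<And>x. x \<in> X \<Longrightarrow> R (f x) (f' x)) \<Longrightarrow> R (sum f X) (sum f' X)"
  by (induction X rule: infinite_finite_induct) (auto intro: R_zero R_add)

text \<open>Powers are treated together with a further factor, because \<open>R\<close> need not
  relate the two units.\<close>

lemma R_power_mult: "R a a' \<Longrightarrow> R b b' \<Longrightarrow> R (a ^ n * b) (a' ^ n * b')"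
  by (induction n) (auto simp: mult.assoc intro: R_mult)

lemma R_one_plus_power_mult: "R a a' \<Longrightarrow> R b b' \<Longrightarrow> R ((1 + a) ^ n * b) ((1 + a') ^ n * b')"
  by (induction n) (auto simp: mult.assoc distrib_right intro: R_mult R_add)

lemma R_mult_one_plus_power: "R a a' \<Longrightarrow> R b b' \<Longrightarrow> R (b * (1 + a) ^ n) (b' * (1 + a') ^ n)"
  by (induction n) (auto simp: power_Suc2 distrib_left simp del: power_Suc simp flip: mult.assoc intro: R_mult R_add)

end

locale species_linked = species I \<Omega> N P r d xinv yinv z + linked sc sc' R
  for I :: "'v set" and \<Omega> N P r d xinv yinv and z :: "'v \<Rightarrow> 'k::field"
    and sc :: "'k \<Rightarrow> 't::ring_1" and sc' :: "'k \<Rightarrow> 's::ring_1" and R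
begin

sublocale A: species_algebra I \<Omega> N P r d xinv yinv z sc ..
sublocale A': species_algebra I \<Omega> N P r d xinv yinv z sc' ..

lemma R_be: "(\<And>a. a \<in> M \<Longrightarrow> R (E a) (E' a)) \<Longrightarrow> i \<in> I \<Longrightarrow> R (A.be E i) (A'.be E' i)"
  unfolding A.be_def A'.be_def by (rule R_sum) (simp add: M_iff)

lemma R_bh:
  assumes "\<And>a. a \<in> M \<Longrightarrow> R (E a) (E' a)" "\<And>a. a \<in> M \<Longrightarrow> R (\<epsilon> a) (\<epsilon>' a)" "i \<in> I"
  shows "R (A.bh E \<epsilon> i) (A'.bh E' \<epsilon>' i)"
  unfolding A.bh_def A'.bh_def
  by (intro R_sum R_sc R_one_plus_power_mult assms) (use assms(3) in \<open>simp_all add: M_iff\<close>)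

lemma R_bA:
  assumes \<epsilon>: "\<And>a. a \<in> M \<Longrightarrow> R (\<epsilon> a) (\<epsilon>' a)"
    and \<alpha>: "\<And>a b g. (a, b) \<in> Sg \<Longrightarrow> g \<in> {1..N (fst a) (fst b)} \<Longrightarrow> R (\<alpha> a b g) (\<alpha>' a b g)"
    and g: "g \<in> {1..N i j}"
  shows "R (A.bA \<epsilon> \<alpha> i j g) (A'.bA \<epsilon>' \<alpha>' i j g)"
proof -
  have "R (if ((i, l), (j, m)) \<in> Sg then \<alpha> (i, l) (j, m) g * (1 + \<epsilon> (j, m)) ^ \<tau>' i j else 0)
    (if ((i, l), (j, m)) \<in> Sg then \<alpha>' (i, l) (j, m) g * (1 + \<epsilon>' (j, m)) ^ \<tau>' i j else 0)" for l m
    using \<alpha>[of "(i, l)" "(j, m)" g] \<epsilon>[of "(j, m)"] g Sg_M R_zero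
    by (auto intro!: R_mult_one_plus_power)
  then show ?thesis unfolding A.bA_def A'.bA_def by (intro R_sc R_sum)
qed

lemma R_gE:
  assumes h: "R (h i) (h' i)" and e: "R (e i) (e' i)"
    and A: "ei_action I \<Omega> N P r d xinv yinv z sc e h A" and A': "ei_action I \<Omega> N P r d xinv yinv z sc' e' h' A'"
    and i: "i \<in> I"
  shows "R (A.gE e h (i, l)) (A'.gE e' h' (i, l))"
  unfolding ei_action.E_eq[OF A] ei_action.E_eq[OF A']
    cyclic_action.E_def[OF ei_action.cyc[OF A i]] cyclic_action.E_def[OF ei_action.cyc[OF A' i]]
  by (intro R_sum R_sc R_power_mult h e)

lemma R_g\<epsilon>:
  assumes "R (h i) (h' i)" "R (A.gE e h (i, l)) (A'.gE e' h' (i, l))"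
  shows "R (A.g\<epsilon> e h (i, l)) (A'.g\<epsilon> e' h' (i, l))"
  using assms by (simp add: A.g\<epsilon>_def A'.g\<epsilon>_def left_diff_distrib R_diff R_power_mult)

lemma R_g\<alpha>:
  assumes "R (h j) (h' j)" "R (A.gE e h (i, l)) (A'.gE e' h' (i, l))" "R (A.gE e h (j, m)) (A'.gE e' h' (j, m))"
    "R (A i j g) (A' i j g)"
  shows "R (A.g\<alpha> e h A (i, l) (j, m) g) (A'.g\<alpha> e' h' A' (i, l) (j, m) g)"
  using assms by (auto simp: A.g\<alpha>_def A'.g\<alpha>_def simp flip: power_mult intro!: R_sc R_mult R_power_mult)

end

section \<open>Homomorphisms out of the path algebra of the second triple\<close>

section \<open>Presentations of generalized preprojective algebras\<close>

text \<open>The power with exponent 0 is the unit, which \<open>f\<close> may fail to preserve;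
  hence the additional factor \<open>y\<close>, or the condition \<open>n > 0\<close>.\<close>

lemma nonunital_hom_simps:
  fixes C :: "('o, 'm) small_cat" and f :: "('m \<Rightarrow>\<^sub>0 'k::field) \<Rightarrow> 't::ring_1"
  assumes "finite_cat C" "scalars sc" "nonunital_hom (cat_alg C) sc f"
  shows "f 0 = 0"
    and "\<And>x y. x \<in> carrier (cat_alg C) \<Longrightarrow> y \<in> carrier (cat_alg C) \<Longrightarrow> f (x - y) = f x - f y"
    and "\<And>X g. (\<And>x. x \<in> X \<Longrightarrow> g x \<in> carrier (cat_alg C)) \<Longrightarrow> f (sum g X) = (\<Sum>x\<in>X. f (g x))"
    and "\<And>x y n. x \<in> carrier (cat_alg C) \<Longrightarrow> y \<in> carrier (cat_alg C) \<Longrightarrow>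
      f (x [^]\<^bsub>cat_alg C\<^esub> (n :: nat) \<otimes>\<^bsub>cat_alg C\<^esub> y) = f x ^ n * f y"
    and "\<And>x y n. x \<in> carrier (cat_alg C) \<Longrightarrow> y \<in> carrier (cat_alg C) \<Longrightarrow>
      f (y \<otimes>\<^bsub>cat_alg C\<^esub> x [^]\<^bsub>cat_alg C\<^esub> (n :: nat)) = f y * f x ^ n"
    and "\<And>x n. x \<in> carrier (cat_alg C) \<Longrightarrow> n > 0 \<Longrightarrow> f (x [^]\<^bsub>cat_alg C\<^esub> (n :: nat)) = f x ^ n"
proof -
  interpret finite_cat C by fact
  interpret scalars sc by fact
  interpret ring "A :: ('k, 'm \<Rightarrow>\<^sub>0 'k) module" by (rule ring_cat_alg)
  note hs = nonunital_homD[OF assms(3), unfolded cat_alg_simps]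
  show f0: "f 0 = 0" using hs(1)[of 0 0] zero_carrier by simp
  show "f (x - y) = f x - f y" if "x \<in> carrier A" "y \<in> carrier A" for x y :: "'m \<Rightarrow>\<^sub>0 'k"
  proof -
    have "x - y \<in> carrier A" using add_carrier[OF that(1) minus_carrier[OF that(2)]] by simp
    from hs(1)[OF this that(2)] show ?thesis by simp
  qed
  show "f (sum g X) = (\<Sum>x\<in>X. f (g x))" if "\<And>x. x \<in> X \<Longrightarrow> g x \<in> carrier A" for X :: "'x set" and g :: "'x \<Rightarrow> 'm \<Rightarrow>\<^sub>0 'k"
    using that by (induction X rule: infinite_finite_induct) (simp_all add: f0 hs(1) sum_carrier)
  have pow: "x [^]\<^bsub>A\<^esub> (n :: nat) \<in> carrier A" if "x \<in> carrier A" for x :: "'m \<Rightarrow>\<^sub>0 'k" and n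
    using that by (rule nat_pow_closed)
  show l: "f (x [^]\<^bsub>A\<^esub> (n :: nat) \<otimes>\<^bsub>A\<^esub> y) = f x ^ n * f y" if x: "x \<in> carrier A" and y: "y \<in> carrier A"
    for x y :: "'m \<Rightarrow>\<^sub>0 'k" and n
    using y
  proof (induction n arbitrary: y)
    case 0
    then show ?case unfolding nat_pow_0 one_mult[OF 0] by simp
  next
    case (Suc n)
    have "x [^]\<^bsub>A\<^esub> Suc n \<otimes>\<^bsub>A\<^esub> y = x [^]\<^bsub>A\<^esub> n \<otimes>\<^bsub>A\<^esub> (x \<otimes>\<^bsub>A\<^esub> y)"
      unfolding nat_pow_Suc by (rule mult_assoc[OF pow[OF x] x Suc.prems])
    then have "f (x [^]\<^bsub>A\<^esub> Suc n \<otimes>\<^bsub>A\<^esub> y) = f x ^ n * f (x \<otimes>\<^bsub>A\<^esub> y)"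
      using Suc.IH[OF mult_carrier[OF x Suc.prems]] by (simp only:)
    then show ?case unfolding hs(2)[OF x Suc.prems] by (simp only: power_Suc2 mult.assoc)
  qed
  show "f (y \<otimes>\<^bsub>A\<^esub> x [^]\<^bsub>A\<^esub> (n :: nat)) = f y * f x ^ n" if x: "x \<in> carrier A" and y: "y \<in> carrier A"
    for x y :: "'m \<Rightarrow>\<^sub>0 'k" and n
  proof (induction n)
    case 0
    then show ?case unfolding nat_pow_0 mult_one[OF y] by simp
  next
    case (Suc n)
    have "y \<otimes>\<^bsub>A\<^esub> x [^]\<^bsub>A\<^esub> Suc n = y \<otimes>\<^bsub>A\<^esub> x [^]\<^bsub>A\<^esub> n \<otimes>\<^bsub>A\<^esub> x"
      unfolding nat_pow_Suc by (rule mult_assoc[OF y pow[OF x] x, symmetric])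
    then have "f (y \<otimes>\<^bsub>A\<^esub> x [^]\<^bsub>A\<^esub> Suc n) = f (y \<otimes>\<^bsub>A\<^esub> x [^]\<^bsub>A\<^esub> n) * f x"
      using hs(2)[OF mult_carrier[OF y pow[OF x]] x] by (simp only:)
    then show ?case unfolding Suc.IH by (simp only: power_Suc2 mult.assoc)
  qed
  show "f (x [^]\<^bsub>A\<^esub> (n :: nat)) = f x ^ n" if x: "x \<in> carrier A" and n: "n > 0"
    for x :: "'m \<Rightarrow>\<^sub>0 'k" and n
  proof -
    obtain m where m: "n = Suc m" using n gr0_conv_Suc by blast
    show ?thesis unfolding m nat_pow_Suc l[OF x x] by (simp only: power_Suc2)
  qed
qed

lemma compr3: "{h i j g |i j g. P i j g} = (\<lambda>(i, j, g). h i j g) ` {(i, j, g). P i j g}"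
  by (auto simp: image_iff) blast

text \<open>The properties of the triple on \<open>M\<close> by which its defining relations become
  those of \<open>gp_action\<close> and \<open>gp_relator\<close>.\<close>

locale gp_model = species I \<Omega> N P r d xinv yinv z
  for I :: "'v set" and \<Omega> N P r d xinv yinv and z :: "'v \<Rightarrow> 'k::field" +
  fixes C' :: "'v \<times> nat \<Rightarrow> 'v \<times> nat \<Rightarrow> int" and D' :: "'v \<times> nat \<Rightarrow> nat"
    and \<Omega>' :: "(('v \<times> nat) \<times> ('v \<times> nat)) set"
  assumes dbl': "double_orientation \<Omega>' = Sg"
    and C'_g: "(a, b) \<in> Sg \<Longrightarrow> cartan_g C' a b = N (fst a) (fst b)"
    and C'_f: "(a, b) \<in> Sg \<Longrightarrow> cartan_f C' b a = qq (fst a) (fst b)"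
    and D': "a \<in> M \<Longrightarrow> D' a = q (fst a)"
    and sgn': "(a, b) \<in> Sg \<Longrightarrow> gp_sgn \<Omega>' a b = sgn (fst a) (fst b)"
begin

abbreviation "G \<equiv> gp_quiver M C' \<Omega>'"
abbreviation "B \<equiv> path_alg G :: ('k, _) module"

lemma arcs_iff: "Alpha a b g \<in> arcs G \<longleftrightarrow> (a, b) \<in> Sg \<and> g \<in> {1..N (fst a) (fst b)}"
  "Eps a \<in> arcs G \<longleftrightarrow> a \<in> M"
  unfolding gp_quiver_def dbl' by (auto simp: C'_g simp del: split_paired_Ex)

lemma ends [simp]: "tail G (Alpha a b g) = b" "head G (Alpha a b g) = a" "tail G (Eps a) = a" "head G (Eps a) = a"
  "verts G = M"
  by (simp_all add: gp_quiver_def)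

lemma arc_cases:
  assumes "x \<in> arcs G"
  obtains a b g where "x = Alpha a b g" "(a, b) \<in> Sg" "g \<in> {1..N (fst a) (fst b)}"
  | a where "x = Eps a" "a \<in> M"
  using assms arcs_iff by (cases x) auto

lemma wf_G: "wf_digraph G"
proof
  fix x assume x: "x \<in> arcs G"
  show "tail G x \<in> verts G" "head G x \<in> verts G" using x by (cases rule: arc_cases; auto dest: Sg_M)+
qed

sublocale G: wf_digraph G by (rule wf_G)

lemma finite_cat_G: "finite_cat (path_cat G)"
  using finite_M by (intro G.finite_cat_path_cat) simp

sublocale PC: finite_cat "path_cat G" by (rule finite_cat_G)

lemma mors_path_cat: "(u, p, v) \<in> mors (path_cat G) \<longleftrightarrow> G.awalk u p v"
  by (simp add: path_cat_def qpaths_def)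

lemma gens_carrier [simp]:
  shows "a \<in> M \<Longrightarrow> (gp_eps a :: _ \<Rightarrow>\<^sub>0 'k) \<in> carrier B"
    and "(a, b) \<in> Sg \<Longrightarrow> g \<in> {1..N (fst a) (fst b)} \<Longrightarrow> (gp_alpha a b g :: _ \<Rightarrow>\<^sub>0 'k) \<in> carrier B"
    and "a \<in> M \<Longrightarrow> (basis_elt (a, [], a) :: _ \<Rightarrow>\<^sub>0 'k) \<in> carrier B"
proof -
  show "a \<in> M \<Longrightarrow> (gp_eps a :: _ \<Rightarrow>\<^sub>0 'k) \<in> carrier B"
    by (rule PC.single_carrier) (simp add: mors_path_cat G.awalk_Cons_iff G.awalk_Nil_iff arcs_iff)
  show "a \<in> M \<Longrightarrow> (basis_elt (a, [], a) :: _ \<Rightarrow>\<^sub>0 'k) \<in> carrier B"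
    by (rule PC.single_carrier) (simp add: mors_path_cat G.awalk_Nil_iff)
  show "(gp_alpha a b g :: _ \<Rightarrow>\<^sub>0 'k) \<in> carrier B" if "(a, b) \<in> Sg" "g \<in> {1..N (fst a) (fst b)}"
    using Sg_M[OF that(1)] that
    by (intro PC.single_carrier) (simp add: mors_path_cat G.awalk_Cons_iff G.awalk_Nil_iff arcs_iff)
qed

abbreviation Rel :: "((('v \<times> nat), ('v \<times> nat) gp_arrow) qpath \<Rightarrow>\<^sub>0 'k) set" where
  "Rel \<equiv> gp_relations M C' D' \<Omega>'"

definition mesh :: "'v \<times> nat \<Rightarrow> (('v \<times> nat), ('v \<times> nat) gp_arrow) qpath \<Rightarrow>\<^sub>0 'k" where
  "mesh a = (\<Sum>b\<in>{b. (b, a) \<in> Sg}. \<Sum>g=1..N (fst b) (fst a). \<Sum>f<qq (fst a) (fst b).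
     sgn (fst a) (fst b) \<odot>\<^bsub>B\<^esub> (gp_eps a [^]\<^bsub>B\<^esub> f \<otimes>\<^bsub>B\<^esub> gp_alpha a b g \<otimes>\<^bsub>B\<^esub> gp_alpha b a g
       \<otimes>\<^bsub>B\<^esub> gp_eps a [^]\<^bsub>B\<^esub> (qq (fst a) (fst b) - 1 - f)))"

lemma Rel_eq: "Rel = (\<lambda>a. gp_eps a [^]\<^bsub>B\<^esub> q (fst a)) ` M \<union>
    (\<lambda>(a, b, g). gp_eps a [^]\<^bsub>B\<^esub> qq (fst a) (fst b) \<otimes>\<^bsub>B\<^esub> gp_alpha a b g
      - gp_alpha a b g \<otimes>\<^bsub>B\<^esub> gp_eps b [^]\<^bsub>B\<^esub> qq (fst b) (fst a)) `
        {(a, b, g). (a, b) \<in> Sg \<and> g \<in> {1..N (fst a) (fst b)}} \<union> mesh ` M"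
proof -
  have 1: "{gp_eps k [^]\<^bsub>B\<^esub> D' k |k. k \<in> M} = (\<lambda>a. gp_eps a [^]\<^bsub>B\<^esub> q (fst a)) ` M"
  proof -
    have "{gp_eps k [^]\<^bsub>B\<^esub> D' k |k. k \<in> M} = (\<lambda>k. gp_eps k [^]\<^bsub>B\<^esub> D' k) ` M" by blast
    also have "\<dots> = (\<lambda>a. gp_eps a [^]\<^bsub>B\<^esub> q (fst a)) ` M" by (rule image_cong) (simp_all only: D')
    finally show ?thesis .
  qed
  have 2: "{gp_eps i [^]\<^bsub>B\<^esub> cartan_f C' j i \<otimes>\<^bsub>B\<^esub> gp_alpha i j g
         - gp_alpha i j g \<otimes>\<^bsub>B\<^esub> gp_eps j [^]\<^bsub>B\<^esub> cartan_f C' i j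
         |i j g. (i, j) \<in> Sg \<and> g \<in> {1..cartan_g C' i j}} =
    (\<lambda>(a, b, g). gp_eps a [^]\<^bsub>B\<^esub> qq (fst a) (fst b) \<otimes>\<^bsub>B\<^esub> gp_alpha a b g
      - gp_alpha a b g \<otimes>\<^bsub>B\<^esub> gp_eps b [^]\<^bsub>B\<^esub> qq (fst b) (fst a)) `
        {(a, b, g). (a, b) \<in> Sg \<and> g \<in> {1..N (fst a) (fst b)}}" (is "?L = ?f ` ?X")
  proof -
    have "?L = (\<lambda>(i, j, g). gp_eps i [^]\<^bsub>B\<^esub> cartan_f C' j i \<otimes>\<^bsub>B\<^esub> gp_alpha i j g
         - gp_alpha i j g \<otimes>\<^bsub>B\<^esub> gp_eps j [^]\<^bsub>B\<^esub> cartan_f C' i j) ` {(i, j, g). (i, j) \<in> Sg \<and> g \<in> {1..cartan_g C' i j}}"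
      by (rule compr3)
    also have "\<dots> = ?f ` ?X"
    proof (rule image_cong)
      show "{(i, j, g). (i, j) \<in> Sg \<and> g \<in> {1..cartan_g C' i j}} = ?X" using C'_g by auto
      fix x assume "x \<in> ?X"
      then obtain a b g where x: "x = (a, b, g)" "(a, b) \<in> Sg" by (cases x) auto
      show "(case x of (i, j, g) \<Rightarrow> gp_eps i [^]\<^bsub>B\<^esub> cartan_f C' j i \<otimes>\<^bsub>B\<^esub> gp_alpha i j g
         - gp_alpha i j g \<otimes>\<^bsub>B\<^esub> gp_eps j [^]\<^bsub>B\<^esub> cartan_f C' i j) = ?f x"
        unfolding x prod.case C'_f[OF x(2)] C'_f[OF Sg_sym[OF x(2)]] ..
    qed
    finally show ?thesis .
  qed
  have 3: "(\<Sum>j\<in>{j. (j, i) \<in> Sg}. \<Sum>g=1..cartan_g C' j i. \<Sum>f<cartan_f C' j i.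
         gp_sgn \<Omega>' i j \<odot>\<^bsub>B\<^esub> (gp_eps i [^]\<^bsub>B\<^esub> f \<otimes>\<^bsub>B\<^esub> gp_alpha i j g \<otimes>\<^bsub>B\<^esub> gp_alpha j i g
             \<otimes>\<^bsub>B\<^esub> gp_eps i [^]\<^bsub>B\<^esub> (cartan_f C' j i - 1 - f))) = mesh i" for i
    unfolding mesh_def
  proof (rule sum.cong[OF refl])
    fix j assume "j \<in> {j. (j, i) \<in> Sg}"
    then have ji: "(j, i) \<in> Sg" and ij: "(i, j) \<in> Sg" by (simp_all add: Sg_sym)
    show "(\<Sum>g=1..cartan_g C' j i. \<Sum>f<cartan_f C' j i.
         gp_sgn \<Omega>' i j \<odot>\<^bsub>B\<^esub> (gp_eps i [^]\<^bsub>B\<^esub> f \<otimes>\<^bsub>B\<^esub> gp_alpha i j g \<otimes>\<^bsub>B\<^esub> gp_alpha j i g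
             \<otimes>\<^bsub>B\<^esub> gp_eps i [^]\<^bsub>B\<^esub> (cartan_f C' j i - 1 - f))) =
       (\<Sum>g=1..N (fst j) (fst i). \<Sum>f<qq (fst i) (fst j). sgn (fst i) (fst j) \<odot>\<^bsub>B\<^esub>
         (gp_eps i [^]\<^bsub>B\<^esub> f \<otimes>\<^bsub>B\<^esub> gp_alpha i j g \<otimes>\<^bsub>B\<^esub> gp_alpha j i g
             \<otimes>\<^bsub>B\<^esub> gp_eps i [^]\<^bsub>B\<^esub> (qq (fst i) (fst j) - 1 - f)))"
      unfolding C'_g[OF ji] C'_f[OF ij] sgn'[OF ij] ..
  qed
  show ?thesis
    unfolding gp_relations_def Let_def dbl' 1 2 3 by auto
qed

end

locale gp_hom = gp_model I \<Omega> N P r d xinv yinv z C' D' \<Omega>' + scalars sc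
  for I :: "'v set" and \<Omega> N P r d xinv yinv and z :: "'v \<Rightarrow> 'k::field" and C' D' \<Omega>'
    and sc :: "'k \<Rightarrow> 't::ring_1" +
  fixes f :: "(('v \<times> nat, ('v \<times> nat) gp_arrow) qpath \<Rightarrow>\<^sub>0 'k) \<Rightarrow> 't"
  assumes hom: "nonunital_hom (path_alg (gp_quiver M C' \<Omega>')) sc f"
begin

sublocale SA: species_algebra I \<Omega> N P r d xinv yinv z sc ..

lemmas f_simps = nonunital_homD[OF hom]
lemmas f_simps' = nonunital_hom_simps[OF finite_cat_G scalars_axioms hom]

definition fE :: "'v \<times> nat \<Rightarrow> 't" where "fE a = f (basis_elt (a, [], a))"
definition f\<epsilon> :: "'v \<times> nat \<Rightarrow> 't" where "f\<epsilon> a = f (gp_eps a)"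
definition f\<alpha> :: "'v \<times> nat \<Rightarrow> 'v \<times> nat \<Rightarrow> nat \<Rightarrow> 't" where "f\<alpha> a b g = f (gp_alpha a b g)"

lemma f_eps_power: "a \<in> M \<Longrightarrow> f (gp_eps a [^]\<^bsub>B\<^esub> q (fst a)) = f\<epsilon> a ^ q (fst a)"
  unfolding f\<epsilon>_def using q_pos by (intro f_simps'(6) gens_carrier)

lemma f_commutation:
  assumes ab: "(a, b) \<in> Sg" and g: "g \<in> {1..N (fst a) (fst b)}"
  shows "f (gp_eps a [^]\<^bsub>B\<^esub> m \<otimes>\<^bsub>B\<^esub> gp_alpha a b g - gp_alpha a b g \<otimes>\<^bsub>B\<^esub> gp_eps b [^]\<^bsub>B\<^esub> n) =
    f\<epsilon> a ^ m * f\<alpha> a b g - f\<alpha> a b g * f\<epsilon> b ^ n"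
proof -
  interpret ring B by (rule PC.ring_cat_alg)
  have a: "a \<in> M" and b: "b \<in> M" using Sg_M[OF ab] by auto
  note c = gens_carrier(1)[OF a] gens_carrier(1)[OF b] gens_carrier(2)[OF ab g]
  have p: "gp_eps a [^]\<^bsub>B\<^esub> m \<otimes>\<^bsub>B\<^esub> gp_alpha a b g \<in> carrier B" "gp_alpha a b g \<otimes>\<^bsub>B\<^esub> gp_eps b [^]\<^bsub>B\<^esub> n \<in> carrier B"
    by (intro PC.mult_carrier nat_pow_closed c)+
  show ?thesis
    unfolding f_simps'(2)[OF p] f_simps'(4)[OF c(1,3)] f_simps'(5)[OF c(2,3)] f\<epsilon>_def f\<alpha>_def ..
qed

lemma f_mesh:
  assumes a: "a \<in> M"
  shows "mesh a \<in> carrier B" "f (mesh a) = SA.gp_relator f\<epsilon> f\<alpha> a"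
proof -
  interpret ring B by (rule PC.ring_cat_alg)
  have ca: "gp_eps a \<in> carrier B" by (rule gens_carrier(1)[OF a])
  define T where "T b g i = sgn (fst a) (fst b) \<odot>\<^bsub>B\<^esub> (gp_eps a [^]\<^bsub>B\<^esub> i \<otimes>\<^bsub>B\<^esub> gp_alpha a b g \<otimes>\<^bsub>B\<^esub> gp_alpha b a g
       \<otimes>\<^bsub>B\<^esub> gp_eps a [^]\<^bsub>B\<^esub> (qq (fst a) (fst b) - 1 - i))" for b g i
  have T: "T b g i \<in> carrier B \<and> f (T b g i) = sc (sgn (fst a) (fst b)) *
      (f\<epsilon> a ^ i * (f\<alpha> a b g * f\<alpha> b a g * f\<epsilon> a ^ (qq (fst a) (fst b) - 1 - i)))"
    if ba: "b \<in> {b. (b, a) \<in> Sg}" and g: "g \<in> {1..N (fst b) (fst a)}" for b g i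
  proof -
    have ba: "(b, a) \<in> Sg" and ab: "(a, b) \<in> Sg" using ba Sg_sym by auto
    have "N (fst a) (fst b) = N (fst b) (fst a)"
      by (rule dbl_N) (use ab in \<open>cases a; cases b; simp add: Sg_iff\<close>)
    then have g': "g \<in> {1..N (fst a) (fst b)}" using g by simp
    have cab: "gp_alpha a b g \<in> carrier B" and cba: "gp_alpha b a g \<in> carrier B"
      using gens_carrier(2)[OF ab g'] gens_carrier(2)[OF ba g] .
    have p: "gp_eps a [^]\<^bsub>B\<^esub> i \<otimes>\<^bsub>B\<^esub> gp_alpha a b g \<in> carrier B"
      by (intro PC.mult_carrier nat_pow_closed ca cab)
    have p2: "gp_eps a [^]\<^bsub>B\<^esub> i \<otimes>\<^bsub>B\<^esub> gp_alpha a b g \<otimes>\<^bsub>B\<^esub> gp_alpha b a g \<in> carrier B"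
      by (intro PC.mult_carrier p cba)
    have p3: "gp_eps a [^]\<^bsub>B\<^esub> i \<otimes>\<^bsub>B\<^esub> gp_alpha a b g \<otimes>\<^bsub>B\<^esub> gp_alpha b a g
       \<otimes>\<^bsub>B\<^esub> gp_eps a [^]\<^bsub>B\<^esub> (qq (fst a) (fst b) - 1 - i) \<in> carrier B"
      by (intro PC.mult_carrier nat_pow_closed p2 ca)
    have "T b g i \<in> carrier B" unfolding T_def cat_alg_simps by (rule PC.scale_carrier[OF p3])
    moreover have "f (T b g i) = sc (sgn (fst a) (fst b)) *
      (f\<epsilon> a ^ i * (f\<alpha> a b g * f\<alpha> b a g * f\<epsilon> a ^ (qq (fst a) (fst b) - 1 - i)))"
      unfolding T_def f_simps(3)[OF p3] f_simps'(5)[OF ca p2] f_simps(2)[OF p cba] f_simps'(4)[OF ca cab]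
        f\<epsilon>_def f\<alpha>_def by (simp only: mult.assoc)
    ultimately show ?thesis by blast
  qed
  note Tc = T[THEN conjunct1] and Tf = T[THEN conjunct2]
  have mesh: "mesh a = (\<Sum>b\<in>{b. (b, a) \<in> Sg}. \<Sum>g\<in>{1..N (fst b) (fst a)}. \<Sum>i<qq (fst a) (fst b). T b g i)"
    by (simp only: mesh_def T_def)
  have inner_carrier: "(\<Sum>i<qq (fst a) (fst b). T b g i) \<in> carrier B"
    if "b \<in> {b. (b, a) \<in> Sg}" "g \<in> {1..N (fst b) (fst a)}" for b g
    by (rule PC.sum_carrier) (rule Tc[OF that])
  have inner: "f (\<Sum>i<qq (fst a) (fst b). T b g i) = sc (sgn (fst a) (fst b)) * (\<Sum>i<qq (fst a) (fst b).
      f\<epsilon> a ^ i * (f\<alpha> a b g * f\<alpha> b a g * f\<epsilon> a ^ (qq (fst a) (fst b) - 1 - i)))"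
    if "b \<in> {b. (b, a) \<in> Sg}" "g \<in> {1..N (fst b) (fst a)}" for b g
  proof -
    have "f (\<Sum>i<qq (fst a) (fst b). T b g i) = (\<Sum>i<qq (fst a) (fst b). f (T b g i))"
      by (rule f_simps'(3)) (rule Tc[OF that])
    also have "\<dots> = (\<Sum>i<qq (fst a) (fst b). sc (sgn (fst a) (fst b)) *
      (f\<epsilon> a ^ i * (f\<alpha> a b g * f\<alpha> b a g * f\<epsilon> a ^ (qq (fst a) (fst b) - 1 - i))))"
      by (rule sum.cong[OF refl]) (rule Tf[OF that])
    finally show ?thesis by (simp only: sum_distrib_left)
  qed
  have middle_carrier: "(\<Sum>g\<in>{1..N (fst b) (fst a)}. \<Sum>i<qq (fst a) (fst b). T b g i) \<in> carrier B"
    if "b \<in> {b. (b, a) \<in> Sg}" for b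
    by (rule PC.sum_carrier) (rule inner_carrier[OF that])
  have middle: "f (\<Sum>g\<in>{1..N (fst b) (fst a)}. \<Sum>i<qq (fst a) (fst b). T b g i) =
      (\<Sum>g\<in>{1..N (fst b) (fst a)}. f (\<Sum>i<qq (fst a) (fst b). T b g i))"
    if "b \<in> {b. (b, a) \<in> Sg}" for b
    by (rule f_simps'(3)) (rule inner_carrier[OF that])
  show "mesh a \<in> carrier B" unfolding mesh by (rule PC.sum_carrier) (rule middle_carrier)
  have "f (mesh a) = (\<Sum>b\<in>{b. (b, a) \<in> Sg}. f (\<Sum>g\<in>{1..N (fst b) (fst a)}. \<Sum>i<qq (fst a) (fst b). T b g i))"
    unfolding mesh by (rule f_simps'(3)) (rule middle_carrier)
  also have "\<dots> = SA.gp_relator f\<epsilon> f\<alpha> a"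
    unfolding SA.gp_relator_def
  proof (rule sum.cong[OF refl])
    fix b assume b: "b \<in> {b. (b, a) \<in> Sg}"
    show "f (\<Sum>g\<in>{1..N (fst b) (fst a)}. \<Sum>i<qq (fst a) (fst b). T b g i) =
      (\<Sum>g\<in>{1..N (fst b) (fst a)}. sc (sgn (fst a) (fst b)) * (\<Sum>i<qq (fst a) (fst b).
        f\<epsilon> a ^ i * (f\<alpha> a b g * f\<alpha> b a g * f\<epsilon> a ^ (qq (fst a) (fst b) - 1 - i))))"
      unfolding middle[OF b] by (rule sum.cong[OF refl]) (rule inner[OF b])
  qed
  finally show "f (mesh a) = SA.gp_relator f\<epsilon> f\<alpha> a" .
qed

lemma Rel_carrier: "Rel \<subseteq> carrier B"
proof -
  interpret ring B by (rule PC.ring_cat_alg)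
  have "gp_eps a [^]\<^bsub>B\<^esub> m \<otimes>\<^bsub>B\<^esub> gp_alpha a b g - gp_alpha a b g \<otimes>\<^bsub>B\<^esub> gp_eps b [^]\<^bsub>B\<^esub> n \<in> carrier B"
    if ab: "(a, b) \<in> Sg" and g: "g \<in> {1..N (fst a) (fst b)}" for a b g and m n :: nat
  proof -
    have "a \<in> M" "b \<in> M" using Sg_M[OF ab] by auto
    note c = gens_carrier(1)[OF this(1)] gens_carrier(1)[OF this(2)] gens_carrier(2)[OF ab g]
    have p: "gp_eps a [^]\<^bsub>B\<^esub> m \<otimes>\<^bsub>B\<^esub> gp_alpha a b g \<in> carrier B" "gp_alpha a b g \<otimes>\<^bsub>B\<^esub> gp_eps b [^]\<^bsub>B\<^esub> n \<in> carrier B"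
      by (intro PC.mult_carrier nat_pow_closed c)+
    from PC.add_carrier[OF p(1) PC.minus_carrier[OF p(2)]] show ?thesis by simp
  qed
  note comm = this
  have 1: "(\<lambda>(a, b, g). gp_eps a [^]\<^bsub>B\<^esub> qq (fst a) (fst b) \<otimes>\<^bsub>B\<^esub> gp_alpha a b g
      - gp_alpha a b g \<otimes>\<^bsub>B\<^esub> gp_eps b [^]\<^bsub>B\<^esub> qq (fst b) (fst a)) `
        {(a, b, g). (a, b) \<in> Sg \<and> g \<in> {1..N (fst a) (fst b)}} \<subseteq> carrier B"
  proof (rule image_subsetI)
    fix x assume x: "x \<in> {(a, b, g). (a, b) \<in> Sg \<and> g \<in> {1..N (fst a) (fst b)}}"
    obtain a b g where abg: "x = (a, b, g)" by (cases x)
    have "(a, b) \<in> Sg" "g \<in> {1..N (fst a) (fst b)}" using x by (auto simp: abg)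
    then show "(case x of (a, b, g) \<Rightarrow> gp_eps a [^]\<^bsub>B\<^esub> qq (fst a) (fst b) \<otimes>\<^bsub>B\<^esub> gp_alpha a b g
      - gp_alpha a b g \<otimes>\<^bsub>B\<^esub> gp_eps b [^]\<^bsub>B\<^esub> qq (fst b) (fst a)) \<in> carrier B"
      unfolding abg prod.case by (rule comm)
  qed
  have 2: "(\<lambda>a. gp_eps a [^]\<^bsub>B\<^esub> q (fst a)) ` M \<subseteq> carrier B"
    using nat_pow_closed[OF gens_carrier(1)] by blast
  have 3: "mesh ` M \<subseteq> carrier B" using f_mesh(1) by blast
  show ?thesis unfolding Rel_eq using 1 2 3 by (intro Un_least)
qed

lemma path_mult:
  "basis_elt (v', q', v'') \<otimes>\<^bsub>B\<^esub> basis_elt (u, p, v) = (if v' = v then basis_elt (u, p @ q', v'') else 0)"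
  by (simp add: cat_alg_mult_single path_cat_def)

lemma path_carrier: "G.awalk u p v \<Longrightarrow> (basis_elt (u, p, v) :: _ \<Rightarrow>\<^sub>0 'k) \<in> carrier B"
  by (rule PC.single_carrier) (simp add: mors_path_cat)

lemma f_unit_left:
  assumes "a \<in> M" "G.awalk u p a"
  shows "fE a * f (basis_elt (u, p, a)) = f (basis_elt (u, p, a))"
  unfolding fE_def f_simps(2)[OF gens_carrier(3)[OF assms(1)] path_carrier[OF assms(2)], symmetric] path_mult by simp

lemma f_unit_right:
  assumes "a \<in> M" "G.awalk a p u"
  shows "f (basis_elt (a, p, u)) * fE a = f (basis_elt (a, p, u))"
  unfolding fE_def f_simps(2)[OF path_carrier[OF assms(2)] gens_carrier(3)[OF assms(1)], symmetric] path_mult by simp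

lemma fE_fE: "a \<in> M \<Longrightarrow> b \<in> M \<Longrightarrow> fE a * fE b = (if a = b then fE a else 0)"
  unfolding fE_def f_simps(2)[OF gens_carrier(3) gens_carrier(3), symmetric] path_mult
  by (simp add: f_simps'(1))

lemma awalk_gens:
  "a \<in> M \<Longrightarrow> G.awalk a [Eps a] a"
  "(a, b) \<in> Sg \<Longrightarrow> g \<in> {1..N (fst a) (fst b)} \<Longrightarrow> G.awalk b [Alpha a b g] a"
  using Sg_M by (auto simp: G.awalk_Cons_iff G.awalk_Nil_iff arcs_iff simp del: split_paired_All)

lemma f_path:
  assumes "G.awalk u p v"
  shows "f (basis_elt (u, p, v)) =
    path_prod (\<lambda>x. case x of Alpha a b g \<Rightarrow> f\<alpha> a b g | Eps a \<Rightarrow> f\<epsilon> a) p * fE u"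
  using assms
proof (induction p arbitrary: v rule: rev_induct)
  case Nil
  then show ?case by (simp add: G.awalk_Nil_iff fE_def)
next
  case (snoc x p)
  let ?m = "\<lambda>x. case x of Alpha a b g \<Rightarrow> f\<alpha> a b g | Eps a \<Rightarrow> f\<epsilon> a"
  have p: "G.awalk u p (tail G x)" and x: "x \<in> arcs G" and v: "v = head G x"
    using snoc.prems by (auto simp: G.awalk_Cons_iff G.awalk_Nil_iff dest: G.awalk_ends)
  have "G.awalk (tail G x) [x] v"
    using G.tail_in_verts[OF x] G.head_in_verts[OF x] by (simp add: G.awalk_Cons_iff G.awalk_Nil_iff x v)
  note c = path_carrier[OF p] path_carrier[OF this]
  have "basis_elt (u, p @ [x], v) = basis_elt (tail G x, [x], v) \<otimes>\<^bsub>B\<^esub> basis_elt (u, p, tail G x)"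
    by (simp add: path_mult)
  then have "f (basis_elt (u, p @ [x], v)) = f (basis_elt (tail G x, [x], v)) * f (basis_elt (u, p, tail G x))"
    using f_simps(2)[OF c(2,1)] by (simp only:)
  also have "f (basis_elt (tail G x, [x], v)) = ?m x"
    unfolding v by (cases x) (simp_all add: f\<alpha>_def f\<epsilon>_def)
  finally show ?case unfolding snoc.IH[OF p] by (simp add: path_prod_append mult.assoc)
qed

text \<open>Together with \<open>f_Rel_zero\<close>: a homomorphism kills the defining ideal exactly
  if its values on the generators form a \<open>gp_action\<close> with vanishing mesh
  relators.\<close>

lemma gp_action_f:
  assumes 0: "\<And>x. x \<in> Rel \<Longrightarrow> f x = 0"
  shows "gp_action I \<Omega> N P r d xinv yinv z sc fE f\<epsilon> f\<alpha>" "\<And>a. a \<in> M \<Longrightarrow> SA.gp_relator f\<epsilon> f\<alpha> a = 0"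
proof -
  show "gp_action I \<Omega> N P r d xinv yinv z sc fE f\<epsilon> f\<alpha>"
  proof (intro gp_action.intro gp_action_axioms.intro SA.species_algebra_axioms)
    fix a assume a: "a \<in> M"
    show "fE a * f\<epsilon> a = f\<epsilon> a" "f\<epsilon> a * fE a = f\<epsilon> a"
      unfolding f\<epsilon>_def using f_unit_left[OF a] f_unit_right[OF a] awalk_gens(1)[OF a] by blast+
    show "f\<epsilon> a ^ q (fst a) = 0"
      using 0[of "gp_eps a [^]\<^bsub>B\<^esub> q (fst a)"] a f_eps_power[OF a] by (simp add: Rel_eq)
  next
    fix a b assume "a \<in> M" "b \<in> M"
    then show "fE a * fE b = (if a = b then fE a else 0)" by (rule fE_fE)
  next
    fix a b g assume ab: "(a, b) \<in> Sg" "g \<in> {1..N (fst a) (fst b)}"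
    have M: "a \<in> M" "b \<in> M" using Sg_M[OF ab(1)] by auto
    show "fE a * f\<alpha> a b g = f\<alpha> a b g" "f\<alpha> a b g * fE b = f\<alpha> a b g"
      unfolding f\<alpha>_def using f_unit_left[OF M(1)] f_unit_right[OF M(2)] awalk_gens(2)[OF ab] by blast+
    have "gp_eps a [^]\<^bsub>B\<^esub> qq (fst a) (fst b) \<otimes>\<^bsub>B\<^esub> gp_alpha a b g
      - gp_alpha a b g \<otimes>\<^bsub>B\<^esub> gp_eps b [^]\<^bsub>B\<^esub> qq (fst b) (fst a) \<in> Rel"
      unfolding Rel_eq by (rule UnI1, rule UnI2, rule image_eqI[of _ _ "(a, b, g)"]) (use ab in auto)
    from 0[OF this] show "f\<epsilon> a ^ qq (fst a) (fst b) * f\<alpha> a b g = f\<alpha> a b g * f\<epsilon> b ^ qq (fst b) (fst a)"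
      unfolding f_commutation[OF ab] by simp
  qed
  show "SA.gp_relator f\<epsilon> f\<alpha> a = 0" if "a \<in> M" for a
    using 0[of "mesh a"] that f_mesh(2)[OF that] by (simp add: Rel_eq)
qed

lemma f_Rel_zero:
  assumes ga: "gp_action I \<Omega> N P r d xinv yinv z sc fE f\<epsilon> f\<alpha>" and rel: "\<And>a. a \<in> M \<Longrightarrow> SA.gp_relator f\<epsilon> f\<alpha> a = 0"
    and x: "x \<in> Idl\<^bsub>B\<^esub> Rel"
  shows "f x = 0"
proof (rule nonunital_hom_genideal[OF PC.ring_cat_alg hom Rel_carrier _ x])
  interpret gp_action I \<Omega> N P r d xinv yinv z sc fE f\<epsilon> f\<alpha> by fact
  fix y assume "y \<in> Rel"
  then show "f y = 0"
    unfolding Rel_eq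
  proof (elim UnE imageE)
    fix a assume "y = gp_eps a [^]\<^bsub>B\<^esub> q (fst a)" "a \<in> M"
    then show ?thesis using f_eps_power[of a] \<epsilon>_nil[of a] by simp
  next
    fix x assume y: "y = (case x of (a, b, g) \<Rightarrow> gp_eps a [^]\<^bsub>B\<^esub> qq (fst a) (fst b) \<otimes>\<^bsub>B\<^esub> gp_alpha a b g
        - gp_alpha a b g \<otimes>\<^bsub>B\<^esub> gp_eps b [^]\<^bsub>B\<^esub> qq (fst b) (fst a))"
      and x: "x \<in> {(a, b, g). (a, b) \<in> Sg \<and> g \<in> {1..N (fst a) (fst b)}}"
    obtain a b g where abg: "x = (a, b, g)" by (cases x)
    have ab: "(a, b) \<in> Sg" and g: "g \<in> {1..N (fst a) (fst b)}" using x by (auto simp: abg)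
    show ?thesis unfolding y abg prod.case f_commutation[OF ab g] using \<epsilon>\<alpha>[OF ab g] by simp
  next
    fix a assume "y = mesh a" "a \<in> M"
    then show ?thesis using f_mesh(2) rel by simp
  qed
qed

end

context gp_model
begin

text \<open>Paths are sent to products of the given elements; the path algebra is free, so only the
  idempotents impose conditions at this point.\<close>

lemma gp_hom_exists:
  fixes sc :: "'k \<Rightarrow> 't::ring_1"
  assumes ga: "gp_action I \<Omega> N P r d xinv yinv z sc E \<epsilon> \<alpha>"
  obtains f where "gp_hom I \<Omega> N P r d xinv yinv z C' D' \<Omega>' sc f"
    "\<And>a. a \<in> M \<Longrightarrow> gp_hom.fE f a = E a" "\<And>a. a \<in> M \<Longrightarrow> gp_hom.f\<epsilon> f a = \<epsilon> a"
    "\<And>a b g. (a, b) \<in> Sg \<Longrightarrow> g \<in> {1..N (fst a) (fst b)} \<Longrightarrow> gp_hom.f\<alpha> f a b g = \<alpha> a b g"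
proof -
  interpret gp_action I \<Omega> N P r d xinv yinv z sc E \<epsilon> \<alpha> by fact
  let ?m = "\<lambda>x. case x of Alpha a b g \<Rightarrow> \<alpha> a b g | Eps a \<Rightarrow> \<epsilon> a"
  let ?f = "lin_ext (path_rep E ?m)"
  have rep: "cat_rep (path_cat G) (path_rep E ?m)"
  proof (rule G.cat_rep_path_rep)
    fix x assume "x \<in> arcs G"
    then show "E (head G x) * ?m x = ?m x"
      by (cases rule: arc_cases) (simp_all add: E\<alpha> E\<epsilon>)
  qed (simp add: EE)
  interpret H: gp_hom I \<Omega> N P r d xinv yinv z C' D' \<Omega>' sc ?f
    by unfold_locales (rule lin_ext_hom[OF finite_cat_G rep])
  show thesis
  proof (rule that[of ?f])
    show "gp_hom I \<Omega> N P r d xinv yinv z C' D' \<Omega>' sc ?f" by unfold_locales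
    show "H.fE a = E a" for a unfolding H.fE_def by (simp add: path_rep_def)
    show "H.f\<epsilon> a = \<epsilon> a" if "a \<in> M" for a using \<epsilon>E[OF that] unfolding H.f\<epsilon>_def by (simp add: path_rep_def)
    show "H.f\<alpha> a b g = \<alpha> a b g" if "(a, b) \<in> Sg" "g \<in> {1..N (fst a) (fst b)}" for a b g
      using \<alpha>E[OF that] unfolding H.f\<alpha>_def by (simp add: path_rep_def)
  qed
qed

text \<open>The path algebra is spanned by products of generators, so it is enough to relate the
  values of \<open>f\<close> and \<open>f'\<close> on the generators.\<close>

lemma graph_gp:
  fixes sc :: "'k \<Rightarrow> 't::ring_1" and sc' :: "'k \<Rightarrow> 's::ring_1"
  assumes f: "gp_hom I \<Omega> N P r d xinv yinv z C' D' \<Omega>' sc f" and f': "gp_hom I \<Omega> N P r d xinv yinv z C' D' \<Omega>' sc' f'"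
    and "linked sc sc' R"
    and E: "\<And>a. a \<in> M \<Longrightarrow> R (gp_hom.fE f a) (gp_hom.fE f' a)"
    and \<epsilon>: "\<And>a. a \<in> M \<Longrightarrow> R (gp_hom.f\<epsilon> f a) (gp_hom.f\<epsilon> f' a)"
    and \<alpha>: "\<And>a b g. (a, b) \<in> Sg \<Longrightarrow> g \<in> {1..N (fst a) (fst b)} \<Longrightarrow> R (gp_hom.f\<alpha> f a b g) (gp_hom.f\<alpha> f' a b g)"
    and x: "x \<in> carrier B"
  shows "R (f x) (f' x)"
proof -
  interpret H: gp_hom I \<Omega> N P r d xinv yinv z C' D' \<Omega>' sc f by fact
  interpret H': gp_hom I \<Omega> N P r d xinv yinv z C' D' \<Omega>' sc' f' by fact
  interpret linked sc sc' R by fact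
  let ?m = "\<lambda>x. case x of Alpha a b g \<Rightarrow> H.f\<alpha> a b g | Eps a \<Rightarrow> H.f\<epsilon> a"
  let ?m' = "\<lambda>x. case x of Alpha a b g \<Rightarrow> H'.f\<alpha> a b g | Eps a \<Rightarrow> H'.f\<epsilon> a"
  have path: "R (path_prod ?m p * c) (path_prod ?m' p * c')" if "set p \<subseteq> arcs G" "R c c'" for p c c'
    using that
  proof (induction p arbitrary: c c')
    case (Cons x p)
    have "R (?m x) (?m' x)" using Cons.prems(1)
      by (cases x) (auto simp: arcs_iff \<epsilon> \<alpha>)
    then have "R (?m x * c) (?m' x * c')" using Cons.prems(2) by (rule R_mult)
    with Cons show ?case by (simp add: mult.assoc)
  qed simp
  show ?thesis using x
  proof (induction x rule: PC.carrier_induct)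
    case zero
    show ?case using H.f_simps'(1) H'.f_simps'(1) R_zero by simp
  next
    case (single m c)
    obtain u p v where m: "m = (u, p, v)" by (cases m)
    have w: "G.awalk u p v" using single by (simp add: m mors_path_cat)
    have car: "(basis_elt m :: _ \<Rightarrow>\<^sub>0 'k) \<in> carrier B" by (rule PC.single_carrier[OF single])
    have "R (f (basis_elt m)) (f' (basis_elt m))"
      unfolding m H.f_path[OF w] H'.f_path[OF w]
      by (rule path) (use w E G.awalk_hd_in_verts[OF w] in \<open>auto simp: G.awalk_def\<close>)
    moreover have "Poly_Mapping.single m c = c \<odot>\<^bsub>B\<^esub> basis_elt m" by simp
    ultimately show ?case using H.f_simps(3)[OF car, of c] H'.f_simps(3)[OF car, of c] R_sc by metis
  next
    case (add u v)
    then show ?case using H.f_simps(1)[of u v] H'.f_simps(1)[of u v] by (simp add: R_add)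
  qed
qed

end

section \<open>The bisets X(i) x X(j) over G_ij in coordinates\<close>

section \<open>Preprojective algebras of EI quivers of Cartan triples\<close>

text \<open>The representatives in the definition of rho are arbitrary choices. For a function that
  is constant on orbits they may be exchanged for an explicit system \<open>s\<close>.\<close>

lemma sum_representatives:
  assumes self: "\<And>y. y \<in> Y \<Longrightarrow> y \<in> orb y" and sub: "\<And>y. y \<in> Y \<Longrightarrow> orb y \<subseteq> Y"
    and orb: "\<And>y y'. y \<in> Y \<Longrightarrow> y' \<in> orb y \<Longrightarrow> orb y' = orb y"
    and const: "\<And>y y'. y \<in> Y \<Longrightarrow> y' \<in> orb y \<Longrightarrow> \<Gamma> y' = \<Gamma> y"
    and s: "\<And>k. k < n \<Longrightarrow> s k \<in> Y" and inj: "inj_on (\<lambda>k. orb (s k)) {..<n}"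
    and surj: "\<And>y. y \<in> Y \<Longrightarrow> \<exists>k<n. s k \<in> orb y"
  shows "(\<Sum>y\<in>representatives (orb ` Y). \<Gamma> y) = (\<Sum>k<n. \<Gamma> (s k))"
proof -
  let ?r = "\<lambda>U. SOME y. y \<in> U"
  have r: "?r (orb y) \<in> orb y" if "y \<in> Y" for y unfolding some_in_eq using self[OF that] by (intro notI) (simp only: empty_iff)
  have "inj_on ?r (orb ` Y)"
  proof (rule inj_onI)
    fix U V assume "U \<in> orb ` Y" "V \<in> orb ` Y" and eq: "?r U = ?r V"
    then obtain y y' where y: "y \<in> Y" "U = orb y" and y': "y' \<in> Y" "V = orb y'" by blast
    have "orb (?r (orb y)) = orb (?r (orb y'))" using eq unfolding y(2) y'(2) by (rule arg_cong)
    then show "U = V" unfolding orb[OF y(1) r[OF y(1)]] orb[OF y'(1) r[OF y'(1)]] y(2) y'(2) .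
  qed
  then have 1: "(\<Sum>y\<in>representatives (orb ` Y). \<Gamma> y) = (\<Sum>U\<in>orb ` Y. \<Gamma> (?r U))"
    unfolding representatives_def by (subst sum.reindex) (simp_all only: o_def)
  have 2: "orb ` Y = (\<lambda>k. orb (s k)) ` {..<n}"
  proof (intro equalityI subsetI)
    fix U assume "U \<in> orb ` Y"
    then obtain y where y: "y \<in> Y" "U = orb y" by blast
    obtain k where k: "k < n" "s k \<in> orb y" using surj[OF y(1)] by (elim exE conjE)
    show "U \<in> (\<lambda>k. orb (s k)) ` {..<n}"
      unfolding y(2) orb[OF y(1) k(2), symmetric] using k(1) by blast
  next
    fix U assume "U \<in> (\<lambda>k. orb (s k)) ` {..<n}"
    then obtain k where "k < n" "U = orb (s k)" by auto
    then show "U \<in> orb ` Y" using s[of k] by simp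
  qed
  have 3: "(\<Sum>U\<in>(\<lambda>k. orb (s k)) ` {..<n}. \<Gamma> (?r U)) = (\<Sum>k<n. \<Gamma> (?r (orb (s k))))"
    by (subst sum.reindex[OF inj]) (simp only: o_def)
  have 4: "(\<Sum>k<n. \<Gamma> (?r (orb (s k)))) = (\<Sum>k<n. \<Gamma> (s k))"
  proof (rule sum.cong[OF refl])
    fix k assume "k \<in> {..<n}"
    then have "s k \<in> Y" using s by simp
    from const[OF this r[OF this]] show "\<Gamma> (?r (orb (s k))) = \<Gamma> (s k)" .
  qed
  show ?thesis unfolding 1 unfolding 2 unfolding 3 by (rule 4)
qed

lemma representatives_subset:
  "(\<And>U. U \<in> S \<Longrightarrow> U \<noteq> {} \<and> U \<subseteq> Y) \<Longrightarrow> representatives S \<subseteq> Y"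
  unfolding representatives_def by (rule image_subsetI) (metis some_in_eq subsetD)

context finite_ei_quiver
begin

text \<open>A path of one arrow has no inner vertex and hence no moves.\<close>

lemma ei_rel_single:
  assumes "y \<in> bset (Y a)"
  shows "ei_rel Q [a] `` {[y]} = {[y]}"
proof -
  have "ei_move Q [a] = {}" by (auto simp: ei_move_def Cons_eq_append_conv)
  then show ?thesis using assms by (auto simp: ei_rel_def)
qed

end

locale ei_model = species I \<Omega> N P r d xinv yinv z
  for I :: "'v set" and \<Omega> N P r d xinv yinv and z :: "'v \<Rightarrow> 'k::field" +
  fixes C :: "'v \<Rightarrow> 'v \<Rightarrow> int" and D :: "'v \<Rightarrow> nat"
  assumes D_eq: "i \<in> I \<Longrightarrow> D i = q i * d i" and N_eq: "N i j = cartan_g C i j"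
begin

lemma D_pos: "i \<in> I \<Longrightarrow> D i > 0" using q_pos d_pos by (simp add: D_eq P_pos)

lemma coprime_P_d: "i \<in> I \<Longrightarrow> coprime P (d i)"
proof -
  assume i: "i \<in> I"
  show ?thesis
  proof (cases "P = 1")
    case False
    with P have p: "prime P" "P = CHAR('k)" by (auto simp: char_exponent_def)
    have "\<not> P dvd d i" using d_unit[OF i] unfolding p(2) of_nat_eq_0_iff_char_dvd .
    with p show ?thesis by (simp add: prime_imp_coprime)
  qed simp
qed

text \<open>One of \<open>qq i j\<close> and \<open>qq j i\<close> is 1, the quotients of
  \<open>d i\<close> and \<open>d j\<close> by their gcd are coprime, and \<open>P\<close> is prime
  to both of them.\<close>

lemma coprime_F: "i \<in> I \<Longrightarrow> j \<in> I \<Longrightarrow> coprime (F i j) (F j i)"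
proof -
  assume i: "i \<in> I" and j: "j \<in> I"
  let ?a = "d i div gcd (d i) (d j)" and ?b = "d j div gcd (d i) (d j)"
  have ab: "coprime ?a ?b" using d_pos[OF i] by (intro div_gcd_coprime) simp
  have dvd: "?a dvd d i" "?b dvd d j" by (metis dvd_div_mult_self dvd_triv_left gcd_dvd1 gcd_dvd2)+
  have Pa: "coprime P ?a" "coprime P ?b"
    using coprime_divisors[OF dvd_refl dvd(1) coprime_P_d[OF i]]
      coprime_divisors[OF dvd_refl dvd(2) coprime_P_d[OF j]] .
  have "qq i j = 1 \<or> qq j i = 1" by (auto simp: qq_def)
  then have "coprime (qq i j) (qq j i)" by auto
  moreover have "coprime (qq i j) ?b" "coprime (qq j i) ?a" using Pa by (auto simp: qq_def)
  ultimately show ?thesis using ab by (simp add: F_def gcd.commute coprime_commute)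
qed

definition k :: "'v \<Rightarrow> 'v \<Rightarrow> nat" where "k i j = gcd (D i) (D j)"

text \<open>\<open>D i\<close> and \<open>D j\<close> are \<open>F i j\<close> and
  \<open>F j i\<close> times the same number \<open>?m\<close>, which is the gcd since the cofactors
  are coprime. Thus \<open>F i j\<close> is the index of G_ij in X(i).\<close>

lemma D_F: "i \<in> I \<Longrightarrow> j \<in> I \<Longrightarrow> D i = F i j * k i j"
  and D_F': "i \<in> I \<Longrightarrow> j \<in> I \<Longrightarrow> D j = F j i * k i j"
proof -
  assume i: "i \<in> I" and j: "j \<in> I"
  let ?m = "P ^ min (r i) (r j) * gcd (d i) (d j)"
  have 1: "D i = F i j * ?m"
  proof -
    have "F i j * ?m = (qq i j * P ^ min (r i) (r j)) * (d i div gcd (d i) (d j) * gcd (d i) (d j))"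
      by (simp only: F_def ac_simps)
    then show ?thesis by (simp add: D_eq[OF i] qq_min)
  qed
  have 2: "D j = F j i * ?m"
  proof -
    have "F j i * ?m = (qq j i * P ^ min (r i) (r j)) * (d j div gcd (d i) (d j) * gcd (d i) (d j))"
      by (simp only: F_def ac_simps gcd.commute[of "d j"])
    then show ?thesis by (simp add: D_eq[OF j] qq_min')
  qed
  have "k i j = gcd (F i j) (F j i) * ?m" unfolding k_def 1 2
    using gcd_mult_distrib_nat[of ?m "F i j" "F j i"] by (simp only: mult.commute[of ?m])
  also have "gcd (F i j) (F j i) = 1" using coprime_F[OF i j] by (simp add: coprime_iff_gcd_eq_1)
  finally have "k i j = ?m" by simp
  with 1 2 show "D i = F i j * k i j" "D j = F j i * k i j" by simp_all
qed

lemma F_k: "i \<in> I \<Longrightarrow> j \<in> I \<Longrightarrow> D i div k i j = F i j" "i \<in> I \<Longrightarrow> j \<in> I \<Longrightarrow> D j div k i j = F j i"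
proof -
  assume i: "i \<in> I" and j: "j \<in> I"
  have "k i j > 0" using D_pos[OF i] by (simp add: k_def)
  then show "D i div k i j = F i j" "D j div k i j = F j i"
    unfolding D_F[OF i j] D_F'[OF i j] by simp_all
qed

lemma F_pos: "i \<in> I \<Longrightarrow> j \<in> I \<Longrightarrow> F i j > 0"
  using D_F[of i j] D_pos[of i] by (cases "F i j") simp_all

abbreviation "Z n \<equiv> integer_mod_group n"

text \<open>X(i) with G_ij acting on the right; \<open>Rb\<close> is X(j) with G_ij acting on the
  left.\<close>

definition Lb :: "'v \<Rightarrow> 'v \<Rightarrow> (int, int, int) biset" where
  "Lb i j = \<lparr>bset = carrier (Z (D i)), lact = (\<lambda>g y. g \<otimes>\<^bsub>Z (D i)\<^esub> y), ract = (\<lambda>y h. y \<otimes>\<^bsub>Z (D i)\<^esub> cyc_embed (k i j) (D i) h)\<rparr>"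

definition Rb :: "'v \<Rightarrow> 'v \<Rightarrow> (int, int, int) biset" where
  "Rb i j = \<lparr>bset = carrier (Z (D j)), lact = (\<lambda>h y. cyc_embed (k i j) (D j) h \<otimes>\<^bsub>Z (D j)\<^esub> y), ract = (\<lambda>y g. y \<otimes>\<^bsub>Z (D j)\<^esub> g)\<rparr>"

lemma cartan_biset_eq: "cartan_biset D i j = biset_prod (Z (k i j)) (Lb i j) (Rb i j)"
  by (simp add: cartan_biset_def Lb_def Rb_def k_def Let_def)

lemma carrier_Z: "n > 0 \<Longrightarrow> x \<in> carrier (Z n) \<longleftrightarrow> 0 \<le> x \<and> x < int n"
  by (auto simp: carrier_integer_mod_group)

lemma mod_carrier: "n > 0 \<Longrightarrow> x mod int n \<in> carrier (Z n)"
  by (simp add: carrier_Z)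

lemma cyc_embed_add:
  assumes "n dvd c"
  shows "cyc_embed n c ((a + b) mod int n) = (cyc_embed n c a + cyc_embed n c b) mod int c"
proof -
  obtain m where c: "c = n * m" using assms by (rule dvdE)
  show ?thesis
  proof (cases "n = 0")
    case False
    then have "cyc_embed n c ((a + b) mod int n) = ((a + b) mod int n * int m) mod (int n * int m)"
      by (simp add: cyc_embed_def c)
    also have "\<dots> = ((a + b) * int m) mod int c" by (simp add: c mod_mult_mult2)
    also have "\<dots> = (a * int m mod int c + b * int m mod int c) mod int c"
      by (simp only: distrib_right mod_add_eq)
    finally show ?thesis using False by (simp add: cyc_embed_def c)
  qed (simp add: cyc_embed_def c)
qed

lemma cyc_embed_simps:
  assumes "n > 0"
  shows "cyc_embed m n h \<in> carrier (Z n)" and "cyc_embed m n 0 = 0"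
  using assms by (simp_all add: cyc_embed_def mod_carrier)

lemma biset_Lb:
  assumes i: "i \<in> I"
  shows "biset (Z (D i)) (Z (k i j)) (Lb i j)"
proof -
  interpret G1: group "Z (D i)" by simp
  interpret G2: group "Z (k i j)" by simp
  note cl = cyc_embed_simps(1)[OF D_pos[OF i], of "k i j"] and zero = cyc_embed_simps(2)[OF D_pos[OF i], of "k i j"]
  have add: "cyc_embed (k i j) (D i) (a \<otimes>\<^bsub>Z (k i j)\<^esub> b) = cyc_embed (k i j) (D i) a \<otimes>\<^bsub>Z (D i)\<^esub> cyc_embed (k i j) (D i) b" for a b
    using cyc_embed_add[of "k i j" "D i"] by (simp add: k_def)
  have one: "\<one>\<^bsub>Z n\<^esub> = 0" for n by simp
  show ?thesis
  proof unfold_locales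
    fix y h h' assume "y \<in> bset (Lb i j)"
    then have "y \<in> carrier (Z (D i))" by (simp only: Lb_def biset.simps)
    then show "ract (Lb i j) (ract (Lb i j) y h) h' = ract (Lb i j) y (h \<otimes>\<^bsub>Z (k i j)\<^esub> h')"
      unfolding Lb_def biset.simps add by (intro G1.m_assoc cl)
    show "ract (Lb i j) y \<one>\<^bsub>Z (k i j)\<^esub> = y"
      using G1.r_one[OF \<open>y \<in> carrier (Z (D i))\<close>] unfolding Lb_def biset.simps one zero .
  qed (simp_all only: Lb_def biset.simps G1.m_closed cl G1.l_one G1.m_assoc)
qed

lemma biset_Rb:
  assumes j: "j \<in> I"
  shows "biset (Z (k i j)) (Z (D j)) (Rb i j)"
proof -
  interpret G1: group "Z (k i j)" by simp
  interpret G2: group "Z (D j)" by simp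
  note cl = cyc_embed_simps(1)[OF D_pos[OF j], of "k i j"] and zero = cyc_embed_simps(2)[OF D_pos[OF j], of "k i j"]
  have add: "cyc_embed (k i j) (D j) (a \<otimes>\<^bsub>Z (k i j)\<^esub> b) = cyc_embed (k i j) (D j) a \<otimes>\<^bsub>Z (D j)\<^esub> cyc_embed (k i j) (D j) b" for a b
    using cyc_embed_add[of "k i j" "D j"] by (simp add: k_def)
  have one: "\<one>\<^bsub>Z n\<^esub> = 0" for n by simp
  show ?thesis
  proof unfold_locales
    fix y h h' assume "y \<in> bset (Rb i j)"
    then have "y \<in> carrier (Z (D j))" by (simp only: Rb_def biset.simps)
    then show "lact (Rb i j) h (lact (Rb i j) h' y) = lact (Rb i j) (h \<otimes>\<^bsub>Z (k i j)\<^esub> h') y"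
      unfolding Rb_def biset.simps add by (intro G2.m_assoc[symmetric] cl)
    show "lact (Rb i j) \<one>\<^bsub>Z (k i j)\<^esub> y = y"
      using G2.l_one[OF \<open>y \<in> carrier (Z (D j))\<close>] unfolding Rb_def biset.simps one zero .
  qed (simp_all only: Rb_def biset.simps G2.m_closed cl G2.r_one G2.m_assoc)
qed

lemma biset_pair: "i \<in> I \<Longrightarrow> j \<in> I \<Longrightarrow> biset_pair (Z (D i)) (Z (k i j)) (Z (D j)) (Lb i j) (Rb i j)"
  by (intro biset_pair.intro biset_Lb biset_Rb)

text \<open>The class of the pair of \<eta>_i^s and \<eta>_j^t, where \<open>s\<close> and
  \<open>t\<close> are arbitrary integers.\<close>

definition cl :: "'v \<Rightarrow> 'v \<Rightarrow> int \<Rightarrow> int \<Rightarrow> (int \<times> int) set" where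
  "cl i j s t = biset_prod_rel (Z (k i j)) (Lb i j) (Rb i j) `` {(s mod int (D i), t mod int (D j))}"

context
  fixes i j assumes i: "i \<in> I" and j: "j \<in> I"
begin

interpretation bp: biset_pair "Z (D i)" "Z (k i j)" "Z (D j)" "Lb i j" "Rb i j"
  by (rule biset_pair[OF i j])

lemma mods: "s mod int (D i) \<in> bset (Lb i j)" "t mod int (D j) \<in> bset (Rb i j)"
  using D_pos[OF i] D_pos[OF j] by (simp_all add: Lb_def Rb_def mod_carrier)

lemma cl_bset: "cl i j s t \<in> bset (cartan_biset D i j)"
  unfolding cl_def cartan_biset_eq by (rule bp.prod_elem[OF mods])

lemma cl_cases:
  assumes "y \<in> bset (cartan_biset D i j)"
  obtains s t where "y = cl i j s t"
proof -
  obtain s t where st: "s \<in> bset (Lb i j)" "t \<in> bset (Rb i j)"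
    and y: "y = biset_prod_rel (Z (k i j)) (Lb i j) (Rb i j) `` {(s, t)}"
    using assms unfolding cartan_biset_eq by (rule bp.prod_elemE)
  have "s mod int (D i) = s" "t mod int (D j) = t"
    using st D_pos[OF i] D_pos[OF j] by (auto simp: Lb_def Rb_def carrier_Z)
  with y that[of s t] show thesis by (simp add: cl_def)
qed

lemma lact_cl:
  assumes "g \<in> carrier (Z (D i))"
  shows "lact (cartan_biset D i j) g (cl i j s t) = cl i j (g + s) t"
proof -
  have "lact (Lb i j) g (s mod int (D i)) = (g + s) mod int (D i)" by (simp add: Lb_def mod_add_right_eq)
  then show ?thesis unfolding cartan_biset_eq cl_def bp.lact_prod[OF assms mods] by (simp only:)
qed

lemma ract_cl:
  assumes "g \<in> carrier (Z (D j))"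
  shows "ract (cartan_biset D i j) (cl i j s t) g = cl i j s (t + g)"
proof -
  have "ract (Rb i j) (t mod int (D j)) g = (t + g) mod int (D j)" by (simp add: Rb_def mod_add_left_eq)
  then show ?thesis unfolding cartan_biset_eq cl_def bp.ract_prod[OF assms mods] by (simp only:)
qed

text \<open>The exponent \<open>h\<close> of the generator of G_ij may range over all integers,
  since only its residue modulo \<open>k i j\<close> matters. This avoids reductions in later
  calculations.\<close>

lemma cl_mem_iff:
  "(s, t) \<in> cl i j s' t' \<longleftrightarrow> s \<in> carrier (Z (D i)) \<and> t \<in> carrier (Z (D j)) \<and>
    (\<exists>h. [s' = s + h * int (F i j)] (mod int (D i)) \<and> [t = h * int (F j i) + t'] (mod int (D j)))"
proof -
  have k: "k i j > 0" using D_pos[OF i] by (simp add: k_def)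
  have emb: "cyc_embed (k i j) (D i) h = h * int (F i j) mod int (D i)" "cyc_embed (k i j) (D j) h = h * int (F j i) mod int (D j)" for h
    by (simp_all add: cyc_embed_def F_k[OF i j])
  have embmod: "(h mod int (k i j)) * int (F i j) mod int (D i) = h * int (F i j) mod int (D i)"
    "(h mod int (k i j)) * int (F j i) mod int (D j) = h * int (F j i) mod int (D j)" for h
    unfolding D_F[OF i j] D_F'[OF i j] of_nat_mult mult.commute[of "int (F _ _)" "int (k i j)"]
      mod_mult_mult2 mod_mod_trivial by (rule refl)+
  have "(s, t) \<in> cl i j s' t' \<longleftrightarrow> s \<in> carrier (Z (D i)) \<and> (\<exists>h\<in>carrier (Z (k i j)).
      s' mod int (D i) = (s + h * int (F i j) mod int (D i)) mod int (D i) \<and>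
      t = (h * int (F j i) mod int (D j) + t' mod int (D j)) mod int (D j))"
    using mods(2) by (simp add: cl_def bp.rel_iff) (simp add: Lb_def Rb_def emb)
  also have "\<dots> \<longleftrightarrow> s \<in> carrier (Z (D i)) \<and> t \<in> carrier (Z (D j)) \<and> (\<exists>h\<in>carrier (Z (k i j)).
      [s' = s + h * int (F i j)] (mod int (D i)) \<and> [t = h * int (F j i) + t'] (mod int (D j)))"
  proof -
    have "t = (h * int (F j i) mod int (D j) + t' mod int (D j)) mod int (D j) \<longleftrightarrow>
      t \<in> carrier (Z (D j)) \<and> [t = h * int (F j i) + t'] (mod int (D j))" for h
      using D_pos[OF j] unfolding mod_add_eq cong_def carrier_Z[OF D_pos[OF j]]
      using D_pos[OF j] by auto
    moreover have "s' mod int (D i) = (s + h * int (F i j) mod int (D i)) mod int (D i) \<longleftrightarrow>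
      [s' = s + h * int (F i j)] (mod int (D i))" for h
      unfolding mod_add_right_eq cong_def ..
    ultimately show ?thesis by metis
  qed
  also have "(\<exists>h\<in>carrier (Z (k i j)).
      [s' = s + h * int (F i j)] (mod int (D i)) \<and> [t = h * int (F j i) + t'] (mod int (D j))) \<longleftrightarrow>
    (\<exists>h. [s' = s + h * int (F i j)] (mod int (D i)) \<and> [t = h * int (F j i) + t'] (mod int (D j)))" (is "?l \<longleftrightarrow> ?r")
  proof
    assume ?r
    then obtain h where h: "[s' = s + h * int (F i j)] (mod int (D i))" "[t = h * int (F j i) + t'] (mod int (D j))" by blast
    have "[h mod int (k i j) * int (F i j) = h * int (F i j)] (mod int (D i))"
      "[h mod int (k i j) * int (F j i) = h * int (F j i)] (mod int (D j))"
      by (simp_all only: cong_def embmod)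
    then have "[s' = s + h mod int (k i j) * int (F i j)] (mod int (D i))" "[t = h mod int (k i j) * int (F j i) + t'] (mod int (D j))"
      using h by (meson cong_add cong_refl cong_sym cong_trans)+
    then show ?l using mod_carrier[OF k] by blast
  qed blast
  finally show ?thesis .
qed

lemma cl_eq:
  assumes "[s' = s + h * int (F i j)] (mod int (D i))" "[t = h * int (F j i) + t'] (mod int (D j))"
  shows "cl i j s t = cl i j s' t'"
proof -
  have "(s mod int (D i), t mod int (D j)) \<in> cl i j s' t'"
    unfolding cl_mem_iff using assms D_pos[OF i] D_pos[OF j] mod_carrier
    by (auto simp: cong_def mod_add_left_eq intro!: exI[of _ h])
  then show ?thesis
    unfolding cl_def using bp.class_eqI by simp
qed

lemma cl_self: "(s mod int (D i), t mod int (D j)) \<in> cl i j s t"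
  unfolding cl_mem_iff using D_pos[OF i] D_pos[OF j] mod_carrier
  by (auto simp: cong_def intro!: exI[of _ 0])

lemma cl_eqD:
  assumes "cl i j s t = cl i j s' t'"
  shows "\<exists>h. [s' = s + h * int (F i j)] (mod int (D i)) \<and> [t = h * int (F j i) + t'] (mod int (D j))"
proof -
  have "(s mod int (D i), t mod int (D j)) \<in> cl i j s' t'" using cl_self[of s t] assms by simp
  then show ?thesis unfolding cl_mem_iff by (auto simp: cong_def mod_add_left_eq)
qed

end

section \<open>The doubled EI quiver, composition in coordinates, and sums over orbits\<close>

abbreviation "Qc \<equiv> cartan_ei_quiver I C D \<Omega>"
abbreviation "DQ \<equiv> double_ei_quiver Qc"

lemma Qc_simps [simp]:
  "(i, j, g) \<in> arcs (quiver Qc) \<longleftrightarrow> (i, j) \<in> \<Omega> \<and> g \<in> {1..N i j}"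
  "verts (quiver Qc) = I" "tail (quiver Qc) (i, j, g) = j" "head (quiver Qc) (i, j, g) = i"
  "vgrp Qc i = Z (D i)" "abiset Qc (i, j, g) = cartan_biset D i j"
  by (simp_all add: cartan_ei_quiver_def N_eq)

lemma DQ_simps [simp]:
  "Orig a \<in> arcs (quiver DQ) \<longleftrightarrow> a \<in> arcs (quiver Qc)" "Star a \<in> arcs (quiver DQ) \<longleftrightarrow> a \<in> arcs (quiver Qc)"
  "verts (quiver DQ) = I" "tail (quiver DQ) (Orig a) = tail (quiver Qc) a" "head (quiver DQ) (Orig a) = head (quiver Qc) a"
  "tail (quiver DQ) (Star a) = head (quiver Qc) a" "head (quiver DQ) (Star a) = tail (quiver Qc) a"
  "vgrp DQ i = Z (D i)" "abiset DQ (Orig a) = abiset Qc a" "bset (abiset DQ (Star a)) = bset (abiset Qc a)"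
  "lact (abiset DQ (Star (i, j, g))) x y = ract (cartan_biset D i j) y (inv\<^bsub>Z (D j)\<^esub> x)"
  "ract (abiset DQ (Star (i, j, g))) y x = lact (cartan_biset D i j) (inv\<^bsub>Z (D i)\<^esub> x) y"
  by (auto simp: double_ei_quiver_def double_quiver_def dual_biset_def image_iff)

lemma \<Omega>_I: "(i, j) \<in> \<Omega> \<Longrightarrow> i \<in> I \<and> j \<in> I" using \<Omega>_sub by auto

lemma finite_arcs: "finite (arcs (quiver Qc))"
proof (rule finite_subset)
  show "arcs (quiver Qc) \<subseteq> (SIGMA i:I. SIGMA j:I. {1..N i j})"
    using \<Omega>_sub by (auto simp: cartan_ei_quiver_def N_eq)
  show "finite (SIGMA i:I. SIGMA j:I. {1..N i j})" using finite_I by (intro finite_SigmaI) auto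
qed

lemma finite_ei_Qc: "finite_ei_quiver Qc"
proof -
  interpret fin_digraph "quiver Qc"
  proof unfold_locales
    show "finite (verts (quiver Qc))" using finite_I by simp
    show "finite (arcs (quiver Qc))" by (rule finite_arcs)
    fix a assume "a \<in> arcs (quiver Qc)"
    then show "tail (quiver Qc) a \<in> verts (quiver Qc)" "head (quiver Qc) a \<in> verts (quiver Qc)"
      by (cases a; use \<Omega>_I in auto)+
  qed
  show ?thesis
  proof (intro finite_ei_quiver.intro finite_ei_quiver_axioms.intro fin_digraph_axioms)
    fix i assume "i \<in> verts (quiver Qc)"
    then show "group (vgrp Qc i)" "finite (carrier (vgrp Qc i))"
      using D_pos by (simp_all add: carrier_integer_mod_group)
  next
    fix a assume a: "a \<in> arcs (quiver Qc)"
    obtain i j g where ijg: "a = (i, j, g)" by (cases a)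
    with a have i: "i \<in> I" and j: "j \<in> I" using \<Omega>_I by auto
    interpret bp: biset_pair "Z (D i)" "Z (k i j)" "Z (D j)" "Lb i j" "Rb i j" by (rule biset_pair[OF i j])
    show "biset (vgrp Qc (head (quiver Qc) a)) (vgrp Qc (tail (quiver Qc) a)) (abiset Qc a)"
      using bp.biset_biset_prod by (simp add: ijg cartan_biset_eq)
    show "bset (abiset Qc a) \<noteq> {}" using cl_bset[OF i j] by (auto simp: ijg)
    show "finite (bset (abiset Qc a))"
    proof -
      have "finite (bset (Lb i j) \<times> bset (Rb i j))"
        using D_pos[OF i] D_pos[OF j] by (simp add: Lb_def Rb_def carrier_integer_mod_group)
      then show ?thesis
        using bp.equiv_rel by (simp add: ijg cartan_biset_eq biset_prod_def finite_quotient equiv_type)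
    qed
  qed
qed

sublocale DQ: finite_ei_quiver DQ
  by (rule finite_ei_quiver.finite_double[OF finite_ei_Qc])

abbreviation "EA \<equiv> cat_alg (ei_cat DQ) :: ('k, _) module"

sublocale EC: finite_cat "ei_cat DQ" by (rule DQ.finite_cat_ei_cat)

end

context ei_model
begin

lemma inv_Z: "n > 0 \<Longrightarrow> inv\<^bsub>Z n\<^esub> (x mod int n) = (- x) mod int n"
  using mod_carrier[of n x] by (simp add: mod_minus_eq)

lemma cl_mod: "cl i j (s mod int (D i) + s') t = cl i j (s + s') t" "cl i j (s' + s mod int (D i)) t = cl i j (s' + s) t"
  "cl i j s (t mod int (D j) + t') = cl i j s (t + t')" "cl i j s (t' + t mod int (D j)) = cl i j s (t' + t)"
  by (simp_all only: cl_def mod_add_left_eq mod_add_right_eq)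

text \<open>\<open>gm\<close>, \<open>co\<close> and \<open>st\<close> are the morphisms \<eta>_i^s,
  b and its dual for b the class \<open>cl i j s t\<close>, parametrized by integers so that
  composition adds or subtracts exponents.\<close>

definition gm :: "'v \<Rightarrow> int \<Rightarrow> ('v, ('v \<times> 'v \<times> nat) darrow, int, (int \<times> int) set) ei_mor" where
  "gm i s = DQ.gmor i (s mod int (D i))"

definition co :: "'v \<Rightarrow> 'v \<Rightarrow> nat \<Rightarrow> int \<Rightarrow> int \<Rightarrow> ('v, ('v \<times> 'v \<times> nat) darrow, int, (int \<times> int) set) ei_mor" where
  "co i j g s t = DQ.cmor j [Orig (i, j, g)] i [cl i j s t]"

definition st :: "'v \<Rightarrow> 'v \<Rightarrow> nat \<Rightarrow> int \<Rightarrow> int \<Rightarrow> ('v, ('v \<times> 'v \<times> nat) darrow, int, (int \<times> int) set) ei_mor" where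
  "st i j g s t = DQ.cmor i [Star (i, j, g)] j [cl i j s t]"

lemma gm_mor: "i \<in> I \<Longrightarrow> gm i s \<in> mors (ei_cat DQ)"
  using D_pos[of i] by (simp add: gm_def DQ.gmor_mor mod_carrier)

lemma gmE:
  assumes "i \<in> I" "x \<in> carrier (Z (D i))"
  shows "DQ.gmor i x = gm i x"
  using assms D_pos[OF assms(1)] by (simp add: gm_def carrier_Z)

lemma gm_dom [simp]: "cdom (ei_cat DQ) (gm i s) = i" "ccod (ei_cat DQ) (gm i s) = i"
  "cdom (ei_cat DQ) (co i j g s t) = j" "ccod (ei_cat DQ) (co i j g s t) = i"
  "cdom (ei_cat DQ) (st i j g s t) = i" "ccod (ei_cat DQ) (st i j g s t) = j"
  by (simp_all add: gm_def co_def st_def)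

lemma gm_gm: "ccomp (ei_cat DQ) (gm i s) (gm i t) = gm i (s + t)"
  by (simp add: gm_def DQ.comp_gmor_gmor mod_add_eq)

context
  fixes i j g assumes ij: "(i, j) \<in> \<Omega>" and g: "g \<in> {1..N i j}"
begin

lemma i: "i \<in> I" and j: "j \<in> I" using \<Omega>_I[OF ij] by auto

lemma single_walk: "DQ.awalk j [Orig (i, j, g)] i" "DQ.awalk i [Star (i, j, g)] j"
  using ij g i j by (simp_all add: DQ.awalk_Cons_iff DQ.awalk_Nil_iff)

lemma single_lists: "[cl i j s t] \<in> ei_lists DQ [Orig (i, j, g)]" "[cl i j s t] \<in> ei_lists DQ [Star (i, j, g)]"
  using cl_bset[OF i j] by simp_all

lemma co_mor: "co i j g s t \<in> mors (ei_cat DQ)" and st_mor: "st i j g s t \<in> mors (ei_cat DQ)"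
  unfolding co_def st_def by (intro DQ.cmor_mor single_walk single_lists; simp)+

lemma mod_mem: "x mod int (D i) \<in> carrier (Z (D i))" "x mod int (D j) \<in> carrier (Z (D j))"
  using D_pos[OF i] D_pos[OF j] by (simp_all add: mod_carrier)

lemma mod_mem': "x mod int (D i) \<in> carrier (vgrp DQ i)" "x mod int (D j) \<in> carrier (vgrp DQ j)"
  using mod_mem by simp_all

lemma gm_co: "ccomp (ei_cat DQ) (gm i x) (co i j g s t) = co i j g (x + s) t"
proof -
  have "DQ.act_last [Orig (i, j, g)] (x mod int (D i)) [cl i j s t] = [cl i j (x + s) t]"
    unfolding DQ.act_last_def using lact_cl[OF i j mod_mem(1)] by (simp add: cl_mod)
  then show ?thesis
    unfolding gm_def co_def DQ.comp_gmor_cmor[OF single_walk(1) list.distinct(2) single_lists(1) mod_mem'(1)] by (simp only:)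
qed

lemma co_gm: "ccomp (ei_cat DQ) (co i j g s t) (gm j x) = co i j g s (t + x)"
proof -
  have "DQ.act_hd [Orig (i, j, g)] [cl i j s t] (x mod int (D j)) = [cl i j s (t + x)]"
    unfolding DQ.act_hd_def using ract_cl[OF i j mod_mem(2)] by (simp add: cl_mod)
  then show ?thesis
    unfolding gm_def co_def DQ.comp_cmor_gmor[OF single_walk(1) list.distinct(2) single_lists(1) mod_mem'(2)] by (simp only:)
qed

text \<open>The sign comes from the inverse in the action on the dual biset.\<close>

lemma gm_st: "ccomp (ei_cat DQ) (gm j x) (st i j g s t) = st i j g s (t - x)"
proof -
  have "DQ.act_last [Star (i, j, g)] (x mod int (D j)) [cl i j s t] = [cl i j s (t - x)]"
    unfolding DQ.act_last_def using ract_cl[OF i j mod_mem(2), of s t "- x"]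
    by (simp add: inv_Z[OF D_pos[OF j]] cl_mod del: inv_integer_mod_group)
  then show ?thesis
    unfolding gm_def st_def DQ.comp_gmor_cmor[OF single_walk(2) list.distinct(2) single_lists(2) mod_mem'(2)] by (simp only:)
qed

lemma st_gm: "ccomp (ei_cat DQ) (st i j g s t) (gm i x) = st i j g (s - x) t"
proof -
  have "DQ.act_hd [Star (i, j, g)] [cl i j s t] (x mod int (D i)) = [cl i j (s - x) t]"
    unfolding DQ.act_hd_def using lact_cl[OF i j mod_mem(1), of "- x" s t]
    by (simp add: inv_Z[OF D_pos[OF i]] cl_mod del: inv_integer_mod_group)
  then show ?thesis
    unfolding gm_def st_def DQ.comp_cmor_gmor[OF single_walk(2) list.distinct(2) single_lists(2) mod_mem'(1)] by (simp only:)
qed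

lemma elt_co: "ei_elt Qc (i, j, g) (cl i j s t) = (basis_elt (co i j g s t) :: _ \<Rightarrow>\<^sub>0 'k)"
  and star_st: "ei_star Qc (i, j, g) (cl i j s t) = (basis_elt (st i j g s t) :: _ \<Rightarrow>\<^sub>0 'k)"
  using cl_bset[OF i j, of s t]
  by (simp_all add: ei_elt_def ei_star_def co_def st_def DQ.cmor_def DQ.ei_rel_single)

lemma orbit_right: "(\<lambda>h. ract (cartan_biset D i j) (cl i j s t) h) ` carrier (Z (D j)) = range (cl i j s)"
proof (intro equalityI subsetI)
  fix y assume "y \<in> (\<lambda>h. ract (cartan_biset D i j) (cl i j s t) h) ` carrier (Z (D j))"
  then show "y \<in> range (cl i j s)" using ract_cl[OF i j] by auto
next
  fix y assume "y \<in> range (cl i j s)"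
  then obtain x where y: "y = cl i j s x" by auto
  have "y = ract (cartan_biset D i j) (cl i j s t) ((x - t) mod int (D j))"
    unfolding ract_cl[OF i j mod_mem(2)] cl_mod y by simp
  then show "y \<in> (\<lambda>h. ract (cartan_biset D i j) (cl i j s t) h) ` carrier (Z (D j))"
    using mod_mem(2) by blast
qed

lemma orbit_left: "(\<lambda>h. lact (cartan_biset D i j) h (cl i j s t)) ` carrier (Z (D i)) = range (\<lambda>s. cl i j s t)"
proof (intro equalityI subsetI)
  fix y assume "y \<in> (\<lambda>h. lact (cartan_biset D i j) h (cl i j s t)) ` carrier (Z (D i))"
  then show "y \<in> range (\<lambda>s. cl i j s t)" using lact_cl[OF i j] by auto
next
  fix y assume "y \<in> range (\<lambda>s. cl i j s t)"
  then obtain x where y: "y = cl i j x t" by auto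
  have "y = lact (cartan_biset D i j) ((x - s) mod int (D i)) (cl i j s t)"
    unfolding lact_cl[OF i j mod_mem(1)] cl_mod y by simp
  then show "y \<in> (\<lambda>h. lact (cartan_biset D i j) h (cl i j s t)) ` carrier (Z (D i))"
    using mod_mem(1) by blast
qed

lemma cong_F:
  shows "[a = b + h * int (F i j)] (mod int (D i)) \<Longrightarrow> [a = b] (mod int (F i j))"
    and "[a = b + h * int (F j i)] (mod int (D j)) \<Longrightarrow> [a = b] (mod int (F j i))"
proof -
  have *: "[a = b] (mod int n)" if "[a = b + h * int n] (mod int m)" "n dvd m" for a b h and n m :: nat
  proof -
    have "[a = b + h * int n] (mod int n)" using that by (meson cong_dvd_modulus int_dvd_int_iff)
    then show ?thesis by (simp add: cong_def)
  qed
  show "[a = b + h * int (F i j)] (mod int (D i)) \<Longrightarrow> [a = b] (mod int (F i j))"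
    by (erule *) (simp add: D_F[OF i j])
  show "[a = b + h * int (F j i)] (mod int (D j)) \<Longrightarrow> [a = b] (mod int (F j i))"
    by (erule *) (simp add: D_F'[OF i j])
qed

text \<open>The right orbit of \<open>cl i j s t\<close> is determined by \<open>s\<close> modulo
  \<open>F i j\<close>, the index of G_ij in X(i).\<close>

lemma sum_right_orbits:
  assumes \<Gamma>: "\<And>s t t'. \<Gamma> (cl i j s t) = \<Gamma> (cl i j s t')"
  shows "(\<Sum>y\<in>representatives (right_orbits Qc (i, j, g)). \<Gamma> y) = (\<Sum>k<F i j. \<Gamma> (cl i j (int k) 0))"
proof -
  define orb where "orb y = (\<lambda>h. ract (cartan_biset D i j) y h) ` carrier (Z (D j))" for y
  have orb: "orb (cl i j s t) = range (cl i j s)" for s t unfolding orb_def by (rule orbit_right)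
  have "right_orbits Qc (i, j, g) = orb ` bset (cartan_biset D i j)"
    by (simp add: right_orbits_def orb_def[abs_def])
  moreover have "(\<Sum>y\<in>representatives (orb ` bset (cartan_biset D i j)). \<Gamma> y) = (\<Sum>k<F i j. \<Gamma> (cl i j (int k) 0))"
  proof (rule sum_representatives)
    fix y assume "y \<in> bset (cartan_biset D i j)"
    then obtain s t where y: "y = cl i j s t" by (rule cl_cases[OF i j])
    show "y \<in> orb y" unfolding y orb by (rule rangeI)
    show "orb y \<subseteq> bset (cartan_biset D i j)" unfolding y orb using cl_bset[OF i j] by blast
    show "orb y' = orb y" if "y' \<in> orb y" for y' using that unfolding y orb by (auto simp: orb)
    show "\<Gamma> y' = \<Gamma> y" if "y' \<in> orb y" for y' using that \<Gamma>[of s _ t] unfolding y orb by auto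
    have F: "F i j > 0" by (rule F_pos[OF i j])
    define m where "m = nat (s mod int (F i j))"
    have m: "int m = s mod int (F i j)" "m < F i j" using F by (simp_all add: m_def nat_less_iff)
    have "cl i j (int m) 0 = cl i j s (- (s div int (F i j) * int (F j i)))"
      by (rule cl_eq[OF i j, of _ _ "s div int (F i j)"]) (simp_all add: m)
    with m show "\<exists>k<F i j. cl i j (int k) 0 \<in> orb y" unfolding y orb by blast
  next
    show "inj_on (\<lambda>k. orb (cl i j (int k) 0)) {..<F i j}"
    proof (rule inj_onI)
      fix m n assume mn: "m \<in> {..<F i j}" "n \<in> {..<F i j}" "orb (cl i j (int m) 0) = orb (cl i j (int n) 0)"
      then have "cl i j (int m) 0 \<in> range (cl i j (int n))" unfolding orb by blast
      then obtain x where "cl i j (int m) 0 = cl i j (int n) x" by blast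
      then obtain h where "[int n = int m + h * int (F i j)] (mod int (D i))" using cl_eqD[OF i j] by blast
      then have "[int n = int m] (mod int (F i j))" by (rule cong_F)
      with mn show "m = n" by (simp add: cong_int_iff cong_def)
    qed
  qed (rule cl_bset[OF i j])
  ultimately show ?thesis by (simp only:)
qed

text \<open>The representatives have the exponents \<open>- int k\<close>, so that the products over
  left orbits become conjugates by \<open>k\<close>-th powers of the generator at \<open>j\<close>,
  in the same form as over right orbits.\<close>

lemma sum_left_orbits:
  assumes \<Gamma>: "\<And>s s' t. \<Gamma> (cl i j s t) = \<Gamma> (cl i j s' t)"
  shows "(\<Sum>y\<in>representatives (left_orbits Qc (i, j, g)). \<Gamma> y) = (\<Sum>k<F j i. \<Gamma> (cl i j 0 (- int k)))"
proof -
  define orb where "orb y = (\<lambda>h. lact (cartan_biset D i j) h y) ` carrier (Z (D i))" for y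
  have orb: "orb (cl i j s t) = range (\<lambda>s. cl i j s t)" for s t unfolding orb_def by (rule orbit_left)
  have "left_orbits Qc (i, j, g) = orb ` bset (cartan_biset D i j)"
    by (simp add: left_orbits_def orb_def[abs_def])
  moreover have "(\<Sum>y\<in>representatives (orb ` bset (cartan_biset D i j)). \<Gamma> y) = (\<Sum>k<F j i. \<Gamma> (cl i j 0 (- int k)))"
  proof (rule sum_representatives)
    fix y assume "y \<in> bset (cartan_biset D i j)"
    then obtain s t where y: "y = cl i j s t" by (rule cl_cases[OF i j])
    show "y \<in> orb y" unfolding y orb by (rule rangeI)
    show "orb y \<subseteq> bset (cartan_biset D i j)" unfolding y orb using cl_bset[OF i j] by blast
    show "orb y' = orb y" if "y' \<in> orb y" for y' using that unfolding y orb by (auto simp: orb)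
    show "\<Gamma> y' = \<Gamma> y" if "y' \<in> orb y" for y' using that \<Gamma>[of _ t s] unfolding y orb by auto
    have F: "F j i > 0" by (rule F_pos[OF j i])
    define m where "m = nat ((- t) mod int (F j i))"
    have m: "int m = (- t) mod int (F j i)" "m < F j i" using F by (simp_all add: m_def nat_less_iff)
    have "- t = (- t) div int (F j i) * int (F j i) + int m" unfolding m by simp
    then have t: "t = - ((- t) div int (F j i)) * int (F j i) + - int m" by simp
    have "cl i j ((- t) div int (F j i) * int (F i j)) t = cl i j 0 (- int m)"
      by (rule cl_eq[OF i j, of _ _ "- ((- t) div int (F j i))"]) (simp, unfold cong_def, rule arg_cong, rule t)
    with m show "\<exists>k<F j i. cl i j 0 (- int k) \<in> orb y" unfolding y orb by blast
  next
    show "inj_on (\<lambda>k. orb (cl i j 0 (- int k))) {..<F j i}"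
    proof (rule inj_onI)
      fix m n assume mn: "m \<in> {..<F j i}" "n \<in> {..<F j i}" "orb (cl i j 0 (- int m)) = orb (cl i j 0 (- int n))"
      then have "cl i j 0 (- int m) \<in> range (\<lambda>s. cl i j s (- int n))" unfolding orb by blast
      then obtain x where "cl i j 0 (- int m) = cl i j x (- int n)" by blast
      then obtain h where "[- int m = h * int (F j i) + (- int n)] (mod int (D j))" using cl_eqD[OF i j] by blast
      then have "[- int m = - int n] (mod int (F j i))" unfolding add.commute[of "h * _"] by (rule cong_F)
      then have "[int m = int n] (mod int (F j i))" by (simp add: cong_minus_minus_iff)
      with mn show "m = n" by (simp add: cong_int_iff cong_def)
    qed
  qed (rule cl_bset[OF i j])
  ultimately show ?thesis by (simp only:)
qed

end

lemma sum_dbl: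
  fixes G :: "'v \<Rightarrow> 'v \<Rightarrow> 't::comm_monoid_add"
  shows "(\<Sum>i\<in>I. \<Sum>j\<in>{j. (j, i) \<in> dbl}. G i j) = (\<Sum>(i, j)\<in>\<Omega>. G i j + G j i)"
proof -
  have fin: "finite \<Omega>" by (rule finite_subset[OF \<Omega>_sub]) (simp add: finite_I)
  have "(\<Sum>i\<in>I. \<Sum>j\<in>{j. (j, i) \<in> dbl}. G i j) = (\<Sum>(i, j)\<in>(SIGMA i:I. {j. (j, i) \<in> dbl}). G i j)"
    using finite_I finite_dbl by (intro sum.Sigma) auto
  also have "(SIGMA i:I. {j. (j, i) \<in> dbl}) = \<Omega> \<union> \<Omega>\<inverse>"
    using \<Omega>_sub by (auto simp: dbl_iff)
  also have "(\<Sum>(i, j)\<in>\<Omega> \<union> \<Omega>\<inverse>. G i j) = (\<Sum>(i, j)\<in>\<Omega>. G i j) + (\<Sum>(i, j)\<in>\<Omega>\<inverse>. G i j)"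
    using fin asym by (intro sum.union_disjoint) auto
  also have "(\<Sum>(i, j)\<in>\<Omega>\<inverse>. G i j) = (\<Sum>(i, j)\<in>\<Omega>. G j i)"
    by (rule sum.reindex_bij_witness[of _ prod.swap prod.swap]) auto
  finally show ?thesis by (simp add: case_prod_unfold sum.distrib)
qed

lemma sum_arcs:
  fixes G :: "'v \<times> 'v \<times> nat \<Rightarrow> 't::comm_monoid_add"
  shows "(\<Sum>a\<in>arcs (quiver Qc). G a) = (\<Sum>(i, j)\<in>\<Omega>. \<Sum>g\<in>{1..N i j}. G (i, j, g))"
proof -
  have fin: "finite \<Omega>" by (rule finite_subset[OF \<Omega>_sub]) (simp add: finite_I)
  have "(\<Sum>(i, j)\<in>\<Omega>. \<Sum>g\<in>{1..N i j}. G (i, j, g)) = (\<Sum>a\<in>\<Omega>. \<Sum>g\<in>{1..N (fst a) (snd a)}. G (fst a, snd a, g))"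
    by (simp add: case_prod_unfold)
  also have "\<dots> = (\<Sum>(a, g)\<in>(SIGMA a:\<Omega>. {1..N (fst a) (snd a)}). G (fst a, snd a, g))"
    using fin by (intro sum.Sigma) auto
  also have "\<dots> = (\<Sum>a\<in>arcs (quiver Qc). G a)"
    by (rule sum.reindex_bij_witness[of _ "\<lambda>(i, j, g). ((i, j), g)" "\<lambda>((i, j), g). (i, j, g)"]) auto
  finally show ?thesis ..
qed

end

section \<open>Homomorphisms out of the category algebra of the doubled EI quiver\<close>

locale ei_hom = ei_model I \<Omega> N P r d xinv yinv z C D + scalars sc
  for I :: "'v set" and \<Omega> N P r d xinv yinv and z :: "'v \<Rightarrow> 'k::field" and C D
    and sc :: "'k \<Rightarrow> 't::ring_1" +
  fixes f :: "(('v, ('v \<times> 'v \<times> nat) darrow, int, (int \<times> int) set) ei_mor \<Rightarrow>\<^sub>0 'k) \<Rightarrow> 't"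
  assumes hom: "nonunital_hom (cat_alg (ei_cat (double_ei_quiver (cartan_ei_quiver I C D \<Omega>)))) sc f"
begin

sublocale SA: species_algebra I \<Omega> N P r d xinv yinv z sc ..

lemmas f_simps = nonunital_homD[OF hom]
lemmas f_simps' = nonunital_hom_simps[OF EC.finite_cat_axioms scalars_axioms hom]

definition fm :: "('v, ('v \<times> 'v \<times> nat) darrow, int, (int \<times> int) set) ei_mor \<Rightarrow> 't" where
  "fm x = f (basis_elt x)"

definition fg :: "'v \<Rightarrow> int \<Rightarrow> 't" where "fg i s = fm (gm i s)"
definition fe :: "'v \<Rightarrow> 't" where "fe i = fg i 0"
definition fh :: "'v \<Rightarrow> 't" where "fh i = fg i 1"
text \<open>A reverse arrow is represented by the dual of the base point of its biset;
  \<open>st j i g 0 0\<close> is a morphism from \<open>j\<close> to \<open>i\<close>.\<close>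

definition fa :: "'v \<Rightarrow> 'v \<Rightarrow> nat \<Rightarrow> 't" where
  "fa i j g = (if (i, j) \<in> \<Omega> then fm (co i j g 0 0) else fm (st j i g 0 0))"

lemma fm_mult:
  assumes "x \<in> mors (ei_cat DQ)" "y \<in> mors (ei_cat DQ)"
  shows "fm x * fm y = (if cdom (ei_cat DQ) x = ccod (ei_cat DQ) y then fm (ccomp (ei_cat DQ) x y) else 0)"
proof -
  have "fm x * fm y = f (basis_elt x \<otimes>\<^bsub>EA\<^esub> basis_elt y)"
    unfolding fm_def by (rule f_simps(2)[symmetric]) (rule EC.single_carrier[OF assms(1)], rule EC.single_carrier[OF assms(2)])
  then show ?thesis by (simp add: cat_alg_mult_single f_simps'(1) fm_def)
qed

lemma fg_fg: "i \<in> I \<Longrightarrow> j \<in> I \<Longrightarrow> fg i s * fg j t = (if i = j then fg i (s + t) else 0)"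
  unfolding fg_def by (simp add: fm_mult gm_mor gm_gm)

lemma fg_cong: "[s = t] (mod int (D i)) \<Longrightarrow> fg i s = fg i t"
  by (simp add: fg_def gm_def cong_def)

lemma fg_power: "i \<in> I \<Longrightarrow> fg i (int n) = fh i ^ n * fe i"
proof (induction n)
  case (Suc n)
  have "fg i (int (Suc n)) = fh i * fg i (int n)" using Suc.prems by (simp add: fh_def fg_fg)
  with Suc show ?case by (simp add: mult.assoc)
qed (simp add: fe_def)

lemma fh_e: "i \<in> I \<Longrightarrow> fh i ^ n * fe i = fe i * fh i ^ n"
  by (rule power_intertwine) (simp add: fe_def fh_def fg_fg)

lemma fg_power': "i \<in> I \<Longrightarrow> n > 0 \<Longrightarrow> fg i (int n) = fh i ^ n"
  using gr0_conv_Suc[of n] by (auto simp: fg_power power_Suc2 mult.assoc simp del: power_Suc of_nat_Suc) (simp add: fe_def fh_def fg_fg)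

lemma fg_minus:
  assumes "i \<in> I" "n < D i"
  shows "fg i (- int n) = fh i ^ (D i - n)"
proof -
  have "fg i (- int n) = fg i (int (D i - n))" using assms(2) by (intro fg_cong) (simp add: cong_def of_nat_diff)
  also have "\<dots> = fh i ^ (D i - n)" using assms by (intro fg_power') simp_all
  finally show ?thesis .
qed

context
  fixes i j g assumes ij: "(i, j) \<in> \<Omega>" and g: "g \<in> {1..N i j}"
begin

lemma ijI: "i \<in> I" "j \<in> I" using \<Omega>_I[OF ij] by auto

lemma fa_eq: "fa i j g = fm (co i j g 0 0)" "fa j i g = fm (st i j g 0 0)"
  using ij asym[OF ij] by (simp_all add: fa_def)

lemma fg_co: "fg i x * fm (co i j g s t) = fm (co i j g (x + s) t)"
  and co_fg: "fm (co i j g s t) * fg j x = fm (co i j g s (t + x))"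
  and fg_st: "fg j x * fm (st i j g s t) = fm (st i j g s (t - x))"
  and st_fg: "fm (st i j g s t) * fg i x = fm (st i j g (s - x) t)"
  unfolding fg_def using ijI
  by (simp_all add: fm_mult gm_mor co_mor[OF ij g] st_mor[OF ij g] gm_co[OF ij g] co_gm[OF ij g] gm_st[OF ij g] st_gm[OF ij g])

lemma fm_co: "fm (co i j g s t) = fg i s * (fa i j g * fg j t)"
  by (simp add: fa_eq co_fg fg_co)

lemma fm_st: "fm (st i j g s t) = fg j (- t) * (fa j i g * fg i (- s))"
  by (simp add: fa_eq fg_st st_fg)

lemma fa_fe: "fe i * fa i j g = fa i j g" "fa i j g * fe j = fa i j g" "fe j * fa j i g = fa j i g" "fa j i g * fe i = fa j i g"
  by (simp_all add: fa_eq fe_def fg_co co_fg fg_st st_fg)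

text \<open>In the biset, \<eta>_i^(F_ij) on the left equals \<eta>_j^(F_ji) on the right, because
  both are images of the generator of G_ij.\<close>

lemma fh_fa: "fh i ^ F i j * fa i j g = fa i j g * fh j ^ F j i" "fh j ^ F j i * fa j i g = fa j i g * fh i ^ F i j"
proof -
  have F: "fh i ^ F i j = fg i (int (F i j))" "fh j ^ F j i = fg j (int (F j i))"
    using ijI F_pos by (simp_all add: fg_power')
  have "cl i j (int (F i j)) 0 = cl i j 0 (int (F j i))"
    by (rule cl_eq[OF ijI, of _ _ "- 1"]) (simp_all add: cong_def)
  then show "fh i ^ F i j * fa i j g = fa i j g * fh j ^ F j i"
    unfolding F fa_eq fg_co co_fg by (simp add: co_def)
  have "cl i j 0 (- int (F j i)) = cl i j (- int (F i j)) 0"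
    by (rule cl_eq[OF ijI, of _ _ "- 1"]) (simp_all add: cong_def)
  then show "fh j ^ F j i * fa j i g = fa j i g * fh i ^ F i j"
    unfolding F fa_eq fg_st st_fg by (simp add: st_def)
qed

end

lemma dbl_cases:
  assumes "(i, j) \<in> dbl" "g \<in> {1..N i j}"
  obtains "(i, j) \<in> \<Omega>" | "(j, i) \<in> \<Omega>" "g \<in> {1..N j i}"
  using assms N_sym by (auto simp: dbl_iff)

lemma ei_action: "ei_action I \<Omega> N P r d xinv yinv z sc fe fh fa"
proof unfold_locales
  fix i j assume "i \<in> I" "j \<in> I"
  then show "fe i * fe j = (if i = j then fe i else 0)" by (simp add: fe_def fg_fg)
next
  fix i assume i: "i \<in> I"
  show "fe i * fh i = fh i" "fh i * fe i = fh i" using i by (simp_all add: fe_def fh_def fg_fg)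
  have "fh i ^ D i = fg i (int (D i))" using fg_power'[OF i D_pos[OF i]] by simp
  also have "\<dots> = fe i" unfolding fe_def by (rule fg_cong) (simp add: cong_def)
  finally show "fh i ^ (q i * d i) = fe i" by (simp add: D_eq[OF i])
next
  fix i j g assume ij: "(i, j) \<in> dbl" "g \<in> {1..N i j}"
  show "fe i * fa i j g = fa i j g" "fa i j g * fe j = fa i j g" "fh i ^ F i j * fa i j g = fa i j g * fh j ^ F j i"
    using ij by (cases rule: dbl_cases; simp add: fa_fe fh_fa)+
qed

text \<open>The contribution of one arrow to the relator at \<open>i\<close>: by
  \<open>rho_term\<close>, it is the sum over right orbits if \<open>(i, j)\<close> lies in
  \<Omega>, and the sum over left orbits if \<open>(j, i)\<close> does.\<close>

definition T :: "'v \<Rightarrow> 'v \<Rightarrow> nat \<Rightarrow> 't" where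
  "T i j g = (\<Sum>n<F i j. fh i ^ n * (fa i j g * fa j i g * fh i ^ (D i - n)))"

lemma F_le_D: "i \<in> I \<Longrightarrow> j \<in> I \<Longrightarrow> F i j \<le> D i"
  by (rule dvd_imp_le[OF _ D_pos]) (simp_all add: D_F[of i j])

lemma T_eq:
  assumes "i \<in> I" "j \<in> I" "fe i * (fa i j g * fa j i g) = fa i j g * fa j i g"
  shows "(\<Sum>n<F i j. fg i (int n) * (fa i j g * fa j i g * fg i (- int n))) = T i j g"
  unfolding T_def
proof (rule sum.cong[OF refl])
  fix n assume "n \<in> {..<F i j}"
  then have n: "n < D i" using F_le_D[OF assms(1,2)] by simp
  have "fg i (int n) * (fa i j g * fa j i g * fg i (- int n)) = fh i ^ n * (fe i * (fa i j g * fa j i g)) * fg i (- int n)"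
    unfolding fg_power[OF assms(1)] by (simp only: mult.assoc)
  then show "fg i (int n) * (fa i j g * fa j i g * fg i (- int n)) = fh i ^ n * (fa i j g * fa j i g * fh i ^ (D i - n))"
    unfolding assms(3) fg_minus[OF assms(1) n] by (simp only: mult.assoc)
qed

lemma ei_relator_T: "(\<Sum>i\<in>I. SA.ei_relator fh fa i) = (\<Sum>(i, j)\<in>\<Omega>. \<Sum>g\<in>{1..N i j}. T i j g - T j i g)"
proof -
  have "(\<Sum>i\<in>I. SA.ei_relator fh fa i) = (\<Sum>i\<in>I. \<Sum>j\<in>{j. (j, i) \<in> dbl}. \<Sum>g\<in>{1..N j i}. sc (sgn i j) * T i j g)"
    by (rule sum.cong[OF refl]) (simp add: SA.ei_relator_def T_def D_eq)
  also have "\<dots> = (\<Sum>(i, j)\<in>\<Omega>. (\<Sum>g\<in>{1..N j i}. sc (sgn i j) * T i j g) + (\<Sum>g\<in>{1..N i j}. sc (sgn j i) * T j i g))"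
    by (rule sum_dbl)
  also have "\<dots> = (\<Sum>(i, j)\<in>\<Omega>. \<Sum>g\<in>{1..N i j}. T i j g - T j i g)"
  proof (rule sum.cong[OF refl], clarify)
    fix i j assume ij: "(i, j) \<in> \<Omega>"
    have "sc (sgn i j) = 1" "sc (sgn j i) = - 1" using ij asym[OF ij] by (simp_all add: sgn_def gp_sgn_def sc_minus)
    then show "(\<Sum>g\<in>{1..N j i}. sc (sgn i j) * T i j g) + (\<Sum>g\<in>{1..N i j}. sc (sgn j i) * T j i g)
      = (\<Sum>g\<in>{1..N i j}. T i j g - T j i g)"
      using N_sym[OF ij] by (simp add: sum_subtractf sum_negf)
  qed
  finally show ?thesis .
qed

text \<open>For b the class \<open>cl i j s t\<close>, the exponent \<open>t\<close> cancels in the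
  product of b with its dual, which is \<open>fa i j g * fa j i g\<close> conjugated by
  \<open>fg i s\<close>. In the opposite product \<open>s\<close> cancels and the conjugation is by
  \<open>fg j (- t)\<close>. Summation over orbits gives the two values of \<open>T\<close>.\<close>

lemma rho_term:
  assumes a: "(i, j) \<in> \<Omega>" "g \<in> {1..N i j}"
  defines "R \<equiv> \<Sum>b\<in>representatives (right_orbits Qc (i, j, g)). ei_elt Qc (i, j, g) b \<otimes>\<^bsub>EA\<^esub> ei_star Qc (i, j, g) b"
    and "L \<equiv> \<Sum>c\<in>representatives (left_orbits Qc (i, j, g)). ei_star Qc (i, j, g) c \<otimes>\<^bsub>EA\<^esub> ei_elt Qc (i, j, g) c"
  shows "R \<in> carrier EA" "L \<in> carrier EA" "f R = T i j g" "f L = T j i g"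
proof -
  have i: "i \<in> I" and j: "j \<in> I" using ijI[OF a] by auto
  let ?b = "\<lambda>s t. basis_elt (co i j g s t) \<otimes>\<^bsub>EA\<^esub> basis_elt (st i j g s t)"
  let ?c = "\<lambda>s t. basis_elt (st i j g s t) \<otimes>\<^bsub>EA\<^esub> basis_elt (co i j g s t)"
  have car: "basis_elt (co i j g s t) \<in> carrier EA" "basis_elt (st i j g s t) \<in> carrier EA" for s t
    by (intro EC.single_carrier co_mor[OF a] st_mor[OF a])+
  have rb: "representatives (right_orbits Qc (i, j, g)) \<subseteq> bset (cartan_biset D i j)"
  proof (rule representatives_subset)
    fix U assume "U \<in> right_orbits Qc (i, j, g)"
    then obtain y where "y \<in> bset (cartan_biset D i j)" "U = (\<lambda>h. ract (cartan_biset D i j) y h) ` carrier (Z (D j))"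
      by (auto simp: right_orbits_def)
    moreover from this(1) obtain s t where "y = cl i j s t" by (rule cl_cases[OF i j])
    ultimately have "U = range (cl i j s)" by (simp add: orbit_right[OF a])
    then show "U \<noteq> {} \<and> U \<subseteq> bset (cartan_biset D i j)" using cl_bset[OF i j] by blast
  qed
  have lb: "representatives (left_orbits Qc (i, j, g)) \<subseteq> bset (cartan_biset D i j)"
  proof (rule representatives_subset)
    fix U assume "U \<in> left_orbits Qc (i, j, g)"
    then obtain y where "y \<in> bset (cartan_biset D i j)" "U = (\<lambda>h. lact (cartan_biset D i j) h y) ` carrier (Z (D i))"
      by (auto simp: left_orbits_def)
    moreover from this(1) obtain s t where "y = cl i j s t" by (rule cl_cases[OF i j])
    ultimately have "U = range (\<lambda>s. cl i j s t)" by (simp add: orbit_left[OF a])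
    then show "U \<noteq> {} \<and> U \<subseteq> bset (cartan_biset D i j)" using cl_bset[OF i j] by blast
  qed
  have car: "ei_elt Qc (i, j, g) y \<in> carrier EA" "ei_star Qc (i, j, g) y \<in> carrier EA"
    if y: "y \<in> bset (cartan_biset D i j)" for y
  proof -
    from y obtain s t where y: "y = cl i j s t" by (rule cl_cases[OF i j])
    show "ei_elt Qc (i, j, g) y \<in> carrier EA" unfolding y elt_co[OF a] by (rule EC.single_carrier[OF co_mor[OF a]])
    show "ei_star Qc (i, j, g) y \<in> carrier EA" unfolding y star_st[OF a] by (rule EC.single_carrier[OF st_mor[OF a]])
  qed
  have R1: "ei_elt Qc (i, j, g) y \<otimes>\<^bsub>EA\<^esub> ei_star Qc (i, j, g) y \<in> carrier EA" if "y \<in> representatives (right_orbits Qc (i, j, g))" for y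
    by (rule EC.mult_carrier; rule car; rule subsetD[OF rb that])
  have L1: "ei_star Qc (i, j, g) y \<otimes>\<^bsub>EA\<^esub> ei_elt Qc (i, j, g) y \<in> carrier EA" if "y \<in> representatives (left_orbits Qc (i, j, g))" for y
    by (rule EC.mult_carrier; rule car; rule subsetD[OF lb that])
  show "R \<in> carrier EA" unfolding R_def by (rule EC.sum_carrier[OF R1])
  show "L \<in> carrier EA" unfolding L_def by (rule EC.sum_carrier[OF L1])
  define \<Gamma> where "\<Gamma> y = f (ei_elt Qc (i, j, g) y) * f (ei_star Qc (i, j, g) y)" for y
  define \<Delta> where "\<Delta> y = f (ei_star Qc (i, j, g) y) * f (ei_elt Qc (i, j, g) y)" for y
  have \<Gamma>: "\<Gamma> (cl i j s t) = fg i s * (fa i j g * fa j i g * fg i (- s))" for s t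
  proof -
    have "\<Gamma> (cl i j s t) = fm (co i j g s 0) * fg j t * fm (st i j g s t)"
      unfolding co_fg[OF a] by (simp add: \<Gamma>_def elt_co[OF a] star_st[OF a] fm_def)
    also have "\<dots> = fm (co i j g s 0) * fm (st i j g s 0)"
      by (simp add: mult.assoc fg_st[OF a])
    also have "\<dots> = fg i s * fm (co i j g 0 0) * (fm (st i j g 0 0) * fg i (- s))"
      by (simp add: fg_co[OF a] st_fg[OF a])
    finally show ?thesis by (simp add: fa_eq[OF a] mult.assoc)
  qed
  have \<Delta>: "\<Delta> (cl i j s t) = fg j (- t) * (fa j i g * fa i j g * fg j t)" for s t
  proof -
    have "\<Delta> (cl i j s t) = fm (st i j g 0 t) * fg i (- s) * fm (co i j g s t)"
      unfolding st_fg[OF a] by (simp add: \<Delta>_def elt_co[OF a] star_st[OF a] fm_def)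
    also have "\<dots> = fm (st i j g 0 t) * fm (co i j g 0 t)"
      by (simp add: mult.assoc fg_co[OF a])
    also have "\<dots> = fg j (- t) * fm (st i j g 0 0) * (fm (co i j g 0 0) * fg j t)"
      by (simp add: fg_st[OF a] co_fg[OF a])
    finally show ?thesis by (simp add: fa_eq[OF a] mult.assoc)
  qed
  have "f R = (\<Sum>y\<in>representatives (right_orbits Qc (i, j, g)). \<Gamma> y)"
    unfolding R_def \<Gamma>_def
    by (rule trans[OF f_simps'(3)[OF R1] sum.cong[OF refl]], assumption, rule f_simps(2))
      (rule car, erule subsetD[OF rb])+
  also have "\<dots> = (\<Sum>n<F i j. \<Gamma> (cl i j (int n) 0))"
    by (rule sum_right_orbits[OF a]) (simp only: \<Gamma>)
  also have "\<dots> = T i j g"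
    unfolding \<Gamma> by (rule T_eq[OF i j]) (simp only: fa_fe[OF a] flip: mult.assoc)
  finally show "f R = T i j g" .
  have "f L = (\<Sum>y\<in>representatives (left_orbits Qc (i, j, g)). \<Delta> y)"
    unfolding L_def \<Delta>_def
    by (rule trans[OF f_simps'(3)[OF L1] sum.cong[OF refl]], assumption, rule f_simps(2))
      (rule car, erule subsetD[OF lb])+
  also have "\<dots> = (\<Sum>n<F j i. \<Delta> (cl i j 0 (- int n)))"
    by (rule sum_left_orbits[OF a]) (simp only: \<Delta>)
  also have "\<dots> = T j i g"
    unfolding \<Delta> minus_minus by (rule T_eq[OF j i]) (simp only: fa_fe[OF a] flip: mult.assoc)
  finally show "f L = T j i g" .
qed

lemma rho_carrier: "ei_rho Qc \<in> carrier EA"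
  and f_rho: "f (ei_rho Qc) = (\<Sum>i\<in>I. SA.ei_relator fh fa i)"
proof -
  define G where "G a = (\<Sum>b\<in>representatives (right_orbits Qc a). ei_elt Qc a b \<otimes>\<^bsub>EA\<^esub> ei_star Qc a b) -
        (\<Sum>c\<in>representatives (left_orbits Qc a). ei_star Qc a c \<otimes>\<^bsub>EA\<^esub> ei_elt Qc a c)" for a
  have rho: "ei_rho Qc = (\<Sum>a\<in>arcs (quiver Qc). G a)"
    by (simp only: ei_rho_def Let_def G_def)
  have G: "G a \<in> carrier EA" "f (G a) = (case a of (i, j, g) \<Rightarrow> T i j g - T j i g)" if "a \<in> arcs (quiver Qc)" for a
  proof -
    obtain i j g where ijg: "a = (i, j, g)" by (cases a)
    have a: "(i, j) \<in> \<Omega>" "g \<in> {1..N i j}" using that by (simp_all add: ijg)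
    note t = rho_term[OF a]
    show "G a \<in> carrier EA"
      using EC.add_carrier[OF t(1) EC.minus_carrier[OF t(2)]] unfolding G_def ijg by simp
    show "f (G a) = (case a of (i, j, g) \<Rightarrow> T i j g - T j i g)"
      unfolding G_def ijg f_simps'(2)[OF t(1,2)] t(3,4) by simp
  qed
  show "ei_rho Qc \<in> carrier EA" unfolding rho by (rule EC.sum_carrier[OF G(1)])
  have "f (ei_rho Qc) = (\<Sum>a\<in>arcs (quiver Qc). f (G a))" unfolding rho by (rule f_simps'(3)[OF G(1)])
  also have "\<dots> = (\<Sum>a\<in>arcs (quiver Qc). case a of (i, j, g) \<Rightarrow> T i j g - T j i g)"
    by (rule sum.cong[OF refl G(2)])
  also have "\<dots> = (\<Sum>i\<in>I. SA.ei_relator fh fa i)" unfolding sum_arcs ei_relator_T by simp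
  finally show "f (ei_rho Qc) = (\<Sum>i\<in>I. SA.ei_relator fh fa i)" .
qed

text \<open>The idempotents \<open>fe i\<close> separate the parts of rho at different vertices, so
  one element encodes a relation for each vertex.\<close>

lemma f_rho_zero_iff: "f (ei_rho Qc) = 0 \<longleftrightarrow> (\<forall>i\<in>I. SA.ei_relator fh fa i = 0)"
proof
  interpret A: ei_action I \<Omega> N P r d xinv yinv z sc fe fh fa by (rule ei_action)
  assume 0: "f (ei_rho Qc) = 0"
  have e: "fe i * SA.ei_relator fh fa j = (if i = j then SA.ei_relator fh fa j else 0)" if i: "i \<in> I" and j: "j \<in> I" for i j
  proof -
    have "fe j * SA.ei_relator fh fa j = SA.ei_relator fh fa j"
      unfolding SA.ei_relator_def sum_distrib_left
    proof (intro sum.cong[OF refl], unfold sc_left_comm[of "fe j"] sum_distrib_left, intro arg_cong[of _ _ "(*) _"] sum.cong[OF refl])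
      fix l g n assume l: "l \<in> {l. (l, j) \<in> dbl}" and g: "g \<in> {1..N l j}"
      have jl: "(j, l) \<in> dbl" "g \<in> {1..N j l}" using l g dbl_sym dbl_N by auto
      have "fe j * (fh j ^ n * (fa j l g * fa l j g * fh j ^ (q j * d j - n))) =
        (fe j * fh j ^ n) * fa j l g * (fa l j g * fh j ^ (q j * d j - n))" by (simp only: mult.assoc)
      also have "(fe j * fh j ^ n) * fa j l g = fh j ^ n * fa j l g"
        unfolding fh_e[OF j, symmetric] mult.assoc A.eA[OF jl] ..
      finally show "fe j * (fh j ^ n * (fa j l g * fa l j g * fh j ^ (q j * d j - n))) =
        fh j ^ n * (fa j l g * fa l j g * fh j ^ (q j * d j - n))" by (simp only: mult.assoc)
    qed
    then show ?thesis using A.ee[OF i j] by (metis mult.assoc mult_zero_left)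
  qed
  show "\<forall>i\<in>I. SA.ei_relator fh fa i = 0"
  proof
    fix i assume i: "i \<in> I"
    have "0 = fe i * (\<Sum>j\<in>I. SA.ei_relator fh fa j)" using 0 by (simp add: f_rho)
    also have "\<dots> = (\<Sum>j\<in>I. if i = j then SA.ei_relator fh fa j else 0)"
      unfolding sum_distrib_left by (rule sum.cong[OF refl]) (rule e[OF i])
    also have "\<dots> = SA.ei_relator fh fa i" using i finite_I by simp
    finally show "SA.ei_relator fh fa i = 0" ..
  qed
qed (simp add: f_rho)

lemma f_rho_ideal:
  assumes "\<And>i. i \<in> I \<Longrightarrow> SA.ei_relator fh fa i = 0" "x \<in> Idl\<^bsub>EA\<^esub> {ei_rho Qc}"
  shows "f x = 0"
  by (rule nonunital_hom_genideal[OF EC.ring_cat_alg hom _ _ assms(2)])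
    (use rho_carrier f_rho_zero_iff assms(1) in auto)

end

section \<open>Extension of an \<open>ei_action\<close> to the category of the doubled
  quiver\<close>

context ei_model
begin

lemma DQ_arcE:
  assumes "a \<in> arcs (quiver DQ)" "y \<in> bset (abiset DQ a)"
  obtains (Orig) i j g s t where "a = Orig (i, j, g)" "(i, j) \<in> \<Omega>" "g \<in> {1..N i j}" "y = cl i j s t"
  | (Star) i j g s t where "a = Star (i, j, g)" "(i, j) \<in> \<Omega>" "g \<in> {1..N i j}" "y = cl i j s t"
proof (cases a)
  case a: (Orig b)
  obtain i j g where b: "b = (i, j, g)" by (cases b)
  have ij: "(i, j) \<in> \<Omega>" and g: "g \<in> {1..N i j}" and y: "y \<in> bset (cartan_biset D i j)"
    using assms unfolding a b by simp_all
  obtain s t where y': "y = cl i j s t" using \<Omega>_I[OF ij] by (auto intro: cl_cases[OF _ _ y])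
  show thesis by (rule Orig[OF _ ij g y']) (simp only: a b)
next
  case a: (Star b)
  obtain i j g where b: "b = (i, j, g)" by (cases b)
  have ij: "(i, j) \<in> \<Omega>" and g: "g \<in> {1..N i j}" and y: "y \<in> bset (cartan_biset D i j)"
    using assms unfolding a b by simp_all
  obtain s t where y': "y = cl i j s t" using \<Omega>_I[OF ij] by (auto intro: cl_cases[OF _ _ y])
  show thesis by (rule Star[OF _ ij g y']) (simp only: a b)
qed

end

locale ei_model_action = ei_model I \<Omega> N P r d xinv yinv z C D + ei_action I \<Omega> N P r d xinv yinv z sc e h A
  for I :: "'v set" and \<Omega> N P r d xinv yinv and z :: "'v \<Rightarrow> 'k::field" and C D
    and sc :: "'k \<Rightarrow> 't::ring_1" and e h A
begin

text \<open>Powers of \<open>h i\<close> with integer exponents, reduced modulo the order; the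
  factor \<open>e i\<close> makes the exponent 0 give \<open>e i\<close> and not 1.\<close>

definition hz :: "'v \<Rightarrow> int \<Rightarrow> 't" where "hz i s = h i ^ nat (s mod int (D i)) * e i"

lemma h_cong: "i \<in> I \<Longrightarrow> [m = n] (mod D i) \<Longrightarrow> h i ^ m * e i = h i ^ n * e i"
  using cyclic_action.h_cong[OF cyc] by (simp add: D_eq)

lemma hz_nat: "i \<in> I \<Longrightarrow> hz i (int n) = h i ^ n * e i"
  unfolding hz_def of_nat_mod[symmetric] nat_int by (rule h_cong) (simp_all add: cong_def)

lemma hz_cong: "[s = t] (mod int (D i)) \<Longrightarrow> hz i s = hz i t"
  by (simp add: hz_def cong_def)

lemma hz_natE:
  assumes "i \<in> I"
  obtains n where "[s = int n] (mod int (D i))" "hz i s = h i ^ n * e i"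
proof -
  have "[s = int (nat (s mod int (D i)))] (mod int (D i))" using D_pos[OF assms] by (simp add: cong_def)
  then show thesis by (rule that) (simp add: hz_def)
qed

lemma hz_hz:
  assumes "i \<in> I"
  shows "hz i s * hz i t = hz i (s + t)"
proof -
  obtain m where m: "[s = int m] (mod int (D i))" "hz i s = h i ^ m * e i" by (rule hz_natE[OF assms])
  obtain n where n: "[t = int n] (mod int (D i))" "hz i t = h i ^ n * e i" by (rule hz_natE[OF assms])
  have "hz i s * hz i t = h i ^ m * (e i * h i ^ n) * e i" unfolding m n by (simp only: mult.assoc)
  also have "e i * h i ^ n = h i ^ n * e i" by (rule cyclic_action.h_comm_e[OF cyc[OF assms], symmetric])
  also have "h i ^ m * (h i ^ n * e i) * e i = hz i (int (m + n))"
    unfolding hz_nat[OF assms] using assms by (simp add: power_add mult.assoc ee)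
  also have "\<dots> = hz i (s + t)"
    by (rule hz_cong) (simp add: cong_add[OF m(1) n(1)] cong_sym)
  finally show ?thesis .
qed

lemma e_hz: "i \<in> I \<Longrightarrow> e i * hz i s = hz i s"
  using hz_hz[of i 0 s] hz_nat[of i 0] by simp

lemma hz_e: "i \<in> I \<Longrightarrow> hz i s * e i = hz i s"
  unfolding hz_def by (simp add: mult.assoc ee)

lemma hz_0: "i \<in> I \<Longrightarrow> hz i 0 = e i"
  using hz_nat[of i 0] by simp

lemma hz_A:
  assumes ij: "(i, j) \<in> dbl" and g: "g \<in> {1..N i j}"
  shows "hz i (s * int (F i j)) * A i j g = A i j g * hz j (s * int (F j i))"
proof -
  have i: "i \<in> I" and j: "j \<in> I" using dbl_I[OF ij] by auto
  \<comment> \<open>Only \<open>s\<close> modulo \<open>k i j\<close> matters on either side, as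
    \<open>F i j * k i j = D i\<close> and \<open>F j i * k i j = D j\<close>. So one natural number
    serves for both exponents.\<close>
  define n where "n = nat (s mod int (k i j))"
  have k: "k i j > 0" using D_pos[OF i] by (simp add: k_def)
  have n: "int n = s mod int (k i j)" using k by (simp add: n_def)
  have ns: "[int n = s] (mod int (k i j))" by (simp add: n cong_def)
  have "int (k i j) dvd int n - s" using ns by (simp only: cong_iff_dvd_diff)
  then have "int (F i j) * int (k i j) dvd int (F i j) * (int n - s)" "int (F j i) * int (k i j) dvd int (F j i) * (int n - s)"
    by (rule mult_dvd_mono[OF dvd_refl])+
  then have "[int (n * F i j) = s * int (F i j)] (mod int (D i))" "[int (n * F j i) = s * int (F j i)] (mod int (D j))"
    unfolding D_F[OF i j] D_F'[OF i j] cong_iff_dvd_diff of_nat_mult right_diff_distrib by (simp_all only: mult.commute)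
  then have hz: "hz i (s * int (F i j)) = h i ^ (n * F i j) * e i" "hz j (s * int (F j i)) = h j ^ (n * F j i) * e j"
    using hz_cong hz_nat i j by metis+
  have "h i ^ (n * F i j) * (e i * A i j g) = A i j g * h j ^ (n * F j i)"
    unfolding eA[OF ij g] mult.commute[of n] power_mult by (rule power_intertwine[OF hA[OF ij g]])
  also have "\<dots> = A i j g * e j * h j ^ (n * F j i)" unfolding Ae[OF ij g] ..
  also have "\<dots> = A i j g * (h j ^ (n * F j i) * e j)"
    unfolding mult.assoc cyclic_action.h_comm_e[OF cyc[OF j]] ..
  finally show ?thesis unfolding hz by (simp only: mult.assoc)
qed

text \<open>By \<open>hz_A\<close>, elements of G_ij pass from one side of the arrow to the other,
  so the value depends only on the class.\<close>

lemma class_invariant: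
  assumes ij: "(i, j) \<in> \<Omega>" and g: "g \<in> {1..N i j}" and eq: "cl i j s t = cl i j s' t'"
  shows "hz i s * (A i j g * hz j t) = hz i s' * (A i j g * hz j t')"
    and "hz j (- t) * (A j i g * hz i (- s)) = hz j (- t') * (A j i g * hz i (- s'))"
proof -
  have i: "i \<in> I" and j: "j \<in> I" using \<Omega>_I[OF ij] by auto
  have d: "(i, j) \<in> dbl" "(j, i) \<in> dbl" using ij by (simp_all add: dbl_iff)
  have g': "g \<in> {1..N j i}" using g N_sym[OF ij] by simp
  obtain x where x: "[s' = s + x * int (F i j)] (mod int (D i))" "[t = x * int (F j i) + t'] (mod int (D j))"
    using cl_eqD[OF i j eq] by blast
  have "hz i s * (A i j g * hz j t) = hz i s * (A i j g * hz j (x * int (F j i))) * hz j t'"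
    unfolding hz_cong[OF x(2)] hz_hz[OF j, symmetric] by (simp only: mult.assoc)
  also have "\<dots> = hz i s * hz i (x * int (F i j)) * (A i j g * hz j t')"
    unfolding hz_A[OF d(1) g, symmetric] by (simp only: mult.assoc)
  also have "hz i s * hz i (x * int (F i j)) = hz i s'"
    unfolding hz_hz[OF i] by (rule hz_cong[OF cong_sym[OF x(1)]])
  finally show "hz i s * (A i j g * hz j t) = hz i s' * (A i j g * hz j t')" .
  have y: "[- t' = - t + x * int (F j i)] (mod int (D j))" "[- s = x * int (F i j) + (- s')] (mod int (D i))"
  proof -
    have "- t' - (- t + x * int (F j i)) = t - (x * int (F j i) + t')" "- s - (x * int (F i j) + - s') = s' - (s + x * int (F i j))"
      by simp_all
    with x show "[- t' = - t + x * int (F j i)] (mod int (D j))" "[- s = x * int (F i j) + (- s')] (mod int (D i))"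
      by (simp_all only: cong_iff_dvd_diff)
  qed
  have "hz j (- t) * (A j i g * hz i (- s)) = hz j (- t) * (A j i g * hz i (x * int (F i j))) * hz i (- s')"
    unfolding hz_cong[OF y(2)] hz_hz[OF i, symmetric] by (simp only: mult.assoc)
  also have "\<dots> = hz j (- t) * hz j (x * int (F j i)) * (A j i g * hz i (- s'))"
    unfolding hz_A[OF d(2) g', symmetric] by (simp only: mult.assoc)
  also have "hz j (- t) * hz j (x * int (F j i)) = hz j (- t')"
    unfolding hz_hz[OF j] by (rule hz_cong[OF cong_sym[OF y(1)]])
  finally show "hz j (- t) * (A j i g * hz i (- s)) = hz j (- t') * (A j i g * hz i (- s'))" .
qed

text \<open>A pair of exponents is chosen for the class; \<open>class_invariant\<close> makes the
  choice harmless, see \<open>\<beta>_cl\<close>.\<close>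

fun \<beta> :: "('v \<times> 'v \<times> nat) darrow \<Rightarrow> (int \<times> int) set \<Rightarrow> 't" where
  "\<beta> (Orig (i, j, g)) y = (let (s, t) = SOME st. y = cl i j (fst st) (snd st) in hz i s * (A i j g * hz j t))"
| "\<beta> (Star (i, j, g)) y = (let (s, t) = SOME st. y = cl i j (fst st) (snd st) in hz j (- t) * (A j i g * hz i (- s)))"

declare \<beta>.simps [simp del]

lemma \<beta>_cl:
  assumes ij: "(i, j) \<in> \<Omega>" and g: "g \<in> {1..N i j}"
  shows "\<beta> (Orig (i, j, g)) (cl i j s t) = hz i s * (A i j g * hz j t)"
    and "\<beta> (Star (i, j, g)) (cl i j s t) = hz j (- t) * (A j i g * hz i (- s))"
proof -
  obtain s' t' where st: "(SOME st. cl i j s t = cl i j (fst st) (snd st)) = (s', t')" by fastforce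
  have "cl i j s t = cl i j s' t'"
    using someI[of "\<lambda>st. cl i j s t = cl i j (fst st) (snd st)" "(s, t)"] unfolding st by simp
  from class_invariant[OF assms this] show "\<beta> (Orig (i, j, g)) (cl i j s t) = hz i s * (A i j g * hz j t)"
    "\<beta> (Star (i, j, g)) (cl i j s t) = hz j (- t) * (A j i g * hz i (- s))"
    by (simp_all only: \<beta>.simps st Let_def prod.case)
qed

lemma ei_representation: "ei_representation DQ hz \<beta>"
proof unfold_locales
  fix u v x y assume uv: "u \<in> verts (quiver DQ)" "v \<in> verts (quiver DQ)" "x \<in> carrier (vgrp DQ u)" "y \<in> carrier (vgrp DQ v)"
  show "hz u x * hz v y = (if u = v then hz u (x \<otimes>\<^bsub>vgrp DQ u\<^esub> y) else 0)"
  proof (cases "u = v")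
    case True
    have "hz u (x + y) = hz u ((x + y) mod int (D u))" by (rule hz_cong) (simp add: cong_def)
    with uv True show ?thesis by (simp add: hz_hz)
  next
    case False
    have "hz u x * e u = hz u x" "e v * hz v y = hz v y" using uv by (simp_all add: hz_e e_hz)
    then have "hz u x * hz v y = hz u x * (e u * e v) * hz v y" by (metis mult.assoc)
    with uv False show ?thesis by (simp add: ee)
  qed
next
  fix a y x assume a: "a \<in> arcs (quiver DQ)" "y \<in> bset (abiset DQ a)" and x: "x \<in> carrier (vgrp DQ (head (quiver DQ) a))"
  from a show "hz (head (quiver DQ) a) x * \<beta> a y = \<beta> a (lact (abiset DQ a) x y)"
  proof (cases rule: DQ_arcE)
    case (Orig i j g s t)
    have i: "i \<in> I" and j: "j \<in> I" using \<Omega>_I[OF Orig(2)] by auto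
    have xc: "x \<in> carrier (Z (D i))" using x Orig(1) by simp
    have "lact (abiset DQ a) x y = cl i j (x + s) t" using lact_cl[OF i j xc] by (simp add: Orig)
    moreover have "\<beta> a (cl i j (x + s) t) = hz i x * \<beta> a y"
      unfolding Orig(1,4) \<beta>_cl[OF Orig(2,3)] by (simp only: hz_hz[OF i] flip: mult.assoc)
    ultimately show ?thesis by (simp add: Orig(1))
  next
    case (Star i j g s t)
    have i: "i \<in> I" and j: "j \<in> I" using \<Omega>_I[OF Star(2)] by auto
    have xc: "x \<in> carrier (Z (D j))" using x Star(1) by simp
    then have "inv\<^bsub>Z (D j)\<^esub> x = (- x) mod int (D j)" by simp
    then have "lact (abiset DQ a) x y = cl i j s (t - x)"
      using ract_cl[OF i j mod_carrier[OF D_pos[OF j]], of s t "- x"] by (simp add: Star cl_mod del: inv_integer_mod_group)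
    moreover have "\<beta> a (cl i j s (t - x)) = hz j x * \<beta> a y"
    proof -
      have "hz j (- (t - x)) = hz j x * hz j (- t)" by (simp add: hz_hz[OF j])
      then show ?thesis unfolding Star(1,4) \<beta>_cl[OF Star(2,3)] by (simp only: mult.assoc)
    qed
    ultimately show ?thesis by (simp add: Star(1))
  qed
next
  fix a y x assume a: "a \<in> arcs (quiver DQ)" "y \<in> bset (abiset DQ a)" and x: "x \<in> carrier (vgrp DQ (tail (quiver DQ) a))"
  from a show "\<beta> a y * hz (tail (quiver DQ) a) x = \<beta> a (ract (abiset DQ a) y x)"
  proof (cases rule: DQ_arcE)
    case (Orig i j g s t)
    have i: "i \<in> I" and j: "j \<in> I" using \<Omega>_I[OF Orig(2)] by auto
    have xc: "x \<in> carrier (Z (D j))" using x Orig(1) by simp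
    have "ract (abiset DQ a) y x = cl i j s (t + x)" using ract_cl[OF i j xc] by (simp add: Orig)
    moreover have "\<beta> a (cl i j s (t + x)) = \<beta> a y * hz j x"
      unfolding Orig(1,4) \<beta>_cl[OF Orig(2,3)] by (simp only: hz_hz[OF j] mult.assoc)
    ultimately show ?thesis by (simp add: Orig(1))
  next
    case (Star i j g s t)
    have i: "i \<in> I" and j: "j \<in> I" using \<Omega>_I[OF Star(2)] by auto
    have xc: "x \<in> carrier (Z (D i))" using x Star(1) by simp
    then have "inv\<^bsub>Z (D i)\<^esub> x = (- x) mod int (D i)" by simp
    then have "ract (abiset DQ a) y x = cl i j (s - x) t"
      using lact_cl[OF i j mod_carrier[OF D_pos[OF i]], of "- x" s t] by (simp add: Star cl_mod del: inv_integer_mod_group)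
    moreover have "\<beta> a (cl i j (s - x) t) = \<beta> a y * hz i x"
    proof -
      have "hz i (- (s - x)) = hz i (- s) * hz i x" by (simp add: hz_hz[OF i])
      then show ?thesis unfolding Star(1,4) \<beta>_cl[OF Star(2,3)] by (simp only: mult.assoc)
    qed
    ultimately show ?thesis by (simp add: Star(1))
  qed
qed

text \<open>The universal property of the category algebra: \<open>hz\<close> and
  \<open>\<beta>\<close> form an \<open>ei_representation\<close>, whose linear extension has the
  prescribed values on generators.\<close>

lemma ei_hom_exists:
  obtains f where "ei_hom I \<Omega> N P r d xinv yinv z C D sc f"
    "\<And>i. i \<in> I \<Longrightarrow> ei_hom.fe D f i = e i" "\<And>i. i \<in> I \<Longrightarrow> ei_hom.fh D f i = h i"
    "\<And>i j g. (i, j) \<in> dbl \<Longrightarrow> g \<in> {1..N i j} \<Longrightarrow> ei_hom.fa I \<Omega> C D f i j g = A i j g"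
proof -
  interpret X: ei_representation DQ hz \<beta> by (rule ei_representation)
  let ?f = "lin_ext (DQ.ei_rep hz \<beta>)"
  interpret H: ei_hom I \<Omega> N P r d xinv yinv z C D sc ?f
    by unfold_locales (rule lin_ext_hom[OF EC.finite_cat_axioms X.cat_rep_ei_rep])
  have fg: "H.fg i s = hz i s" for i s
  proof -
    have "H.fg i s = hz i (s mod int (D i))" by (simp add: H.fg_def H.fm_def gm_def)
    also have "\<dots> = hz i s" by (rule hz_cong) (simp add: cong_def)
    finally show ?thesis .
  qed
  show thesis
  proof (rule that)
    show "ei_hom I \<Omega> N P r d xinv yinv z C D sc ?f" by unfold_locales
    fix i assume i: "i \<in> I"
    show "H.fe i = e i" using i by (simp add: H.fe_def fg hz_0)
    show "H.fh i = h i" using i hz_nat[of i 1] by (simp add: H.fh_def fg he)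
  next
    fix i j g assume ij: "(i, j) \<in> dbl" "g \<in> {1..N i j}"
    note I = dbl_I[OF ij(1), THEN conjunct1] dbl_I[OF ij(1), THEN conjunct2]
    show "H.fa i j g = A i j g"
    proof (cases "(i, j) \<in> \<Omega>")
      case True
      have "H.fm (co i j g 0 0) = \<beta> (Orig (i, j, g)) (cl i j 0 0)"
        unfolding H.fm_def co_def by (simp add: X.ei_rep_cmor[OF single_walk(1)[OF True ij(2)] single_lists(1)[OF True ij(2)]])
      also have "\<dots> = A i j g" using I by (simp add: \<beta>_cl[OF True ij(2)] hz_0 eA[OF ij] Ae[OF ij])
      finally show ?thesis using True by (simp add: H.fa_def)
    next
      case False
      then have ji: "(j, i) \<in> \<Omega>" "g \<in> {1..N j i}" using ij N_sym by (auto simp: dbl_iff)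
      have "H.fm (st j i g 0 0) = \<beta> (Star (j, i, g)) (cl j i 0 0)"
        unfolding H.fm_def st_def by (simp add: X.ei_rep_cmor[OF single_walk(2)[OF ji] single_lists(2)[OF ji]])
      also have "\<dots> = A i j g" using I by (simp add: \<beta>_cl[OF ji] hz_0 eA[OF ij] Ae[OF ij])
      finally show ?thesis using False by (simp add: H.fa_def)
    qed
  qed
qed

end


context ei_model
begin

text \<open>Every morphism is a product of group elements and base points of arrows, by induction on
  the path. So it is enough to relate the values of \<open>f\<close> and \<open>f'\<close> on
  generators.\<close>

lemma graph_ei:
  fixes sc :: "'k \<Rightarrow> 't::ring_1" and sc' :: "'k \<Rightarrow> 's::ring_1"
  assumes f: "ei_hom I \<Omega> N P r d xinv yinv z C D sc f" and f': "ei_hom I \<Omega> N P r d xinv yinv z C D sc' f'"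
    and "linked sc sc' R"
    and e: "\<And>i. i \<in> I \<Longrightarrow> R (ei_hom.fe D f i) (ei_hom.fe D f' i)"
    and h: "\<And>i. i \<in> I \<Longrightarrow> R (ei_hom.fh D f i) (ei_hom.fh D f' i)"
    and a: "\<And>i j g. (i, j) \<in> dbl \<Longrightarrow> g \<in> {1..N i j} \<Longrightarrow> R (ei_hom.fa I \<Omega> C D f i j g) (ei_hom.fa I \<Omega> C D f' i j g)"
    and x: "x \<in> carrier EA"
  shows "R (f x) (f' x)"
proof -
  interpret H: ei_hom I \<Omega> N P r d xinv yinv z C D sc f by fact
  interpret H': ei_hom I \<Omega> N P r d xinv yinv z C D sc' f' by fact
  interpret linked sc sc' R by fact
  have fg: "R (H.fg i s) (H'.fg i s)" if i: "i \<in> I" for i s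
  proof -
    have "[s = int (nat (s mod int (D i)))] (mod int (D i))" using D_pos[OF i] by (simp add: cong_def)
    then have "H.fg i s = H.fh i ^ nat (s mod int (D i)) * H.fe i" "H'.fg i s = H'.fh i ^ nat (s mod int (D i)) * H'.fe i"
      using H.fg_power[OF i] H'.fg_power[OF i] H.fg_cong H'.fg_cong by metis+
    then show ?thesis using i e h by (simp add: R_power_mult)
  qed
  have single: "R (H.fm (DQ.cmor (tail (quiver DQ) b) [b] (head (quiver DQ) b) [y])) (H'.fm (DQ.cmor (tail (quiver DQ) b) [b] (head (quiver DQ) b) [y]))"
    if "b \<in> arcs (quiver DQ)" "y \<in> bset (abiset DQ b)" for b y
    using that
  proof (cases rule: DQ_arcE)
    case (Orig i j g s t)
    have d: "(i, j) \<in> dbl" and i: "i \<in> I" and j: "j \<in> I" using \<Omega>_I[OF Orig(2)] Orig(2) by (auto simp: dbl_iff)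
    have "R (H.fm (co i j g s t)) (H'.fm (co i j g s t))"
      unfolding H.fm_co[OF Orig(2,3)] H'.fm_co[OF Orig(2,3)] by (intro R_mult fg i j a[OF d Orig(3)])
    then show ?thesis by (simp add: Orig(1,4) co_def)
  next
    case (Star i j g s t)
    have d: "(j, i) \<in> dbl" and i: "i \<in> I" and j: "j \<in> I" using \<Omega>_I[OF Star(2)] Star(2) by (auto simp: dbl_iff)
    have g: "g \<in> {1..N j i}" using Star(3) N_sym[OF Star(2)] by simp
    have "R (H.fm (st i j g s t)) (H'.fm (st i j g s t))"
      unfolding H.fm_st[OF Star(2,3)] H'.fm_st[OF Star(2,3)] by (intro R_mult fg i j a[OF d g])
    then show ?thesis by (simp add: Star(1,4) st_def)
  qed
  have path: "R (H.fm (DQ.cmor u p v ys)) (H'.fm (DQ.cmor u p v ys))"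
    if "DQ.awalk u p v" "p \<noteq> []" "ys \<in> ei_lists DQ p" for u p v ys
    using that
  proof (induction p arbitrary: v ys rule: rev_induct)
    case (snoc b p)
    from snoc.prems(3) obtain ys' y where ys: "ys = ys' @ [y]" "ys' \<in> ei_lists DQ p" "y \<in> bset (abiset DQ b)"
      by (rule DQ.ei_lists_snocE) auto
    from snoc.prems(1) have w: "DQ.awalk u p (tail (quiver DQ) b)" and b: "b \<in> arcs (quiver DQ)" and v: "v = head (quiver DQ) b"
      unfolding DQ.awalk_snoc_iff by auto
    have wb: "DQ.awalk (tail (quiver DQ) b) [b] v" using b DQ.head_in_verts by (simp add: DQ.awalk_Cons_iff DQ.awalk_Nil_iff v)
    have yb: "[y] \<in> ei_lists DQ [b]" using ys by simp
    note R1 = single[OF b ys(3), folded v]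
    show ?case
    proof (cases "p = []")
      case True
      with ys w have "ys' = []" "u = tail (quiver DQ) b" by (auto simp: DQ.awalk_Nil_iff)
      with R1 True ys show ?thesis by simp
    next
      case False
      let ?m = "DQ.cmor (tail (quiver DQ) b) [b] v [y]" and ?n = "DQ.cmor u p (tail (quiver DQ) b) ys'"
      have m: "?m \<in> mors (ei_cat DQ)" and n: "?n \<in> mors (ei_cat DQ)"
        using wb yb w False ys(2) by (simp_all add: DQ.cmor_mor)
      have "ccomp (ei_cat DQ) ?m ?n = DQ.cmor u (p @ [b]) v ys" unfolding ys(1) by (rule DQ.comp_cmor_cmor[OF w ys(2) wb yb])
      then have "H.fm (DQ.cmor u (p @ [b]) v ys) = H.fm ?m * H.fm ?n" "H'.fm (DQ.cmor u (p @ [b]) v ys) = H'.fm ?m * H'.fm ?n"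
        unfolding H.fm_mult[OF m n] H'.fm_mult[OF m n] by simp_all
      then show ?thesis using R_mult[OF R1 snoc.IH[OF w False ys(2)]] by simp
    qed
  qed simp
  have mor: "R (H.fm m) (H'.fm m)" if "m \<in> mors (ei_cat DQ)" for m
    using that
  proof (cases rule: DQ.mor_cases)
    case (group v g)
    then have "m = gm v g" "v \<in> I" using gmE by auto
    then show ?thesis using fg[of v g] by (simp add: H.fg_def H'.fg_def)
  next
    case (list u p v ys)
    then show ?thesis using path by simp
  qed
  show ?thesis using x
  proof (induction x rule: EC.carrier_induct)
    case zero
    show ?case using H.f_simps'(1) H'.f_simps'(1) R_zero by simp
  next
    case (single m c)
    have car: "(basis_elt m :: _ \<Rightarrow>\<^sub>0 'k) \<in> carrier EA" by (rule EC.single_carrier[OF single])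
    have "R (f (basis_elt m)) (f' (basis_elt m))" using mor[OF single] by (simp only: H.fm_def H'.fm_def)
    moreover have "Poly_Mapping.single m c = c \<odot>\<^bsub>EA\<^esub> basis_elt m" by simp
    ultimately show ?case using H.f_simps(3)[OF car, of c] H'.f_simps(3)[OF car, of c] R_sc by metis
  next
    case (add u v)
    then show ?case using H.f_simps(1)[of u v] H'.f_simps(1)[of u v] by (simp add: R_add)
  qed
qed

end

section \<open>Congruence rules, and the graph of a pair of homomorphisms\<close>

context species_algebra
begin

lemma ei_relator_cong:
  assumes i: "i \<in> I" and h: "\<And>i. i \<in> I \<Longrightarrow> h i = h' i"
    and A: "\<And>i j g. (i, j) \<in> dbl \<Longrightarrow> g \<in> {1..N i j} \<Longrightarrow> A i j g = A' i j g"
  shows "ei_relator h A i = ei_relator h' A' i"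
  unfolding ei_relator_def h[OF i]
proof (rule sum.cong[OF refl], rule sum.cong[OF refl])
  fix j g assume "j \<in> {j. (j, i) \<in> dbl}" and g: "g \<in> {1..N j i}"
  then have ji: "(j, i) \<in> dbl" and ij: "(i, j) \<in> dbl" using dbl_sym by auto
  have "A i j g = A' i j g" "A j i g = A' j i g" using A[OF ij] A[OF ji] g dbl_N[OF ij] by simp_all
  then show "sc (sgn i j) * (\<Sum>f<F i j. h' i ^ f * (A i j g * A j i g * h' i ^ (q i * d i - f))) =
    sc (sgn i j) * (\<Sum>f<F i j. h' i ^ f * (A' i j g * A' j i g * h' i ^ (q i * d i - f)))" by simp
qed

lemma gp_relator_cong:
  assumes a: "a \<in> M" and \<epsilon>: "\<And>a. a \<in> M \<Longrightarrow> \<epsilon> a = \<epsilon>' a"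
    and \<alpha>: "\<And>a b g. (a, b) \<in> Sg \<Longrightarrow> g \<in> {1..N (fst a) (fst b)} \<Longrightarrow> \<alpha> a b g = \<alpha>' a b g"
  shows "gp_relator \<epsilon> \<alpha> a = gp_relator \<epsilon>' \<alpha>' a"
  unfolding gp_relator_def \<epsilon>[OF a]
proof (rule sum.cong[OF refl], rule sum.cong[OF refl])
  fix b g assume b: "b \<in> {b. (b, a) \<in> Sg}" and g: "g \<in> {1..N (fst b) (fst a)}"
  then have ba: "(b, a) \<in> Sg" and ab: "(a, b) \<in> Sg" using Sg_sym by auto
  have "N (fst a) (fst b) = N (fst b) (fst a)"
    by (rule dbl_N) (use ab in \<open>cases a; cases b; simp add: Sg_iff\<close>)
  then have "\<alpha> a b g = \<alpha>' a b g" "\<alpha> b a g = \<alpha>' b a g" using \<alpha>[OF ab] \<alpha>[OF ba] g by simp_all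
  then show "sc (sgn (fst a) (fst b)) * (\<Sum>f<qq (fst a) (fst b). \<epsilon>' a ^ f * (\<alpha> a b g * \<alpha> b a g * \<epsilon>' a ^ (qq (fst a) (fst b) - 1 - f))) =
    sc (sgn (fst a) (fst b)) * (\<Sum>f<qq (fst a) (fst b). \<epsilon>' a ^ f * (\<alpha>' a b g * \<alpha>' b a g * \<epsilon>' a ^ (qq (fst a) (fst b) - 1 - f)))"
    by simp
qed

end

lemma (in species) gp_action_cong:
  assumes "gp_action I \<Omega> N P r d xinv yinv z sc E \<epsilon> \<alpha>"
    and E: "\<And>a. a \<in> M \<Longrightarrow> E' a = E a" and \<epsilon>: "\<And>a. a \<in> M \<Longrightarrow> \<epsilon>' a = \<epsilon> a"
    and \<alpha>: "\<And>a b g. (a, b) \<in> Sg \<Longrightarrow> g \<in> {1..N (fst a) (fst b)} \<Longrightarrow> \<alpha>' a b g = \<alpha> a b g"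
  shows "gp_action I \<Omega> N P r d xinv yinv z sc E' \<epsilon>' \<alpha>'"
proof -
  interpret gp_action I \<Omega> N P r d xinv yinv z sc E \<epsilon> \<alpha> by fact
  show ?thesis
  proof (intro gp_action.intro gp_action_axioms.intro species_algebra_axioms)
    fix a b g assume ab: "(a, b) \<in> Sg" and g: "g \<in> {1..N (fst a) (fst b)}"
    note M = Sg_M[OF ab, THEN conjunct1] Sg_M[OF ab, THEN conjunct2]
    show "E' a * \<alpha>' a b g = \<alpha>' a b g" "\<alpha>' a b g * E' b = \<alpha>' a b g"
      "\<epsilon>' a ^ qq (fst a) (fst b) * \<alpha>' a b g = \<alpha>' a b g * \<epsilon>' b ^ qq (fst b) (fst a)"
      unfolding E[OF M(1)] E[OF M(2)] \<epsilon>[OF M(1)] \<epsilon>[OF M(2)] \<alpha>[OF ab g]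
      by (rule E\<alpha>[OF ab g], rule \<alpha>E[OF ab g], rule \<epsilon>\<alpha>[OF ab g])
  qed (simp_all add: E \<epsilon> EE E\<epsilon> \<epsilon>E \<epsilon>_nil)
qed

text \<open>The image of an algebra in a product of two rings is closed under the
  operations.\<close>

lemma linked_graph:
  assumes "scalars sc" "scalars sc'" "finite_cat C" "nonunital_hom (cat_alg C) sc f" "nonunital_hom (cat_alg C) sc' f'"
  shows "linked sc sc' (\<lambda>x y. \<exists>a\<in>carrier (cat_alg C). x = f a \<and> y = f' a)"
proof -
  interpret S: scalars sc by fact
  interpret S': scalars sc' by fact
  interpret finite_cat C by fact
  note h = nonunital_homD[OF assms(4)] nonunital_homD[OF assms(5)]
    and h0 = nonunital_hom_simps(1)[OF assms(3,1,4)] nonunital_hom_simps(1)[OF assms(3,2,5)]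
  show ?thesis
  proof unfold_locales
    show "\<exists>a\<in>carrier A. 0 = f a \<and> 0 = f' a" using zero_carrier h0 by auto
  next
    fix a a' b b' assume "\<exists>x\<in>carrier A. a = f x \<and> a' = f' x" "\<exists>x\<in>carrier A. b = f x \<and> b' = f' x"
    then obtain x y where x: "x \<in> carrier A" "a = f x" "a' = f' x" and y: "y \<in> carrier A" "b = f y" "b' = f' y" by blast
    show "\<exists>x\<in>carrier A. a + b = f x \<and> a' + b' = f' x"
      by (rule bexI[of _ "x \<oplus>\<^bsub>A\<^esub> y"]) (use x y h add_carrier in auto)
    show "\<exists>x\<in>carrier A. a * b = f x \<and> a' * b' = f' x"
      by (rule bexI[of _ "x \<otimes>\<^bsub>A\<^esub> y"]) (use x y h mult_carrier in auto)
  next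
    fix a a' c assume "\<exists>x\<in>carrier A. a = f x \<and> a' = f' x"
    then obtain x where x: "x \<in> carrier A" "a = f x" "a' = f' x" by blast
    show "\<exists>x\<in>carrier A. sc c * a = f x \<and> sc' c * a' = f' x"
      by (rule bexI[of _ "c \<odot>\<^bsub>A\<^esub> x"]) (use x h scale_carrier in auto)
  qed
qed

section \<open>The isomorphism for any data that satisfy both models\<close>

locale two_models = gp_model I \<Omega> N P r d xinv yinv z C' D' \<Omega>' + ei_model I \<Omega> N P r d xinv yinv z C D
  for I :: "'v set" and \<Omega> N P r d xinv yinv and z :: "'v \<Rightarrow> 'k::field" and C' D' \<Omega>' C D
begin

text \<open>The maps \<open>r1\<close> and \<open>r2\<close> embed the two quotients. Converting the
  generators in the image of \<open>r1\<close> defines \<open>\<phi>\<close> on the path algebra,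
  with values in the ring of \<open>r1\<close>; the generators in the image of \<open>r2\<close>
  define \<open>\<psi>\<close> in the same way. Both vanish on the ideals by the comparison of
  relators, and the substitutions are inverse to each other, so that the two families of pairs
  required by \<open>quot_alg_isomorphic\<close> coincide.\<close>

theorem preproj_algs_isomorphic:
  "(ei_preproj_alg Qc :: ('k, _) module) \<cong>\<^sub>a gen_preproj_alg M C' D' \<Omega>'"
proof -
  let ?EA = "cat_alg (ei_cat DQ) :: ('k, _) module"
  let ?B = "path_alg (gp_quiver M C' \<Omega>') :: ('k, _) module"
  define J1 where "J1 = Idl\<^bsub>?EA\<^esub> {ei_rho Qc}"
  define J2 where "J2 = Idl\<^bsub>?B\<^esub> Rel"
  have ring1: "ring ?EA" by (rule EC.ring_cat_alg)
  have ring2: "ring ?B" by (rule PC.ring_cat_alg)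
  \<comment> \<open>That the relators lie in the carriers has been shown in the presence of a
    homomorphism; the zero map provides one.\<close>
  have null: "nonunital_hom (cat_alg c) endo_scalar (\<lambda>_. 0 :: ('x, 'k) endo)" for c :: "('o, 'm) small_cat"
    by (simp add: nonunital_hom_def)
  have rho: "ei_rho Qc \<in> carrier ?EA"
  proof -
    interpret H: ei_hom I \<Omega> N P r d xinv yinv z C D endo_scalar "\<lambda>_. 0 :: (nat, 'k) endo"
      by unfold_locales (rule null)
    show ?thesis by (rule H.rho_carrier)
  qed
  have Rel: "Rel \<subseteq> carrier ?B"
  proof -
    interpret H: gp_hom I \<Omega> N P r d xinv yinv z C' D' \<Omega>' endo_scalar "\<lambda>_. 0 :: (nat, 'k) endo"
      by unfold_locales (rule null)
    show ?thesis by (rule H.Rel_carrier)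
  qed
  have id1: "ideal J1 ?EA" unfolding J1_def by (rule ring.genideal_ideal[OF ring1]) (simp add: rho)
  have id2: "ideal J2 ?B" unfolding J2_def by (rule ring.genideal_ideal[OF ring2 Rel])
  obtain r1 :: "(('v, ('v \<times> 'v \<times> nat) darrow, int, (int \<times> int) set) ei_mor \<Rightarrow>\<^sub>0 'k) \<Rightarrow> (('v, ('v \<times> 'v \<times> nat) darrow, int, (int \<times> int) set) ei_mor, 'k) endo" where r1: "nonunital_hom ?EA endo_scalar r1"
    "\<And>a. a \<in> carrier ?EA \<Longrightarrow> r1 a = 0 \<longleftrightarrow> a \<in> J1" by (rule EC.ideal_embedding[OF id1]) blast
  obtain r2 :: "(('v \<times> nat, ('v \<times> nat) gp_arrow) qpath \<Rightarrow>\<^sub>0 'k) \<Rightarrow> (('v \<times> nat, ('v \<times> nat) gp_arrow) qpath, 'k) endo" where r2: "nonunital_hom ?B endo_scalar r2"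
    "\<And>b. b \<in> carrier ?B \<Longrightarrow> r2 b = 0 \<longleftrightarrow> b \<in> J2" by (rule PC.ideal_embedding[OF id2]) blast
  have R1: "ei_hom I \<Omega> N P r d xinv yinv z C D endo_scalar r1" by unfold_locales (rule r1(1))
  have R2: "gp_hom I \<Omega> N P r d xinv yinv z C' D' \<Omega>' endo_scalar r2" by unfold_locales (rule r2(1))
  interpret H1: ei_hom I \<Omega> N P r d xinv yinv z C D endo_scalar r1 by (rule R1)
  interpret H2: gp_hom I \<Omega> N P r d xinv yinv z C' D' \<Omega>' endo_scalar r2 by (rule R2)
  have r1_rho: "r1 (ei_rho Qc) = 0"
    using r1(2)[OF rho] ring.genideal_self[OF ring1, of "{ei_rho Qc}"] rho by (simp add: J1_def)
  have r2_Rel: "r2 x = 0" if "x \<in> Rel" for x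
    using r2(2)[of x] Rel ring.genideal_self[OF ring2 Rel] that by (auto simp: J2_def)
  interpret A1: ei_action I \<Omega> N P r d xinv yinv z endo_scalar H1.fe H1.fh H1.fa by (rule H1.ei_action)
  interpret G2: gp_action I \<Omega> N P r d xinv yinv z endo_scalar H2.fE H2.f\<epsilon> H2.f\<alpha> by (rule H2.gp_action_f(1)[OF r2_Rel])
  let ?E = "H1.SA.gE H1.fe H1.fh" and ?\<epsilon> = "H1.SA.g\<epsilon> H1.fe H1.fh" and ?\<alpha> = "H1.SA.g\<alpha> H1.fe H1.fh H1.fa"
  let ?e = "H2.SA.be H2.fE" and ?h = "H2.SA.bh H2.fE H2.f\<epsilon>" and ?A = "H2.SA.bA H2.f\<epsilon> H2.f\<alpha>"
  obtain \<phi> where \<phi>: "gp_hom I \<Omega> N P r d xinv yinv z C' D' \<Omega>' endo_scalar \<phi>"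
    and \<phi>E: "\<And>a. a \<in> M \<Longrightarrow> gp_hom.fE \<phi> a = ?E a" and \<phi>\<epsilon>: "\<And>a. a \<in> M \<Longrightarrow> gp_hom.f\<epsilon> \<phi> a = ?\<epsilon> a"
    and \<phi>\<alpha>: "\<And>a b g. (a, b) \<in> Sg \<Longrightarrow> g \<in> {1..N (fst a) (fst b)} \<Longrightarrow> gp_hom.f\<alpha> \<phi> a b g = ?\<alpha> a b g"
    by (rule gp_hom_exists[OF A1.gp_action_conv]) blast
  have A2: "ei_action I \<Omega> N P r d xinv yinv z endo_scalar ?e ?h ?A" by (rule G2.ei_action_back)
  interpret B2: ei_model_action I \<Omega> N P r d xinv yinv z C D endo_scalar ?e ?h ?A
    by (intro ei_model_action.intro A2 ei_model_axioms)
  obtain \<psi> where \<psi>: "ei_hom I \<Omega> N P r d xinv yinv z C D endo_scalar \<psi>"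
    and \<psi>e: "\<And>i. i \<in> I \<Longrightarrow> ei_hom.fe D \<psi> i = ?e i" and \<psi>h: "\<And>i. i \<in> I \<Longrightarrow> ei_hom.fh D \<psi> i = ?h i"
    and \<psi>a: "\<And>i j g. (i, j) \<in> dbl \<Longrightarrow> g \<in> {1..N i j} \<Longrightarrow> ei_hom.fa I \<Omega> C D \<psi> i j g = ?A i j g"
    by (rule B2.ei_hom_exists) blast
  interpret H\<phi>: gp_hom I \<Omega> N P r d xinv yinv z C' D' \<Omega>' endo_scalar \<phi> by (rule \<phi>)
  interpret H\<psi>: ei_hom I \<Omega> N P r d xinv yinv z C D endo_scalar \<psi> by (rule \<psi>)
  show ?thesis
    unfolding ei_preproj_alg_def gen_preproj_alg_def Let_def
      J1_def[symmetric] J2_def[symmetric]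
  proof (rule quot_alg_isomorphic)
    show "embedded_quotient J1 ?EA endo_scalar r1"
      by (intro embedded_quotient.intro id1 embedded_quotient_axioms.intro r1) (simp add: EC.scale_carrier)
    show "embedded_quotient J2 ?B endo_scalar r2"
      by (intro embedded_quotient.intro id2 embedded_quotient_axioms.intro r2) (simp add: PC.scale_carrier)
    show "nonunital_hom ?EA endo_scalar \<psi>" "nonunital_hom ?B endo_scalar \<phi>" by (rule H\<psi>.hom, rule H\<phi>.hom)
    show "\<psi> a = 0" if "a \<in> J1" for a
    proof (rule H\<psi>.f_rho_ideal)
      show "a \<in> Idl\<^bsub>?EA\<^esub> {ei_rho Qc}" using that by (simp only: J1_def)
      fix i assume i: "i \<in> I"
      have "H2.SA.ei_relator H\<psi>.fh H\<psi>.fa i = H2.SA.ei_relator ?h ?A i"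
        by (rule H2.SA.ei_relator_cong[OF i \<psi>h \<psi>a])
      also have "\<dots> = 0" by (rule G2.ei_relator_back[OF H2.gp_action_f(2)[OF r2_Rel] i])
      finally show "H2.SA.ei_relator H\<psi>.fh H\<psi>.fa i = 0" .
    qed
    show "\<phi> b = 0" if "b \<in> J2" for b
    proof (rule H\<phi>.f_Rel_zero)
      show "b \<in> Idl\<^bsub>?B\<^esub> Rel" using that by (simp only: J2_def)
      show "gp_action I \<Omega> N P r d xinv yinv z endo_scalar H\<phi>.fE H\<phi>.f\<epsilon> H\<phi>.f\<alpha>"
        by (rule gp_action_cong[OF A1.gp_action_conv \<phi>E \<phi>\<epsilon> \<phi>\<alpha>])
      fix a assume a: "a \<in> M"
      obtain i l where il: "a = (i, l)" "i \<in> I" "l < d i" using a by (auto simp: M_def)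
      have "H1.SA.gp_relator H\<phi>.f\<epsilon> H\<phi>.f\<alpha> a = H1.SA.gp_relator ?\<epsilon> ?\<alpha> a"
        by (rule H1.SA.gp_relator_cong[OF a \<phi>\<epsilon> \<phi>\<alpha>])
      also have "\<dots> = 0"
        using A1.ei_relator_iff[OF il(2)] H1.f_rho_zero_iff r1_rho il by auto
      finally show "H1.SA.gp_relator H\<phi>.f\<epsilon> H\<phi>.f\<alpha> a = 0" .
    qed
    \<comment> \<open>The pairs \<open>(\<phi> b, r2 b)\<close> contain the pairs of converted
      generators. The inverse substitution maps these to the pairs of group generators and arrows:
      in the first entry by the lemmas \<open>A1.be_conv\<close>, \<open>A1.bh_conv\<close> and
      \<open>A1.bA_conv\<close>, in the second by the choice of \<open>\<psi>\<close>.\<close>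
    show "\<exists>b\<in>carrier ?B. r1 a = \<phi> b \<and> \<psi> a = r2 b" if a: "a \<in> carrier ?EA" for a
    proof -
      let ?R = "\<lambda>x y. \<exists>b\<in>carrier ?B. x = \<phi> b \<and> y = r2 b"
      interpret species_linked I \<Omega> N P r d xinv yinv z endo_scalar endo_scalar ?R
        by (intro species_linked.intro species_axioms linked_graph[OF endo.scalars_axioms endo.scalars_axioms finite_cat_G H\<phi>.hom H2.hom])
      have E: "?R (?E a) (H2.fE a)" if a: "a \<in> M" for a
        unfolding \<phi>E[OF a, symmetric] H\<phi>.fE_def H2.fE_def using gens_carrier(3)[OF a] by blast
      have \<epsilon>: "?R (?\<epsilon> a) (H2.f\<epsilon> a)" if a: "a \<in> M" for a
        unfolding \<phi>\<epsilon>[OF a, symmetric] H\<phi>.f\<epsilon>_def H2.f\<epsilon>_def using gens_carrier(1)[OF a] by blast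
      have \<alpha>: "?R (?\<alpha> a b g) (H2.f\<alpha> a b g)" if ab: "(a, b) \<in> Sg" "g \<in> {1..N (fst a) (fst b)}" for a b g
        unfolding \<phi>\<alpha>[OF ab, symmetric] H\<phi>.f\<alpha>_def H2.f\<alpha>_def using gens_carrier(2)[OF ab] by blast
      show ?thesis
      proof (rule graph_ei[OF R1 \<psi> linked_axioms _ _ _ a])
        fix i assume i: "i \<in> I"
        show "?R (H1.fe i) (H\<psi>.fe i)"
          unfolding A1.be_conv[OF i, symmetric] \<psi>e[OF i] by (rule R_be[OF _ i]) (rule E)
        show "?R (H1.fh i) (H\<psi>.fh i)"
          unfolding A1.bh_conv[OF i, symmetric] \<psi>h[OF i] by (rule R_bh[OF _ _ i]) (rule E, assumption, rule \<epsilon>)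
      next
        fix i j g assume ij: "(i, j) \<in> dbl" "g \<in> {1..N i j}"
        show "?R (H1.fa i j g) (H\<psi>.fa i j g)"
          unfolding A1.bA_conv[OF ij, symmetric] \<psi>a[OF ij] by (rule R_bA[OF _ _ ij(2)]) (rule \<epsilon>, assumption, rule \<alpha>)
      qed
    qed
    \<comment> \<open>Conversely, the pairs \<open>(r1 a, \<psi> a)\<close> contain the pairs of
      group generators and arrows. The substitution gives the first entries by the choice of
      \<open>\<phi>\<close> and restores the second ones by \<open>G2.gE_back\<close> and its
      companions.\<close>
    show "\<exists>a\<in>carrier ?EA. r1 a = \<phi> b \<and> \<psi> a = r2 b" if b: "b \<in> carrier ?B" for b
    proof -
      let ?R = "\<lambda>x y. \<exists>a\<in>carrier ?EA. x = r1 a \<and> y = \<psi> a"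
      interpret species_linked I \<Omega> N P r d xinv yinv z endo_scalar endo_scalar ?R
        by (intro species_linked.intro species_axioms linked_graph[OF endo.scalars_axioms endo.scalars_axioms EC.finite_cat_axioms H1.hom H\<psi>.hom])
      have e: "?R (H1.fe i) (?e i)" and h: "?R (H1.fh i) (?h i)" if i: "i \<in> I" for i
        unfolding \<psi>e[OF i, symmetric] \<psi>h[OF i, symmetric] H1.fe_def H\<psi>.fe_def H1.fh_def H\<psi>.fh_def
          H1.fg_def H\<psi>.fg_def H1.fm_def H\<psi>.fm_def
        using EC.single_carrier[OF gm_mor[OF i]] by blast+
      have A: "?R (H1.fa i j g) (?A i j g)" if ij: "(i, j) \<in> dbl" "g \<in> {1..N i j}" for i j g
        using ij
      proof (cases rule: H1.dbl_cases)
        case 1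
        show ?thesis
          unfolding \<psi>a[OF ij, symmetric] H1.fa_eq(1)[OF 1 ij(2)] H\<psi>.fa_eq(1)[OF 1 ij(2)] H1.fm_def H\<psi>.fm_def
          using EC.single_carrier[OF co_mor[OF 1 ij(2)]] by blast
      next
        case 2
        show ?thesis
          unfolding \<psi>a[OF ij, symmetric] H1.fa_eq(2)[OF 2] H\<psi>.fa_eq(2)[OF 2] H1.fm_def H\<psi>.fm_def
          using EC.single_carrier[OF st_mor[OF 2]] by blast
      qed
      have E: "?R (?E a) (H2.SA.gE ?e ?h a)" if a: "a \<in> M" for a
        using a by (cases a) (simp only: M_iff, rule R_gE[OF h e H1.ei_action A2]; simp)
      have "\<exists>a\<in>carrier ?EA. \<phi> b = r1 a \<and> r2 b = \<psi> a"
      proof (rule graph_gp[OF \<phi> R2 linked_axioms _ _ _ b])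
        fix a assume a: "a \<in> M"
        obtain i l where il: "a = (i, l)" "i \<in> I" using a by (auto simp: M_def)
        show "?R (H\<phi>.fE a) (H2.fE a)"
          unfolding \<phi>E[OF a] using E[OF a] G2.gE_back[of i l] a by (simp add: il)
        show "?R (H\<phi>.f\<epsilon> a) (H2.f\<epsilon> a)"
          unfolding \<phi>\<epsilon>[OF a] using R_g\<epsilon>[OF h[OF il(2)] E[OF a, unfolded il(1)]] G2.g\<epsilon>_back[of i l] a by (simp add: il)
      next
        fix a b g assume ab: "(a, b) \<in> Sg" "g \<in> {1..N (fst a) (fst b)}"
        obtain i l j m where ijlm: "a = (i, l)" "b = (j, m)" by (cases a; cases b)
        have ij: "(i, j) \<in> dbl" "g \<in> {1..N i j}" using ab by (simp_all add: ijlm Sg_iff)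
        have M: "a \<in> M" "b \<in> M" using Sg_M[OF ab(1)] by auto
        have j: "j \<in> I" using dbl_I[OF ij(1)] by simp
        have "?R (?\<alpha> a b g) (H2.SA.g\<alpha> ?e ?h ?A a b g)"
          unfolding ijlm by (rule R_g\<alpha>, rule h[OF j], rule E[OF M(1), unfolded ijlm], rule E[OF M(2), unfolded ijlm], rule A[OF ij])
        then show "?R (H\<phi>.f\<alpha> a b g) (H2.f\<alpha> a b g)"
          unfolding \<phi>\<alpha>[OF ab] using G2.g\<alpha>_back[OF ab(1)[unfolded ijlm] ij(2)] by (simp add: ijlm)
      qed
      then show ?thesis by metis
    qed
  qed
qed

end

section \<open>Arithmetic of the given triple and of the associated one\<close>

lemma cartan_triple_facts:
  fixes I :: "'v set"
  assumes "cartan_triple I C D \<Omega>"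
  shows "finite I" "\<Omega> \<subseteq> I \<times> I" "\<And>i. i \<in> I \<Longrightarrow> D i > 0" "\<And>i j. (i, j) \<in> \<Omega> \<Longrightarrow> (j, i) \<notin> \<Omega>" "\<And>i j. (i, j) \<in> \<Omega> \<Longrightarrow> i \<noteq> j"
    "\<And>i j. i \<in> I \<Longrightarrow> j \<in> I \<Longrightarrow> (i, j) \<in> double_orientation \<Omega> \<longleftrightarrow> C i j < 0"
proof -
  have o: "orientation I C \<Omega>" using assms by (simp add: cartan_triple_def)
  note o = o[unfolded orientation_def]
  have sub: "\<Omega> \<subseteq> I \<times> I" by (rule o[THEN conjunct1])
  have neg: "{(i, j), (j, i)} \<inter> \<Omega> \<noteq> {} \<longleftrightarrow> C i j < 0" if "i \<in> I" "j \<in> I" for i j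
    using o[THEN conjunct2, THEN conjunct1, THEN bspec, OF that(1), THEN bspec, OF that(2)] .
  have acyclic: "x 1 \<noteq> x (t + 1)" if "t \<ge> 1" "\<forall>s\<in>{1..t}. (x s, x (s + 1)) \<in> \<Omega>" for t and x :: "nat \<Rightarrow> 'v"
    using o[THEN conjunct2, THEN conjunct2, THEN spec, THEN mp, OF that(1), THEN spec, THEN mp, OF that(2)] .
  show "\<Omega> \<subseteq> I \<times> I" by (rule sub)
  show "finite I" "i \<in> I \<Longrightarrow> D i > 0" for i using assms by (auto simp: cartan_triple_def symmetrizer_def Suc_le_eq)
  show "i \<noteq> j" if "(i, j) \<in> \<Omega>" for i j
    using acyclic[of 1 "\<lambda>s. if s = 1 then i else j"] that by auto
  show "(j, i) \<notin> \<Omega>" if ij: "(i, j) \<in> \<Omega>" for i j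
  proof
    assume ji: "(j, i) \<in> \<Omega>"
    define x where "x s = (if s = 2 then j else i)" for s :: nat
    have "(x s, x (s + 1)) \<in> \<Omega>" if "s \<in> {1..2}" for s
    proof -
      have "s = 1 \<or> s = 2" using that by auto
      then show ?thesis using ij ji by (auto simp: x_def)
    qed
    then have "x 1 \<noteq> x (2 + 1)" by (intro acyclic) auto
    then show False by (simp add: x_def)
  qed
  show "(i, j) \<in> double_orientation \<Omega> \<longleftrightarrow> C i j < 0" if "i \<in> I" "j \<in> I" for i j
    using neg[OF that] by (auto simp: double_orientation_def)
qed

lemma coprime_inverse_nat:
  assumes "coprime a (b::nat)"
  shows "\<exists>x. [x * a = 1] (mod b)"
  using assms by (metis coprime_iff_invertible_nat mult.commute One_nat_def)

theorem theoremB: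
  fixes n :: nat and C :: "nat \<Rightarrow> nat \<Rightarrow> int" and D :: "nat \<Rightarrow> nat" and \<Omega> :: "(nat \<times> nat) set"
    and p :: nat
  assumes "n \<ge> 1"
    and "cartan_triple {1..n} C D \<Omega>"
    and "enough_roots_of_unity TYPE('k::field) {1..n} D"
    and "p = CHAR('k)"
  shows "(ei_preproj_alg (cartan_ei_quiver {1..n} C D \<Omega>) :: ('k, _) module) \<cong>\<^sub>a
    gen_preproj_alg (ass_index p {1..n} D) (ass_matrix p C D)
      (ass_symmetrizer p D) (ass_orientation p D \<Omega>)"
proof -
  let ?I = "{1..n}"
  note T = cartan_triple_facts[OF assms(2)]
  \<comment> \<open>The characteristic exponent, with which characteristic 0 is covered by
    \<open>r i = 0\<close>, \<open>d i = D i\<close> and \<open>P = 1\<close>.\<close>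
  define P where "P = (if p = 0 then 1 else p)"
  define r where "r = p_exp p D"
  define d where "d = p_free p D"
  have CHAR_prime: "prime CHAR('k)" if "CHAR('k) \<noteq> 0"
    using prime_CHAR_semidom[where ?'a = 'k] that by simp
  have P: "char_exponent TYPE('k) P"
    using CHAR_prime by (auto simp: char_exponent_def P_def assms(4))
  have P_pos: "P > 0" by (simp add: P_def)
  have pP: "p ^ r i = P ^ r i" for i by (simp add: P_def r_def p_exp_def)
  have D: "D i = P ^ r i * d i" for i
  proof (cases "p = 0")
    case False
    have "p ^ multiplicity p (D i) dvd D i" by (rule multiplicity_dvd)
    then show ?thesis using False by (simp add: P_def r_def d_def p_free_def p_exp_def)
  qed (simp add: P_def r_def d_def p_free_def p_exp_def)
  have d_pos: "d i > 0" if "i \<in> ?I" for i using T(3)[OF that] D[of i] by (cases "d i") auto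
  have d_unit: "of_nat (d i) \<noteq> (0 :: 'k)" if i: "i \<in> ?I" for i
  proof
    assume "of_nat (d i) = (0 :: 'k)"
    then have dvd: "p dvd d i" by (simp add: of_nat_eq_0_iff_char_dvd assms(4))
    then have p0: "p \<noteq> 0" using d_pos[OF i] by auto
    then have prime: "prime p" using CHAR_prime unfolding assms(4) by blast
    \<comment> \<open>Otherwise \<open>p\<close> would divide \<open>D i\<close> once more than its
      multiplicity allows.\<close>
    have "p ^ Suc (r i) dvd D i" using dvd p0 unfolding D[of i] by (simp add: P_def mult.commute mult_dvd_mono)
    then have "Suc (r i) \<le> multiplicity p (D i)"
      using prime T(3)[OF i] by (subst (asm) power_dvd_iff_le_multiplicity) (auto simp: not_prime_unit)
    then show False using p0 by (simp add: r_def p_exp_def)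
  qed
  have cop: "coprime (P ^ r i) (d i)" if i: "i \<in> ?I" for i
  proof (cases "P = 1")
    case False
    then have "prime P" "P = CHAR('k)" using P by (auto simp: char_exponent_def)
    then show ?thesis using d_unit[OF i] by (simp add: prime_imp_coprime of_nat_eq_0_iff_char_dvd)
  qed simp
  \<comment> \<open>Here the assumption on roots of unity enters: t^(c_i) - 1 splits, so there are
    at least \<open>d i\<close> roots of unity of order dividing \<open>d i\<close>.\<close>
  have card: "d i \<le> card {a :: 'k. a ^ d i = 1}" if i: "i \<in> ?I" for i
    using assms(3) i by (intro card_roots_of_unity[OF P refl[of "P ^ r i"] d_unit[OF i]]) (simp add: enough_roots_of_unity_def D)
  obtain z :: "nat \<Rightarrow> 'k" where z: "\<And>i. i \<in> ?I \<Longrightarrow> primitive_root (d i) (z i)"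
    "\<And>i j. i \<in> ?I \<Longrightarrow> j \<in> ?I \<Longrightarrow> z i ^ (d i div gcd (d i) (d j)) = z j ^ (d j div gcd (d i) (d j))"
    by (rule compatible_primitive_roots[OF T(1)]) (erule d_pos, erule card, blast)
  \<comment> \<open>Inverses exist since \<open>P ^ r i\<close> and \<open>d i\<close> are coprime.
    Any choice will do.\<close>
  define xinv where "xinv i = (SOME x. [x * P ^ r i = 1] (mod d i))" for i
  define yinv where "yinv i = (SOME x. [x * d i = 1] (mod P ^ r i))" for i
  have xinv: "[xinv i * P ^ r i = 1] (mod d i)" if i: "i \<in> ?I" for i
    unfolding xinv_def by (rule someI_ex) (rule coprime_inverse_nat[OF cop[OF i]])
  have yinv: "[yinv i * d i = 1] (mod P ^ r i)" if i: "i \<in> ?I" for i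
    unfolding yinv_def by (rule someI_ex, rule coprime_inverse_nat) (use cop[OF i] in \<open>simp only: coprime_commute\<close>)
  interpret species ?I \<Omega> "cartan_g C" P r d xinv yinv z
  proof unfold_locales
    show "cartan_g C i j = cartan_g C j i" for i j by (simp only: cartan_g_def gcd.commute)
  qed (rule T(1), rule T(2), erule T(4), rule P, erule d_pos, rule d_unit, assumption, erule z(1), rule z(2), assumption+,
      erule xinv, erule yinv)
  have M: "ass_index p ?I D = M" unfolding M_def by (simp add: ass_index_def d_def)
  have Sigma: "((i, l), (j, m)) \<in> Sg \<longleftrightarrow> (i, j) \<in> dbl \<and> (l, m) \<in> Sigma_set p D i j" for i l j m
    unfolding Sg_iff Sigma_set_def by (simp add: pP flip: r_def d_def)
  have dbl: "i \<noteq> j" "C i j < 0" if "(i, j) \<in> dbl" for i j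
    using that T(5,6) dbl_I[OF that] by (auto simp: dbl_iff)
  \<comment> \<open>The two opposite entries of C' are the negatives of g_ij times
    \<open>qq j i\<close> and \<open>qq i j\<close>. These two factors are coprime, so that C' has
    the same numbers g as C and its numbers f are the \<open>qq\<close>.\<close>
  have C': "ass_matrix p C D (i, l) (j, m) = - int (cartan_g C i j * qq j i)" if "((i, l), (j, m)) \<in> Sg" for i l j m
  proof -
    have "int p ^ (r j - min (r i) (r j)) = int (qq j i)"
      unfolding qq_def by (simp add: P_def r_def p_exp_def min.commute)
    then show ?thesis using that dbl[of i j] by (simp add: ass_matrix_def Sigma cartan_g_def flip: r_def)
  qed
  have g_pos: "cartan_g C i j > 0" if "(i, j) \<in> dbl" for i j
    using dbl(2)[OF that] by (simp add: cartan_g_def)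
  have gcd_qq: "gcd (qq i j) (qq j i) = 1" for i j
  proof -
    have "qq i j = 1 \<or> qq j i = 1" by (auto simp: qq_def)
    then show ?thesis by auto
  qed
  have C'_g: "cartan_g (ass_matrix p C D) a b = cartan_g C (fst a) (fst b)" if ab: "(a, b) \<in> Sg" for a b
  proof -
    obtain i l j m where [simp]: "a = (i, l)" "b = (j, m)" by (cases a; cases b)
    have "cartan_g C j i = cartan_g C i j" by (simp add: cartan_g_def gcd.commute)
    then have "cartan_g (ass_matrix p C D) a b = gcd (cartan_g C i j * qq j i) (cartan_g C i j * qq i j)"
      using C'[of i l j m] C'[of j m i l] ab Sg_sym[OF ab]
      by (simp only: cartan_g_def[of "ass_matrix p C D"] \<open>a = _\<close> \<open>b = _\<close> gcd_neg1 gcd_neg2 gcd_int_int_eq abs_of_nat nat_int)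
    also have "\<dots> = cartan_g C i j * gcd (qq j i) (qq i j)" by (rule gcd_mult_distrib_nat[symmetric])
    finally show ?thesis by (simp add: gcd_qq)
  qed
  have C'_f: "cartan_f (ass_matrix p C D) b a = qq (fst a) (fst b)" if ab: "(a, b) \<in> Sg" for a b
  proof -
    obtain i l j m where ijlm: "a = (i, l)" "b = (j, m)" by (cases a; cases b)
    have ji: "(j, i) \<in> dbl" using Sg_sym[OF ab] by (simp add: ijlm Sg_iff)
    have "nat \<bar>ass_matrix p C D b a\<bar> = cartan_g C j i * qq i j"
      using C'[of j m i l] Sg_sym[OF ab] by (simp only: ijlm abs_minus_cancel abs_of_nat nat_int)
    then show ?thesis
      using g_pos[OF ji] C'_g[OF Sg_sym[OF ab]] by (simp add: cartan_f_def ijlm)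
  qed
  have sub: "ass_orientation p D \<Omega> \<subseteq> Sg" by (auto simp: ass_orientation_def Sigma dbl_iff)
  have orient: "((i, l), (j, m)) \<in> ass_orientation p D \<Omega> \<longleftrightarrow> ((i, l), (j, m)) \<in> Sg \<and> (i, j) \<in> \<Omega>" for i l j m
    by (auto simp: ass_orientation_def Sigma dbl_iff)
  interpret two_models ?I \<Omega> "cartan_g C" P r d xinv yinv z "ass_matrix p C D" "ass_symmetrizer p D" "ass_orientation p D \<Omega>" C D
  proof unfold_locales
    have "(a, b) \<in> double_orientation (ass_orientation p D \<Omega>) \<longleftrightarrow> (a, b) \<in> Sg" for a b
    proof -
      obtain i l j m where ijlm: "a = (i, l)" "b = (j, m)" by (cases a; cases b)
      have "(a, b) \<in> Sg \<longleftrightarrow> (b, a) \<in> Sg" using Sg_sym by blast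
      moreover have "(i, j) \<in> \<Omega> \<or> (j, i) \<in> \<Omega>" if "(a, b) \<in> Sg" using that by (simp add: ijlm Sg_iff dbl_iff)
      ultimately show ?thesis by (auto simp: double_orientation_def ijlm orient)
    qed
    then show "double_orientation (ass_orientation p D \<Omega>) = Sg" by auto
  next
    fix a b assume ab: "(a, b) \<in> Sg"
    show "cartan_g (ass_matrix p C D) a b = cartan_g C (fst a) (fst b)" by (rule C'_g[OF ab])
    show "cartan_f (ass_matrix p C D) b a = qq (fst a) (fst b)" by (rule C'_f[OF ab])
    show "gp_sgn (ass_orientation p D \<Omega>) a b = sgn (fst a) (fst b)"
      using ab by (cases a; cases b) (simp add: gp_sgn_def sgn_def orient)
  next
    fix a assume "a \<in> M"
    show "ass_symmetrizer p D a = q (fst a)" by (simp add: ass_symmetrizer_def pP flip: r_def)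
  qed (rule D, rule refl)
  show ?thesis unfolding M by (rule preproj_algs_isomorphic)
qed


end
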